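(* Let $d\ge1$ be an integer, let $V$ be a nonnegative function on $\mathbb{S}^d$, and write $\mu=\|V\|_{L^{\gamma+\frac d2}(\mathbb{S}^d)}$. (1) If either $\gamma>\max\{0,1-d/2\}$, or $\gamma=1/2$ and $d=1$, then for $\mu$ large we have $$|\lambda_1(-\Delta-V)|^\gamma\lesssim L^1_{\gamma,d}\int_{\mathbb{S}^d}V^{\gamma+\frac d2}\,d\omega\qquad\text{as }\mu\to+\infty.$$ (2) For any $\gamma\ge\max\{0,1-d/2\}$, if $\mu\le\frac14 d(2\gamma+d-2)$, then $$|\lambda_1(-\Delta-V)|^{\gamma+\frac d2}\le\int_{\mathbb{S}^d}V^{\gamma+\frac d2}\,d\sigma,$$ and this estimate is optimal.
   Context: $\mathbb{S}^d\subset\mathbb{R}^{d+1}$ is the unit sphere, $\Delta$ its Laplace-Beltrami operator, $d\omega$ the measure on $\mathbb{S}^d$ induced by Lebesgue's measure on $\mathbb{R}^{d+1}$, $|\mathbb{S}^d|=\omega(\mathbb{S}^d)$, and $d\sigma=d\omega/|\mathbb{S}^d|$ the uniform probability measure. All norms on the sphere are with respect to $d\sigma$: $\|u\|_{L^r(\mathbb{S}^d)}=(\int_{\mathbb{S}^d}|u|^r\,d\sigma)^{1/r}$. For a potential $V$ on $\mathbb{S}^d$, $\lambda_1(-\Delta-V)=\inf\{\int_{\mathbb{S}^d}|\nabla u|^2d\sigma-\int_{\mathbb{S}^d}V|u|^2d\sigma: u\in H^1(\mathbb{S}^d),\ \int_{\mathbb{S}^d}|u|^2d\sigma=1\}$ is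 the lowest eigenvalue of $-\Delta-V$. The notation $f\lesssim g$ as $\mu\to+\infty$ means that $f\le c(\mu)\,g$ with $\lim_{\mu\to+\infty}c(\mu)=1$ (here $c$ depends on $V$ only through $\mu$). $L^1_{\gamma,d}$ denotes the optimal (smallest) constant in the one bound state Keller-Lieb-Thirring inequality on $\mathbb{R}^d$: for any function $\phi$ on $\mathbb{R}^d$, $|\lambda_1(-\Delta-\phi)|^\gamma\le L^1_{\gamma,d}\int_{\mathbb{R}^d}\phi_+^{\gamma+\frac d2}\,dx$, where $\phi_+$ is the positive part of $\phi$ and, on $\mathbb{R}^d$, $\lambda_1(-\Delta-\phi)$ denotes the lowest negative eigenvalue of $-\Delta-\phi$ when it exists, and $0$ otherwise. Optimality in (2) is achieved by constant potentials. *)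

theory Defs
  imports "HOL-Analysis.Analysis"
begin

section \<open>Measures on the unit sphere\<close>

text \<open>
  The unit sphere of a Euclidean space of dimension \<open>d + 1\<close> is \<open>\<S>\<^sup>d\<close>. The measure induced on it by
  Lebesgue measure is given by the polar-coordinates (cone) formula: a set \<open>A\<close> has measure
  \<open>(d + 1) \<cdot> |{t x. x \<in> A \<and> 0 < t < 1}|\<close>; see \<open>emeasure_sphere_measure\<close> below.
\<close>

definition sphere_measure :: "'a::euclidean_space measure" where
  "sphere_measure = scale_measure (of_nat DIM('a))
     (distr (restrict_space lborel (ball 0 1 - {0})) (restrict_space borel (sphere 0 1)) sgn)"

definition sphere_prob :: "'a::euclidean_space measure" where
  "sphere_prob = uniform_measure sphere_measure (sphere 0 1)"

lemma space_sphere_measure [simp]: "space sphere_measure = sphere 0 1"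
  by (simp add: sphere_measure_def space_scale_measure space_restrict_space)

lemma sets_sphere_measure [simp]: "sets sphere_measure = sets (restrict_space borel (sphere 0 1))"
  by (simp add: sphere_measure_def)

lemma measurable_sgn_sphere:
  "sgn \<in> restrict_space lborel (ball 0 1 - {0::'a::euclidean_space}) \<rightarrow>\<^sub>M
     restrict_space borel (sphere 0 1)"
proof (rule measurable_restrict_space2)
  show "sgn \<in> space (restrict_space lborel (ball 0 1 - {0::'a})) \<rightarrow> sphere 0 1"
    by (auto simp: space_restrict_space norm_sgn)
  have "(sgn :: 'a \<Rightarrow> 'a) \<in> borel_measurable borel"
    unfolding sgn_div_norm by measurable
  then show "(sgn :: 'a \<Rightarrow> 'a) \<in> borel_measurable (restrict_space lborel (ball 0 1 - {0}))"
    by (intro measurable_restrict_space1) simp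
qed

lemma emeasure_sphere_measure:
  fixes A :: "'a::euclidean_space set"
  assumes "A \<in> sets sphere_measure"
  shows "emeasure sphere_measure A =
    of_nat DIM('a) * emeasure lborel {x \<in> ball 0 1 - {0}. sgn x \<in> A}"
proof -
  let ?B = "ball 0 1 - {0::'a}"
  have "emeasure sphere_measure A =
      of_nat DIM('a) * emeasure (restrict_space lborel ?B) (sgn -` A \<inter> ?B)"
    using assms unfolding sphere_measure_def
    by (simp add: emeasure_distr[OF measurable_sgn_sphere] space_restrict_space)
  also have "emeasure (restrict_space lborel ?B) (sgn -` A \<inter> ?B) = emeasure lborel (sgn -` A \<inter> ?B)"
    by (intro emeasure_restrict_space) auto
  also have "sgn -` A \<inter> ?B = {x \<in> ?B. sgn x \<in> A}"
    by auto
  finally show ?thesis .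
qed


section \<open>Smooth functions and Sobolev spaces\<close>

primrec times_diff :: "nat \<Rightarrow> ('a::real_normed_vector \<Rightarrow> 'b::real_normed_vector) \<Rightarrow> bool" where
  "times_diff 0 f \<longleftrightarrow> continuous_on UNIV f"
| "times_diff (Suc k) f \<longleftrightarrow>
     (\<exists>f'. (\<forall>x. (f has_derivative f' x) (at x)) \<and> (\<forall>v. times_diff k (\<lambda>x. f' x v)))"

definition smooth :: "('a::real_normed_vector \<Rightarrow> 'b::real_normed_vector) \<Rightarrow> bool" where
  "smooth f \<longleftrightarrow> (\<forall>k. times_diff k f)"

definition L2 :: "'a measure \<Rightarrow> ('a \<Rightarrow> 'b::euclidean_space) set" where
  "L2 M = {f \<in> borel_measurable M. integrable M (\<lambda>x. (norm (f x))\<^sup>2)}"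

definition L2_limit ::
    "'a measure \<Rightarrow> (nat \<Rightarrow> 'a \<Rightarrow> 'b::euclidean_space) \<Rightarrow> ('a \<Rightarrow> 'b) \<Rightarrow> bool" where
  "L2_limit M F f \<longleftrightarrow> f \<in> L2 M \<and> (\<forall>n. F n \<in> L2 M) \<and>
     (\<lambda>n. \<integral>x. (norm (F n x - f x))\<^sup>2 \<partial>M) \<longlonglongrightarrow> 0"

text \<open>
  \<open>H1 u g\<close>: the function \<open>u\<close> lies in \<open>H\<^sup>1\<close> of the whole space, the closure of the compactly
  supported smooth functions, and \<open>g\<close> is its gradient (unique up to null sets).
\<close>

definition H1 :: "('b::euclidean_space \<Rightarrow> real) \<Rightarrow> ('b \<Rightarrow> 'b) \<Rightarrow> bool" where
  "H1 u g \<longleftrightarrow> (\<exists>\<psi> G.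
     (\<forall>n. smooth (\<psi> n) \<and> (\<exists>K. compact K \<and> (\<forall>x. x \<notin> K \<longrightarrow> \<psi> n x = 0))) \<and>
     (\<forall>n x. GDERIV (\<psi> n) x :> G n x) \<and>
     L2_limit lborel \<psi> u \<and> L2_limit lborel G g)"

text \<open>
  \<open>H1_sphere u g\<close>: the same on the unit sphere. Smooth functions on the sphere are the restrictions of
  smooth functions on the ambient space, and their gradient on the sphere is the tangential
  component of the ambient gradient.
\<close>

definition H1_sphere :: "('a::euclidean_space \<Rightarrow> real) \<Rightarrow> ('a \<Rightarrow> 'a) \<Rightarrow> bool" where
  "H1_sphere u g \<longleftrightarrow> (\<exists>\<psi> G.
     (\<forall>n. smooth (\<psi> n)) \<and> (\<forall>n x. GDERIV (\<psi> n) x :> G n x) \<and>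
     L2_limit sphere_prob \<psi> u \<and>
     L2_limit sphere_prob (\<lambda>n x. G n x - (x \<bullet> G n x) *\<^sub>R x) g)"


section \<open>Lowest eigenvalues\<close>

text \<open>
  The integrability requirement restricts \<open>u\<close> to the form domain. It holds for all \<open>u\<close> in \<open>H\<^sup>1\<close>
  as soon as \<open>V\<close> belongs to a Lebesgue space for which the Sobolev embedding controls the
  integral of \<open>V u\<^sup>2\<close>.
\<close>

definition lambda1_sphere :: "('a::euclidean_space \<Rightarrow> real) \<Rightarrow> real" where
  "lambda1_sphere V = Inf {(\<integral>x. (norm (g x))\<^sup>2 \<partial>sphere_prob) - (\<integral>x. V x * (u x)\<^sup>2 \<partial>sphere_prob) | u g.
     H1_sphere u g \<and> integrable sphere_prob (\<lambda>x. V x * (u x)\<^sup>2) \<and> (\<integral>x. (u x)\<^sup>2 \<partial>sphere_prob) = 1}"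

definition form_domain ::
    "('b::euclidean_space \<Rightarrow> real) \<Rightarrow> ('b \<Rightarrow> real) \<Rightarrow> ('b \<Rightarrow> 'b) \<Rightarrow> bool" where
  "form_domain \<phi> u g \<longleftrightarrow> H1 u g \<and> integrable lborel (\<lambda>x. \<phi> x * (u x)\<^sup>2)"

text \<open>
  \<open>schroedinger \<phi> u w\<close>: the function \<open>u\<close> is in the domain of the operator \<open>-\<Delta> - \<phi>\<close> associated with
  the quadratic form \<open>\<integral> |\<nabla>u|\<^sup>2 - \<integral> \<phi> u\<^sup>2\<close>, and the operator maps \<open>u\<close> to \<open>w\<close>.
\<close>

definition schroedinger ::
    "('b::euclidean_space \<Rightarrow> real) \<Rightarrow> ('b \<Rightarrow> real) \<Rightarrow> ('b \<Rightarrow> real) \<Rightarrow> bool" where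
  "schroedinger \<phi> u w \<longleftrightarrow> w \<in> L2 lborel \<and>
     (\<exists>g. form_domain \<phi> u g \<and>
       (\<forall>v h. form_domain \<phi> v h \<longrightarrow>
         (\<integral>x. g x \<bullet> h x \<partial>lborel) - (\<integral>x. \<phi> x * u x * v x \<partial>lborel) = (\<integral>x. w x * v x \<partial>lborel)))"

definition eigenvalue :: "('b::euclidean_space \<Rightarrow> real) \<Rightarrow> real \<Rightarrow> bool" where
  "eigenvalue \<phi> E \<longleftrightarrow> (\<exists>u. \<not> (AE x in lborel. u x = 0) \<and> schroedinger \<phi> u (\<lambda>x. E * u x))"

definition lambda1 :: "('b::euclidean_space \<Rightarrow> real) \<Rightarrow> real" where
  "lambda1 \<phi> =
     (if \<exists>E<0. eigenvalue \<phi> E \<and> (\<forall>E'<0. eigenvalue \<phi> E' \<longrightarrow> E \<le> E')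
      then LEAST E. E < 0 \<and> eigenvalue \<phi> E else 0)"


section \<open>The Keller--Lieb--Thirring constant for one bound state\<close>

text \<open>The dimension of the Euclidean space is carried by the type argument.\<close>

definition KLT_const :: "'b::euclidean_space itself \<Rightarrow> real \<Rightarrow> ennreal" where
  "KLT_const T \<gamma> = Inf {C. \<forall>\<phi>\<in>borel_measurable borel.
     ennreal (\<bar>lambda1 (\<phi> :: 'b \<Rightarrow> real)\<bar> powr \<gamma>)
       \<le> C * (\<integral>\<^sup>+x. ennreal (max 0 (\<phi> x) powr (\<gamma> + DIM('b) / 2)) \<partial>lborel)}"


section \<open>Potentials on the sphere\<close>

definition Lp_norm :: "'a measure \<Rightarrow> real \<Rightarrow> ('a \<Rightarrow> real) \<Rightarrow> real" where
  "Lp_norm M r f = (\<integral>x. \<bar>f x\<bar> powr r \<partial>M) powr (1 / r)"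

definition nonneg_Lp :: "real \<Rightarrow> ('a::euclidean_space \<Rightarrow> real) set" where
  "nonneg_Lp r = {V \<in> borel_measurable sphere_measure.
     (\<forall>x\<in>sphere 0 1. 0 \<le> V x) \<and> integrable sphere_measure (\<lambda>x. V x powr r)}"

end

theory Submission
  imports Defs "HOL-Complex_Analysis.Great_Picard" "HOL-Library.Diagonal_Subsequence"
begin

text \<open>
  Every estimate on \<open>\<lambda>\<^sub>1\<close> comes from a form bound \<open>\<integral> V \<psi>\<^sup>2 \<le> \<integral> |\<nabla>\<psi>|\<^sup>2 + \<Lambda> \<integral> \<psi>\<^sup>2\<close> for smooth \<open>\<psi>\<close>, which
  implies \<open>- \<Lambda> \<le> \<lambda>\<^sub>1 \<le> - \<integral> V \<le> 0\<close> (\<open>lambda1_sphere_abs_le\<close>). Put \<open>p = \<gamma> + d/2\<close>.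

  Large \<open>\<mu>\<close>. A strongly attractive potential only sees small pieces of the sphere, which are nearly
  flat. A partition of unity with \<open>\<Sum> \<zeta>\<^sub>e\<^sup>2 = 1\<close> cuts a trial function into pieces supported in small caps
  (\<open>sphere_partition\<close>). The gnomonic projection maps a cap into Euclidean space. It distorts volumes
  by a factor between \<open>1\<close> and some \<open>\<kappa>\<close> close to \<open>1\<close>, and gradients only decrease, so the Euclidean inequality carries over to
  each piece (\<open>cap_form_bound\<close>). The partition costs a constant \<open>C\<^sub>\<kappa>\<close> independent of \<open>V\<close>, which is
  negligible against \<open>(L \<integral> V\<^sup>p)\<^sup>1\<^sup>/\<^sup>\<gamma>\<close> as \<open>\<mu>\<close> grows, and then \<open>\<kappa>\<close> tends to \<open>1\<close>
  (\<open>lambda1_sphere_asymptotic\<close>). The Euclidean inequality is stated for the lowest eigenvalue, whereas a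
  bound on the quadratic form is required. The two agree for bounded compactly supported potentials:
  a negative infimum of the form is attained by Rellich compactness, hence an eigenvalue
  (\<open>ground_attained\<close>, \<open>KLT_form_bound\<close>).

  Small \<open>\<mu>\<close>. Let \<open>q = 2p/(p - 1)\<close>, so that \<open>d/(q - 2) = d(p - 1)/2\<close> is the threshold for \<open>\<mu>\<close>. By Hoelder's
  inequality the form bound with \<open>\<Lambda> = \<mu>\<close> follows from the sharp interpolation inequality
  \<open>d/(q - 2) \<parallel>\<psi>\<parallel>\<^sub>q\<^sup>2 \<le> \<integral> |\<nabla>\<psi>|\<^sup>2 + d/(q - 2) \<parallel>\<psi>\<parallel>\<^sub>2\<^sup>2\<close> (\<open>sphere_interpolation\<close>, \<open>lambda1_sphere_le_Lp_norm\<close>).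
  For functions of the height \<open>x \<bullet> e\<close> this is a one-dimensional inequality with weight \<open>sin\<^sup>d\<^sup>-\<^sup>1\<close>: a
  minimiser of the quotient exists, and a monotone quantity along its Euler-Lagrange equation forces it to be
  constant (\<open>ultraspherical_rigidity\<close>, \<open>ultraspherical_interpolation\<close>). The general case is reduced to this
  one by polarisation, which preserves all \<open>L\<^sup>q\<close> norms and does not increase the energy. In a compact class
  closed under polarisation, the function that maximises \<open>\<integral> v(x) (x \<bullet> e)\<close> is fixed by the polarisations
  towards \<open>e\<close>, and so depends on the height only (\<open>zonal_rearrangement\<close>). A constant potential
  \<open>\<mu>\<close> has \<open>\<lambda>\<^sub>1 = - \<mu>\<close> and gives equality.
\<close>

abbreviation nn_lborel :: "('a::euclidean_space \<Rightarrow> ennreal) \<Rightarrow> ennreal" (binder "NN " 60) where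
  "nn_lborel f \<equiv> \<integral>\<^sup>+x. f x \<partial>lborel"

section \<open>Calculus of smooth functions\<close>

lemma times_diff_SucD: "times_diff (Suc k) f \<Longrightarrow> times_diff k f"
proof (induction k arbitrary: f)
  case 0
  then show ?case
    by (auto simp: continuous_on_eq_continuous_within intro: has_derivative_continuous)
next
  case (Suc k)
  then obtain f' where f': "\<And>x. (f has_derivative f' x) (at x)"
    and "\<And>v. times_diff (Suc k) (\<lambda>x. f' x v)"
    by (auto simp del: times_diff.simps simp: times_diff.simps(2)[of "Suc k"])
  with Suc.IH have "\<And>v. times_diff k (\<lambda>x. f' x v)" by blast
  with f' show ?case by auto
qed

lemma times_diff_continuous: "times_diff k f \<Longrightarrow> continuous_on UNIV f"
  by (induction k) (auto simp: times_diff_SucD simp del: times_diff.simps(2))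

lemma times_diff_const: "times_diff k (\<lambda>x. c)"
  by (induction k arbitrary: c) (auto intro!: exI[of _ "\<lambda>_ _. 0"])

lemma times_diff_bounded_linear: "bounded_linear f \<Longrightarrow> times_diff k f"
  by (cases k)
     (auto simp: times_diff_const linear_continuous_on bounded_linear_imp_has_derivative
           intro!: exI[of _ "\<lambda>_. f"])

lemma times_diff_add:
  "times_diff k f \<Longrightarrow> times_diff k g \<Longrightarrow> times_diff k (\<lambda>x. f x + g x)"
proof (induction k arbitrary: f g)
  case 0
  then show ?case by (auto intro: continuous_on_add)
next
  case (Suc k)
  then obtain f' g' where "\<And>x. (f has_derivative f' x) (at x)" "\<And>v. times_diff k (\<lambda>x. f' x v)"
    "\<And>x. (g has_derivative g' x) (at x)" "\<And>v. times_diff k (\<lambda>x. g' x v)" by auto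
  then show ?case
    using Suc.IH by (auto intro!: exI[of _ "\<lambda>x v. f' x v + g' x v"] has_derivative_add)
qed

lemma times_diff_sum:
  "(\<And>i. i \<in> I \<Longrightarrow> times_diff k (f i)) \<Longrightarrow> times_diff k (\<lambda>x. \<Sum>i\<in>I. f i x)"
  by (induction I rule: infinite_finite_induct) (auto simp: times_diff_const intro!: times_diff_add)

lemma (in bounded_bilinear) times_diff:
  "times_diff k f \<Longrightarrow> times_diff k g \<Longrightarrow> times_diff k (\<lambda>x. prod (f x) (g x))"
proof (induction k arbitrary: f g)
  case 0
  then show ?case by (auto intro: continuous_on)
next
  case (Suc k)
  have fg: "times_diff k f" "times_diff k g"
    using Suc.prems by (auto intro: times_diff_SucD simp del: times_diff.simps(2))
  obtain f' g' where *: "\<And>x. (f has_derivative f' x) (at x)" "\<And>v. times_diff k (\<lambda>x. f' x v)"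
    "\<And>x. (g has_derivative g' x) (at x)" "\<And>v. times_diff k (\<lambda>x. g' x v)"
    using Suc.prems by auto
  show ?case
    unfolding times_diff.simps
  proof (intro exI conjI allI)
    show "((\<lambda>x. prod (f x) (g x)) has_derivative (\<lambda>v. prod (f x) (g' x v) + prod (f' x v) (g x))) (at x)"
      for x by (rule FDERIV) fact+
    show "times_diff k (\<lambda>x. prod (f x) (g' x v) + prod (f' x v) (g x))" for v
      by (intro times_diff_add Suc.IH fg *)
  qed
qed

lemmas times_diff_scaleR = bounded_bilinear.times_diff[OF bounded_bilinear_scaleR]
lemmas times_diff_mult = bounded_bilinear.times_diff[OF bounded_bilinear_mult]
lemmas times_diff_inner = bounded_bilinear.times_diff[OF bounded_bilinear_inner]

lemma times_diff_compose:
  fixes g :: "'a::real_normed_vector \<Rightarrow> 'b::euclidean_space"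
  shows "times_diff k f \<Longrightarrow> times_diff k g \<Longrightarrow> times_diff k (\<lambda>x. f (g x))"
proof (induction k arbitrary: f)
  case 0
  then show ?case by (auto intro: continuous_on_compose2)
next
  case (Suc k)
  have g: "times_diff k g" using Suc.prems(2) by (rule times_diff_SucD)
  obtain f' g' where f': "\<And>x. (f has_derivative f' x) (at x)" "\<And>v. times_diff k (\<lambda>x. f' x v)"
    and g': "\<And>x. (g has_derivative g' x) (at x)" "\<And>v. times_diff k (\<lambda>x. g' x v)"
    using Suc.prems by auto
  show ?case
    unfolding times_diff.simps
  proof (intro exI conjI allI)
    show "((\<lambda>x. f (g x)) has_derivative (\<lambda>v. f' (g x) (g' x v))) (at x)" for x
      using diff_chain_at[OF g'(1) f'(1)] by (simp add: o_def)
    have *: "(\<lambda>x. f' (g x) (g' x v)) = (\<lambda>x. \<Sum>b\<in>Basis. (g' x v \<bullet> b) *\<^sub>R f' (g x) b)" for v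
    proof
      fix x
      interpret bounded_linear "f' (g x)" by (rule has_derivative_bounded_linear[OF f'(1)])
      have "f' (g x) (g' x v) = f' (g x) (\<Sum>b\<in>Basis. (g' x v \<bullet> b) *\<^sub>R b)"
        by (simp add: euclidean_representation)
      also have "\<dots> = (\<Sum>b\<in>Basis. (g' x v \<bullet> b) *\<^sub>R f' (g x) b)"
        by (simp add: sum scaleR)
      finally show "f' (g x) (g' x v) = (\<Sum>b\<in>Basis. (g' x v \<bullet> b) *\<^sub>R f' (g x) b)" .
    qed
    show "times_diff k (\<lambda>x. f' (g x) (g' x v))" for v
      unfolding * by (intro times_diff_sum times_diff_scaleR times_diff_inner times_diff_const g' Suc.IH f' g)
  qed
qed

text \<open>
  A square root in a denominator is smooth as long as its argument stays positive; all real
  exponents are treated at once because differentiating changes the exponent.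
\<close>

lemma times_diff_powr:
  fixes f :: "'a::real_normed_vector \<Rightarrow> real"
  assumes pos: "\<And>x. 0 < f x"
  shows "times_diff k f \<Longrightarrow> times_diff k (\<lambda>x. f x powr a)"
proof (induction k arbitrary: a)
  case 0
  have "f x \<noteq> 0" for x using pos[of x] by simp
  with 0 show ?case by (auto intro!: continuous_on_powr continuous_on_const)
next
  case (Suc k)
  obtain f' where f': "\<And>x. (f has_derivative f' x) (at x)" "\<And>v. times_diff k (\<lambda>x. f' x v)"
    using Suc.prems by auto
  show ?case
    unfolding times_diff.simps
  proof (intro exI conjI allI)
    show "((\<lambda>x. f x powr a) has_derivative (\<lambda>v. (a * f x powr (a - 1)) * f' x v)) (at x)" for x
      using has_derivative_powr[OF f'(1)[of x] has_derivative_const[of a] pos] pos[of x]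
      by (simp add: powr_diff mult_ac)
    show "times_diff k (\<lambda>x. (a * f x powr (a - 1)) * f' x v)" for v
      by (intro times_diff_mult times_diff_const f' Suc.IH times_diff_SucD[OF Suc.prems])
  qed
qed

lemma smooth_const: "smooth (\<lambda>x. c)"
  by (simp add: smooth_def times_diff_const)

lemma smooth_bounded_linear: "bounded_linear f \<Longrightarrow> smooth f"
  by (simp add: smooth_def times_diff_bounded_linear)

lemma smooth_add: "smooth f \<Longrightarrow> smooth g \<Longrightarrow> smooth (\<lambda>x. f x + g x)"
  by (simp add: smooth_def times_diff_add)

lemma smooth_sum: "(\<And>i. i \<in> I \<Longrightarrow> smooth (f i)) \<Longrightarrow> smooth (\<lambda>x. \<Sum>i\<in>I. f i x)"
  by (simp add: smooth_def times_diff_sum)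

lemma smooth_scaleR: "smooth f \<Longrightarrow> smooth g \<Longrightarrow> smooth (\<lambda>x. f x *\<^sub>R g x)"
  by (simp add: smooth_def times_diff_scaleR)

lemma smooth_mult:
  fixes f g :: "'a::real_normed_vector \<Rightarrow> 'b::real_normed_algebra"
  shows "smooth f \<Longrightarrow> smooth g \<Longrightarrow> smooth (\<lambda>x. f x * g x)"
  by (simp add: smooth_def times_diff_mult)

lemma smooth_power2:
  fixes f :: "'a::real_normed_vector \<Rightarrow> real"
  shows "smooth f \<Longrightarrow> smooth (\<lambda>x. (f x)^2)"
  unfolding power2_eq_square by (rule smooth_mult)

lemma smooth_inner:
  fixes f g :: "'a::real_normed_vector \<Rightarrow> 'b::real_inner"
  shows "smooth f \<Longrightarrow> smooth g \<Longrightarrow> smooth (\<lambda>x. f x \<bullet> g x)"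
  by (simp add: smooth_def times_diff_inner)

lemma smooth_diff:
  fixes f g :: "'a::real_normed_vector \<Rightarrow> 'b::real_normed_vector"
  assumes "smooth f" "smooth g" shows "smooth (\<lambda>x. f x - g x)"
  using smooth_add[OF assms(1) smooth_scaleR[OF smooth_const[of "-1"] assms(2)]] by simp

lemma smooth_compose:
  fixes g :: "'a::real_normed_vector \<Rightarrow> 'b::euclidean_space"
  shows "smooth f \<Longrightarrow> smooth g \<Longrightarrow> smooth (\<lambda>x. f (g x))"
  by (simp add: smooth_def times_diff_compose)

lemma smooth_powr:
  fixes f :: "'a::real_normed_vector \<Rightarrow> real"
  assumes "smooth f" "\<And>x. 0 < f x" shows "smooth (\<lambda>x. f x powr a)"
  using assms by (simp add: smooth_def times_diff_powr)

lemma smooth_continuous: "smooth f \<Longrightarrow> continuous_on S f"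
  unfolding smooth_def using times_diff_continuous continuous_on_subset by blast

lemma smooth_has_derivative:
  assumes "smooth f"
  obtains f' where "\<And>x. (f has_derivative f' x) (at x)" "\<And>v. smooth (\<lambda>x. f' x v)"
proof -
  from assms have "times_diff (Suc 0) f" unfolding smooth_def by blast
  then obtain f' where f': "\<And>x. (f has_derivative f' x) (at x)" by auto
  have "smooth (\<lambda>x. f' x v)" for v
    unfolding smooth_def
  proof
    fix k
    from assms have "times_diff (Suc k) f" unfolding smooth_def by blast
    then obtain g' where g': "\<And>x. (f has_derivative g' x) (at x)" "\<And>v. times_diff k (\<lambda>x. g' x v)"
      by auto
    have "g' x = f' x" for x by (rule has_derivative_unique[OF g'(1) f'(1)])
    then have "g' = f'" by (rule ext)
    with g' show "times_diff k (\<lambda>x. f' x v)" by simp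
  qed
  with f' show ?thesis by (rule that)
qed

definition grad :: "('a::euclidean_space \<Rightarrow> real) \<Rightarrow> 'a \<Rightarrow> 'a" where
  "grad f x = (\<Sum>b\<in>Basis. frechet_derivative f (at x) b *\<^sub>R b)"

lemma grad_eq: "GDERIV f x :> g \<Longrightarrow> grad f x = g"
  unfolding gderiv_def grad_def
  by (subst frechet_derivative_at[symmetric], assumption) (simp add: inner_commute[of _ g] euclidean_representation)

lemma has_derivative_grad:
  assumes "f differentiable (at x)" shows "(f has_derivative (\<lambda>h. grad f x \<bullet> h)) (at x)"
proof -
  let ?D = "frechet_derivative f (at x)"
  have D: "(f has_derivative ?D) (at x)" using assms frechet_derivative_works by blast
  interpret D: bounded_linear ?D by (rule has_derivative_bounded_linear[OF D])
  have "?D h = grad f x \<bullet> h" for h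
  proof -
    have "?D h = ?D (\<Sum>b\<in>Basis. (h \<bullet> b) *\<^sub>R b)" by (simp add: euclidean_representation)
    also have "\<dots> = grad f x \<bullet> h"
      by (simp add: D.sum D.scaleR grad_def inner_sum_left inner_commute[of h] mult.commute)
    finally show ?thesis .
  qed
  then have "?D = (\<lambda>h. grad f x \<bullet> h)" by auto
  with D show ?thesis by metis
qed

lemma smooth_differentiable: "smooth f \<Longrightarrow> f differentiable (at x)"
  by (metis differentiable_def smooth_has_derivative)

lemma smooth_GDERIV: "smooth f \<Longrightarrow> GDERIV f x :> grad f x"
  using has_derivative_grad[OF smooth_differentiable] by (simp add: gderiv_def inner_commute)

lemma smooth_grad_has_derivative: "smooth f \<Longrightarrow> (f has_derivative (\<lambda>h. grad f x \<bullet> h)) (at x)"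
  by (intro has_derivative_grad smooth_differentiable)

lemma has_derivative_inner_imp_grad: "(f has_derivative (\<lambda>h. g \<bullet> h)) (at x) \<Longrightarrow> grad f x = g"
  by (rule grad_eq) (simp add: gderiv_def inner_commute)

lemma smooth_grad: assumes "smooth f" shows "smooth (grad f)"
proof -
  obtain f' where f': "\<And>x. (f has_derivative f' x) (at x)" "\<And>v. smooth (\<lambda>x. f' x v)"
    using smooth_has_derivative[OF assms] by blast
  have "grad f = (\<lambda>x. \<Sum>b\<in>Basis. f' x b *\<^sub>R b)"
    unfolding grad_def using frechet_derivative_at[OF f'(1)] by (auto simp: fun_eq_iff)
  then show ?thesis
    by (auto intro!: smooth_sum smooth_scaleR smooth_const f')
qed

lemma grad_add:
  assumes "smooth f" "smooth g" shows "grad (\<lambda>x. f x + g x) x = grad f x + grad g x"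
  using has_derivative_add[OF assms[THEN smooth_grad_has_derivative]]
  by (intro has_derivative_inner_imp_grad) (simp add: inner_add_left)

lemma grad_mult:
  assumes "smooth f" "smooth g"
  shows "grad (\<lambda>x. f x * g x) x = f x *\<^sub>R grad g x + g x *\<^sub>R grad f x"
  using has_derivative_mult[OF assms[THEN smooth_grad_has_derivative]]
  by (intro has_derivative_inner_imp_grad) (simp add: inner_add_left mult.commute)

lemma grad_cmult:
  assumes "smooth f" shows "grad (\<lambda>x. c * f x) x = c *\<^sub>R grad f x"
  using has_derivative_mult_right[OF smooth_grad_has_derivative[OF assms]]
  by (intro has_derivative_inner_imp_grad) simp


section \<open>A smooth function that is not analytic\<close>

text \<open>
  The powers in the denominator make the family closed under differentiation.
\<close>

definition flat_exp :: "nat \<Rightarrow> real \<Rightarrow> real" where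
  "flat_exp n t = (if t > 0 then exp (- 1 / t) / t ^ n else 0)"

lemma flat_exp_limit: "((\<lambda>t. exp (- 1 / t) / t ^ n) \<longlongrightarrow> (0::real)) (at_right 0)"
proof -
  have "((\<lambda>s::real. s ^ n / exp s) \<longlongrightarrow> 0) at_top"
    by (rule tendsto_power_div_exp_0)
  then have "((\<lambda>t::real. inverse t ^ n / exp (inverse t)) \<longlongrightarrow> 0) (at_right 0)"
    by (rule filterlim_compose[OF _ filterlim_inverse_at_top_right])
  then show ?thesis
    by (simp add: exp_minus field_simps)
qed

lemma flat_exp_deriv:
  "(flat_exp n has_real_derivative flat_exp (n + 2) t - n * flat_exp (n + 1) t) (at t)"
proof -
  consider "t > 0" | "t < 0" | "t = 0" by linarith
  then show ?thesis
  proof cases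
    case 1
    have "((\<lambda>t. exp (- 1 / t) / t ^ n) has_real_derivative
        (exp (- 1 / t) * (1 / t^2) * t ^ n - exp (- 1 / t) * (n * t ^ (n - 1))) / (t ^ n * t ^ n)) (at t)"
      using 1 by (auto intro!: derivative_eq_intros simp: power2_eq_square)
    also have "(exp (- 1 / t) * (1 / t^2) * t ^ n - exp (- 1 / t) * (n * t ^ (n - 1))) / (t ^ n * t ^ n)
        = flat_exp (n + 2) t - n * flat_exp (n + 1) t"
      using 1 by (cases n) (auto simp: flat_exp_def field_simps power2_eq_square)
    finally show ?thesis
      by (rule has_field_derivative_transform_within_open[of _ _ _ "{0<..}"])
         (use 1 in \<open>auto simp: flat_exp_def\<close>)
  next
    case 2
    have "((\<lambda>t. 0) has_real_derivative 0) (at t)" by simp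
    then have "(flat_exp n has_real_derivative 0) (at t)"
      by (rule has_field_derivative_transform_within_open[of _ _ _ "{..<0}"])
         (use 2 in \<open>auto simp: flat_exp_def\<close>)
    with 2 show ?thesis by (simp add: flat_exp_def)
  next
    case 3
    have "((\<lambda>h. flat_exp n h / h) \<longlongrightarrow> 0) (at_right 0)"
      by (rule Lim_transform_eventually[OF flat_exp_limit[of "Suc n"]])
         (auto simp: flat_exp_def eventually_at_right_less field_simps
           intro!: eventually_mono[OF eventually_at_right_less])
    moreover have "((\<lambda>h. flat_exp n h / h) \<longlongrightarrow> 0) (at_left 0)"
      by (rule Lim_transform_eventually[OF tendsto_const])
         (auto simp: flat_exp_def eventually_at_filter)
    ultimately have "((\<lambda>h. flat_exp n h / h) \<longlongrightarrow> 0) (at 0)"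
      by (simp add: filterlim_split_at_real)
    with 3 show ?thesis
      by (simp add: DERIV_def flat_exp_def)
  qed
qed

lemma smooth_flat_exp: "smooth (flat_exp n)"
proof -
  have "times_diff k (flat_exp n)" for k
  proof (induction k arbitrary: n)
    case 0
    show ?case using DERIV_isCont[OF flat_exp_deriv] by (auto intro: continuous_at_imp_continuous_on)
  next
    case (Suc k)
    show ?case
      unfolding times_diff.simps
    proof (intro exI conjI allI)
      show "(flat_exp n has_derivative (\<lambda>h. (flat_exp (n + 2) t - n * flat_exp (n + 1) t) * h)) (at t)" for t
        using flat_exp_deriv[of n t] by (simp add: has_field_derivative_def)
      show "times_diff k (\<lambda>t. (flat_exp (n + 2) t - n * flat_exp (n + 1) t) * v)" for v
        using times_diff_mult[OF times_diff_add[OF Suc times_diff_mult[OF times_diff_const[of k "- real n"] Suc]]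
            times_diff_const[of k v], of "n+2" "n+1"] by simp
    qed
  qed
  then show ?thesis by (simp add: smooth_def)
qed

lemma flat_exp_pos: "t > 0 \<Longrightarrow> flat_exp n t > 0" and flat_exp_nonpos: "t \<le> 0 \<Longrightarrow> flat_exp n t = 0"
  by (auto simp: flat_exp_def)

lemma flat_exp_nonneg: "flat_exp n t \<ge> 0"
  by (auto simp: flat_exp_def)


section \<open>Rigidity for the ultraspherical equation on an interval\<close>

lemma has_real_derivative_powr_const:
  assumes f: "(f has_real_derivative f') (at x within S)" and pos: "f x > (0::real)" and x: "x \<in> S"
  shows "((\<lambda>x. f x powr c) has_real_derivative c * f x powr c * f' / f x) (at x within S)"
proof -
  have "((\<lambda>x. f x powr c) has_derivative (\<lambda>h. f x powr c * (0 * ln (f x) + (f' * h) * c / f x))) (at x within S)"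
    by (rule has_derivative_powr[OF f[unfolded has_field_derivative_def] has_derivative_const[of c] pos x])
  moreover have "(\<lambda>h. f x powr c * (0 * ln (f x) + (f' * h) * c / f x)) = (*) (c * f x powr c * f' / f x)"
    by (simp add: fun_eq_iff)
  ultimately show ?thesis
    unfolding has_field_derivative_def by (simp only:)
qed

text \<open>
  With \<open>p = u' / u\<close>, the function \<open>\<Psi> = u\<^sup>2\<^sup>r sin\<^sup>n\<^sup>-\<^sup>1 (p G - n cot p\<^sup>2 + y p\<^sup>3)\<close> vanishes at both ends. The
  coefficient \<open>y\<close> removes the term in \<open>cot p\<^sup>3\<close> from its derivative. What remains is a quadratic form in
  \<open>p' - cot p\<close> and \<open>p\<^sup>2\<close>, and with this choice of \<open>r\<close> it is positive definite when \<open>q (n - 2) < 2 n\<close>. Then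
  \<open>\<Psi>\<close> is increasing, so it is zero together with its derivative.
\<close>

lemma ultraspherical_rigidity:
  fixes n q m A a b :: real and u u' u'' :: "real \<Rightarrow> real"
  assumes ab: "0 < a" "a < b" "b < pi" and n: "n \<ge> 1" and q: "q > 2" "q * (n - 2) < 2 * n"
    and A: "A = n / (q - 2)"
    and pos: "\<And>x. x \<in> {a..b} \<Longrightarrow> 0 < u x"
    and u': "\<And>x. x \<in> {a..b} \<Longrightarrow> (u has_real_derivative u' x) (at x within {a..b})"
    and u'': "\<And>x. x \<in> {a..b} \<Longrightarrow> (u' has_real_derivative u'' x) (at x within {a..b})"
    and ode: "\<And>x. x \<in> {a..b} \<Longrightarrow> u'' x + (n - 1) * cot x * u' x = A * u x - m * u x powr (q - 1)"
    and bc: "u' a = 0" "u' b = 0"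
    and x: "x \<in> {a..b}"
  shows "u' x = 0"
proof -
  define r where "r = (n + 3 - q) / (n + 2)"
  define y where "y = - n * (q - 1) / (n + 2)"
  define k where "k = 2 * r + q - 2"
  define N where "N = 1 + k + 3 * y"
  define K where "K = k + 2 * r * y"
  define p where "p x = u' x / u x" for x
  define p' where "p' x = u'' x / u x - (p x)^2" for x
  define G where "G x = A - m * u x powr (q - 2)" for x
  define w where "w x = u x powr (2 * r) * sin x powr (n - 1)" for x
  define \<Psi> where "\<Psi> x = w x * (p x * G x - n * cot x * (p x)^2 + y * p x ^ 3)" for x
  define M where "M x = p' x - cot x * p x" for x
  define \<Psi>' where "\<Psi>' x = w x * ((M x + N / 2 * (p x)^2)^2 + (K - N^2 / 4) * (p x) ^ 4)" for x
  have delta: "K - N^2 / 4 > 0"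
  proof -
    have n2: "n + 2 > 0" using n by simp
    have "(K - N^2 / 4) * (n + 2)^2 = (q - 1) * n * (2 * n - q * (n - 2))"
    proof -
      define R where "R = n + 3 - q" define Y where "Y = - n * (q - 1)"
      have rR: "r * (n + 2) = R" "y * (n + 2) = Y"
        unfolding r_def y_def R_def Y_def using n2 by auto
      have "(K - N^2 / 4) * (n + 2)^2
          = (2 * (r * (n + 2)) + (q - 2) * (n + 2)) * (n + 2) + 2 * (r * (n + 2)) * (y * (n + 2))
            - ((n + 2) + 2 * (r * (n + 2)) + (q - 2) * (n + 2) + 3 * (y * (n + 2)))^2 / 4"
        unfolding K_def N_def k_def by (simp add: power2_eq_square field_simps)
      also have "\<dots> = (q - 1) * n * (2 * n - q * (n - 2))"
        unfolding rR unfolding R_def Y_def by (simp add: power2_eq_square field_simps)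
      finally show ?thesis .
    qed
    moreover have "(q - 1) * n * (2 * n - q * (n - 2)) > 0"
      using n q by (intro mult_pos_pos) auto
    ultimately show ?thesis using n2 by (metis zero_less_mult_pos2 zero_less_power)
  qed
  have s: "sin x > 0" if "x \<in> {a..b}" for x
    using that ab by (intro sin_gt_zero) auto
  have w_pos: "w x > 0" if "x \<in> {a..b}" for x
    using pos[OF that] s[OF that] by (simp add: w_def)
  have p_d: "(p has_real_derivative p' x) (at x within {a..b})" if "x \<in> {a..b}" for x
    unfolding p_def p'_def using pos[OF that]
    by (auto intro!: derivative_eq_intros u' u'' that simp: field_simps power2_eq_square)
  have G_eq: "p' x + (n - 1) * cot x * p x + (p x)^2 = G x" if "x \<in> {a..b}" for x
  proof -
    have "p' x + (n - 1) * cot x * p x + (p x)^2 = (u'' x + (n - 1) * cot x * u' x) / u x"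
      by (simp add: p_def p'_def add_divide_distrib)
    also have "\<dots> = G x"
      unfolding ode[OF that] G_def using pos[OF that]
      by (simp add: field_simps powr_diff power2_eq_square)
    finally show ?thesis .
  qed
  have G_d: "(G has_real_derivative (q - 2) * (G x - A) * p x) (at x within {a..b})"
    if "x \<in> {a..b}" for x
    unfolding G_def p_def using pos[OF that]
    by (auto intro!: derivative_eq_intros u' that simp: powr_diff field_simps power2_eq_square power4_eq_xxxx)
  have w_d: "(w has_real_derivative w x * (2 * r * p x + (n - 1) * cot x)) (at x within {a..b})"
    if "x \<in> {a..b}" for x
  proof -
    have "(w has_real_derivative (2 * r) * u x powr (2 * r) * u' x / u x * sin x powr (n - 1)
        + (n - 1) * sin x powr (n - 1) * cos x / sin x * u x powr (2 * r)) (at x within {a..b})"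
      unfolding w_def
      by (intro DERIV_mult has_real_derivative_powr_const u' pos s that DERIV_subset[OF DERIV_sin]) auto
    then show ?thesis
      by (simp add: w_def p_def cot_def algebra_simps)
  qed
  have cot_d: "(cot has_real_derivative - (1 + (cot x)^2)) (at x within {a..b})"
    if "x \<in> {a..b}" for x
  proof -
    have "(cot has_real_derivative - inverse ((sin x)^2)) (at x)" using s[OF that] by (intro DERIV_cot) auto
    moreover have "- inverse ((sin x)^2) = - (1 + (cot x)^2)"
    proof -
      have "(1 + (cot x)^2) * (sin x)^2 = 1"
        using s[OF that] by (simp add: cot_def field_simps)
      then show ?thesis using s[OF that] by (simp add: field_simps)
    qed
    ultimately show ?thesis by (metis has_field_derivative_at_within)
  qed
  have Psi_d: "(\<Psi> has_real_derivative \<Psi>' x) (at x within {a..b})" if x: "x \<in> {a..b}" for x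
  proof -
    have "(\<Psi> has_real_derivative
        (w x * (2 * r * p x + (n - 1) * cot x)) * (p x * G x - n * cot x * (p x)^2 + y * p x ^ 3)
        + w x * (p' x * G x + p x * ((q - 2) * (G x - A) * p x)
            - n * (- (1 + (cot x)^2) * (p x)^2 + cot x * (2 * p x * p' x)) + y * (3 * (p x)^2 * p' x)))
        (at x within {a..b})"
      unfolding \<Psi>_def
      by (auto intro!: derivative_eq_intros w_d p_d G_d cot_d x simp: algebra_simps power2_eq_square)
    moreover have "(2 * r * p x + (n - 1) * cot x) * (p x * G x - n * cot x * (p x)^2 + y * p x ^ 3)
        + (p' x * G x + p x * ((q - 2) * (G x - A) * p x)
            - n * (- (1 + (cot x)^2) * (p x)^2 + cot x * (2 * p x * p' x)) + y * (3 * (p x)^2 * p' x))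
        = (M x + N / 2 * (p x)^2)^2 + (K - N^2 / 4) * (p x) ^ 4"
    proof -
      define P c \<alpha> where "P = p x" and "c = cot x" and "\<alpha> = p' x"
      have qA: "(q - 2) * A = n" using q A by simp
      have yn: "(n + 2) * y = - n * (q - 1)" unfolding y_def using n by simp
      have "(2 * r * P + (n - 1) * c) * (P * (\<alpha> + (n - 1) * c * P + P^2) - n * c * P^2 + y * P ^ 3)
        + (\<alpha> * (\<alpha> + (n - 1) * c * P + P^2)
            + P * ((q - 2) * (\<alpha> + (n - 1) * c * P + P^2) * P - ((q - 2) * A) * P)
            - n * (- (1 + c^2) * P^2 + c * (2 * P * \<alpha>)) + y * (3 * P^2 * \<alpha>))
        = (\<alpha> - c * P + N / 2 * P^2)^2 + (K - N^2 / 4) * P ^ 4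
          + c * P ^ 3 * ((n + 2) * y + n * (q - 1))"
        unfolding qA K_def N_def k_def
        by (simp add: algebra_simps power2_eq_square power3_eq_cube power4_eq_xxxx)
      then show ?thesis
        unfolding yn M_def G_eq[OF x, symmetric] P_def c_def \<alpha>_def
        by (simp add: algebra_simps)
    qed
    ultimately show ?thesis
      unfolding \<Psi>'_def by (simp only: mult.assoc distrib_left[symmetric])
  qed
  have nonneg: "\<Psi>' x \<ge> 0" if "x \<in> {a..b}" for x
    unfolding \<Psi>'_def using w_pos[OF that] delta by (intro mult_nonneg_nonneg add_nonneg_nonneg) auto
  have mono: "\<Psi> s \<le> \<Psi> t" if "a \<le> s" "s \<le> t" "t \<le> b" for s t
  proof (rule DERIV_nonneg_imp_increasing_open[OF \<open>s \<le> t\<close>])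
    show "\<exists>y. (\<Psi> has_real_derivative y) (at x) \<and> 0 \<le> y" if "s < x" "x < t" for x
      using Psi_d[of x] nonneg[of x] that \<open>a \<le> s\<close> \<open>t \<le> b\<close>
      by (auto simp: at_within_Icc_at intro!: exI[of _ "\<Psi>' x"])
    have "continuous_on {a..b} \<Psi>"
      by (rule DERIV_continuous_on[OF Psi_d])
    then show "continuous_on {s..t} \<Psi>" by (rule continuous_on_subset) (use that in auto)
  qed
  have "p a = 0" "p b = 0" using bc by (auto simp: p_def)
  then have "\<Psi> a = 0" "\<Psi> b = 0" by (auto simp: \<Psi>_def)
  with mono ab have zero: "\<Psi> x = 0" if "x \<in> {a..b}" for x
    using mono[of a x] mono[of x b] that by auto
  have "\<Psi>' x = 0"
  proof -
    have "(\<Psi> has_real_derivative 0) (at x within {a..b})"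
      by (rule has_field_derivative_transform_within[of "\<lambda>_. 0" _ _ _ 1]) (use x zero in auto)
    moreover have "at x within {a..b} \<noteq> bot"
      using x ab by (simp add: trivial_limit_within islimpt_Icc)
    ultimately show ?thesis
      using Psi_d[OF x] has_field_derivative_unique by blast
  qed
  with w_pos[OF x] have "(M x + N / 2 * (p x)^2)^2 + (K - N^2 / 4) * (p x) ^ 4 = 0"
    by (auto simp: \<Psi>'_def)
  with delta have "(p x) ^ 4 = 0"
    by (smt (verit) mult_pos_pos zero_le_power2 zero_less_power_eq_numeral zero_le_even_power even_numeral mult_nonneg_nonneg power_eq_0_iff zero_less_mult_iff)
  then show ?thesis using pos[OF x] by (simp add: p_def)
qed


section \<open>Minimisers of a weighted one-dimensional Sobolev quotient\<close>

lemma powr_tangent_le: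
  fixes g y q :: real
  assumes g: "g > 0" and q: "q > 1"
  shows "g powr q + q * g powr (q - 1) * (y - g) \<le> \<bar>y\<bar> powr q"
proof (cases "y > 0")
  case True
  have "q * (g powr (q - 1)) * (y - g) \<le> y powr q - g powr q"
  proof (rule convex_on_imp_above_tangent[of "{0<..}" "\<lambda>x. x powr q" g y "q * g powr (q - 1)"])
    show "convex_on {0<..} (\<lambda>x. x powr q)"
      using q by (intro powr_convex) auto
    show "((\<lambda>x. x powr q) has_real_derivative q * g powr (q - 1)) (at g within {0<..})"
      by (rule has_field_derivative_at_within[OF has_real_derivative_powr[OF g]])
  qed (use True g in \<open>auto simp: connected_Ioi interior_open\<close>)
  with True show ?thesis by simp
next
  case False
  have "g powr q + q * g powr (q - 1) * (y - g) = g powr (q - 1) * (g + q * (y - g))"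
    using g by (simp add: powr_diff field_simps)
  also have "g + q * (y - g) \<le> 0"
  proof -
    have "q * (y - g) \<le> q * (- g)" using False q by (intro mult_left_mono) auto
    also have "\<dots> \<le> - g" using g q by simp
    finally show ?thesis by simp
  qed
  then have "g powr (q - 1) * (g + q * (y - g)) \<le> 0" by (simp add: mult_nonneg_nonpos)
  also have "0 \<le> \<bar>y\<bar> powr q" by simp
  finally show ?thesis .
qed

locale weighted_interval =
  fixes a b A q :: real and \<rho> :: "real \<Rightarrow> real"
  assumes ab: "a < b" and A: "A > 0" and q: "q > 2"
    and cont_\<rho>: "continuous_on {a..b} \<rho>" and \<rho>_pos: "\<And>x. x \<in> {a..b} \<Longrightarrow> \<rho> x > 0"
begin

definition C1 :: "(real \<Rightarrow> real) \<Rightarrow> (real \<Rightarrow> real) \<Rightarrow> bool" where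
  "C1 f f' \<longleftrightarrow> continuous_on {a..b} f' \<and>
     (\<forall>x\<in>{a..b}. (f has_real_derivative f' x) (at x within {a..b}))"

definition I :: "(real \<Rightarrow> real) \<Rightarrow> real" where "I g = integral {a..b} g"

definition D :: "(real \<Rightarrow> real) \<Rightarrow> (real \<Rightarrow> real) \<Rightarrow> real" where
  "D f f' = I (\<lambda>x. (f' x)^2 * \<rho> x) + A * I (\<lambda>x. (f x)^2 * \<rho> x)"

definition N :: "(real \<Rightarrow> real) \<Rightarrow> real" where "N f = I (\<lambda>x. \<bar>f x\<bar> powr q * \<rho> x)"

definition level :: real where
  "level = Inf {D f f' | f f'. C1 f f' \<and> N f = 1}"

lemma C1_cont: "C1 f f' \<Longrightarrow> continuous_on {a..b} f"
  unfolding C1_def by (auto intro: DERIV_continuous_on)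

lemma C1_cont': "C1 f f' \<Longrightarrow> continuous_on {a..b} f'"
  unfolding C1_def by auto

lemma I_mono: "continuous_on {a..b} f \<Longrightarrow> continuous_on {a..b} g \<Longrightarrow>
    (\<And>x. x \<in> {a..b} \<Longrightarrow> f x \<le> g x) \<Longrightarrow> I f \<le> I g"
  unfolding I_def by (intro integral_le integrable_continuous_real) auto

lemma I_add: "continuous_on {a..b} f \<Longrightarrow> continuous_on {a..b} g \<Longrightarrow> I (\<lambda>x. f x + g x) = I f + I g"
  unfolding I_def by (intro integral_add integrable_continuous_real) auto

lemma I_diff: "continuous_on {a..b} f \<Longrightarrow> continuous_on {a..b} g \<Longrightarrow> I (\<lambda>x. f x - g x) = I f - I g"
  unfolding I_def by (intro integral_diff integrable_continuous_real) auto

lemma I_cmult: "I (\<lambda>x. c * f x) = c * I f"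
  unfolding I_def by simp

lemma I_cong: "(\<And>x. x \<in> {a..b} \<Longrightarrow> f x = g x) \<Longrightarrow> I f = I g"
  unfolding I_def by (rule integral_cong) auto

lemma I_FTC:
  assumes "\<And>x. x \<in> {a..b} \<Longrightarrow> (F has_real_derivative f x) (at x within {a..b})"
  shows "I f = F b - F a"
  unfolding I_def using ab assms
  by (intro integral_unique fundamental_theorem_of_calculus)
     (auto simp: has_real_derivative_iff_has_vector_derivative[symmetric])

lemma I_nonneg: "(\<And>x. x \<in> {a..b} \<Longrightarrow> 0 \<le> f x) \<Longrightarrow> 0 \<le> I f"
  unfolding I_def by (cases "f integrable_on {a..b}") (auto intro: integral_nonneg simp: not_integrable_integral)

lemma cont_powr:
  fixes f :: "real \<Rightarrow> real"
  shows "continuous_on {a..b} f \<Longrightarrow> c > 0 \<Longrightarrow> (\<And>x. x \<in> {a..b} \<Longrightarrow> 0 \<le> f x) \<Longrightarrow>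
   continuous_on {a..b} (\<lambda>x. f x powr c)"
  by (intro continuous_on_powr' continuous_on_const) auto

lemma I_limit:
  assumes lim: "uniform_limit {a..b} f g sequentially" and f: "\<And>n. continuous_on {a..b} (f n)"
  shows "(\<lambda>n. I (f n)) \<longlonglongrightarrow> I g"
proof -
  obtain J K where "\<And>n. (f n has_integral J n) {a..b}" "(g has_integral K) {a..b}" "J \<longlonglongrightarrow> K"
    using uniform_limit_integral[OF lim f] by auto
  moreover from this have "I (f n) = J n" "I g = K" for n
    by (auto simp: I_def integral_unique)
  ultimately show ?thesis by simp
qed

lemma D_nonneg: "0 \<le> D f f'"
  unfolding D_def using A by (intro add_nonneg_nonneg mult_nonneg_nonneg I_nonneg) (auto simp: \<rho>_pos less_imp_le)

lemma N_nonneg: "0 \<le> N f"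
  unfolding N_def by (intro I_nonneg) (auto simp: \<rho>_pos less_imp_le)

lemma level_nonneg_and_le:
  assumes "C1 f f'"
  shows "0 \<le> level" and "level * N f powr (2 / q) \<le> D f f'"
proof -
  let ?S = "{D f f' | f f'. C1 f f' \<and> N f = 1}"
  have bdd: "bdd_below ?S" by (rule bdd_belowI[of _ 0]) (auto simp: D_nonneg)
  have scale: "C1 (\<lambda>x. c * f x) (\<lambda>x. c * f' x) \<and> N (\<lambda>x. c * f x) = c powr q * N f \<and>
      D (\<lambda>x. c * f x) (\<lambda>x. c * f' x) = c^2 * D f f'" if "C1 f f'" "c \<ge> 0" for f f' c
  proof (intro conjI)
    show "C1 (\<lambda>x. c * f x) (\<lambda>x. c * f' x)"
      using that unfolding C1_def by (auto intro!: continuous_intros DERIV_cmult)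
    have "N (\<lambda>x. c * f x) = I (\<lambda>x. c powr q * (\<bar>f x\<bar> powr q * \<rho> x))"
      unfolding N_def using that by (intro I_cong) (simp add: abs_mult powr_mult)
    then show "N (\<lambda>x. c * f x) = c powr q * N f" by (simp add: I_cmult N_def)
    have "I (\<lambda>x. (c * f x)^2 * \<rho> x) = c^2 * I (\<lambda>x. (f x)^2 * \<rho> x)" for f
      unfolding I_cmult[symmetric] by (intro I_cong) (simp add: power_mult_distrib)
    then show "D (\<lambda>x. c * f x) (\<lambda>x. c * f' x) = c^2 * D f f'"
      unfolding D_def by (simp add: algebra_simps)
  qed
  have unit: "C1 (\<lambda>x. c) (\<lambda>x. 0)" for c unfolding C1_def by auto
  have Z: "I \<rho> > 0"
  proof -
    have "I \<rho> \<noteq> 0"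
    proof
      assume "I \<rho> = 0"
      then have "\<rho> a = 0"
        using integral_eq_0_iff[OF cont_\<rho> ab, of] \<rho>_pos ab unfolding I_def by (auto simp: less_imp_le)
      with \<rho>_pos[of a] ab show False by auto
    qed
    moreover have "I \<rho> \<ge> 0" by (intro I_nonneg) (auto simp: \<rho>_pos less_imp_le)
    ultimately show ?thesis by simp
  qed
  have normalise: "C1 (\<lambda>x. N f powr (- 1 / q) * f x) (\<lambda>x. N f powr (- 1 / q) * f' x) \<and>
    N (\<lambda>x. N f powr (- 1 / q) * f x) = 1 \<and>
    D (\<lambda>x. N f powr (- 1 / q) * f x) (\<lambda>x. N f powr (- 1 / q) * f' x) = N f powr (- 2 / q) * D f f'"
    if "C1 f f'" "N f > 0" for f f'
  proof -
    have "(N f powr (- 1 / q)) powr q * N f = 1"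
    proof -
      have "(N f powr (- 1 / q)) powr q = N f powr (- 1)"
        unfolding powr_powr using q by simp
      then show ?thesis using that by (simp add: powr_minus)
    qed
    moreover have "(N f powr (- 1 / q))^2 = N f powr (- 2 / q)"
      by (simp add: power2_eq_square flip: powr_add)
    ultimately show ?thesis using scale[OF that(1), of "N f powr (- 1 / q)"] by simp
  qed
  have "N (\<lambda>x. 1) = I \<rho>" unfolding N_def by simp
  with normalise[OF unit[of 1]] Z have "?S \<noteq> {}" by auto
  then show "0 \<le> level" unfolding level_def by (intro cInf_greatest) (auto simp: D_nonneg)
  show "level * N f powr (2 / q) \<le> D f f'"
  proof (cases "N f > 0")
    case True
    have "level \<le> N f powr (- 2 / q) * D f f'"
      unfolding level_def using normalise[OF assms True] by (intro cInf_lower bdd) force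
    then have "level * N f powr (2 / q) \<le> N f powr (- 2 / q) * D f f' * N f powr (2 / q)"
      by (intro mult_right_mono) auto
    also have "\<dots> = D f f'"
      using True by (simp add: powr_minus)
    finally show ?thesis .
  next
    case False
    with N_nonneg[of f] have "N f = 0" by simp
    then show ?thesis using D_nonneg q by simp
  qed
qed


lemma cont_N:
  assumes "continuous_on {a..b} f" shows "continuous_on {a..b} (\<lambda>x. \<bar>f x\<bar> powr q * \<rho> x)"
  using q by (intro continuous_on_mult cont_powr continuous_on_rabs assms cont_\<rho>) auto

lemma I_\<rho>_pos: "I \<rho> > 0"
proof -
  have "I \<rho> \<noteq> 0"
  proof
    assume "I \<rho> = 0"
    then have "\<rho> a = 0"
      using integral_eq_0_iff[OF cont_\<rho> ab] \<rho>_pos ab unfolding I_def by (auto simp: less_imp_le)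
    with \<rho>_pos[of a] ab show False by auto
  qed
  moreover have "I \<rho> \<ge> 0" by (intro I_nonneg) (auto simp: \<rho>_pos less_imp_le)
  ultimately show ?thesis by simp
qed

lemma \<rho>_lower_bound: obtains \<rho>0 where "\<rho>0 > 0" "\<And>x. x \<in> {a..b} \<Longrightarrow> \<rho>0 \<le> \<rho> x"
proof -
  obtain x0 where "x0 \<in> {a..b}" "\<forall>x\<in>{a..b}. \<rho> x0 \<le> \<rho> x"
    using continuous_attains_inf[OF compact_Icc _ cont_\<rho>] ab by auto
  with \<rho>_pos that show ?thesis by blast
qed

text \<open>
  The pointwise bound \<open>|f'| \<le> s + f'\<^sup>2 / s\<close> gives a modulus of continuity that depends on \<open>D\<close> only, as
  required for the Arzela-Ascoli theorem along a minimising sequence.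
\<close>

lemma C1_oscillation:
  assumes f: "C1 f f'" and s: "s > 0" and r: "\<rho>0 > 0" "\<And>x. x \<in> {a..b} \<Longrightarrow> \<rho>0 \<le> \<rho> x"
    and x: "x \<in> {a..b}" "y \<in> {a..b}"
  shows "\<bar>f x - f y\<bar> \<le> s * \<bar>x - y\<bar> + D f f' / (s * \<rho>0)"
proof -
  have c: "continuous_on {a..b} f'" using f by (rule C1_cont')
  have E: "I (\<lambda>x. (f' x)^2) \<le> D f f' / \<rho>0"
  proof -
    have "\<rho>0 * I (\<lambda>x. (f' x)^2) = I (\<lambda>x. \<rho>0 * (f' x)^2)" by (simp add: I_cmult)
    also have "\<dots> \<le> I (\<lambda>x. (f' x)^2 * \<rho> x)"
      using r by (intro I_mono continuous_intros c cont_\<rho>) (auto simp: mult.commute[of \<rho>0] intro!: mult_left_mono)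
    also have "\<dots> \<le> D f f'"
      unfolding D_def using A by (auto intro!: mult_nonneg_nonneg I_nonneg simp: \<rho>_pos less_imp_le)
    finally show ?thesis using r by (simp add: field_simps)
  qed
  have *: "\<bar>f y - f x\<bar> \<le> s * (y - x) + D f f' / (s * \<rho>0)" if "x \<le> y" "x \<in> {a..b}" "y \<in> {a..b}" for x y
  proof -
    have sub: "{x..y} \<subseteq> {a..b}" using that by auto
    have int: "(f' has_integral (f y - f x)) {x..y}"
      using f that unfolding C1_def
      by (intro fundamental_theorem_of_calculus)
         (auto simp: has_real_derivative_iff_has_vector_derivative[symmetric] intro: DERIV_subset[OF _ sub])
    have c2: "continuous_on {x..y} f'" using c sub by (rule continuous_on_subset)
    have "\<bar>f y - f x\<bar> = \<bar>integral {x..y} f'\<bar>" using integral_unique[OF int] by simp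
    also have "\<dots> \<le> integral {x..y} (\<lambda>t. s + (f' t)^2 / s)"
    proof (rule integral_norm_bound_integral[of f', unfolded real_norm_def])
      show "f' integrable_on {x..y}" using int by blast
      show "(\<lambda>t. s + (f' t)^2 / s) integrable_on {x..y}"
        using s by (intro integrable_continuous_real continuous_intros c2) auto
      fix t
      show "\<bar>f' t\<bar> \<le> s + (f' t)^2 / s"
      proof (cases "\<bar>f' t\<bar> \<le> s")
        case True then show ?thesis using s by (simp add: add_increasing2)
      next
        case False
        then have "s * \<bar>f' t\<bar> \<le> (f' t)^2" by (metis abs_ge_zero linear mult_right_mono power2_abs power2_eq_square)
        then have "\<bar>f' t\<bar> \<le> (f' t)^2 / s" using s by (simp add: field_simps)
        then show ?thesis using s by simp
      qed
    qed
    also have "\<dots> = s * (y - x) + integral {x..y} (\<lambda>t. (f' t)^2) / s"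
      using that s by (subst integral_add) (auto intro!: integrable_continuous_real continuous_intros c2)
    also have "integral {x..y} (\<lambda>t. (f' t)^2) \<le> I (\<lambda>t. (f' t)^2)"
      unfolding I_def using sub
      by (intro integral_subset_le integrable_continuous_real continuous_intros c c2) auto
    finally have "\<bar>f y - f x\<bar> \<le> s * (y - x) + I (\<lambda>t. (f' t)^2) / s"
      using s by (simp add: divide_right_mono)
    also have "I (\<lambda>t. (f' t)^2) / s \<le> D f f' / (s * \<rho>0)"
      using divide_right_mono[OF E, of s] s by (simp add: mult.commute)
    finally show ?thesis by simp
  qed
  show ?thesis
  proof (cases "x \<le> y")
    case True then show ?thesis using *[OF _ x] by (simp add: abs_minus_commute)
  next
    case False then show ?thesis using *[OF _ x(2) x(1)] by simp
  qed
qed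

lemma minimising_limit:
  obtains f f' g where "\<And>n::nat. C1 (f n) (f' n)" "\<And>n. N (f n) = 1"
    "(\<lambda>n. D (f n) (f' n)) \<longlonglongrightarrow> level"
    "continuous_on {a..b} g" "uniform_limit {a..b} f g sequentially"
proof -
  let ?S = "{D f f' | f f'. C1 f f' \<and> N f = 1}"
  have bdd: "bdd_below ?S" by (rule bdd_belowI[of _ 0]) (auto simp: D_nonneg)
  have "?S \<noteq> {}"
  proof -
    define c where "c = I \<rho> powr (- 1 / q)"
    have "N (\<lambda>_. c) = c powr q * I \<rho>"
      unfolding N_def I_cmult c_def by simp
    also have "c powr q = I \<rho> powr (- 1)" unfolding c_def powr_powr using q by simp
    also have "\<dots> * I \<rho> = 1" using I_\<rho>_pos by (simp add: powr_minus)
    finally have "N (\<lambda>_. c) = 1" .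
    moreover have "C1 (\<lambda>_. c) (\<lambda>_. 0)" by (simp add: C1_def)
    ultimately show ?thesis by auto
  qed
  have "\<exists>p. C1 (fst p) (snd p) \<and> N (fst p) = 1 \<and> D (fst p) (snd p) < level + 1 / Suc n" for n
  proof -
    have "\<exists>y\<in>?S. y < level + 1 / Suc n"
      using \<open>?S \<noteq> {}\<close> bdd unfolding level_def by (subst cInf_less_iff[symmetric]) auto
    then show ?thesis by auto
  qed
  then obtain p where p: "\<And>n. C1 (fst (p n)) (snd (p n))" "\<And>n. N (fst (p n)) = 1"
    "\<And>n. D (fst (p n)) (snd (p n)) < level + 1 / Suc n" by metis
  define F F' where "F n = fst (p n)" and "F' n = snd (p n)" for n
  have F: "C1 (F n) (F' n)" "N (F n) = 1" "D (F n) (F' n) < level + 1 / Suc n" for n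
    using p by (auto simp: F_def F'_def)
  have lev: "level \<le> D (F n) (F' n)" for n
    unfolding level_def using F by (intro cInf_lower bdd) auto
  have Dlim: "(\<lambda>n. D (F n) (F' n)) \<longlonglongrightarrow> level"
  proof (rule tendsto_sandwich[of "\<lambda>_. level" _ _ "\<lambda>n. level + 1 / Suc n"])
    show "(\<lambda>n. level + 1 / Suc n) \<longlonglongrightarrow> level"
      using tendsto_add[OF tendsto_const[of level] LIMSEQ_inverse_real_of_nat] by (simp add: inverse_eq_divide)
  qed (use less_imp_le[OF F(3)] in \<open>auto simp: lev\<close>)
  define K where "K = level + 1"
  have DK: "D (F n) (F' n) \<le> K" for n
  proof -
    have "1 / real (Suc n) \<le> 1" by simp
    then show ?thesis using F(3)[of n] unfolding K_def by linarith
  qed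
  obtain \<rho>0 where \<rho>0: "\<rho>0 > 0" "\<And>x. x \<in> {a..b} \<Longrightarrow> \<rho>0 \<le> \<rho> x" using \<rho>_lower_bound by blast
  have osc: "\<bar>F n x - F n y\<bar> \<le> s * \<bar>x - y\<bar> + K / (s * \<rho>0)"
    if "s > 0" "x \<in> {a..b}" "y \<in> {a..b}" for s x y n
    using C1_oscillation[OF F(1)[of n] that(1) \<rho>0 that(2,3)]
      divide_right_mono[OF DK[of n], of "s * \<rho>0"] that \<rho>0(1) by auto
  define M where "M = (2 / I \<rho>) powr (1 / q) + ((b - a) + K / \<rho>0)"
  have bound: "norm (F n x) \<le> M" if x: "x \<in> {a..b}" for n x
  proof -
    have "\<exists>y\<in>{a..b}. \<bar>F n y\<bar> powr q \<le> 2 / I \<rho>"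
    proof (rule ccontr)
      assume "\<not> ?thesis"
      then have "2 / I \<rho> \<le> \<bar>F n y\<bar> powr q" if "y \<in> {a..b}" for y using that by force
      then have "I (\<lambda>y. 2 / I \<rho> * \<rho> y) \<le> N (F n)"
        unfolding N_def
        by (intro I_mono continuous_on_mult continuous_on_const cont_N cont_\<rho> C1_cont[OF F(1)] mult_right_mono)
           (auto simp: \<rho>_pos less_imp_le)
      then show False using F(2)[of n] I_\<rho>_pos unfolding I_cmult by simp
    qed
    then obtain y where y: "y \<in> {a..b}" "\<bar>F n y\<bar> powr q \<le> 2 / I \<rho>" by blast
    have "\<bar>F n y\<bar> = (\<bar>F n y\<bar> powr q) powr (1 / q)" using q by (simp add: powr_powr)
    also have "\<dots> \<le> (2 / I \<rho>) powr (1 / q)" using y q by (intro powr_mono2) auto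
    finally have "\<bar>F n y\<bar> \<le> (2 / I \<rho>) powr (1 / q)" .
    moreover have "\<bar>F n x - F n y\<bar> \<le> 1 * \<bar>x - y\<bar> + K / (1 * \<rho>0)" by (rule osc) (use x y in auto)
    moreover have "\<bar>x - y\<bar> \<le> b - a" using x y by auto
    ultimately show ?thesis unfolding M_def by simp
  qed
  have equi: "\<exists>d. 0 < d \<and> (\<forall>n y. y \<in> {a..b} \<and> norm (x - y) < d \<longrightarrow> norm (F n x - F n y) < e)"
    if "x \<in> {a..b}" "0 < e" for x e
  proof -
    have K: "K > 0" using level_nonneg_and_le(1)[OF F(1)] by (simp add: K_def)
    define s where "s = 2 * K / (e * \<rho>0)"
    have s: "s > 0" using K \<rho>0 that by (simp add: s_def)
    have Ks: "K / (s * \<rho>0) = e / 2" using K \<rho>0 that by (simp add: s_def field_simps)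
    show ?thesis
    proof (intro exI[of _ "e / (2 * s)"] conjI allI impI)
      show "0 < e / (2 * s)" using s that by simp
      fix n y assume y: "y \<in> {a..b} \<and> norm (x - y) < e / (2 * s)"
      have "\<bar>F n x - F n y\<bar> \<le> s * \<bar>x - y\<bar> + e / 2" using osc[OF s that(1), of y n] y Ks by simp
      also have "s * \<bar>x - y\<bar> < s * (e / (2 * s))" using y s by (intro mult_strict_left_mono) auto
      finally show "norm (F n x - F n y) < e" using s by simp
    qed
  qed
  obtain g k where g: "continuous_on {a..b} g" and k: "strict_mono (k :: nat \<Rightarrow> nat)"
    and lim: "\<And>e. 0 < e \<Longrightarrow> \<exists>N. \<forall>n x. n \<ge> N \<and> x \<in> {a..b} \<longrightarrow> norm (F (k n) x - g x) < e"
    using Arzela_Ascoli[of "{a..b}" F M] bound equi by (metis compact_Icc)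
  have "uniform_limit {a..b} (\<lambda>n. F (k n)) g sequentially"
    unfolding uniform_limit_iff eventually_sequentially dist_norm using lim by meson
  moreover have "(\<lambda>n. D (F (k n)) (F' (k n))) \<longlonglongrightarrow> level"
    using LIMSEQ_subseq_LIMSEQ[OF Dlim k] by (simp add: o_def)
  ultimately show ?thesis using that[of "\<lambda>n. F (k n)" "\<lambda>n. F' (k n)" g] F g by blast
qed

text \<open>
  Testing a minimising sequence against \<open>\<phi>\<close> and moving the derivative onto \<open>\<phi>' \<rho>\<close> needs only the
  uniform limit of the sequence, not its derivatives; the sequence is made positive beforehand, so
  that the convexity of the power gives a lower bound for the perturbed norm.
\<close>

lemma very_weak_minimiser:
  obtains u where "continuous_on {a..b} u" "\<And>x. x \<in> {a..b} \<Longrightarrow> 0 \<le> u x" "N u = 1"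
    "\<And>\<phi> \<phi>' \<zeta> \<zeta>'. C1 \<phi> \<phi>' \<Longrightarrow> C1 \<zeta> \<zeta>' \<Longrightarrow> (\<And>x. x \<in> {a..b} \<Longrightarrow> \<phi>' x * \<rho> x = \<zeta> x) \<Longrightarrow>
        \<zeta> a = 0 \<Longrightarrow> \<zeta> b = 0 \<Longrightarrow>
        A * I (\<lambda>x. u x * \<phi> x * \<rho> x) - I (\<lambda>x. u x * \<zeta>' x)
          = level * I (\<lambda>x. u x powr (q - 1) * \<phi> x * \<rho> x)"
proof -
  obtain f f' g where f: "\<And>n::nat. C1 (f n) (f' n)" and Nf: "\<And>n. N (f n) = 1"
    and Dlim: "(\<lambda>n. D (f n) (f' n)) \<longlonglongrightarrow> level"
    and g: "continuous_on {a..b} g" and ul: "uniform_limit {a..b} f g sequentially"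
    by (rule minimising_limit) blast
  define u where "u x = \<bar>g x\<bar>" for x
  define e where "e n = 1 / real (Suc n)" for n
  have e: "e n > 0" for n by (simp add: e_def)
  have e0: "e \<longlonglongrightarrow> 0" using LIMSEQ_inverse_real_of_nat by (simp add: e_def[abs_def] inverse_eq_divide)
  \<comment> \<open>Smooth positive versions of \<open>|f n|\<close>: \<open>N\<close> does not decrease and \<open>D\<close> increases by a vanishing amount.\<close>
  define v where "v n x = sqrt ((f n x)^2 + e n)" for n x
  define v' where "v' n x = f n x * f' n x / v n x" for n x
  have v_pos: "v n x > 0" for n x unfolding v_def using e[of n] by (simp add: add_nonneg_pos)
  have v_sq: "(v n x)^2 = (f n x)^2 + e n" for n x unfolding v_def using e[of n] by (simp add: add_nonneg_nonneg less_imp_le)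
  have v_ge: "\<bar>f n x\<bar> \<le> v n x" for n x
    by (rule power2_le_imp_le) (use v_sq e[of n] v_pos[of n x] in \<open>auto simp: less_imp_le\<close>)
  have v: "C1 (v n) (v' n)" for n
    unfolding C1_def
  proof (intro conjI ballI)
    have cv: "continuous_on {a..b} (v n)" unfolding v_def by (intro continuous_intros C1_cont[OF f])
    show "continuous_on {a..b} (v' n)"
      unfolding v'_def using v_pos by (intro continuous_intros cv C1_cont[OF f] C1_cont'[OF f]) (metis less_irrefl)
    fix x assume x: "x \<in> {a..b}"
    have "(f n has_real_derivative f' n x) (at x within {a..b})" using f x by (auto simp: C1_def)
    then have "((\<lambda>x. sqrt ((f n x)^2 + e n)) has_real_derivative
        (2 * f n x * f' n x) * (inverse (sqrt ((f n x)^2 + e n)) / 2)) (at x within {a..b})"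
      using add_nonneg_pos[OF zero_le_power2 e, of "f n x" n] by (auto intro!: derivative_eq_intros)
    then show "(v n has_real_derivative v' n x) (at x within {a..b})"
      unfolding v_def[abs_def] v'_def by (simp add: field_simps)
  qed
  have Dv: "D (v n) (v' n) \<le> D (f n) (f' n) + A * (e n * I \<rho>)" for n
  proof -
    have "I (\<lambda>x. (v' n x)^2 * \<rho> x) \<le> I (\<lambda>x. (f' n x)^2 * \<rho> x)"
    proof (intro I_mono continuous_intros cont_\<rho> C1_cont'[OF f] C1_cont'[OF v] mult_right_mono)
      fix x assume "x \<in> {a..b}"
      then show "0 \<le> \<rho> x" by (simp add: \<rho>_pos less_imp_le)
      have "\<bar>v' n x\<bar> = \<bar>f' n x\<bar> * (\<bar>f n x\<bar> / v n x)"
        unfolding v'_def using v_pos[of n x] by (simp add: abs_mult)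
      also have "\<dots> \<le> \<bar>f' n x\<bar> * 1"
        using v_ge[of n x] v_pos[of n x] by (intro mult_left_mono) auto
      finally show "(v' n x)^2 \<le> (f' n x)^2" by (simp add: abs_le_square_iff)
    qed
    moreover have "I (\<lambda>x. (v n x)^2 * \<rho> x) = I (\<lambda>x. (f n x)^2 * \<rho> x) + e n * I \<rho>"
      unfolding I_cmult[symmetric] v_sq distrib_right
      by (intro I_add continuous_intros cont_\<rho> C1_cont[OF f])
    ultimately show ?thesis unfolding D_def using A by (simp add: algebra_simps)
  qed
  have Nv: "1 \<le> N (v n)" for n
    unfolding Nf[of n, symmetric] N_def using q v_ge v_pos
    by (intro I_mono cont_N C1_cont[OF f] C1_cont[OF v] mult_right_mono powr_mono2)
       (auto simp: \<rho>_pos less_imp_le)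
  have uv: "uniform_limit {a..b} v u sequentially"
  proof -
    have "\<bar>v n x - u x\<bar> \<le> sqrt (e n) + \<bar>f n x - g x\<bar>" for n x
    proof -
      have "v n x \<le> \<bar>f n x\<bar> + sqrt (e n)"
        unfolding v_def using sqrt_add_le_add_sqrt[of "(f n x)^2" "e n"] e[of n] by simp
      then show ?thesis using v_ge[of n x] e[of n] unfolding u_def by (smt (verit) real_sqrt_ge_zero)
    qed
    note b = this
    show ?thesis
      unfolding uniform_limit_iff
    proof (intro allI impI)
      fix r :: real assume r: "r > 0"
      have "eventually (\<lambda>n. sqrt (e n) < r / 2) sequentially"
        using tendsto_real_sqrt[OF e0] r by (auto dest!: order_tendstoD(2)[of _ _ _ "r/2"])
      moreover have "eventually (\<lambda>n. \<forall>x\<in>{a..b}. dist (f n x) (g x) < r / 2) sequentially"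
        using ul half_gt_zero[OF r] unfolding uniform_limit_iff by blast
      ultimately show "eventually (\<lambda>n. \<forall>x\<in>{a..b}. dist (v n x) (u x) < r) sequentially"
      proof eventually_elim
        case (elim n)
        show ?case
        proof
          fix x assume "x \<in> {a..b}"
          with elim have "dist (f n x) (g x) < r / 2" by blast
          with b[of n x] elim show "dist (v n x) (u x) < r" by (simp add: dist_real_def)
        qed
      qed
    qed
  qed
  have u_cont: "continuous_on {a..b} u" unfolding u_def by (intro continuous_intros g)
  have u_nonneg: "0 \<le> u x" for x by (simp add: u_def)
  have lim_mult: "(\<lambda>n. I (\<lambda>x. v n x * c x)) \<longlonglongrightarrow> I (\<lambda>x. u x * c x)" if "continuous_on {a..b} c" for c
  proof (rule I_limit)
    show "uniform_limit {a..b} (\<lambda>n x. v n x * c x) (\<lambda>x. u x * c x) sequentially"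
      by (intro uniform_lim_mult uv uniform_limit_const compact_imp_bounded
           compact_continuous_image u_cont that compact_Icc)
    show "continuous_on {a..b} (\<lambda>x. v n x * c x)" for n by (intro continuous_intros C1_cont[OF v] that)
  qed
  have u_bdd: "\<exists>B. \<forall>x\<in>{a..b}. u x \<le> B"
    using compact_imp_bounded[OF compact_continuous_image[OF u_cont compact_Icc]]
    unfolding bounded_iff by (auto simp: image_iff) (metis abs_le_D1 atLeastAtMost_iff)
  then obtain B where B: "\<And>x. x \<in> {a..b} \<Longrightarrow> u x \<le> B" by blast
  have lim_powr: "(\<lambda>n. I (\<lambda>x. h n x powr r * c x)) \<longlonglongrightarrow> I (\<lambda>x. u x powr r * c x)"
    if c: "continuous_on {a..b} c" and r: "r > 0" and h: "uniform_limit {a..b} h u sequentially"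
      "\<And>n. continuous_on {a..b} (h n)" "\<And>n x. 0 \<le> h n x" for c r h
  proof (rule I_limit)
    have unif: "uniformly_continuous_on {0..B + 1} (\<lambda>s. s powr r)"
      using r by (intro compact_uniformly_continuous continuous_on_powr' continuous_intros) auto
    have ev: "eventually (\<lambda>n. \<forall>x\<in>{a..b}. dist (h n x) (u x) < 1) sequentially"
      using h(1) unfolding uniform_limit_iff by auto
    have "uniform_limit {a..b} (\<lambda>n x. h n x powr r) (\<lambda>x. u x powr r) sequentially"
      unfolding uniform_limit_iff
    proof (intro allI impI)
      fix s :: real assume "s > 0"
      then obtain d where d: "d > 0" "\<And>x y. x \<in> {0..B+1} \<Longrightarrow> y \<in> {0..B+1} \<Longrightarrow> dist x y < d \<Longrightarrow>
          dist (x powr r) (y powr r) < s"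
        using unif unfolding uniformly_continuous_on_def by metis
      have "eventually (\<lambda>n. \<forall>x\<in>{a..b}. dist (h n x) (u x) < d) sequentially"
        using h(1) d(1) unfolding uniform_limit_iff by auto
      with ev show "eventually (\<lambda>n. \<forall>x\<in>{a..b}. dist (h n x powr r) (u x powr r) < s) sequentially"
      proof eventually_elim
        case (elim n)
        show ?case
        proof
          fix x assume x: "x \<in> {a..b}"
          have "u x \<le> B" "\<bar>h n x - u x\<bar> < 1" "dist (h n x) (u x) < d"
            using B x elim by (auto simp: dist_real_def)
          then show "dist (h n x powr r) (u x powr r) < s"
            using u_nonneg[of x] h(3)[of n x] by (intro d(2)) auto
        qed
      qed
    qed
    then show "uniform_limit {a..b} (\<lambda>n x. h n x powr r * c x) (\<lambda>x. u x powr r * c x) sequentially"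
      by (intro uniform_lim_mult uniform_limit_const compact_imp_bounded compact_continuous_image
           c compact_Icc cont_powr u_cont r u_nonneg)
    show "continuous_on {a..b} (\<lambda>x. h n x powr r * c x)" for n
      using h r by (intro continuous_on_mult cont_powr c) auto
  qed
  have Nu: "N u = 1"
  proof -
    have "uniform_limit {a..b} (\<lambda>n x. \<bar>f n x\<bar>) u sequentially"
      unfolding u_def uniform_limit_iff
    proof (intro allI impI)
      fix r :: real assume "r > 0"
      then have "eventually (\<lambda>n. \<forall>x\<in>{a..b}. dist (f n x) (g x) < r) sequentially"
        using ul unfolding uniform_limit_iff by blast
      then show "eventually (\<lambda>n. \<forall>x\<in>{a..b}. dist \<bar>f n x\<bar> \<bar>g x\<bar> < r) sequentially"
        by (rule eventually_mono) (force simp: dist_real_def intro: le_less_trans[OF abs_triangle_ineq3])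
    qed
    then have "(\<lambda>n. I (\<lambda>x. \<bar>f n x\<bar> powr q * \<rho> x)) \<longlonglongrightarrow> I (\<lambda>x. u x powr q * \<rho> x)"
      using q by (intro lim_powr cont_\<rho> continuous_intros C1_cont[OF f]) auto
    then have "(\<lambda>n. 1) \<longlonglongrightarrow> N u" using Nf u_nonneg by (simp add: N_def)
    then show ?thesis by (simp add: LIMSEQ_const_iff)
  qed
  have EL: "A * I (\<lambda>x. u x * \<phi> x * \<rho> x) - I (\<lambda>x. u x * \<zeta>' x)
          = level * I (\<lambda>x. u x powr (q - 1) * \<phi> x * \<rho> x)"
    if \<phi>: "C1 \<phi> \<phi>'" and \<zeta>: "C1 \<zeta> \<zeta>'" and eq: "\<And>x. x \<in> {a..b} \<Longrightarrow> \<phi>' x * \<rho> x = \<zeta> x"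
      and bc: "\<zeta> a = 0" "\<zeta> b = 0" for \<phi> \<phi>' \<zeta> \<zeta>'
  proof -
    define J where "J = I (\<lambda>x. u x powr (q - 1) * (\<phi> x * \<rho> x))"
    define Jn where "Jn n = I (\<lambda>x. v n x powr (q - 1) * (\<phi> x * \<rho> x))" for n
    define L where "L = A * I (\<lambda>x. u x * (\<phi> x * \<rho> x)) - I (\<lambda>x. u x * \<zeta>' x)"
    define Ln where "Ln n = A * I (\<lambda>x. v n x * (\<phi> x * \<rho> x)) - I (\<lambda>x. v n x * \<zeta>' x)" for n
    note conts = C1_cont[OF \<phi>] C1_cont'[OF \<phi>] C1_cont[OF \<zeta>] C1_cont'[OF \<zeta>] cont_\<rho> C1_cont[OF v] C1_cont'[OF v]
    have Jlim: "Jn \<longlonglongrightarrow> J"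
      unfolding J_def Jn_def using q v_pos
      by (intro lim_powr uv continuous_intros conts) (auto simp: less_imp_le)
    have Llim: "Ln \<longlonglongrightarrow> L"
      unfolding L_def Ln_def by (intro tendsto_intros lim_mult continuous_intros conts)
    have parts: "I (\<lambda>x. v' n x * \<zeta> x) = - I (\<lambda>x. v n x * \<zeta>' x)" for n
    proof -
      have "I (\<lambda>x. v' n x * \<zeta> x + v n x * \<zeta>' x) = v n b * \<zeta> b - v n a * \<zeta> a"
      proof (rule I_FTC)
        fix x assume x: "x \<in> {a..b}"
        have "(v n has_real_derivative v' n x) (at x within {a..b})"
          "(\<zeta> has_real_derivative \<zeta>' x) (at x within {a..b})"
          using v[of n] \<zeta> x by (auto simp: C1_def)
        then show "((\<lambda>x. v n x * \<zeta> x) has_real_derivative v' n x * \<zeta> x + v n x * \<zeta>' x) (at x within {a..b})"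
          by (auto intro!: derivative_eq_intros)
      qed
      also have "I (\<lambda>x. v' n x * \<zeta> x + v n x * \<zeta>' x) = I (\<lambda>x. v' n x * \<zeta> x) + I (\<lambda>x. v n x * \<zeta>' x)"
        by (intro I_add continuous_intros conts)
      finally show ?thesis using bc by simp
    qed
    have key: "level * (1 + t * q * J) powr (2 / q) \<le> level + 2 * t * L + t^2 * D \<phi> \<phi>'"
      if t: "1 + t * q * J > 0" for t
    proof (rule LIMSEQ_le)
      show "(\<lambda>n. level * (1 + t * q * Jn n) powr (2 / q)) \<longlonglongrightarrow> level * (1 + t * q * J) powr (2 / q)"
        using t q by (intro tendsto_intros Jlim) auto
      show "(\<lambda>n. (D (f n) (f' n) + A * (e n * I \<rho>)) + 2 * t * Ln n + t^2 * D \<phi> \<phi>')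
          \<longlonglongrightarrow> level + 2 * t * L + t^2 * D \<phi> \<phi>'"
        using tendsto_add[OF tendsto_add[OF tendsto_add[OF Dlim tendsto_mult[OF tendsto_const[of A] tendsto_mult[OF e0 tendsto_const[of "I \<rho>"]]]]
            tendsto_mult[OF tendsto_const[of "2 * t"] Llim]] tendsto_const[of "t^2 * D \<phi> \<phi>'"]] by simp
      have "eventually (\<lambda>n. 1 + t * q * Jn n > 0) sequentially"
        using t by (intro order_tendstoD(1)[of _ "1 + t * q * J"] tendsto_intros Jlim) auto
      then have "eventually (\<lambda>n. level * (1 + t * q * Jn n) powr (2 / q)
          \<le> (D (f n) (f' n) + A * (e n * I \<rho>)) + 2 * t * Ln n + t^2 * D \<phi> \<phi>') sequentially"
      proof eventually_elim
        case (elim n)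
        define w w' where "w x = v n x + t * \<phi> x" and "w' x = v' n x + t * \<phi>' x" for x
        have w: "C1 w w'"
          unfolding C1_def w_def[abs_def] w'_def[abs_def]
        proof (intro conjI ballI)
          show "continuous_on {a..b} (\<lambda>x. v' n x + t * \<phi>' x)" by (intro continuous_intros conts)
          fix x assume "x \<in> {a..b}"
          then have "(v n has_real_derivative v' n x) (at x within {a..b})"
            "(\<phi> has_real_derivative \<phi>' x) (at x within {a..b})" using v[of n] \<phi> by (auto simp: C1_def)
          then show "((\<lambda>x. v n x + t * \<phi> x) has_real_derivative v' n x + t * \<phi>' x) (at x within {a..b})"
            by (auto intro!: derivative_eq_intros)
        qed
        have "1 + t * q * Jn n \<le> N (v n) + t * q * Jn n" using Nv[of n] by simp
        also have "\<dots> = I (\<lambda>x. \<bar>v n x\<bar> powr q * \<rho> x + (t * q) * (v n x powr (q - 1) * (\<phi> x * \<rho> x)))"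
          unfolding N_def Jn_def I_cmult[symmetric] using q v_pos
          by (intro I_add[symmetric] continuous_on_mult continuous_on_const conts cont_powr cont_N) (auto simp: less_imp_le)
        also have "\<dots> \<le> N w"
          unfolding N_def
        proof (intro I_mono continuous_on_add continuous_on_mult continuous_on_const continuous_on_rabs conts cont_powr C1_cont[OF w])
          fix x assume x: "x \<in> {a..b}"
          have "v n x powr q + q * v n x powr (q - 1) * (w x - v n x) \<le> \<bar>w x\<bar> powr q"
            using q v_pos by (intro powr_tangent_le) auto
          from mult_right_mono[OF this, of "\<rho> x"] \<rho>_pos[OF x] v_pos[of n x]
          show "\<bar>v n x\<bar> powr q * \<rho> x + (t * q) * (v n x powr (q - 1) * (\<phi> x * \<rho> x)) \<le> \<bar>w x\<bar> powr q * \<rho> x"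
            by (simp add: w_def algebra_simps)
        qed (use q v_pos in \<open>auto simp: less_imp_le\<close>)
        finally have "level * (1 + t * q * Jn n) powr (2 / q) \<le> level * N w powr (2 / q)"
          using elim q level_nonneg_and_le(1)[OF w] by (intro mult_left_mono powr_mono2) auto
        also have "\<dots> \<le> D w w'" by (rule level_nonneg_and_le(2)[OF w])
        also have "\<dots> = D (v n) (v' n) + 2 * t * Ln n + t^2 * D \<phi> \<phi>'"
        proof -
          have "I (\<lambda>x. (w' x)^2 * \<rho> x) = I (\<lambda>x. (v' n x)^2 * \<rho> x + ((2 * t) * (v' n x * \<zeta> x) + t^2 * ((\<phi>' x)^2 * \<rho> x)))"
            by (intro I_cong) (simp add: w'_def eq[symmetric] power2_eq_square algebra_simps)
          also have "\<dots> = I (\<lambda>x. (v' n x)^2 * \<rho> x) + (2 * t * I (\<lambda>x. v' n x * \<zeta> x) + t^2 * I (\<lambda>x. (\<phi>' x)^2 * \<rho> x))"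
            by (subst I_add, (intro continuous_intros conts)+, subst I_add)
               (auto intro!: continuous_intros conts simp: I_cmult)
          finally have 1: "I (\<lambda>x. (w' x)^2 * \<rho> x) = \<dots>" .
          have "I (\<lambda>x. (w x)^2 * \<rho> x) = I (\<lambda>x. (v n x)^2 * \<rho> x + ((2 * t) * (v n x * (\<phi> x * \<rho> x)) + t^2 * ((\<phi> x)^2 * \<rho> x)))"
            by (intro I_cong) (simp add: w_def power2_eq_square algebra_simps)
          also have "\<dots> = I (\<lambda>x. (v n x)^2 * \<rho> x) + (2 * t * I (\<lambda>x. v n x * (\<phi> x * \<rho> x)) + t^2 * I (\<lambda>x. (\<phi> x)^2 * \<rho> x))"
            by (subst I_add, (intro continuous_intros conts)+, subst I_add)
               (auto intro!: continuous_intros conts simp: I_cmult)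
          finally have 2: "I (\<lambda>x. (w x)^2 * \<rho> x) = \<dots>" .
          show ?thesis unfolding D_def 1 2 Ln_def parts by (simp add: algebra_simps)
        qed
        finally show ?case using Dv[of n] by simp
      qed
      then show "\<exists>N. \<forall>n\<ge>N. level * (1 + t * q * Jn n) powr (2 / q)
          \<le> (D (f n) (f' n) + A * (e n * I \<rho>)) + 2 * t * Ln n + t^2 * D \<phi> \<phi>'"
        by (simp add: eventually_sequentially)
    qed
    \<comment> \<open>The inequality is an equality at \<open>t = 0\<close>; comparing derivatives there gives the equation.\<close>
    define G where "G t = level + 2 * t * L + t^2 * D \<phi> \<phi>' - level * (1 + t * q * J) powr (2 / q)" for t
    have "(G has_real_derivative 2 * L - level * ((2 / q) * (1 * q * J))) (at 0)"
      unfolding G_def by (auto intro!: derivative_eq_intros)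
    moreover have "\<exists>d>0. \<forall>t. \<bar>0 - t\<bar> < d \<longrightarrow> G 0 \<le> G t"
    proof -
      have "eventually (\<lambda>t. 1 + t * q * J > 0) (nhds 0)"
        by (intro order_tendstoD(1)[of _ 1] tendsto_eq_intros) (auto intro: filterlim_ident)
      then obtain d where "d > 0" "\<And>t. \<bar>t\<bar> < d \<Longrightarrow> 1 + t * q * J > 0"
        unfolding eventually_nhds_metric by (auto simp: dist_real_def)
      then show ?thesis using key by (intro exI[of _ d]) (auto simp: G_def)
    qed
    ultimately have "2 * L - level * ((2 / q) * (1 * q * J)) = 0"
      using DERIV_local_min by (metis)
    then have "L = level * J" using q by (simp add: field_simps)
    then show ?thesis unfolding L_def J_def by (simp add: mult.assoc)
  qed
  show ?thesis by (rule that[OF u_cont u_nonneg Nu EL])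
qed


lemma integral_deriv:
  assumes "continuous_on {a..b} f" "x \<in> {a..b}"
  shows "((\<lambda>x. integral {a..x} f) has_real_derivative f x) (at x within {a..b})"
  using integral_has_real_derivative[OF assms] .

text \<open>
  Regularity after du Bois-Reymond: let \<open>F\<close> be the primitive of \<open>h / \<rho>\<close> that the equation predicts for \<open>u\<close>.
  Two integrations by parts show that \<open>F - u\<close> is orthogonal to every \<open>\<zeta>'\<close> of mean zero. For \<open>\<zeta>'\<close> equal
  to \<open>F - u\<close> minus its mean this means that \<open>u\<close> differs from \<open>F\<close> by a constant.
\<close>

lemma minimiser_ode:
  obtains u h where "N u = 1" "\<And>x. x \<in> {a..b} \<Longrightarrow> 0 \<le> u x"
    "\<And>x. x \<in> {a..b} \<Longrightarrow> (u has_real_derivative h x / \<rho> x) (at x within {a..b})"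
    "\<And>x. x \<in> {a..b} \<Longrightarrow>
       (h has_real_derivative \<rho> x * (A * u x - level * u x powr (q - 1))) (at x within {a..b})"
    "h a = 0" "h b = 0"
proof -
  obtain u where u_cont: "continuous_on {a..b} u" and u_nonneg: "\<And>x. x \<in> {a..b} \<Longrightarrow> 0 \<le> u x"
    and Nu: "N u = 1"
    and EL: "\<And>\<phi> \<phi>' \<zeta> \<zeta>'. C1 \<phi> \<phi>' \<Longrightarrow> C1 \<zeta> \<zeta>' \<Longrightarrow> (\<And>x. x \<in> {a..b} \<Longrightarrow> \<phi>' x * \<rho> x = \<zeta> x) \<Longrightarrow>
        \<zeta> a = 0 \<Longrightarrow> \<zeta> b = 0 \<Longrightarrow>
        A * I (\<lambda>x. u x * \<phi> x * \<rho> x) - I (\<lambda>x. u x * \<zeta>' x)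
          = level * I (\<lambda>x. u x powr (q - 1) * \<phi> x * \<rho> x)"
    by (rule very_weak_minimiser) blast
  define W where "W x = \<rho> x * (A * u x - level * u x powr (q - 1))" for x
  have pw: "continuous_on {a..b} (\<lambda>x. u x powr (q - 1))"
    using q by (intro cont_powr u_cont u_nonneg) auto
  have W_cont: "continuous_on {a..b} W"
    unfolding W_def by (intro continuous_on_mult continuous_on_diff continuous_on_const pw u_cont cont_\<rho>)
  define h where "h x = integral {a..x} W" for x
  have h': "(h has_real_derivative W x) (at x within {a..b})" if "x \<in> {a..b}" for x
    unfolding h_def[abs_def] by (rule integral_deriv[OF W_cont that])
  have h_cont: "continuous_on {a..b} h" by (rule DERIV_continuous_on[OF h'])
  have IW: "I (\<lambda>x. W x * \<phi> x) = A * I (\<lambda>x. u x * \<phi> x * \<rho> x) - level * I (\<lambda>x. u x powr (q - 1) * \<phi> x * \<rho> x)"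
    if "continuous_on {a..b} \<phi>" for \<phi>
  proof -
    have "I (\<lambda>x. W x * \<phi> x) = I (\<lambda>x. A * (u x * \<phi> x * \<rho> x) - level * (u x powr (q - 1) * \<phi> x * \<rho> x))"
      by (intro I_cong) (simp add: W_def algebra_simps)
    also have "\<dots> = I (\<lambda>x. A * (u x * \<phi> x * \<rho> x)) - I (\<lambda>x. level * (u x powr (q - 1) * \<phi> x * \<rho> x))"
      by (intro I_diff continuous_on_mult continuous_on_const pw u_cont cont_\<rho> that)
    finally show ?thesis by (simp only: I_cmult)
  qed
  have ha: "h a = 0" by (simp add: h_def)
  have hb: "h b = 0"
  proof -
    have "A * I (\<lambda>x. u x * 1 * \<rho> x) - I (\<lambda>x. u x * 0) = level * I (\<lambda>x. u x powr (q - 1) * 1 * \<rho> x)"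
      by (rule EL[of "\<lambda>_. 1" "\<lambda>_. 0" "\<lambda>_. 0" "\<lambda>_. 0"]) (auto simp: C1_def)
    then have "I (\<lambda>x. W x * 1) = 0" unfolding IW[OF continuous_on_const] by (simp add: I_def)
    then show ?thesis by (simp add: I_def h_def)
  qed
  define F where "F x = integral {a..x} (\<lambda>x. h x / \<rho> x)" for x
  have hr_cont: "continuous_on {a..b} (\<lambda>x. h x / \<rho> x)"
    using \<rho>_pos by (intro continuous_on_divide h_cont cont_\<rho>) force
  have F': "(F has_real_derivative h x / \<rho> x) (at x within {a..b})" if "x \<in> {a..b}" for x
    unfolding F_def[abs_def] by (rule integral_deriv[OF hr_cont that])
  have F_cont: "continuous_on {a..b} F" by (rule DERIV_continuous_on[OF F'])
  define c where "c = I (\<lambda>x. F x - u x) / (b - a)"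
  define \<zeta>' where "\<zeta>' x = F x - u x - c" for x
  have z'_cont: "continuous_on {a..b} \<zeta>'" unfolding \<zeta>'_def by (intro continuous_intros F_cont u_cont)
  define \<zeta> where "\<zeta> x = integral {a..x} \<zeta>'" for x
  have z: "C1 \<zeta> \<zeta>'" unfolding C1_def \<zeta>_def[abs_def] using integral_deriv[OF z'_cont] z'_cont by auto
  have za: "\<zeta> a = 0" by (simp add: \<zeta>_def)
  have Iz: "I \<zeta>' = 0"
  proof -
    have "I \<zeta>' = I (\<lambda>x. F x - u x) - I (\<lambda>_. c)"
      unfolding \<zeta>'_def by (intro I_diff continuous_intros F_cont u_cont)
    also have "I (\<lambda>_. c) = c * (b - a)" using ab by (simp add: I_def)
    finally show ?thesis using ab by (simp add: c_def)
  qed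
  have zb: "\<zeta> b = 0" using Iz by (simp add: \<zeta>_def I_def)
  define \<phi> where "\<phi> x = integral {a..x} (\<lambda>x. \<zeta> x / \<rho> x)" for x
  have zr_cont: "continuous_on {a..b} (\<lambda>x. \<zeta> x / \<rho> x)"
    using \<rho>_pos by (intro continuous_on_divide C1_cont[OF z] cont_\<rho>) force
  have phi: "C1 \<phi> (\<lambda>x. \<zeta> x / \<rho> x)"
    unfolding C1_def \<phi>_def[abs_def] using integral_deriv[OF zr_cont] zr_cont by auto
  have 1: "I (\<lambda>x. W x * \<phi> x) = I (\<lambda>x. u x * \<zeta>' x)"
    using EL[OF phi z _ za zb] \<rho>_pos IW[OF C1_cont[OF phi]] by force
  have 2: "I (\<lambda>x. W x * \<phi> x) + I (\<lambda>x. h x / \<rho> x * \<zeta> x) = 0"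
  proof -
    have "I (\<lambda>x. W x * \<phi> x + h x / \<rho> x * \<zeta> x) = h b * \<phi> b - h a * \<phi> a"
    proof (rule I_FTC)
      fix x assume x: "x \<in> {a..b}"
      have "(\<phi> has_real_derivative \<zeta> x / \<rho> x) (at x within {a..b})" using phi x by (auto simp: C1_def)
      from DERIV_mult[OF h'[OF x] this]
      show "((\<lambda>x. h x * \<phi> x) has_real_derivative W x * \<phi> x + h x / \<rho> x * \<zeta> x) (at x within {a..b})"
        by (simp add: algebra_simps)
    qed
    moreover have "I (\<lambda>x. W x * \<phi> x + h x / \<rho> x * \<zeta> x) = I (\<lambda>x. W x * \<phi> x) + I (\<lambda>x. h x / \<rho> x * \<zeta> x)"
      by (intro I_add continuous_on_mult W_cont hr_cont C1_cont[OF phi] C1_cont[OF z])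
    ultimately show ?thesis using ha hb by simp
  qed
  have 3: "I (\<lambda>x. h x / \<rho> x * \<zeta> x) + I (\<lambda>x. F x * \<zeta>' x) = 0"
  proof -
    have "I (\<lambda>x. h x / \<rho> x * \<zeta> x + F x * \<zeta>' x) = F b * \<zeta> b - F a * \<zeta> a"
    proof (rule I_FTC)
      fix x assume x: "x \<in> {a..b}"
      have "(\<zeta> has_real_derivative \<zeta>' x) (at x within {a..b})" using z x by (auto simp: C1_def)
      from DERIV_mult[OF F'[OF x] this]
      show "((\<lambda>x. F x * \<zeta> x) has_real_derivative h x / \<rho> x * \<zeta> x + F x * \<zeta>' x) (at x within {a..b})"
        by (simp add: algebra_simps)
    qed
    moreover have "I (\<lambda>x. h x / \<rho> x * \<zeta> x + F x * \<zeta>' x) = I (\<lambda>x. h x / \<rho> x * \<zeta> x) + I (\<lambda>x. F x * \<zeta>' x)"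
      by (intro I_add continuous_on_mult F_cont z'_cont hr_cont C1_cont[OF z])
    ultimately show ?thesis using za zb by simp
  qed
  have "I (\<lambda>x. (\<zeta>' x)^2) = 0"
  proof -
    have "I (\<lambda>x. (\<zeta>' x)^2) = I (\<lambda>x. (F x * \<zeta>' x - u x * \<zeta>' x) - c * \<zeta>' x)"
      by (intro I_cong) (simp add: \<zeta>'_def power2_eq_square algebra_simps)
    also have "\<dots> = I (\<lambda>x. F x * \<zeta>' x - u x * \<zeta>' x) - I (\<lambda>x. c * \<zeta>' x)"
      by (intro I_diff continuous_intros F_cont u_cont z'_cont)
    also have "I (\<lambda>x. F x * \<zeta>' x - u x * \<zeta>' x) = I (\<lambda>x. F x * \<zeta>' x) - I (\<lambda>x. u x * \<zeta>' x)"
      by (intro I_diff continuous_intros F_cont u_cont z'_cont)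
    also have "I (\<lambda>x. c * \<zeta>' x) = 0" by (simp add: I_cmult Iz)
    finally show ?thesis using 1 2 3 by simp
  qed
  then have "\<forall>x\<in>{a..b}. (\<zeta>' x)^2 = 0"
    unfolding I_def
    by (subst (asm) integral_eq_0_iff) (auto intro!: continuous_intros z'_cont ab)
  then have uF: "u x = F x - c" if "x \<in> {a..b}" for x
  proof -
    from \<open>\<forall>x\<in>{a..b}. (\<zeta>' x)^2 = 0\<close> that have "(\<zeta>' x)^2 = 0" by blast
    then show ?thesis by (simp add: \<zeta>'_def)
  qed
  have u': "(u has_real_derivative h x / \<rho> x) (at x within {a..b})" if x: "x \<in> {a..b}" for x
  proof (rule has_field_derivative_transform_within[of "\<lambda>x. F x - c" _ _ _ 1])
    show "((\<lambda>x. F x - c) has_real_derivative h x / \<rho> x) (at x within {a..b})"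
      using DERIV_diff[OF F'[OF x] DERIV_const[of c]] by simp
  qed (use uF x in auto)
  show ?thesis by (rule that[OF Nu u_nonneg u' h'[unfolded W_def] ha hb])
qed

text \<open>
  A zero of the minimiser is a minimum, so the derivative vanishes there as well; uniqueness for the
  linear equation solved by \<open>(u, h)\<close> then makes \<open>u\<close> vanish everywhere.
\<close>

lemma minimiser_pos:
  assumes Nu: "N u = 1" and u_nonneg: "\<And>x. x \<in> {a..b} \<Longrightarrow> 0 \<le> u x"
    and u': "\<And>x. x \<in> {a..b} \<Longrightarrow> (u has_real_derivative h x / \<rho> x) (at x within {a..b})"
    and h': "\<And>x. x \<in> {a..b} \<Longrightarrow>
       (h has_real_derivative \<rho> x * (A * u x - level * u x powr (q - 1))) (at x within {a..b})"
    and bc: "h a = 0" "h b = 0" and x: "x \<in> {a..b}"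
  shows "0 < u x"
proof (rule ccontr)
  assume "\<not> 0 < u x"
  with u_nonneg[OF x] have ux: "u x = 0" by simp
  have hx: "h x = 0"
  proof (cases "x = a \<or> x = b")
    case False
    with x have x: "a < x" "x < b" "x \<in> {a..b}" by auto
    have "(u has_real_derivative h x / \<rho> x) (at x)"
      using u'[OF x(3)] x by (simp add: at_within_Icc_at)
    moreover have "\<forall>y. \<bar>x - y\<bar> < min (x - a) (b - x) \<longrightarrow> u x \<le> u y"
      using ux u_nonneg by (auto simp: abs_if split: if_splits)
    ultimately have "h x / \<rho> x = 0" using x by (intro DERIV_local_min[of u _ x "min (x - a) (b - x)"]) auto
    then show ?thesis using \<rho>_pos[OF x(3)] by simp
  qed (use bc in auto)
  define k where "k x = 1 / \<rho> x + \<rho> x * (A - level * u x powr (q - 2))" for x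
  have u_cont: "continuous_on {a..b} u" by (rule DERIV_continuous_on[OF u'])
  have "continuous_on {a..b} k"
    unfolding k_def using \<rho>_pos q
    by (intro continuous_on_add continuous_on_mult continuous_on_diff continuous_on_const
          continuous_on_divide cont_powr u_cont u_nonneg cont_\<rho>) force+
  then have "bounded (k ` {a..b})" by (intro compact_imp_bounded compact_continuous_image) auto
  then obtain K where K: "\<And>x. x \<in> {a..b} \<Longrightarrow> \<bar>k x\<bar> \<le> K"
    unfolding bounded_iff by (auto simp del: atLeastAtMost_iff)
  define S where "S x = (u x)^2 + (h x)^2" for x
  have S': "(S has_real_derivative 2 * u x * h x * k x) (at x within {a..b})" if x: "x \<in> {a..b}" for x
  proof -
    have "(S has_real_derivative 2 * u x * (h x / \<rho> x) + 2 * h x * (\<rho> x * (A * u x - level * u x powr (q - 1))))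
        (at x within {a..b})"
      unfolding S_def by (auto intro!: derivative_eq_intros u'[OF x] h'[OF x])
    also have "2 * u x * (h x / \<rho> x) + 2 * h x * (\<rho> x * (A * u x - level * u x powr (q - 1))) = 2 * u x * h x * k x"
    proof -
      have "u x powr (q - 1) = u x powr (q - 2) * u x"
      proof (cases "u x = 0")
        case False
        have "u x powr (q - 1) = u x powr ((q - 2) + 1)" by simp
        also have "\<dots> = u x powr (q - 2) * u x" using False u_nonneg[OF x] by (subst powr_add) simp
        finally show ?thesis .
      qed simp
      then show ?thesis unfolding k_def by (simp add: algebra_simps)
    qed
    finally show ?thesis .
  qed
  have S'_bound: "\<bar>2 * u x * h x * k x\<bar> \<le> K * S x" if "x \<in> {a..b}" for x
  proof -
    have "2 * \<bar>u x * h x\<bar> \<le> S x"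
      unfolding S_def using sum_squares_bound[of "\<bar>u x\<bar>" "\<bar>h x\<bar>"] by (simp add: abs_mult)
    then have "(2 * \<bar>u x * h x\<bar>) * \<bar>k x\<bar> \<le> S x * K"
      using K[OF that] by (intro mult_mono) (auto simp: S_def)
    then show ?thesis by (simp add: abs_mult mult_ac)
  qed
  have S_zero: "S x = 0" using ux hx by (simp add: S_def)
  have S_cont: "continuous_on {a..b} S" by (rule DERIV_continuous_on[OF S'])
  have "S y \<le> 0" if y: "y \<in> {a..b}" for y
  proof (cases "x \<le> y")
    case True
    have "exp (- K * y) * S y \<le> exp (- K * x) * S x"
    proof (rule DERIV_nonpos_imp_decreasing_open[OF True])
      fix z assume z: "x < z" "z < y"
      then have zab: "z \<in> {a..b}" "z \<in> {a<..<b}" using x y by auto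
      have "(S has_real_derivative 2 * u z * h z * k z) (at z)"
        using S'[OF zab(1)] zab by (simp add: at_within_Icc_at)
      then have "((\<lambda>y. exp (- K * y) * S y) has_real_derivative
          exp (- K * z) * (2 * u z * h z * k z - K * S z)) (at z)"
        by (auto intro!: derivative_eq_intros simp: algebra_simps)
      moreover have "exp (- K * z) * (2 * u z * h z * k z - K * S z) \<le> 0"
        using S'_bound[OF zab(1)] by (intro mult_nonneg_nonpos) auto
      ultimately show "\<exists>d. ((\<lambda>y. exp (- K * y) * S y) has_real_derivative d) (at z) \<and> d \<le> 0" by blast
      next
      show "continuous_on {x..y} (\<lambda>y. exp (- K * y) * S y)"
        using x y by (intro continuous_intros continuous_on_subset[OF S_cont]) auto
    qed
    then show ?thesis using S_zero by (simp add: mult_le_0_iff)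
  next
    case False
    then have yx: "y \<le> x" by simp
    have "exp (K * y) * S y \<le> exp (K * x) * S x"
    proof (rule DERIV_nonneg_imp_increasing_open[OF yx])
      fix z assume z: "y < z" "z < x"
      then have zab: "z \<in> {a..b}" "z \<in> {a<..<b}" using x y by auto
      have "(S has_real_derivative 2 * u z * h z * k z) (at z)"
        using S'[OF zab(1)] zab by (simp add: at_within_Icc_at)
      then have "((\<lambda>y. exp (K * y) * S y) has_real_derivative
          exp (K * z) * (2 * u z * h z * k z + K * S z)) (at z)"
        by (auto intro!: derivative_eq_intros simp: algebra_simps)
      moreover have "0 \<le> exp (K * z) * (2 * u z * h z * k z + K * S z)"
        using S'_bound[OF zab(1)] by (intro mult_nonneg_nonneg) auto
      ultimately show "\<exists>d. ((\<lambda>y. exp (K * y) * S y) has_real_derivative d) (at z) \<and> 0 \<le> d" by blast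
      next
      show "continuous_on {y..x} (\<lambda>y. exp (K * y) * S y)"
        using x y by (intro continuous_intros continuous_on_subset[OF S_cont]) auto
    qed
    then show ?thesis using S_zero by (simp add: mult_le_0_iff)
  qed
  then have "u y = 0" if "y \<in> {a..b}" for y
    using that unfolding S_def by (smt (verit) sum_power2_le_zero_iff)
  then have "N u = I (\<lambda>_. 0)" unfolding N_def by (intro I_cong) simp
  then show False using Nu by (simp add: I_def)
qed

end

text \<open>
  The sharp inequality on an interval with Neumann ends. The minimiser of the quotient is constant by
  rigidity, which identifies the optimal constant.
\<close>

theorem ultraspherical_interpolation:
  fixes n q A a b :: real and f f' :: "real \<Rightarrow> real"
  assumes ab: "0 < a" "a < b" "b < pi" and n: "n \<ge> 1" and q: "q > 2" "q * (n - 2) < 2 * n"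
    and A: "A = n / (q - 2)"
    and f': "\<And>x. x \<in> {a..b} \<Longrightarrow> (f has_real_derivative f' x) (at x within {a..b})"
      "continuous_on {a..b} f'"
  defines "\<rho> \<equiv> \<lambda>x. sin x powr (n - 1)"
  shows "A * integral {a..b} \<rho> powr (1 - 2 / q) * integral {a..b} (\<lambda>x. \<bar>f x\<bar> powr q * \<rho> x) powr (2 / q)
    \<le> integral {a..b} (\<lambda>x. (f' x)^2 * \<rho> x) + A * integral {a..b} (\<lambda>x. (f x)^2 * \<rho> x)"
proof -
  have s: "sin x > 0" if "x \<in> {a..b}" for x
    using that ab by (intro sin_gt_zero) auto
  interpret W: weighted_interval a b A q \<rho>
  proof
    show "continuous_on {a..b} \<rho>"
      unfolding \<rho>_def using s by (intro continuous_on_powr continuous_intros) force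
    show "0 < \<rho> x" if "x \<in> {a..b}" for x unfolding \<rho>_def using s[OF that] by simp
  qed (use ab q n A in auto)
  obtain u h where Nu: "W.N u = 1" and u_nonneg: "\<And>x. x \<in> {a..b} \<Longrightarrow> 0 \<le> u x"
    and u': "\<And>x. x \<in> {a..b} \<Longrightarrow> (u has_real_derivative h x / \<rho> x) (at x within {a..b})"
    and h': "\<And>x. x \<in> {a..b} \<Longrightarrow>
       (h has_real_derivative \<rho> x * (A * u x - W.level * u x powr (q - 1))) (at x within {a..b})"
    and bc: "h a = 0" "h b = 0" by (rule W.minimiser_ode) blast
  have u_pos: "0 < u x" if "x \<in> {a..b}" for x by (rule W.minimiser_pos[OF Nu u_nonneg u' h' bc that])
  have \<rho>': "(\<rho> has_real_derivative (n - 1) * cot x * \<rho> x) (at x within {a..b})" if "x \<in> {a..b}" for x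
    using has_real_derivative_powr_const[OF DERIV_subset[OF DERIV_sin subset_UNIV] s[OF that] that, of "n - 1"]
    unfolding \<rho>_def by (simp add: cot_def mult_ac)
  define u2 where "u2 x = A * u x - W.level * u x powr (q - 1) - (n - 1) * cot x * (h x / \<rho> x)" for x
  have rig: "h x / \<rho> x = 0" if x: "x \<in> {a..b}" for x
  proof (rule ultraspherical_rigidity[OF ab n q A u_pos u', of u2 W.level])
    fix x assume x: "x \<in> {a..b}"
    have "((\<lambda>x. h x / \<rho> x) has_real_derivative (\<rho> x * (A * u x - W.level * u x powr (q - 1)) * \<rho> x
        - h x * ((n - 1) * cot x * \<rho> x)) / (\<rho> x * \<rho> x)) (at x within {a..b})"
      using W.\<rho>_pos[OF x] by (intro DERIV_divide h' \<rho>' x) auto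
    also have "(\<rho> x * (A * u x - W.level * u x powr (q - 1)) * \<rho> x
        - h x * ((n - 1) * cot x * \<rho> x)) / (\<rho> x * \<rho> x) = u2 x"
      unfolding u2_def using W.\<rho>_pos[OF x] by (simp add: field_simps)
    finally show "((\<lambda>x. h x / \<rho> x) has_real_derivative u2 x) (at x within {a..b})" .
  qed (use bc x in \<open>auto simp: u2_def\<close>)
  have const: "u x = u a" if "x \<in> {a..b}" for x
  proof -
    have "\<exists>c. \<forall>x\<in>{a..b}. u x = c"
      by (rule has_field_derivative_zero_constant[of "{a..b}" u]) (use u' rig in auto)
    then show ?thesis using that ab by fastforce
  qed
  have a_in: "a \<in> {a..b}" using ab by auto
  define c where "c = u a"
  have c: "c > 0" unfolding c_def using u_pos[OF a_in] .
  have "\<rho> a * (A * c - W.level * c powr (q - 1)) = 0"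
  proof (rule has_field_derivative_unique)
    show "(h has_real_derivative \<rho> a * (A * c - W.level * c powr (q - 1))) (at a within {a..b})"
      using h'[OF a_in] by (simp only: c_def)
    show "(h has_real_derivative 0) (at a within {a..b})"
      by (rule has_field_derivative_transform_within[of "\<lambda>_. 0" _ _ _ 1])
         (use a_in rig W.\<rho>_pos in \<open>auto simp: less_le\<close>)
    show "at a within {a..b} \<noteq> bot" using a_in ab by (simp add: trivial_limit_within islimpt_Icc)
  qed
  then have "A * c = W.level * c powr (q - 1)" using W.\<rho>_pos[OF a_in] by simp
  also have "c powr (q - 1) = c powr (q - 2) * c"
    using c powr_add[of c "q - 2" 1] by simp
  finally have A_eq: "A = W.level * c powr (q - 2)" using c by simp
  have "W.N u = W.I (\<lambda>x. c powr q * \<rho> x)"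
    unfolding W.N_def
  proof (rule W.I_cong)
    fix x assume "x \<in> {a..b}"
    then show "\<bar>u x\<bar> powr q * \<rho> x = c powr q * \<rho> x" using const[of x] c by (simp add: c_def)
  qed
  then have Z: "c powr q * W.I \<rho> = 1" using Nu by (simp only: W.I_cmult)
  have "W.I \<rho> powr (1 - 2 / q) * c powr (q - 2) = 1"
  proof -
    have "(c powr q) powr (1 - 2 / q) = c powr (q - 2)"
      unfolding powr_powr using q by (simp add: right_diff_distrib)
    then show ?thesis
      using powr_mult[of "c powr q" "W.I \<rho>" "1 - 2 / q"] Z by (simp add: mult.commute)
  qed
  moreover have "A * W.I \<rho> powr (1 - 2 / q) = (W.level * c powr (q - 2)) * W.I \<rho> powr (1 - 2 / q)"
    by (rule arg_cong[OF A_eq, of "\<lambda>t. t * W.I \<rho> powr (1 - 2 / q)"])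
  ultimately have level_eq: "A * W.I \<rho> powr (1 - 2 / q) = W.level"
    by (simp add: mult_ac)
  have "W.C1 f f'" unfolding W.C1_def using f' by auto
  from W.level_nonneg_and_le(2)[OF this] show ?thesis
    unfolding level_eq[symmetric] by (simp add: W.I_def W.N_def W.D_def)
qed


section \<open>Lebesgue measure under linear isometries\<close>

lemma linear_borel_measurable:
  fixes f :: "'x::euclidean_space \<Rightarrow> 'y::euclidean_space"
  shows "linear f \<Longrightarrow> f \<in> borel_measurable borel"
  by (intro borel_measurable_continuous_onI linear_continuous_on) (simp add: linear_conv_bounded_linear)

text \<open>
  A linear isometry carries Lebesgue measure to a translation invariant measure. Two translation
  invariant measures are proportional: integrating the indicator of \<open>{(x, y). x + y \<in> A, y \<in> B}\<close>
  in both orders compares \<open>\<mu> A \<cdot> \<nu> B\<close> with \<open>\<nu> A \<cdot> \<mu> (- B)\<close>. Unit balls fix the factor, because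
  their volume depends on the dimension only.
\<close>

lemma lborel_distr_isometry:
  fixes f :: "'x::euclidean_space \<Rightarrow> 'a::euclidean_space"
  assumes lin: "linear f" and iso: "\<And>x. norm (f x) = norm x" and dim: "DIM('x) = DIM('a)"
  shows "distr lborel borel f = (lborel :: 'a measure)"
proof -
  interpret linear f by fact
  have [measurable]: "f \<in> borel_measurable borel"
    by (rule linear_borel_measurable) (rule lin)
  have inj: "inj f"
    unfolding linear_injective_0[OF lin] by (metis iso norm_eq_zero)
  have "range f = UNIV"
  proof -
    have "dim (range f) = DIM('a)"
      using dim_image_eq[OF lin, of UNIV] inj dim by (simp add: inj_on_def inj_def)
    then have "span (range f) = UNIV" by (metis dim_eq_full)
    then show ?thesis by (metis linear_subspace_image[OF lin subspace_UNIV] span_eq_iff)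
  qed
  then obtain g where g: "\<And>y. f (g y) = y" by (metis surjD)
  show ?thesis
  proof (rule measure_eqI)
    fix A assume "A \<in> sets (distr lborel borel f)"
    then have [measurable]: "A \<in> sets borel" by simp
    define B where "B = ball (0::'a) 1"
    have [measurable]: "B \<in> sets borel" by (simp add: B_def)
    have volB: "emeasure lborel B = ennreal (unit_ball_vol DIM('a))" by (simp add: B_def emeasure_ball)
    have posB: "emeasure lborel B \<noteq> 0" "emeasure lborel B \<noteq> \<infinity>"
      unfolding volB by (auto simp: ennreal_eq_0_iff not_le)
    have "emeasure (distr lborel borel f) A * emeasure lborel B
        = (NN z. indicator A (f z)) * (NN y. indicator B y)"
    proof -
      have "emeasure (distr lborel borel f) A = (\<integral>\<^sup>+z. indicator A z \<partial>distr lborel borel f)" by simp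
      also have "\<dots> = (NN z. indicator A (f z))" by (subst nn_integral_distr) auto
      finally show ?thesis by simp
    qed
    also have "\<dots> = (NN y. (NN z. indicator A (f z) * indicator B y))"
      by (simp add: nn_integral_multc nn_integral_cmult)
    also have "\<dots> = (NN y. (NN z. indicator A (f z + y) * indicator B y))"
    proof (rule nn_integral_cong)
      fix y
      have "(NN z. indicator A (f z) * indicator B y)
          = (\<integral>\<^sup>+z. indicator A (f z) * indicator B y \<partial>distr lborel borel ((+) (g y)))"
        by (simp only: lborel_distr_plus)
      also have "\<dots> = (NN z. indicator A (f z + y) * indicator B y)"
        by (subst nn_integral_distr) (auto simp: add g add.commute)
      finally show "(NN z. indicator A (f z) * indicator B y)
          = (NN z. indicator A (f z + y) * indicator B y)" .
    qed
    also have "\<dots> = (NN z. (NN y. indicator A (f z + y) * indicator B y))"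
      by (rule lborel_pair.Fubini') measurable
    also have "\<dots> = (NN z. (NN y. indicator A y * indicator B (y - f z)))"
    proof (rule nn_integral_cong)
      fix z
      have "(NN y. indicator A y * indicator B (y - f z))
          = (\<integral>\<^sup>+y. indicator A y * indicator B (y - f z) \<partial>distr lborel borel ((+) (f z)))"
        by (simp only: lborel_distr_plus)
      also have "\<dots> = (NN y. indicator A (f z + y) * indicator B y)"
        by (subst nn_integral_distr) auto
      finally show "(NN y. indicator A (f z + y) * indicator B y)
          = (NN y. indicator A y * indicator B (y - f z))" by simp
    qed
    also have "\<dots> = (NN y. (NN z. indicator A y * indicator B (y - f z)))"
      by (rule lborel_pair.Fubini') measurable
    also have "\<dots> = (NN y. indicator A y * emeasure lborel B)"
    proof (rule nn_integral_cong)
      fix y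
      have "(NN z. indicator B (y - f z)) = (NN z. indicator (ball (g y) 1) z)"
      proof (rule nn_integral_cong)
        fix z
        have "norm (y - f z) = norm (g y - z)" by (metis diff g iso)
        then show "indicator B (y - f z) = (indicator (ball (g y) 1) z :: ennreal)"
          by (simp add: B_def dist_norm indicator_def norm_minus_commute)
      qed
      also have "\<dots> = emeasure lborel B" by (simp add: volB emeasure_ball dim)
      finally show "(NN z. indicator A y * indicator B (y - f z)) = indicator A y * emeasure lborel B"
        by (subst nn_integral_cmult) auto
    qed
    also have "\<dots> = emeasure lborel A * emeasure lborel B"
      by (simp add: nn_integral_multc)
    finally show "emeasure (distr lborel borel f) A = emeasure lborel A"
      using posB by (simp add: ennreal_mult_cancel_left mult.commute[of _ "emeasure lborel B"])
  qed simp
qed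

lemma nn_integral_isometry:
  fixes f :: "'x::euclidean_space \<Rightarrow> 'a::euclidean_space"
  assumes lin: "linear f" and "\<And>x. norm (f x) = norm x" "DIM('x) = DIM('a)"
    and [measurable]: "G \<in> borel_measurable borel"
  shows "(NN x. G (f x)) = (NN x. G x)"
proof -
  have [measurable]: "f \<in> borel_measurable borel"
    by (rule linear_borel_measurable) (rule lin)
  show ?thesis
    unfolding lborel_distr_isometry[OF assms(1-3), symmetric] by (subst nn_integral_distr) auto
qed

lemma nn_integral_scale:
  fixes G :: "'a::euclidean_space \<Rightarrow> ennreal"
  assumes [measurable]: "G \<in> borel_measurable borel" and c: "c > 0"
  shows "(NN x. G x) = ennreal (c ^ DIM('a)) * (NN x. G (c *\<^sub>R x))"
  using c by (subst lborel_affine[of c 0]) (auto simp: nn_integral_density nn_integral_distr nn_integral_cmult)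

lemma hyperplane_isometry:
  fixes e :: "'a::euclidean_space"
  assumes dim: "DIM('a) = DIM('b::euclidean_space) + 1" and e: "norm e = 1"
  obtains J :: "'b::euclidean_space \<Rightarrow> 'a" where "linear J" "\<And>y. norm (J y) = norm y" "\<And>y. e \<bullet> J y = 0"
proof -
  have e0: "e \<noteq> 0" using e by auto
  have sub: "subspace {x. e \<bullet> x = 0}" by (rule subspace_hyperplane)
  have "dim (UNIV :: 'b set) = dim {x. e \<bullet> x = 0}"
    using dim_hyperplane[OF e0] dim by simp
  then obtain J :: "'b \<Rightarrow> 'a" where "linear J" "J ` UNIV = {x. e \<bullet> x = 0}" "\<And>y. y \<in> UNIV \<Longrightarrow> norm (J y) = norm y"
    by (rule isometry_subspaces[OF subspace_UNIV sub]) blast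
  then show ?thesis using that[of J] by blast
qed

lemma linear_isometry_inner:
  fixes J :: "'x::real_inner \<Rightarrow> 'y::real_inner"
  assumes "linear J" "\<And>y. norm (J y) = norm y" shows "J x \<bullet> J y = x \<bullet> y"
proof -
  interpret linear J by fact
  have "norm (J x + J y) = norm (x + y)" by (metis add assms(2))
  then have "(J x + J y) \<bullet> (J x + J y) = (x + y) \<bullet> (x + y)" by (simp add: norm_eq)
  moreover have "J x \<bullet> J x = x \<bullet> x" for x using assms(2)[of x] by (simp add: norm_eq)
  ultimately show ?thesis by (simp add: inner_add_left inner_add_right inner_commute)
qed

lemma nn_integral_cylinder:
  fixes e :: "'a::euclidean_space" and J :: "'b::euclidean_space \<Rightarrow> 'a"
  assumes dim: "DIM('a) = DIM('b) + 1" and e: "norm e = 1"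
    and J: "linear J" "\<And>y. norm (J y) = norm y" "\<And>y. e \<bullet> J y = 0"
    and [measurable]: "G \<in> borel_measurable borel"
  shows "(NN x. G x) = (NN t. (NN y. G (t *\<^sub>R e + J y)))"
    and "(NN x. G x) = (NN y. (NN t. G (t *\<^sub>R e + J y)))"
proof -
  define T :: "real \<times> 'b \<Rightarrow> 'a" where "T p = fst p *\<^sub>R e + J (snd p)" for p
  have bl: "bounded_linear J" using J(1) by (simp add: linear_conv_bounded_linear)
  have T: "linear T"
    unfolding T_def using J(1)
    by (intro linearI) (auto simp: linear_add linear_scale algebra_simps)
  have [measurable]: "J \<in> borel_measurable borel"
    by (intro borel_measurable_continuous_onI linear_continuous_on bl)
  have "norm (T p) = norm p" for p
  proof -
    have "(norm (T p))^2 = (norm (fst p *\<^sub>R e))^2 + (norm (J (snd p)))^2"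
      unfolding T_def by (rule norm_add_Pythagorean) (simp add: orthogonal_def J)
    also have "\<dots> = (norm p)^2"
      using e J(2) by (cases p) (simp add: norm_Pair add_nonneg_nonneg)
    finally have "(norm (T p))^2 = (norm p)^2" .
    then show ?thesis by simp
  qed
  then have "(NN x. G x) = (NN p. G (T p))"
    using T dim by (intro nn_integral_isometry[symmetric]) auto
  also have "\<dots> = (\<integral>\<^sup>+p. G (T p) \<partial>(lborel \<Otimes>\<^sub>M lborel))" by (simp only: lborel_prod)
  also have "\<dots> = (NN t. (NN y. G (T (t, y))))"
    unfolding T_def by (rule lborel.nn_integral_fst[symmetric]) measurable
  finally show 1: "(NN x. G x) = (NN t. (NN y. G (t *\<^sub>R e + J y)))"
    by (simp add: T_def)
  show "(NN x. G x) = (NN y. (NN t. G (t *\<^sub>R e + J y)))"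
    unfolding 1 by (rule lborel_pair.Fubini') measurable
qed


section \<open>Integration on the sphere\<close>

text \<open>The homogeneous extension of degree \<open>0\<close> turns integrals over the sphere into integrals over the ball.\<close>

definition sphere_ext :: "('a::euclidean_space \<Rightarrow> 'b::zero) \<Rightarrow> 'a \<Rightarrow> 'b" where
  "sphere_ext F x = (if x = 0 then 0 else F (sgn x))"

lemma sphere_ext_measurable:
  fixes F :: "'a::euclidean_space \<Rightarrow> 'b::{topological_space, zero}"
  assumes "F \<in> borel_measurable sphere_measure"
  shows "sphere_ext F \<in> borel_measurable borel"
proof -
  have F: "F \<in> borel_measurable (restrict_space borel (sphere 0 1))"
    using assms by (simp cong: measurable_cong_sets)
  have s: "sgn \<in> restrict_space borel (- {0::'a}) \<rightarrow>\<^sub>M restrict_space borel (sphere 0 1)"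
    by (intro measurable_restrict_space2 measurable_restrict_space1)
       (auto simp: space_restrict_space norm_sgn)
  have "(\<lambda>x. F (sgn x)) \<in> borel_measurable (restrict_space borel (- {0}))"
    by (rule measurable_compose[OF s F])
  then have "(\<lambda>x. if x \<in> - {0} then F (sgn x) else 0) \<in> borel_measurable borel"
    by (subst measurable_restrict_space_iff[symmetric]) auto
  also have "(\<lambda>x. if x \<in> - {0} then F (sgn x) else 0) = sphere_ext F"
    by (auto simp: sphere_ext_def)
  finally show ?thesis .
qed

lemma nn_integral_sphere:
  fixes F :: "'a::euclidean_space \<Rightarrow> ennreal"
  assumes F: "F \<in> borel_measurable sphere_measure"
  shows "(\<integral>\<^sup>+x. F x \<partial>sphere_measure)
    = of_nat DIM('a) * (NN x. sphere_ext F x * indicator (ball 0 1) x)"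
proof -
  have F': "F \<in> borel_measurable (restrict_space borel (sphere 0 1))"
    using F by (simp cong: measurable_cong_sets)
  have "(\<integral>\<^sup>+x. F x \<partial>sphere_measure) = of_nat DIM('a) *
      (\<integral>\<^sup>+x. F x \<partial>distr (restrict_space lborel (ball 0 1 - {0})) (restrict_space borel (sphere 0 1)) sgn)"
    unfolding sphere_measure_def by (subst nn_integral_scale_measure) (use F' in auto)
  also have "(\<integral>\<^sup>+x. F x \<partial>distr (restrict_space lborel (ball 0 1 - {0})) (restrict_space borel (sphere 0 1)) sgn)
      = (\<integral>\<^sup>+x. F (sgn x) \<partial>restrict_space lborel (ball 0 1 - {0}))"
    by (rule nn_integral_distr[OF measurable_sgn_sphere]) (use F' in auto)
  also have "\<dots> = (NN x. F (sgn x) * indicator (ball 0 1 - {0}) x)"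
    by (rule nn_integral_restrict_space) simp
  also have "\<dots> = (NN x. sphere_ext F x * indicator (ball 0 1) x)"
    by (intro nn_integral_cong) (auto simp: sphere_ext_def indicator_def)
  finally show ?thesis .
qed

lemma sgn_eq_unit: "norm x = 1 \<Longrightarrow> sgn x = (x::'a::real_normed_vector)"
  by (simp add: sgn_div_norm)

lemma sgn_add_scaled:
  "t > 0 \<Longrightarrow> sgn (t *\<^sub>R x) = sgn (x::'a::real_normed_vector)"
  by (simp add: sgn_scaleR)

lemma nn_integral_sphere_isometry:
  fixes F :: "'a::euclidean_space \<Rightarrow> ennreal" and R :: "'a \<Rightarrow> 'a"
  assumes F: "F \<in> borel_measurable sphere_measure" and R: "linear R" "\<And>x. norm (R x) = norm x"
  shows "(\<lambda>x. F (R x)) \<in> borel_measurable sphere_measure"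
    and "(\<integral>\<^sup>+x. F (R x) \<partial>sphere_measure) = (\<integral>\<^sup>+x. F x \<partial>sphere_measure)"
proof -
  have F': "F \<in> borel_measurable (restrict_space borel (sphere 0 1))"
    using F by (simp cong: measurable_cong_sets)
  have [measurable]: "R \<in> borel_measurable borel"
    by (rule linear_borel_measurable) (rule R(1))
  have "R \<in> restrict_space borel (sphere 0 1) \<rightarrow>\<^sub>M restrict_space borel (sphere 0 1)"
    by (intro measurable_restrict_space2 measurable_restrict_space1) (auto simp: space_restrict_space R)
  from measurable_compose[OF this F']
  show FR: "(\<lambda>x. F (R x)) \<in> borel_measurable sphere_measure"
    by (simp cong: measurable_cong_sets)
  interpret linear R by fact
  have ext: "sphere_ext (\<lambda>x. F (R x)) x = sphere_ext F (R x)" for x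
  proof -
    have "R x = 0 \<longleftrightarrow> x = 0" by (metis R(2) norm_eq_zero)
    then show ?thesis unfolding sphere_ext_def by (simp add: sgn_div_norm scale R)
  qed
  have ind: "indicator (ball 0 1) (R x) = (indicator (ball 0 1) x :: ennreal)" for x
    by (simp add: indicator_def R)
  have "(NN x. sphere_ext F (R x) * indicator (ball 0 1) (R x))
      = (NN x. sphere_ext F x * indicator (ball 0 1) x)"
    by (rule nn_integral_isometry[of R "\<lambda>x. sphere_ext F x * indicator (ball 0 1) x"])
       (use R F in \<open>auto intro!: borel_measurable_times_ennreal sphere_ext_measurable borel_measurable_indicator\<close>)
  then show "(\<integral>\<^sup>+x. F (R x) \<partial>sphere_measure) = (\<integral>\<^sup>+x. F x \<partial>sphere_measure)"
    unfolding nn_integral_sphere[OF F] nn_integral_sphere[OF FR] ext ind by (rule arg_cong)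
qed

lemma nn_integral_power:
  assumes c: "c > 0"
  shows "(NN t. ennreal (t ^ n) * indicator {0<..<c} t) = ennreal (c ^ (n + 1) / (n + 1))"
proof -
  have "(NN t. ennreal (t ^ n) * indicator {0<..<c} t) = (NN t. ennreal (t ^ n) * indicator {0..c} t)"
  proof (rule nn_integral_cong_AE)
    have "AE t in lborel. t \<noteq> (0::real)" "AE t in lborel. t \<noteq> c" by (auto intro: AE_lborel_singleton)
    then show "AE t in lborel. ennreal (t ^ n) * indicator {0<..<c} t = ennreal (t ^ n) * indicator {0..c} t"
      by eventually_elim (auto simp: indicator_def)
  qed
  also have "\<dots> = ennreal (c ^ (n + 1) / (n + 1) - 0 ^ (n + 1) / (n + 1))"
  proof (rule nn_integral_FTC_Icc)
    show "((\<lambda>t. t ^ (n + 1) / real (n + 1)) has_real_derivative t ^ n) (at t)" for t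
      using DERIV_cdivide[OF DERIV_pow[of "n + 1" t UNIV], of "real (n + 1)"] by simp
  qed (use c in auto)
  finally show ?thesis by simp
qed

lemma norm_add_hyperplane:
  fixes e :: "'a::real_inner" and J :: "'b::real_inner \<Rightarrow> 'a"
  assumes e: "norm e = 1" and J: "\<And>y. norm (J y) = norm y" "\<And>y. e \<bullet> J y = 0"
  shows "norm (t *\<^sub>R e + J y) = sqrt (t^2 + (norm y)^2)"
proof -
  have "(norm (t *\<^sub>R e + J y))^2 = (norm (t *\<^sub>R e))^2 + (norm (J y))^2"
    by (rule norm_add_Pythagorean) (simp add: orthogonal_def J)
  then have "(norm (t *\<^sub>R e + J y))^2 = t^2 + (norm y)^2" using e J by simp
  then show ?thesis by (metis norm_ge_zero real_sqrt_unique)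
qed

text \<open>
  Gnomonic projection: on the open half sphere around \<open>e\<close>, every point is \<open>(e + J y) / |e + J y|\<close>
  for exactly one \<open>y\<close>. Cutting the cone over the half sphere at height \<open>t\<close> leaves a copy of the
  \<open>y\<close>-space scaled by \<open>t\<close>, so the formula is Fubini's theorem and a linear substitution.
\<close>

lemma nn_integral_gnomonic:
  fixes e :: "'a::euclidean_space" and J :: "'b::euclidean_space \<Rightarrow> 'a" and F :: "'a \<Rightarrow> ennreal"
  assumes dim: "DIM('a) = DIM('b) + 1" and e: "norm e = 1"
    and J: "linear J" "\<And>y. norm (J y) = norm y" "\<And>y. e \<bullet> J y = 0"
    and F: "F \<in> borel_measurable sphere_measure"
    and half: "\<And>x. x \<in> sphere 0 1 \<Longrightarrow> x \<bullet> e \<le> 0 \<Longrightarrow> F x = 0"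
  shows "(\<integral>\<^sup>+x. F x \<partial>sphere_measure) =
    (NN y. F (sgn (e + J y)) * ennreal (1 / sqrt (1 + (norm y)^2) ^ DIM('a)))"
proof -
  define d where "d = DIM('b)"
  define \<rho> where "\<rho> y = sqrt (1 + (norm y)^2)" for y :: 'b
  let ?i = "\<lambda>t y. ennreal (t ^ d) * indicator {0<..<1 / \<rho> y} t"
  let ?p = "\<lambda>t y. t *\<^sub>R e + J (t *\<^sub>R y)"
  have \<rho>: "\<rho> y > 0" for y by (simp add: \<rho>_def add_pos_nonneg)
  have [measurable]: "\<rho> \<in> borel_measurable borel" unfolding \<rho>_def by measurable
  have [measurable]: "ball (0::'a) 1 \<in> sets borel" by simp
  have [measurable]: "sphere_ext F \<in> borel_measurable borel" by (rule sphere_ext_measurable[OF F])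
  have [measurable]: "J \<in> borel_measurable borel"
    by (rule linear_borel_measurable) (rule J(1))
  have nrm: "norm (e + J y) = \<rho> y" for y
    using norm_add_hyperplane[OF e J(2,3), of 1 y] by (simp add: \<rho>_def)
  have ne: "e + J y \<noteq> 0" for y using nrm[of y] \<rho>[of y] by auto
  have F_ext: "sphere_ext F (e + J y) = F (sgn (e + J y))" for y
    using ne[of y] by (simp add: sphere_ext_def)
  have slice: "(NN y. sphere_ext F (t *\<^sub>R e + J y) * indicator (ball 0 1) (t *\<^sub>R e + J y))
      = (NN y. F (sgn (e + J y)) * (?i t y))" for t
  proof (cases "t > 0")
    case True
    have "(NN y. sphere_ext F (t *\<^sub>R e + J y) * indicator (ball 0 1) (t *\<^sub>R e + J y))
      = ennreal (t ^ d) * (NN y. sphere_ext F (?p t y) * indicator (ball 0 1) (?p t y))"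
      unfolding d_def by (rule nn_integral_scale[OF _ True]) measurable
    also have "\<dots> = (NN y. ennreal (t ^ d) * (sphere_ext F (?p t y) * indicator (ball 0 1) (?p t y)))"
      by (rule nn_integral_cmult[symmetric]) measurable
    also have "\<dots> = (NN y. F (sgn (e + J y)) * (?i t y))"
    proof (rule nn_integral_cong)
      fix y
      have eq: "t *\<^sub>R e + J (t *\<^sub>R y) = t *\<^sub>R (e + J y)" using J(1) by (simp add: linear_scale scaleR_add_right)
      have "sphere_ext F (?p t y) = F (sgn (e + J y))"
        unfolding eq using True ne[of y] by (simp add: sphere_ext_def sgn_add_scaled)
      moreover have "indicator (ball 0 1) (?p t y) = (indicator {0<..<1 / \<rho> y} t :: ennreal)"
        unfolding eq using True nrm[of y] \<rho>[of y] by (simp add: indicator_def pos_less_divide_eq del: scaleR_add_right)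
      ultimately show "ennreal (t ^ d) * (sphere_ext F (?p t y) * indicator (ball 0 1) (?p t y))
        = F (sgn (e + J y)) * (?i t y)"
        by (simp only: mult_ac)
    qed
    finally show ?thesis .
  next
    case False
    have "sphere_ext F (t *\<^sub>R e + J y) = 0" for y
    proof (cases "t *\<^sub>R e + J y = 0")
      case nz: False
      have "sgn (t *\<^sub>R e + J y) \<bullet> e = t / norm (t *\<^sub>R e + J y)"
        using e J(3)[of y] by (simp add: sgn_div_norm inner_add_left inner_add_right inner_commute[of _ e] dot_square_norm divide_inverse mult.commute)
      also have "\<dots> \<le> 0" using False by (simp add: divide_nonpos_nonneg)
      finally show ?thesis using nz by (simp add: sphere_ext_def half norm_sgn)
    qed (simp add: sphere_ext_def)
    with False show ?thesis by simp
  qed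
  have "(\<integral>\<^sup>+x. F x \<partial>sphere_measure) = of_nat (d + 1) * (NN x. sphere_ext F x * indicator (ball 0 1) x)"
    unfolding nn_integral_sphere[OF F] dim d_def ..
  also have "(NN x. sphere_ext F x * indicator (ball 0 1) x)
      = (NN t. (NN y. sphere_ext F (t *\<^sub>R e + J y) * indicator (ball 0 1) (t *\<^sub>R e + J y)))"
    by (rule nn_integral_cylinder(1)[OF dim e J]) measurable
  also have "\<dots> = (NN t. (NN y. sphere_ext F (e + J y) * (?i t y)))"
    unfolding slice F_ext ..
  also have "\<dots> = (NN y. (NN t. sphere_ext F (e + J y) * (?i t y)))"
  proof (rule lborel_pair.Fubini')
    have "(\<lambda>p. indicator {0<..<1 / \<rho> (fst p)} (snd p) :: ennreal)
        = (\<lambda>p. indicator {p. 0 < snd p \<and> snd p < 1 / \<rho> (fst p)} p)" by (auto simp: indicator_def)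
    then have [measurable]: "(\<lambda>p. indicator {0<..<1 / \<rho> (fst p)} (snd p) :: ennreal) \<in> borel_measurable (borel \<Otimes>\<^sub>M borel)"
      by simp
    show "(\<lambda>(y, t). sphere_ext F (e + J y) * (?i t y))
        \<in> borel_measurable (lborel \<Otimes>\<^sub>M lborel)"
      by (simp add: case_prod_beta')
  qed
  also have "\<dots> = (NN y. sphere_ext F (e + J y) * ennreal ((1 / \<rho> y) ^ (d + 1) / (d + 1)))"
    using \<rho> by (intro nn_integral_cong) (subst nn_integral_cmult, auto simp: nn_integral_power[of "1 / \<rho> _"])
  also have "of_nat (d + 1) * \<dots> = (NN y. of_nat (d + 1) * (sphere_ext F (e + J y) * ennreal ((1 / \<rho> y) ^ (d + 1) / (d + 1))))"
    by (rule nn_integral_cmult[symmetric]) measurable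
  also have "\<dots> = (NN y. F (sgn (e + J y)) * ennreal (1 / \<rho> y ^ DIM('a)))"
  proof (rule nn_integral_cong)
    fix y
    have "of_nat (d + 1) * ennreal ((1 / \<rho> y) ^ (d + 1) / (d + 1)) = ennreal (real (d + 1) * ((1 / \<rho> y) ^ (d + 1) / real (d + 1)))"
      unfolding ennreal_of_nat_eq_real_of_nat by (rule ennreal_mult[symmetric]) (use \<rho>[of y] in auto)
    also have "real (d + 1) * ((1 / \<rho> y) ^ (d + 1) / real (d + 1)) = 1 / \<rho> y ^ DIM('a)"
      unfolding dim d_def by (simp add: power_one_over)
    finally have "of_nat (d + 1) * ennreal ((1 / \<rho> y) ^ (d + 1) / (d + 1)) = ennreal (1 / \<rho> y ^ DIM('a))" .
    then show "of_nat (d + 1) * (sphere_ext F (e + J y) * ennreal ((1 / \<rho> y) ^ (d + 1) / (d + 1)))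
        = F (sgn (e + J y)) * ennreal (1 / \<rho> y ^ DIM('a))"
      unfolding F_ext by (metis mult.left_commute)
  qed
  finally show ?thesis by (simp add: \<rho>_def)
qed

lemma nn_integral_cot_substitution:
  fixes f :: "real \<Rightarrow> real"
  assumes [measurable]: "f \<in> borel_measurable borel" and nonneg: "\<And>t. 0 \<le> f t"
  shows "(NN t. ennreal (f t))
    = (NN s. ennreal (f (- cot s) / (sin s)^2) * indicator {0<..<pi} s)"
proof -
  define l where "l k = 1 / real (k + 2)" for k :: nat
  define r where "r k = pi - l k" for k :: nat
  let ?h = "\<lambda>s. ennreal (f (- cot s) / (sin s)^2)"
  let ?I = "\<lambda>k t. ennreal (f t) * indicator {- cot (l k)..- cot (r k)} t"
  have l: "0 < l k" "l k \<le> 1 / 2" for k by (auto simp: l_def field_simps)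
  have lr: "l k \<le> r k" "r k < pi" for k using l[of k] pi_gt3 by (auto simp: r_def)
  have l_anti: "l m \<le> l k" if "k \<le> m" for k m using that by (simp add: l_def frac_le)
  have l0: "l \<longlonglongrightarrow> 0"
    unfolding l_def using LIMSEQ_ignore_initial_segment[OF lim_inverse_n', of 2] by simp
  have sin_pos: "sin x > 0" if "x \<in> {l k..r k}" for x k
    using that l[of k] lr[of k] by (intro sin_gt_zero) auto
  have sub: "(NN t. ?I k t)
      = (NN s. ?h s * indicator {l k..r k} s)" for k
  proof -
    have "(NN t. ennreal (f t * indicator {- cot (l k)..- cot (r k)} t))
      = (NN s. ennreal (f (- cot s) * (1 / (sin s)^2) * indicator {l k..r k} s))"
    proof (rule nn_integral_substitution)
      show "((\<lambda>x. - cot x) has_real_derivative 1 / (sin x)^2) (at x)" if "x \<in> {l k..r k}" for x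
        using DERIV_minus[OF DERIV_cot, of x] sin_pos[OF that] by (simp add: inverse_eq_divide)
      show "continuous_on {l k..r k} (\<lambda>x. 1 / (sin x)^2)"
        using sin_pos by (intro continuous_intros) force
    qed (use lr sin_pos in \<open>auto simp: set_borel_measurable_def\<close>)
    then show ?thesis
      by (simp add: ennreal_mult'' nn_integral_set_ennreal)
  qed
  have mono_cot: "- cot x \<le> - cot y" if "0 < x" "x \<le> y" "y < pi" for x y
  proof (rule DERIV_nonneg_imp_nondecreasing[OF that(2), of "\<lambda>x. - cot x"])
    fix z assume "x \<le> z" "z \<le> y"
    then have "sin z > 0" using that by (intro sin_gt_zero) auto
    then show "\<exists>d. ((\<lambda>x. - cot x) has_real_derivative d) (at z) \<and> 0 \<le> d"
      using DERIV_minus[OF DERIV_cot, of z] by (intro exI[of _ "inverse ((sin z)^2)"]) auto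
  qed
  have cot_r: "- cot (r k) = cot (l k)" for k
    by (simp add: r_def cot_def)
  have cot_large: "\<exists>k. \<bar>t\<bar> \<le> cot (l k)" for t
  proof -
    obtain k :: nat where k: "2 * \<bar>t\<bar> \<le> real k" using real_arch_simple by blast
    have s: "0 < sin (l k)" "sin (l k) \<le> l k"
      using sin_pos[of "l k" k] lr(1)[of k] sin_x_le_x[of "l k"] l[of k] by auto
    have "cos (pi / 3) \<le> cos (l k)" using l[of k] pi_gt3 by (intro cos_monotone_0_pi_le) auto
    then have c: "1 / 2 \<le> cos (l k)" by (simp add: cos_60)
    have "\<bar>t\<bar> \<le> (1 / 2) / l k" using k by (simp add: l_def)
    also have "\<dots> \<le> cot (l k)" unfolding cot_def using c s by (intro frac_le) auto
    finally show ?thesis by blast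
  qed
  have "(NN t. ennreal (f t)) = (SUP k. \<integral>\<^sup>+t. ?I k t \<partial>lborel)"
  proof -
    have "ennreal (f t) = (SUP k. ?I k t)" for t
    proof (rule antisym)
      obtain k where "\<bar>t\<bar> \<le> cot (l k)" using cot_large by blast
      then have "ennreal (f t) = ?I k t"
        unfolding cot_r by (auto simp: indicator_def)
      also have "\<dots> \<le> (SUP k. ?I k t)"
        by (rule SUP_upper) simp
      finally show "ennreal (f t) \<le> (SUP k. ?I k t)" .
    qed (auto intro!: SUP_least simp: indicator_def)
    then have "(NN t. ennreal (f t)) = (NN t. (SUP k. ?I k t))"
      by simp
    also have "\<dots> = (SUP k. \<integral>\<^sup>+t. ?I k t \<partial>lborel)"
    proof (rule nn_integral_monotone_convergence_SUP)
      show "incseq (\<lambda>k t. ?I k t)"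
        unfolding cot_r
      proof (intro incseq_SucI le_funI mult_left_mono)
        fix k t
        have "cot (l k) \<le> cot (l (Suc k))" using mono_cot[of "l (Suc k)" "l k"] l[of k] l[of "Suc k"] l_anti[of k "Suc k"] pi_gt3 by auto
        then show "indicator {- cot (l k)..cot (l k)} t \<le> (indicator {- cot (l (Suc k))..cot (l (Suc k))} t :: ennreal)"
          by (auto simp: indicator_def)
      qed simp
    qed measurable
    finally show ?thesis .
  qed
  also have "\<dots> = (SUP k. \<integral>\<^sup>+s. ?h s * indicator {l k..r k} s \<partial>lborel)"
    by (simp only: sub)
  also have "\<dots> = (NN s. (SUP k. ?h s * indicator {l k..r k} s))"
  proof (rule nn_integral_monotone_convergence_SUP[symmetric])
    show "incseq (\<lambda>k s. ?h s * indicator {l k..r k} s)"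
    proof (intro incseq_SucI le_funI mult_left_mono)
      fix k s
      show "indicator {l k..r k} s \<le> (indicator {l (Suc k)..r (Suc k)} s :: ennreal)"
        using l_anti[of k "Suc k"] by (auto simp: indicator_def r_def)
    qed simp
    show "(\<lambda>s. ?h s * indicator {l k..r k} s) \<in> borel_measurable lborel" for k
      unfolding cot_def by measurable
  qed
  also have "\<dots> = (NN s. ?h s * indicator {0<..<pi} s)"
  proof (rule nn_integral_cong)
    fix s
    show "(SUP k. ?h s * indicator {l k..r k} s)
        = ?h s * indicator {0<..<pi} s"
    proof (rule antisym)
      show "(SUP k. ?h s * indicator {l k..r k} s)
        \<le> ?h s * indicator {0<..<pi} s"
      proof (rule SUP_least)
        fix k
        show "?h s * indicator {l k..r k} s
            \<le> ?h s * indicator {0<..<pi} s"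
          using l[of k] lr[of k] by (intro mult_left_mono) (auto simp: indicator_def)
      qed
      show "?h s * indicator {0<..<pi} s
          \<le> (SUP k. ?h s * indicator {l k..r k} s)"
      proof (cases "s \<in> {0<..<pi}")
        case True
        have "eventually (\<lambda>k. l k < min s (pi - s)) sequentially"
          using order_tendstoD(2)[OF l0, of "min s (pi - s)"] True by auto
        then obtain k where "l k < min s (pi - s)" by (auto simp: eventually_sequentially)
        then have "indicator {0<..<pi} s = (indicator {l k..r k} s :: ennreal)"
          using True by (auto simp: indicator_def r_def)
        then show ?thesis by (auto intro: SUP_upper)
      qed auto
    qed
  qed
  finally show ?thesis .
qed

text \<open>
  Polar coordinates: the sphere is foliated by the meridians
  \<open>\<theta> \<mapsto> cos \<theta> e + sin \<theta> \<omega>\<close>, where the directions \<open>\<omega>\<close> are distributed like \<open>J (sgn y)\<close> for \<open>y\<close> in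
  the unit ball with a density proportional to \<open>|y|\<close>.
\<close>

lemma nn_integral_meridian:
  fixes e :: "'a::euclidean_space" and J :: "'b::euclidean_space \<Rightarrow> 'a" and F :: "'a \<Rightarrow> real"
  assumes dim: "DIM('a) = DIM('b) + 1" and e: "norm e = 1"
    and J: "linear J" "\<And>y. norm (J y) = norm y" "\<And>y. e \<bullet> J y = 0"
    and F: "F \<in> borel_measurable sphere_measure" and nonneg: "\<And>x. x \<in> sphere 0 1 \<Longrightarrow> 0 \<le> F x"
  shows "(\<integral>\<^sup>+x. ennreal (F x) \<partial>sphere_measure) =
    (NN y. (NN s. ennreal (F (cos s *\<^sub>R e + sin s *\<^sub>R J (sgn y)) * sin s ^ (DIM('b) - 1))
        * indicator {0<..<pi} s) * (ennreal (DIM('a) * norm y) * indicator (ball 0 1 - {0}) y))"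
proof -
  define d where "d = DIM('b)"
  define \<rho> where "\<rho> \<tau> = sqrt (1 + \<tau>^2)" for \<tau> :: real
  have \<rho>: "\<rho> \<tau> > 0" for \<tau> by (simp add: \<rho>_def add_pos_nonneg)
  have [measurable]: "\<rho> \<in> borel_measurable borel" unfolding \<rho>_def by measurable
  define G where "G = sphere_ext F"
  let ?c = "\<lambda>s y. cos s *\<^sub>R e + sin s *\<^sub>R J (sgn y)"
  let ?L = "\<lambda>t y. ennreal (G (t *\<^sub>R -e + J y)) * indicator (ball 0 1) (t *\<^sub>R -e + J y)"
  let ?h = "\<lambda>\<tau> y. ennreal (G (\<tau> *\<^sub>R -e + J (sgn y)) / \<rho> \<tau> ^ (d + 1))"
  let ?g = "\<lambda>\<tau> y. ennreal (G (\<tau> *\<^sub>R -e + J (sgn y)))"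
  let ?N = "\<lambda>\<tau> y. (ennreal (norm y) * indicator {y. 0 < norm y \<and> norm y * \<rho> \<tau> < 1} y)"
  let ?u = "\<lambda>y. (ennreal (norm y) * indicator (ball 0 1 - {0}) y)"
  let ?k = "\<lambda>\<tau> y. (norm y * \<tau>) *\<^sub>R -e + J y"
  have [measurable]: "G \<in> borel_measurable borel" unfolding G_def by (rule sphere_ext_measurable[OF F])
  have [measurable]: "ball (0::'a) 1 \<in> sets borel" "ball (0::'b) 1 \<in> sets borel" by simp_all
  have G_nonneg: "0 \<le> G x" for x by (simp add: G_def sphere_ext_def nonneg norm_sgn)
  have G_scale: "G (t *\<^sub>R x) = G x" if "t > 0" for t x
    using that by (simp add: G_def sphere_ext_def sgn_add_scaled)
  have [measurable]: "J \<in> borel_measurable borel"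
    by (rule linear_borel_measurable) (rule J(1))
  interpret J: linear J by (rule J(1))
  have Fm: "(\<lambda>x. ennreal (F x)) \<in> borel_measurable sphere_measure" using F by simp
  have ext: "sphere_ext (\<lambda>x. ennreal (F x)) x = ennreal (G x)" for x
    by (simp add: G_def sphere_ext_def)
  have norm_JS: "norm (t *\<^sub>R -e + J y) = sqrt (t^2 + (norm y)^2)" for t y
    using norm_add_hyperplane[of "-e" J t y] e J by simp
  \<comment> \<open>The line through \<open>J y\<close> parallel to \<open>e\<close> is parametrised by the slope \<open>\<tau> = t / |y|\<close>.\<close>
  have line: "(NN t. ?L t y)
    = (NN \<tau>. ?g \<tau> y * ?N \<tau> y)"
    if y: "y \<noteq> 0" for y
  proof -
    have ny: "norm y > 0" using y by simp
    have "(NN t. ?L t y)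
      = ennreal (norm y) * (NN \<tau>. ennreal (G (?k \<tau> y)) * indicator (ball 0 1) (?k \<tau> y))"
      using nn_integral_scale[of "\<lambda>t. ?L t y", OF _ ny] by simp
    also have "\<dots> = (NN \<tau>. ennreal (norm y) * (ennreal (G (?k \<tau> y)) * indicator (ball 0 1) (?k \<tau> y)))"
      by (rule nn_integral_cmult[symmetric]) measurable
    also have "\<dots> = (NN \<tau>. ?g \<tau> y * ?N \<tau> y)"
    proof (rule nn_integral_cong)
      fix \<tau>
      have "(norm y * \<tau>) *\<^sub>R -e + J y = norm y *\<^sub>R (\<tau> *\<^sub>R -e + J (sgn y))"
        using ny by (simp add: sgn_div_norm J.scale algebra_simps)
      then have 1: "G (?k \<tau> y) = G (\<tau> *\<^sub>R -e + J (sgn y))"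
        using G_scale[OF ny] by metis
      have "norm (?k \<tau> y) = norm y * \<rho> \<tau>"
      proof -
        have "(norm y * \<tau>)^2 + (norm y)^2 = (norm y)^2 * (1 + \<tau>^2)" by (simp add: power_mult_distrib algebra_simps)
        then show ?thesis unfolding norm_JS \<rho>_def by (simp add: real_sqrt_mult)
      qed
      then have 2: "indicator (ball 0 1) (?k \<tau> y) = (indicator {y. 0 < norm y \<and> norm y * \<rho> \<tau> < 1} y :: ennreal)"
        using ny by (simp add: indicator_def)
      show "ennreal (norm y) * (ennreal (G (?k \<tau> y)) * indicator (ball 0 1) (?k \<tau> y))
        = ?g \<tau> y * ?N \<tau> y"
        unfolding 1 2 by (simp only: mult_ac)
    qed
    finally show ?thesis .
  qed
  \<comment> \<open>For a fixed slope the variable \<open>y\<close> runs over a ball, which is rescaled to the unit ball.\<close>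
  have dir: "(NN y. ?g \<tau> y * ?N \<tau> y)
    = (NN y. ?h \<tau> y * ?u y)" for \<tau>
  proof -
    define c where "c = 1 / \<rho> \<tau>"
    have c: "c > 0" using \<rho>[of \<tau>] by (simp add: c_def)
    have "(NN y. ?g \<tau> y * ?N \<tau> y)
      = ennreal (c ^ d) * (NN y. ennreal (G (\<tau> *\<^sub>R -e + J (sgn (c *\<^sub>R y)))) * (ennreal (norm (c *\<^sub>R y)) * indicator {y. 0 < norm y \<and> norm y * \<rho> \<tau> < 1} (c *\<^sub>R y)))"
      unfolding d_def by (rule nn_integral_scale[OF _ c]) measurable
    also have "\<dots> = (NN y. ennreal (c ^ d) * (ennreal (G (\<tau> *\<^sub>R -e + J (sgn (c *\<^sub>R y)))) * (ennreal (norm (c *\<^sub>R y)) * indicator {y. 0 < norm y \<and> norm y * \<rho> \<tau> < 1} (c *\<^sub>R y))))"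
      by (rule nn_integral_cmult[symmetric]) measurable
    also have "\<dots> = (NN y. ?h \<tau> y * ?u y)"
    proof (rule nn_integral_cong)
      fix y :: 'b
      have 1: "sgn (c *\<^sub>R y) = sgn y" using c by (rule sgn_add_scaled)
      have 2: "indicator {y. 0 < norm y \<and> norm y * \<rho> \<tau> < 1} (c *\<^sub>R y) = (indicator (ball 0 1 - {0}) y :: ennreal)"
        using c \<rho>[of \<tau>] by (auto simp: indicator_def c_def)
      have 3: "?h \<tau> y = ?g \<tau> y * ennreal (c ^ (d + 1))"
        using c G_nonneg by (simp add: ennreal_mult'[symmetric] c_def power_divide)
      have 4: "ennreal (norm (c *\<^sub>R y)) = ennreal c * ennreal (norm y)" using c by (simp add: ennreal_mult)
      have 5: "ennreal (c ^ (d + 1)) = ennreal (c ^ d) * ennreal c" using c by (simp add: ennreal_mult mult.commute)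
      show "ennreal (c ^ d) * (ennreal (G (\<tau> *\<^sub>R -e + J (sgn (c *\<^sub>R y)))) * (ennreal (norm (c *\<^sub>R y)) * indicator {y. 0 < norm y \<and> norm y * \<rho> \<tau> < 1} (c *\<^sub>R y)))
        = ?h \<tau> y * ?u y"
        unfolding 1 2 3 4 5 by (simp only: mult_ac)
    qed
    finally show ?thesis .
  qed
  \<comment> \<open>Slopes are turned into angles.\<close>
  have angle: "(NN \<tau>. ?h \<tau> y)
      = (NN s. ennreal (F (?c s y) * sin s ^ (d - 1)) * indicator {0<..<pi} s)"
    if y: "y \<noteq> 0" for y
  proof -
    have "(NN \<tau>. ?h \<tau> y)
      = (NN s. ennreal (G ((- cot s) *\<^sub>R -e + J (sgn y)) / \<rho> (- cot s) ^ (d + 1) / (sin s)^2) * indicator {0<..<pi} s)"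
      by (rule nn_integral_cot_substitution) (measurable, intro divide_nonneg_nonneg zero_le_power G_nonneg less_imp_le[OF \<rho>])
    also have "\<dots> = (NN s. ennreal (F (?c s y) * sin s ^ (d - 1)) * indicator {0<..<pi} s)"
    proof (rule nn_integral_cong)
      fix s
      show "ennreal (G ((- cot s) *\<^sub>R -e + J (sgn y)) / \<rho> (- cot s) ^ (d + 1) / (sin s)^2) * indicator {0<..<pi} s
        = ennreal (F (?c s y) * sin s ^ (d - 1)) * indicator {0<..<pi} s"
      proof (cases "s \<in> {0<..<pi}")
        case True
        then have s: "sin s > 0" by (intro sin_gt_zero) auto
        have \<rho>s: "\<rho> (- cot s) = 1 / sin s"
        proof -
          have "1 + (cot s)^2 = (1 / sin s)^2"
            using s sin_cos_squared_add[of s] by (simp add: cot_def field_simps)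
          then show ?thesis unfolding \<rho>_def using s by (simp add: real_sqrt_divide)
        qed
        have n1: "norm (?c s y) = 1"
          using norm_add_hyperplane[OF e J(2,3), of "cos s" "sin s *\<^sub>R sgn y"] y by (simp add: J.scale norm_sgn)
        have "(- cot s) *\<^sub>R -e + J (sgn y) = (1 / sin s) *\<^sub>R (?c s y)"
          using s by (simp add: cot_def scaleR_add_right)
        also have "G \<dots> = G (?c s y)" using s by (intro G_scale) simp
        also have "\<dots> = F (?c s y)"
          using n1 by (auto simp: G_def sphere_ext_def sgn_eq_unit)
        finally have "G ((- cot s) *\<^sub>R -e + J (sgn y)) = F (?c s y)" .
        moreover have "1 / (1 / sin s) ^ (d + 1) / (sin s)^2 = sin s ^ (d - 1)"
        proof -
          have "sin s ^ (d + 1) = sin s ^ (d - 1) * (sin s)^2"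
            unfolding d_def power_add[symmetric] using DIM_positive[where 'a='b] by simp
          then show ?thesis using s by (simp add: power_divide)
        qed
        ultimately show ?thesis unfolding \<rho>s by (metis divide_divide_eq_left mult.right_neutral times_divide_eq_right)
      qed simp
    qed
    finally show ?thesis .
  qed
  have ae: "AE y in lborel. y \<noteq> (0::'b)" by (rule AE_lborel_singleton)
  have "(\<integral>\<^sup>+x. ennreal (F x) \<partial>sphere_measure) = of_nat DIM('a) * (NN x. ennreal (G x) * indicator (ball 0 1) x)"
    unfolding nn_integral_sphere[OF Fm] ext ..
  also have "(NN x. ennreal (G x) * indicator (ball 0 1) x)
      = (NN y. (NN t. ?L t y))"
  proof (rule nn_integral_cylinder(2)[OF dim])
    show "(\<lambda>x. ennreal (G x) * indicator (ball 0 1) x) \<in> borel_measurable borel" by measurable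
  qed (use e J in auto)
  also have "\<dots> = (NN y. (NN \<tau>. ?g \<tau> y * ?N \<tau> y))"
    by (rule nn_integral_cong_AE) (use ae line in \<open>auto elim!: eventually_mono\<close>)
  also have "\<dots> = (NN \<tau>. (NN y. ?g \<tau> y * ?N \<tau> y))"
  proof (rule lborel_pair.Fubini')
    have "(\<lambda>p. indicator {y. 0 < norm y \<and> norm y * \<rho> (fst p) < 1} (snd p) :: ennreal)
        = (\<lambda>p. indicator {p. 0 < norm (snd p) \<and> norm (snd p) * \<rho> (fst p) < 1} p)" by (auto simp: indicator_def)
    then have [measurable]: "(\<lambda>p :: real \<times> 'b. indicator {y. 0 < norm y \<and> norm y * \<rho> (fst p) < 1} (snd p) :: ennreal) \<in> borel_measurable (borel \<Otimes>\<^sub>M borel)"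
      by simp
    show "(\<lambda>(\<tau>, y). ?g \<tau> y * ?N \<tau> y)
        \<in> borel_measurable (lborel \<Otimes>\<^sub>M lborel)"
      by (simp add: case_prod_beta')
  qed
  also have "\<dots> = (NN \<tau>. (NN y. ?h \<tau> y * ?u y))"
    by (simp only: dir)
  also have "\<dots> = (NN y. (NN \<tau>. ?h \<tau> y * ?u y))"
    by (rule lborel_pair.Fubini') measurable
  also have "\<dots> = (NN y. (NN \<tau>. ?h \<tau> y) * ?u y)"
    by (intro nn_integral_cong nn_integral_multc) measurable
  also have "of_nat DIM('a) * \<dots> = (NN y. of_nat DIM('a) * ((NN \<tau>. ?h \<tau> y) * ?u y))"
    by (rule nn_integral_cmult[symmetric]) measurable
  also have "\<dots> = (NN y. (NN s. ennreal (F (?c s y) * sin s ^ (d - 1))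
        * indicator {0<..<pi} s) * (ennreal (DIM('a) * norm y) * indicator (ball 0 1 - {0}) y))"
  proof (rule nn_integral_cong)
    fix y :: 'b
    show "of_nat DIM('a) * ((NN \<tau>. ?h \<tau> y) * ?u y)
      = (NN s. ennreal (F (?c s y) * sin s ^ (d - 1))
        * indicator {0<..<pi} s) * (ennreal (DIM('a) * norm y) * indicator (ball 0 1 - {0}) y)"
    proof (cases "y = 0")
      case False
      have "ennreal (DIM('a) * norm y) = of_nat DIM('a) * ennreal (norm y)"
        by (simp add: ennreal_mult ennreal_of_nat_eq_real_of_nat)
      then show ?thesis unfolding angle[OF False] by (simp only: mult_ac)
    qed simp
  qed
  finally show ?thesis by (simp add: d_def)
qed


section \<open>Square integrable functions\<close>

abbreviation sqnorm :: "'a measure \<Rightarrow> ('a \<Rightarrow> 'b::real_normed_vector) \<Rightarrow> real" where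
  "sqnorm M f \<equiv> \<integral>x. (norm (f x))^2 \<partial>M"

abbreviation sqint :: "'a measure \<Rightarrow> ('a \<Rightarrow> real) \<Rightarrow> real" where
  "sqint M u \<equiv> \<integral>x. (u x)^2 \<partial>M"

lemma L2_measurable: "f \<in> L2 M \<Longrightarrow> f \<in> borel_measurable M"
  and L2_integrable: "f \<in> L2 M \<Longrightarrow> integrable M (\<lambda>x. (norm (f x))^2)"
  by (auto simp: L2_def)

lemma L2_I:
  "f \<in> borel_measurable M \<Longrightarrow> integrable M (\<lambda>x. (norm (f x))^2) \<Longrightarrow> f \<in> L2 M"
  by (simp add: L2_def)

lemma L2_scaleR: "f \<in> L2 M \<Longrightarrow> (\<lambda>x. c *\<^sub>R f x) \<in> L2 M"
  by (auto simp: L2_def power_mult_distrib)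

lemma norm_add_power2_le: "(norm (x + y))^2 \<le> 2 * (norm x)^2 + 2 * (norm (y::'a::real_normed_vector))^2"
proof -
  have "(norm (x + y))^2 \<le> (norm x + norm y)^2" by (intro power_mono norm_triangle_ineq) simp
  also have "\<dots> \<le> 2 * (norm x)^2 + 2 * (norm y)^2"
    using sum_squares_bound[of "norm x" "norm y"] by (simp add: power2_sum)
  finally show ?thesis .
qed

lemma L2_add: assumes "f \<in> L2 M" "g \<in> L2 M" shows "(\<lambda>x. f x + g x) \<in> L2 M"
proof (rule L2_I)
  have [measurable]: "f \<in> borel_measurable M" "g \<in> borel_measurable M" using assms by (auto simp: L2_def)
  show "(\<lambda>x. f x + g x) \<in> borel_measurable M" by measurable
  show "integrable M (\<lambda>x. (norm (f x + g x))^2)"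
  proof (rule Bochner_Integration.integrable_bound)
    show "integrable M (\<lambda>x. 2 * (norm (f x))^2 + 2 * (norm (g x))^2)"
      by (intro Bochner_Integration.integrable_add integrable_mult_right L2_integrable assms)
    show "(\<lambda>x. (norm (f x + g x))^2) \<in> borel_measurable M" by measurable
    show "AE x in M. norm ((norm (f x + g x))^2) \<le> norm (2 * (norm (f x))^2 + 2 * (norm (g x))^2)"
      using norm_add_power2_le by (auto intro!: AE_I2)
  qed
qed

lemma L2_diff: "f \<in> L2 M \<Longrightarrow> g \<in> L2 M \<Longrightarrow> (\<lambda>x. f x - g x) \<in> L2 M"
  using L2_add[of f M "\<lambda>x. (-1) *\<^sub>R g x"] L2_scaleR[of g M "-1"] by simp

lemma inner_polarization: "x \<bullet> y = ((norm (x + y))^2 - (norm (x - y))^2) / 4"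
  by (simp add: power2_norm_eq_inner inner_add_left inner_add_right inner_diff_left inner_diff_right inner_commute)

lemma L2_inner_integrable: "f \<in> L2 M \<Longrightarrow> g \<in> L2 M \<Longrightarrow> integrable M (\<lambda>x. f x \<bullet> g x)"
  unfolding inner_polarization by (auto intro!: L2_integrable L2_add L2_diff)

lemma L2_mult_integrable:
  fixes f g :: "'a \<Rightarrow> real"
  shows "f \<in> L2 M \<Longrightarrow> g \<in> L2 M \<Longrightarrow> integrable M (\<lambda>x. f x * g x)"
  using L2_inner_integrable[of f M g] by (simp add: mult.commute)

lemma L2_limitD:
  "L2_limit M F f \<Longrightarrow> f \<in> L2 M" "L2_limit M F f \<Longrightarrow> F n \<in> L2 M"
  "L2_limit M F f \<Longrightarrow> (\<lambda>n. sqnorm M (\<lambda>x. F n x - f x)) \<longlonglongrightarrow> 0"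
  by (auto simp: L2_limit_def)

lemma L2_limit_norm:
  assumes "L2_limit M F f"
  shows "(\<lambda>n. sqnorm M (F n)) \<longlonglongrightarrow> sqnorm M f"
proof -
  note int = L2_integrable[OF L2_limitD(1)[OF assms]] L2_integrable[OF L2_limitD(2)[OF assms]]
    L2_integrable[OF L2_diff[OF L2_limitD(2)[OF assms] L2_limitD(1)[OF assms]]]
  define a where "a n = sqnorm M (\<lambda>x. F n x - f x)" for n
  define b where "b = sqnorm M f"
  have a: "a \<longlonglongrightarrow> 0" using L2_limitD(3)[OF assms] by (simp add: a_def[abs_def])
  have b: "b \<ge> 0" by (simp add: b_def)
  have "norm ((norm y)^2 - (norm z)^2) \<le> (1 + 1 / s) * (norm (y - z))^2 + s * (norm z)^2"
    if "s > 0" for s and y z :: 'b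
  proof -
    have "\<bar>norm y - norm z\<bar> \<le> norm (y - z)" by (rule norm_triangle_ineq3)
    moreover have "norm y + norm z \<le> norm (y - z) + 2 * norm z" using norm_triangle_sub[of y z] by simp
    ultimately have "\<bar>norm y - norm z\<bar> * (norm y + norm z) \<le> norm (y - z) * (norm (y - z) + 2 * norm z)"
      by (intro mult_mono) auto
    also have "\<dots> \<le> (1 + 1 / s) * (norm (y - z))^2 + s * (norm z)^2"
    proof -
      have "0 \<le> (norm (y - z) - s * norm z)^2 / s" using that by simp
      also have "\<dots> = (norm (y - z))^2 / s - 2 * norm (y - z) * norm z + s * (norm z)^2"
        using that by (simp add: power2_eq_square field_simps)
      finally show ?thesis by (simp add: power2_eq_square algebra_simps)
    qed
    finally show ?thesis
      by (simp add: square_diff_square_factored power2_eq_square abs_mult mult.commute)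
  qed
  note pw = this
  have bound: "\<bar>(sqnorm M (F n)) - b\<bar> \<le> (1 + 1 / s) * a n + s * b" if s: "s > 0" for s n
  proof -
    have "\<bar>(sqnorm M (F n)) - b\<bar> = \<bar>\<integral>x. (norm (F n x))^2 - (norm (f x))^2 \<partial>M\<bar>"
      unfolding b_def by (subst Bochner_Integration.integral_diff[OF int(2,1)]) (rule refl)
    also have "\<dots> \<le> (LINT x|M. \<bar>(norm (F n x))^2 - (norm (f x))^2\<bar>)" by (rule integral_abs_bound)
    also have "\<dots> \<le> (LINT x|M. (1 + 1 / s) * (norm (F n x - f x))^2 + s * (norm (f x))^2)"
      by (rule integral_mono)
         (intro Bochner_Integration.integrable_diff Bochner_Integration.integrable_add integrable_abs
               integrable_mult_right int pw[OF s, unfolded real_norm_def])+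
    also have "\<dots> = (1 + 1 / s) * a n + s * b"
      unfolding a_def b_def
      by (subst Bochner_Integration.integral_add) (intro integrable_mult_right int | simp)+
    finally show ?thesis .
  qed
  show ?thesis
    unfolding b_def[symmetric]
  proof (rule LIMSEQ_I)
    fix r :: real assume r: "r > 0"
    define s where "s = r / (2 * (b + 1))"
    have s: "s > 0" using r b by (simp add: s_def)
    have sb: "s * b < r / 2"
    proof -
      have "s * b < s * (b + 1)" using s by simp
      also have "\<dots> = r / 2" using b by (simp add: s_def field_simps)
      finally show ?thesis .
    qed
    have "(\<lambda>n. (1 + 1 / s) * a n) \<longlonglongrightarrow> (1 + 1 / s) * 0" by (intro tendsto_mult a tendsto_const)
    then have "eventually (\<lambda>n. (1 + 1 / s) * a n < r / 2) sequentially"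
      using r by (intro order_tendstoD(2)) auto
    then obtain n0 where "\<And>n. n \<ge> n0 \<Longrightarrow> (1 + 1 / s) * a n < r / 2" by (auto simp: eventually_sequentially)
    then show "\<exists>no. \<forall>n\<ge>no. norm (sqnorm M (F n) - b) < r"
      using bound[OF s] sb by (intro exI[of _ n0] allI impI) (smt (verit) real_norm_def field_sum_of_halves)
  qed
qed

lemma L2_limit_scaleR:
  assumes "L2_limit M F f" shows "L2_limit M (\<lambda>n x. c *\<^sub>R F n x) (\<lambda>x. c *\<^sub>R f x)"
proof -
  have "sqnorm M (\<lambda>x. c *\<^sub>R F n x - c *\<^sub>R f x) = c^2 * sqnorm M (\<lambda>x. F n x - f x)" for n
    by (simp add: scaleR_diff_right[symmetric] power_mult_distrib del: scaleR_diff_right)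
  moreover have "(\<lambda>n. c^2 * sqnorm M (\<lambda>x. F n x - f x)) \<longlonglongrightarrow> c^2 * 0"
    by (intro tendsto_mult tendsto_const L2_limitD[OF assms])
  ultimately show ?thesis
    using assms by (auto simp: L2_limit_def intro: L2_scaleR)
qed

lemma L2_limit_add:
  assumes "L2_limit M F f" "L2_limit M G g" shows "L2_limit M (\<lambda>n x. F n x + G n x) (\<lambda>x. f x + g x)"
proof -
  note L2s = L2_integrable L2_diff L2_add L2_limitD(1,2)[OF assms(1)] L2_limitD(1,2)[OF assms(2)]
  have "(\<lambda>n. sqnorm M (\<lambda>x. (F n x + G n x) - (f x + g x))) \<longlonglongrightarrow> 0"
  proof (rule tendsto_sandwich[OF _ _ tendsto_const])
    show "(\<lambda>n. 2 * sqnorm M (\<lambda>x. F n x - f x) + 2 * sqnorm M (\<lambda>x. G n x - g x)) \<longlonglongrightarrow> 0"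
      using tendsto_add[OF tendsto_mult[OF tendsto_const[of 2] L2_limitD(3)[OF assms(1)]]
          tendsto_mult[OF tendsto_const[of 2] L2_limitD(3)[OF assms(2)]]] by simp
    have "sqnorm M (\<lambda>x. (F n x + G n x) - (f x + g x))
        \<le> 2 * sqnorm M (\<lambda>x. F n x - f x) + 2 * sqnorm M (\<lambda>x. G n x - g x)" for n
    proof -
      have "sqnorm M (\<lambda>x. (F n x + G n x) - (f x + g x))
          \<le> (LINT x|M. 2 * (norm (F n x - f x))^2 + 2 * (norm (G n x - g x))^2)"
      proof (rule integral_mono)
        show "(norm ((F n x + G n x) - (f x + g x)))^2 \<le> 2 * (norm (F n x - f x))^2 + 2 * (norm (G n x - g x))^2" for x
          using norm_add_power2_le[of "F n x - f x" "G n x - g x"] by (simp add: add_diff_add)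
      qed (intro Bochner_Integration.integrable_add integrable_mult_right L2s)+
      also have "\<dots> = 2 * sqnorm M (\<lambda>x. F n x - f x) + 2 * sqnorm M (\<lambda>x. G n x - g x)"
        by (subst Bochner_Integration.integral_add) (intro integrable_mult_right L2s | simp)+
      finally show ?thesis .
    qed
    then show "\<forall>\<^sub>F n in sequentially. sqnorm M (\<lambda>x. (F n x + G n x) - (f x + g x))
        \<le> 2 * sqnorm M (\<lambda>x. F n x - f x) + 2 * sqnorm M (\<lambda>x. G n x - g x)" by simp
  qed auto
  then show ?thesis unfolding L2_limit_def by (auto intro!: L2s)
qed

lemma L2_limit_const: "f \<in> L2 M \<Longrightarrow> L2_limit M (\<lambda>_. f) f"
  by (simp add: L2_limit_def)

lemma L2_limit_subseq:
  "L2_limit M F f \<Longrightarrow> strict_mono r \<Longrightarrow> L2_limit M (\<lambda>n. F (r n)) f"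
  unfolding L2_limit_def using LIMSEQ_subseq_LIMSEQ by (fastforce simp: o_def)

lemma L2_limit_AE_subseq:
  assumes "L2_limit M F f"
  obtains r where "strict_mono r" "AE x in M. (\<lambda>n. F (r n) x) \<longlonglongrightarrow> f x"
proof -
  have int: "integrable M (\<lambda>x. (norm (F n x - f x))^2)" for n
    by (intro L2_integrable L2_diff L2_limitD[OF assms])
  obtain r where r: "strict_mono r" "AE x in M. (\<lambda>n. (norm (F (r n) x - f x))^2) \<longlonglongrightarrow> 0"
  proof -
    have "(\<lambda>n. \<integral>x. norm ((norm (F n x - f x))^2) \<partial>M) \<longlonglongrightarrow> 0" using L2_limitD(3)[OF assms] by simp
    then show ?thesis using tendsto_L1_AE_subseq[of M "\<lambda>n x. (norm (F n x - f x))^2", OF int] that by blast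
  qed
  have "AE x in M. (\<lambda>n. F (r n) x) \<longlonglongrightarrow> f x"
    using r(2)
  proof (rule AE_mp, intro AE_I2 impI)
    fix x assume "(\<lambda>n. (norm (F (r n) x - f x))^2) \<longlonglongrightarrow> 0"
    then have "(\<lambda>n. sqrt ((norm (F (r n) x - f x))^2)) \<longlonglongrightarrow> sqrt 0" by (rule tendsto_real_sqrt)
    then show "(\<lambda>n. F (r n) x) \<longlonglongrightarrow> f x"
      by (simp add: tendsto_norm_zero_iff LIM_zero_iff)
  qed
  with r(1) that show ?thesis by blast
qed

text \<open>
  The Riesz--Fischer theorem. Along a rapidly converging subsequence the increments are bounded almost
  everywhere by a geometric series, and Fatou's lemma turns the pointwise limit into a limit in \<open>L\<^sup>2\<close>.
\<close>

lemma L2_complete: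
  fixes F :: "nat \<Rightarrow> 'a \<Rightarrow> 'b::euclidean_space"
  assumes F: "\<And>n. F n \<in> L2 M"
    and Cauchy: "\<And>e. e > 0 \<Longrightarrow> \<exists>N. \<forall>m\<ge>N. \<forall>n\<ge>N. sqnorm M (\<lambda>x. F m x - F n x) < e"
  obtains f where "L2_limit M F f"
proof -
  have [measurable]: "F n \<in> borel_measurable M" for n using F by (rule L2_measurable)
  have int: "integrable M (\<lambda>x. (norm (F m x - F n x))^2)" for m n
    by (intro L2_integrable L2_diff F)
  have "\<exists>r. \<forall>k. True \<and> (r (Suc k) > r k \<and> (\<forall>n\<ge>r (Suc k). sqnorm M (\<lambda>x. F (r (Suc k)) x - F n x) < (1 / 4) ^ k))"
  proof (rule dependent_nat_choice)
    fix m k :: nat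
    have "(1/4 :: real) ^ k > 0" by simp
    from Cauchy[OF this] obtain N where N: "\<forall>m\<ge>N. \<forall>n\<ge>N. sqnorm M (\<lambda>x. F m x - F n x) < (1 / 4) ^ k" by blast
    show "\<exists>y. True \<and> y > m \<and> (\<forall>n\<ge>y. sqnorm M (\<lambda>x. F y x - F n x) < (1 / 4) ^ k)"
      using N by (intro exI[of _ "max N (Suc m)"]) auto
  qed simp
  then obtain r0 where r0: "\<And>k. r0 (Suc k) > r0 k"
    "\<And>k n. n \<ge> r0 (Suc k) \<Longrightarrow> sqnorm M (\<lambda>x. F (r0 (Suc k)) x - F n x) < (1 / 4) ^ k" by auto
  define r where "r k = r0 (Suc k)" for k
  have r_mono: "strict_mono r" unfolding r_def by (intro strict_monoI_Suc) (use r0 in auto)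
  define \<Delta> where "\<Delta> k x = F (r (Suc k)) x - F (r k) x" for k x
  let ?t = "\<lambda>k x. ennreal (2 ^ k * (norm (\<Delta> k x))^2)"
  let ?e = "\<lambda>n k x. ennreal ((norm (F n x - F (r k) x))^2)"
  have [measurable]: "\<Delta> k \<in> borel_measurable M" for k unfolding \<Delta>_def by measurable
  have \<Delta>_int: "(\<integral>\<^sup>+x. ?t k x \<partial>M) \<le> ennreal ((1 / 2) ^ k)" for k
  proof -
    have "sqnorm M (\<Delta> k) \<le> (1 / 4) ^ k"
      using r0(2)[of k "r (Suc k)"] r0(1)[of "Suc k"] by (simp add: \<Delta>_def r_def norm_minus_commute)
    then have "2 ^ k * sqnorm M (\<Delta> k) \<le> 2 ^ k * (1 / 4) ^ k" by simp
    also have "\<dots> = (1 / 2) ^ k" unfolding power_mult_distrib[symmetric] by simp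
    finally have "(LINT x|M. 2 ^ k * (norm (\<Delta> k x))^2) \<le> (1 / 2) ^ k" by simp
    moreover have "(\<integral>\<^sup>+x. ?t k x \<partial>M) = ennreal (LINT x|M. 2 ^ k * (norm (\<Delta> k x))^2)"
      unfolding \<Delta>_def using int by (intro nn_integral_eq_integral) auto
    ultimately show ?thesis by (simp add: ennreal_leI)
  qed
  have "AE x in M. (\<Sum>k. ?t k x) \<noteq> \<infinity>"
  proof (rule nn_integral_PInf_AE)
    have "(\<integral>\<^sup>+x. (\<Sum>k. ?t k x) \<partial>M) = (\<Sum>k. \<integral>\<^sup>+x. ?t k x \<partial>M)"
      by (rule nn_integral_suminf) measurable
    also have "\<dots> \<le> (\<Sum>k. ennreal ((1 / 2) ^ k))" by (intro suminf_le \<Delta>_int) auto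
    also have "\<dots> = ennreal (\<Sum>k. (1 / 2) ^ k)" by (intro suminf_ennreal2) (auto intro: summable_geometric)
    finally show "(\<integral>\<^sup>+x. (\<Sum>k. ?t k x) \<partial>M) \<noteq> \<infinity>"
      by (metis ennreal_neq_top infinity_ennreal_def top.extremum_uniqueI)
  qed measurable
  then have conv: "AE x in M. convergent (\<lambda>k. F (r k) x)"
  proof (rule AE_mp, intro AE_I2 impI)
    fix x assume fin: "(\<Sum>k. ?t k x) \<noteq> \<infinity>"
    define C where "C = enn2real (\<Sum>k. ?t k x)"
    have C: "C \<ge> 0" "(\<Sum>k. ?t k x) = ennreal C"
      unfolding C_def using fin by (auto simp: ennreal_enn2real top.not_eq_extremum)
    have "2 ^ k * (norm (\<Delta> k x))^2 \<le> C" for k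
    proof -
      have "(\<Sum>i\<in>{k}. ennreal (2 ^ i * (norm (\<Delta> i x))^2)) \<le> ennreal C"
        unfolding C(2)[symmetric] by (rule sum_le_suminf) (simp_all add: summableI)
      then have "?t k x \<le> ennreal C" by simp
      then show ?thesis using C(1) by (simp add: ennreal_le_iff)
    qed
    then have "(norm (\<Delta> k x))^2 \<le> C * (1 / 2) ^ k" for k by (simp add: field_simps)
    then have "norm (\<Delta> k x) \<le> sqrt (C * (1 / 2) ^ k)" for k by (rule real_le_rsqrt)
    moreover have "sqrt (C * (1 / 2) ^ k) = sqrt C * (sqrt (1 / 2)) ^ k" for k
      by (subst real_sqrt_mult, subst real_sqrt_power) (rule refl)
    ultimately have geo: "norm (\<Delta> k x) \<le> sqrt C * (sqrt (1 / 2)) ^ k" for k by simp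
    have "summable (\<lambda>k. \<Delta> k x)"
    proof (rule summable_comparison_test'[of "\<lambda>k. sqrt C * (sqrt (1 / 2)) ^ k" 0])
      show "summable (\<lambda>k. sqrt C * (sqrt (1 / 2)) ^ k)"
        by (intro summable_mult summable_geometric) (simp add: real_sqrt_divide)
    qed (rule geo)
    then have "convergent (\<lambda>n. \<Sum>k<n. \<Delta> k x)" by (simp add: summable_iff_convergent)
    moreover have "(\<Sum>k<n. \<Delta> k x) = F (r n) x - F (r 0) x" for n
      unfolding \<Delta>_def by (rule sum_lessThan_telescope)
    ultimately have "convergent (\<lambda>n. (F (r n) x - F (r 0) x) + F (r 0) x)"
      by (intro convergent_add convergent_const) simp
    then show "convergent (\<lambda>k. F (r k) x)" by simp
  qed
  define f where "f x = lim (\<lambda>k. F (r k) x)" for x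
  have [measurable]: "f \<in> borel_measurable M" unfolding f_def by measurable
  have lim: "AE x in M. (\<lambda>k. F (r k) x) \<longlonglongrightarrow> f x"
    using conv by (rule AE_mp) (auto simp: f_def convergent_LIMSEQ_iff)
  have est: "(\<integral>\<^sup>+x. ennreal ((norm (F n x - f x))^2) \<partial>M) \<le> ennreal e"
    if N: "\<forall>m\<ge>N. \<forall>n\<ge>N. sqnorm M (\<lambda>x. F m x - F n x) < e" and n: "n \<ge> N" for e n N
  proof -
    have "(\<integral>\<^sup>+x. ennreal ((norm (F n x - f x))^2) \<partial>M) = (\<integral>\<^sup>+x. liminf (\<lambda>k. ?e n k x) \<partial>M)"
    proof (rule nn_integral_cong_AE, use lim in \<open>rule AE_mp\<close>, intro AE_I2 impI)
      fix x assume "(\<lambda>k. F (r k) x) \<longlonglongrightarrow> f x"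
      then have "(\<lambda>k. ?e n k x) \<longlonglongrightarrow> ennreal ((norm (F n x - f x))^2)"
        by (intro tendsto_intros)
      then show "ennreal ((norm (F n x - f x))^2) = liminf (\<lambda>k. ?e n k x)"
        by (rule lim_imp_Liminf[OF sequentially_bot, symmetric])
    qed
    also have "\<dots> \<le> liminf (\<lambda>k. \<integral>\<^sup>+x. ?e n k x \<partial>M)"
      by (rule nn_integral_liminf) measurable
    also have "\<dots> \<le> liminf (\<lambda>k. ennreal e)"
    proof (rule Liminf_mono)
      have "eventually (\<lambda>k. k \<ge> N) sequentially" by (rule eventually_ge_at_top)
      then show "eventually (\<lambda>k. (\<integral>\<^sup>+x. ?e n k x \<partial>M) \<le> ennreal e) sequentially"
      proof eventually_elim
        case (elim k)
        then have "r k \<ge> N" using seq_suble[OF r_mono, of k] by simp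
        then have "sqnorm M (\<lambda>x. F n x - F (r k) x) < e" using N n by blast
        moreover have "(\<integral>\<^sup>+x. ?e n k x \<partial>M) = ennreal (sqnorm M (\<lambda>x. F n x - F (r k) x))"
          using int by (intro nn_integral_eq_integral) auto
        ultimately show ?case by (simp add: ennreal_leI)
      qed
    qed
    also have "\<dots> = ennreal e" by (simp add: Liminf_const)
    finally show ?thesis .
  qed
  have diff: "(\<lambda>x. F n x - f x) \<in> L2 M" if "n \<ge> N" "\<forall>m\<ge>N. \<forall>n\<ge>N. sqnorm M (\<lambda>x. F m x - F n x) < 1" for n N
  proof (rule L2_I)
    have "(\<integral>\<^sup>+x. ennreal (norm ((norm (F n x - f x))^2)) \<partial>M) \<le> ennreal 1" using est[OF that(2,1)] by simp
    then show "integrable M (\<lambda>x. (norm (F n x - f x))^2)"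
      by (intro integrableI_bounded) (auto intro: order_le_less_trans)
  qed measurable
  obtain N1 where N1: "\<forall>m\<ge>N1. \<forall>n\<ge>N1. sqnorm M (\<lambda>x. F m x - F n x) < 1" using Cauchy[of 1] by auto
  have f: "f \<in> L2 M" using L2_diff[OF F[of N1] diff[OF _ N1, of N1]] by simp
  have "(\<lambda>n. sqnorm M (\<lambda>x. F n x - f x)) \<longlonglongrightarrow> 0"
  proof (rule LIMSEQ_I)
    fix e :: real assume e: "e > 0"
    then obtain N where N: "\<forall>m\<ge>N. \<forall>n\<ge>N. sqnorm M (\<lambda>x. F m x - F n x) < e / 2" using Cauchy[of "e/2"] by auto
    have "sqnorm M (\<lambda>x. F n x - f x) \<le> e / 2" if "n \<ge> N" for n
    proof -
      have "ennreal (sqnorm M (\<lambda>x. F n x - f x)) = (\<integral>\<^sup>+x. ennreal ((norm (F n x - f x))^2) \<partial>M)"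
        by (intro nn_integral_eq_integral[symmetric] L2_integrable L2_diff F f) auto
      also have "\<dots> \<le> ennreal (e / 2)" using est[OF N that] .
      finally show ?thesis using e by (simp add: ennreal_le_iff)
    qed
    then show "\<exists>no. \<forall>n\<ge>no. norm (sqnorm M (\<lambda>x. F n x - f x) - 0) < e"
      using e by (intro exI[of _ N]) (fastforce simp: order_le_less_trans)
  qed
  with f F show ?thesis by (intro that) (simp add: L2_limit_def)
qed


section \<open>Test functions and local compactness\<close>

definition test_fun :: "('b::euclidean_space \<Rightarrow> real) \<Rightarrow> bool" where
  "test_fun \<psi> \<longleftrightarrow> smooth \<psi> \<and> (\<exists>K. compact K \<and> (\<forall>x. x \<notin> K \<longrightarrow> \<psi> x = 0))"

lemma test_fun_smooth: "test_fun \<psi> \<Longrightarrow> smooth \<psi>" by (simp add: test_fun_def)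

lemma test_fun_support:
  assumes "test_fun \<psi>"
  obtains K where "compact K" "\<And>x. x \<notin> K \<Longrightarrow> \<psi> x = 0" "\<And>x. x \<notin> K \<Longrightarrow> grad \<psi> x = 0"
proof -
  obtain K where K: "compact K" "\<And>x. x \<notin> K \<Longrightarrow> \<psi> x = 0" using assms by (auto simp: test_fun_def)
  have "grad \<psi> x = 0" if x: "x \<notin> K" for x
  proof (rule has_derivative_inner_imp_grad)
    have "open (- K)" using K(1) by (simp add: compact_imp_closed open_Compl)
    then have "(\<psi> has_derivative (\<lambda>h. 0)) (at x)"
      by (rule has_derivative_transform_within_open[OF has_derivative_const[of 0]]) (use x K in auto)
    then show "(\<psi> has_derivative (\<lambda>h. 0 \<bullet> h)) (at x)" by simp
  qed
  with K that show ?thesis by blast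
qed

lemma continuous_compact_L2:
  fixes f :: "'b::euclidean_space \<Rightarrow> 'c::euclidean_space"
  assumes f: "continuous_on UNIV f" and K: "compact K" "\<And>x. x \<notin> K \<Longrightarrow> f x = 0"
  shows "f \<in> L2 lborel"
proof (rule L2_I)
  show [measurable]: "f \<in> borel_measurable lborel" using f by (simp add: borel_measurable_continuous_onI)
  have "integrable lborel (\<lambda>x. indicator K x *\<^sub>R (norm (f x))^2)"
    by (rule borel_integrable_compact[OF K(1)]) (intro continuous_intros continuous_on_subset[OF f], simp)
  also have "(\<lambda>x. indicator K x *\<^sub>R (norm (f x))^2) = (\<lambda>x. (norm (f x))^2)"
  proof (rule ext)
    fix x show "indicator K x *\<^sub>R (norm (f x))^2 = (norm (f x))^2" by (cases "x \<in> K") (auto simp: K(2))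
  qed
  finally show "integrable lborel (\<lambda>x. (norm (f x))^2)" .
qed

lemma test_fun_L2:
  assumes "test_fun \<psi>" shows "\<psi> \<in> L2 lborel" "grad \<psi> \<in> L2 lborel"
  using test_fun_support[OF assms] continuous_compact_L2 smooth_continuous[of \<psi> UNIV]
    smooth_continuous[OF smooth_grad, of \<psi> UNIV] test_fun_smooth[OF assms] by metis+

lemma test_fun_add:
  assumes "test_fun f" "test_fun g" shows "test_fun (\<lambda>x. f x + g x)"
proof -
  obtain K K' where K: "compact K" "\<forall>x. x \<notin> K \<longrightarrow> f x = 0" and K': "compact K'" "\<forall>x. x \<notin> K' \<longrightarrow> g x = 0"
    using assms unfolding test_fun_def by blast
  have "compact (K \<union> K')" using K K' by (intro compact_Un)
  moreover have "\<forall>x. x \<notin> K \<union> K' \<longrightarrow> f x + g x = 0" using K K' by simp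
  moreover have "smooth (\<lambda>x. f x + g x)" using assms by (intro smooth_add test_fun_smooth)
  ultimately show ?thesis unfolding test_fun_def by blast
qed

lemma test_fun_cmult:
  assumes "test_fun f" shows "test_fun (\<lambda>x. c * f x)"
proof -
  obtain K where K: "compact K" "\<And>x. x \<notin> K \<Longrightarrow> f x = 0" using assms by (auto simp: test_fun_def)
  then show ?thesis using smooth_mult[OF smooth_const[of c] test_fun_smooth[OF assms]]
    unfolding test_fun_def by (intro conjI exI[of _ K]) auto
qed

lemma nn_integral_Icc:
  fixes f :: "real \<Rightarrow> real"
  assumes f: "continuous_on {a..b} f" and nonneg: "\<And>x. x \<in> {a..b} \<Longrightarrow> 0 \<le> f x"
  shows "(NN x. ennreal (f x) * indicator {a..b} x) = ennreal (integral {a..b} f)"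
proof -
  have int: "(f has_integral integral {a..b} f) {a..b}"
    using integrable_continuous_real[OF f] by (rule integrable_integral)
  have "(\<lambda>x. indicator {a..b} x *\<^sub>R f x) \<in> borel_measurable borel"
    by (rule borel_measurable_continuous_on_indicator[OF _ f]) simp
  then have m: "(\<lambda>x. f x * indicator {a..b} x) \<in> borel_measurable borel" by (simp add: mult.commute)
  have "((\<lambda>x. f x * indicator {a..b} x) has_integral integral {a..b} f) UNIV"
  proof -
    have "(\<lambda>x. f x * indicator {a..b} x) = (\<lambda>x. if x \<in> {a..b} then f x else 0)"
      by (auto simp: indicator_def)
    with int show ?thesis by (simp only: has_integral_restrict_UNIV)
  qed
  then have "(NN x. ennreal (f x * indicator {a..b} x)) = ennreal (integral {a..b} f)"
    by (intro nn_integral_has_integral_lborel[OF m]) (auto simp: indicator_def nonneg)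
  then show ?thesis by (simp add: nn_integral_set_ennreal)
qed

lemma nn_integral_translate:
  fixes G :: "'b::euclidean_space \<Rightarrow> ennreal"
  assumes [measurable]: "G \<in> borel_measurable borel"
  shows "(NN x. G (x + y)) = (NN x. G x)"
proof -
  have "(NN x. G x) = (\<integral>\<^sup>+x. G x \<partial>distr lborel borel ((+) y))" by (simp only: lborel_distr_plus)
  also have "\<dots> = (NN x. G (x + y))" by (subst nn_integral_distr) (auto simp: add.commute)
  finally show ?thesis ..
qed

text \<open>
  The increment is the integral of the directional derivative along the segment, and the square of a mean
  is at most the mean of the squares.
\<close>

lemma smooth_increment_le:
  fixes \<psi> :: "'b::euclidean_space \<Rightarrow> real"
  assumes \<psi>: "smooth \<psi>"
  shows "ennreal ((\<psi> (x + y) - \<psi> x)^2)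
    \<le> (NN t. ennreal ((norm y)^2 * (norm (grad \<psi> (x + t *\<^sub>R y)))^2) * indicator {0..1} t)"
proof -
  define g where "g t = grad \<psi> (x + t *\<^sub>R y) \<bullet> y" for t
  define c where "c = \<psi> (x + y) - \<psi> x"
  have gc: "continuous_on S (\<lambda>t. grad \<psi> (x + t *\<^sub>R y))" for S
    by (rule continuous_on_compose2[OF smooth_continuous[OF smooth_grad[OF \<psi>], of UNIV]])
       (auto intro!: continuous_intros)
  have g_cont: "continuous_on {0..1} g" unfolding g_def by (intro continuous_intros gc)
  have g: "(g has_integral c) {0..1}"
  proof -
    have "((\<lambda>t. \<psi> (x + t *\<^sub>R y)) has_vector_derivative g t) (at t within {0..1})" for t
    proof -
      have "((\<lambda>t. x + t *\<^sub>R y) has_derivative (\<lambda>h. h *\<^sub>R y)) (at t)" by (auto intro!: derivative_eq_intros)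
      from diff_chain_at[OF this smooth_grad_has_derivative[OF \<psi>]]
      have "((\<lambda>t. \<psi> (x + t *\<^sub>R y)) has_vector_derivative g t) (at t)"
        by (simp add: has_vector_derivative_def o_def g_def)
      then show ?thesis by (rule has_vector_derivative_at_within)
    qed
    from fundamental_theorem_of_calculus[of 0 1 "\<lambda>t. \<psi> (x + t *\<^sub>R y)" g] this
    show ?thesis by (simp add: c_def)
  qed
  \<comment> \<open>Expanding \<open>(g - c)\<^sup>2\<close>, where \<open>c\<close> is the mean of \<open>g\<close>.\<close>
  have g2: "c^2 \<le> integral {0..1} (\<lambda>t. (g t)^2)"
  proof -
    have 1: "(\<lambda>t. (g t)^2) integrable_on {0..1}" by (intro integrable_continuous_real continuous_intros g_cont)
    have "((\<lambda>t. (g t)^2 - (2 * c) * g t + c^2) has_integral (integral {0..1} (\<lambda>t. (g t)^2) - (2 * c) * c + c^2)) {0..1}"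
      using has_integral_add[OF has_integral_diff[OF integrable_integral[OF 1] has_integral_mult_right[OF g, of "2 * c"]]
          has_integral_const_real[of "c^2" 0 1]] by simp
    moreover have "0 \<le> (g t)^2 - (2 * c) * g t + c^2" for t
      using zero_le_power2[of "g t - c"] by (simp add: power2_diff mult_ac)
    ultimately have "0 \<le> integral {0..1} (\<lambda>t. (g t)^2) - (2 * c) * c + c^2" by (rule has_integral_nonneg)
    then show ?thesis by (simp add: power2_eq_square)
  qed
  also have "\<dots> \<le> integral {0..1} (\<lambda>t. (norm y)^2 * (norm (grad \<psi> (x + t *\<^sub>R y)))^2)"
  proof (rule integral_le)
    show "(g t)^2 \<le> (norm y)^2 * (norm (grad \<psi> (x + t *\<^sub>R y)))^2" for t
      unfolding g_def using Cauchy_Schwarz_ineq[of "grad \<psi> (x + t *\<^sub>R y)" y] by (simp add: power2_norm_eq_inner mult.commute)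
  qed (intro integrable_continuous_real continuous_intros g_cont gc)+
  finally show ?thesis
    by (subst nn_integral_Icc) (auto intro!: continuous_intros gc simp: c_def ennreal_leI)
qed

lemma translation_estimate:
  assumes \<psi>: "smooth \<psi>"
  shows "(NN x. ennreal ((\<psi> (x + y) - \<psi> x)^2))
    \<le> ennreal ((norm y)^2) * (NN x. ennreal ((norm (grad \<psi> x))^2))"
proof -
  have [measurable]: "grad \<psi> \<in> borel_measurable borel"
    by (intro borel_measurable_continuous_onI smooth_continuous smooth_grad \<psi>)
  have "(NN x. ennreal ((\<psi> (x + y) - \<psi> x)^2))
      \<le> (NN x. (NN t. ennreal ((norm y)^2 * (norm (grad \<psi> (x + t *\<^sub>R y)))^2) * indicator {0..1} t))"
    by (intro nn_integral_mono smooth_increment_le \<psi>)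
  also have "\<dots> = (NN t. (NN x. ennreal ((norm y)^2 * (norm (grad \<psi> (x + t *\<^sub>R y)))^2) * indicator {0..1} t))"
    by (rule lborel_pair.Fubini') measurable
  also have "\<dots> = (NN t. ennreal ((norm y)^2) * (NN x. ennreal ((norm (grad \<psi> x))^2)) * indicator {0..1} (t::real))"
  proof (rule nn_integral_cong)
    fix t :: real
    have "(NN x. ennreal ((norm y)^2 * (norm (grad \<psi> (x + t *\<^sub>R y)))^2) * indicator {0..1} t)
       = (NN x. ennreal ((norm y)^2 * (norm (grad \<psi> x))^2) * indicator {0..1} t)"
      by (rule nn_integral_translate[of "\<lambda>x. ennreal ((norm y)^2 * (norm (grad \<psi> x))^2) * indicator {0..1} t"]) measurable
    also have "\<dots> = (NN x. ennreal ((norm y)^2) * ennreal ((norm (grad \<psi> x))^2) * indicator {0..1} t)"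
      by (simp add: ennreal_mult)
    also have "\<dots> = ennreal ((norm y)^2) * (NN x. ennreal ((norm (grad \<psi> x))^2)) * indicator {0..1} t"
      by (simp add: nn_integral_multc nn_integral_cmult)
    finally show "(NN x. ennreal ((norm y)^2 * (norm (grad \<psi> (x + t *\<^sub>R y)))^2) * indicator {0..1} t)
       = ennreal ((norm y)^2) * (NN x. ennreal ((norm (grad \<psi> x))^2)) * indicator {0..1} t" .
  qed
  also have "\<dots> = ennreal ((norm y)^2) * (NN x. ennreal ((norm (grad \<psi> x))^2))"
    by (subst nn_integral_cmult) auto
  finally show ?thesis .
qed

definition ball_average :: "real \<Rightarrow> ('b::euclidean_space \<Rightarrow> real) \<Rightarrow> 'b \<Rightarrow> real" where
  "ball_average h \<psi> x = (\<integral>z. \<psi> (x + z) \<partial>uniform_measure lborel (ball 0 h))"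

lemma nn_integral_uniform_ball:
  fixes f :: "'b::euclidean_space \<Rightarrow> ennreal"
  assumes [measurable]: "f \<in> borel_measurable borel"
  shows "(\<integral>\<^sup>+z. f z \<partial>uniform_measure lborel (ball 0 h))
    = (NN z. f z * indicator (ball 0 h) z) / emeasure lborel (ball (0::'b) h)"
  by (rule nn_integral_uniform_measure) auto

text \<open>
  Jensen's inequality for the square, with the mean over a ball.
\<close>

lemma ball_jensen:
  fixes f :: "'b::euclidean_space \<Rightarrow> real"
  assumes f: "continuous_on UNIV f" and h: "h > 0"
  defines "\<nu> \<equiv> uniform_measure lborel (ball (0::'b) h)"
  shows "integrable \<nu> f" and "ennreal ((\<integral>z. f z \<partial>\<nu>)^2) \<le> (\<integral>\<^sup>+z. ennreal ((f z)^2) \<partial>\<nu>)"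
proof -
  have vol: "emeasure lborel (ball (0::'b) h) \<noteq> 0" "emeasure lborel (ball (0::'b) h) < top"
    using h by (auto simp: emeasure_ball ennreal_eq_0_iff not_le)
  interpret prob_like: finite_measure \<nu>
    unfolding \<nu>_def
    by (rule finite_measureI) (use vol in simp)
  have total: "measure \<nu> (space \<nu>) = 1"
    unfolding \<nu>_def measure_def using vol by simp
  have ae: "AE z in \<nu>. z \<in> ball 0 h"
    unfolding \<nu>_def by (subst AE_uniform_measure) (use vol in auto)
  have [measurable]: "f \<in> borel_measurable \<nu>"
    using borel_measurable_continuous_onI[OF f] by (simp add: \<nu>_def cong: measurable_cong_sets)
  have "bounded (f ` cball 0 h)"
    by (intro compact_imp_bounded compact_continuous_image continuous_on_subset[OF f]) auto
  then obtain B where "\<forall>y\<in>f ` cball 0 h. norm y \<le> B" unfolding bounded_iff by blast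
  then have B: "\<bar>f z\<bar> \<le> B" if "z \<in> cball 0 h" for z using that by auto
  show int: "integrable \<nu> f"
  proof (rule prob_like.integrable_const_bound[of _ B])
    show "AE z in \<nu>. norm (f z) \<le> B"
      using ae by eventually_elim (use B in simp)
  qed measurable
  have int2: "integrable \<nu> (\<lambda>z. (f z)^2)"
  proof (rule prob_like.integrable_const_bound[of _ "B^2"])
    show "AE z in \<nu>. norm ((f z)^2) \<le> B^2"
      using ae
    proof eventually_elim
      case (elim z)
      then have "\<bar>f z\<bar>^2 \<le> B^2" by (intro power_mono B) auto
      then show ?case by simp
    qed
  qed measurable
  define c where "c = (\<integral>z. f z \<partial>\<nu>)"
  have "0 \<le> (\<integral>z. (f z - c)^2 \<partial>\<nu>)" by simp
  also have "\<dots> = (\<integral>z. (f z)^2 - 2 * c * f z + c^2 \<partial>\<nu>)"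
    by (rule Bochner_Integration.integral_cong) (simp_all add: power2_diff)
  also have "\<dots> = (\<integral>z. (f z)^2 \<partial>\<nu>) - 2 * c * c + c^2"
    using int int2 total by (simp add: c_def)
  finally have "c^2 \<le> (\<integral>z. (f z)^2 \<partial>\<nu>)" by (simp add: power2_eq_square)
  then have "ennreal (c^2) \<le> ennreal (\<integral>z. (f z)^2 \<partial>\<nu>)" by (rule ennreal_leI)
  also have "\<dots> = (\<integral>\<^sup>+z. ennreal ((f z)^2) \<partial>\<nu>)"
    using int2 by (intro nn_integral_eq_integral[symmetric]) auto
  finally show "ennreal ((\<integral>z. f z \<partial>\<nu>)^2) \<le> (\<integral>\<^sup>+z. ennreal ((f z)^2) \<partial>\<nu>)" by (simp add: c_def)
qed

lemma ball_average_diff: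
  assumes "continuous_on UNIV f" "continuous_on UNIV g" "h > 0"
  shows "ball_average h (\<lambda>x. f x - g x) x = ball_average h f x - ball_average h g x"
  unfolding ball_average_def
  by (rule Bochner_Integration.integral_diff)
     (intro ball_jensen(1) assms continuous_on_compose2[OF assms(1)] continuous_on_compose2[OF assms(2)] continuous_intros; simp)+

lemma nn_integral_uniform_ball_le:
  fixes f :: "'b::euclidean_space \<Rightarrow> ennreal"
  assumes "f \<in> borel_measurable borel"
  shows "(\<integral>\<^sup>+z. f z \<partial>uniform_measure lborel (ball 0 h)) \<le> (NN z. f z) / emeasure lborel (ball (0::'b) h)"
  unfolding nn_integral_uniform_ball[OF assms]
  by (intro divide_right_mono_ennreal nn_integral_mono) (simp add: indicator_def)

lemma ball_average_le:
  fixes \<psi> :: "'b::euclidean_space \<Rightarrow> real"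
  assumes \<psi>: "continuous_on UNIV \<psi>" and h: "h > 0"
  shows "ennreal ((ball_average h \<psi> x)^2)
    \<le> (NN z. ennreal ((\<psi> z)^2)) / emeasure lborel (ball (0::'b) h)"
proof -
  have [measurable]: "\<psi> \<in> borel_measurable borel" using \<psi> by (rule borel_measurable_continuous_onI)
  have c: "continuous_on UNIV (\<lambda>z. \<psi> (x + z))"
    by (rule continuous_on_compose2[OF \<psi>]) (auto intro!: continuous_intros)
  have "ennreal ((ball_average h \<psi> x)^2) \<le> (\<integral>\<^sup>+z. ennreal ((\<psi> (x + z))^2) \<partial>uniform_measure lborel (ball 0 h))"
    unfolding ball_average_def by (rule ball_jensen(2)[OF c h])
  also have "\<dots> \<le> (NN z. ennreal ((\<psi> (x + z))^2)) / emeasure lborel (ball (0::'b) h)"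
    by (rule nn_integral_uniform_ball_le) measurable
  also have "(NN z. ennreal ((\<psi> (x + z))^2)) = (NN z. ennreal ((\<psi> z)^2))"
    using nn_integral_translate[of "\<lambda>z. ennreal ((\<psi> z)^2)" x] by (simp add: add.commute)
  finally show ?thesis .
qed

lemma ball_average_oscillation:
  fixes \<psi> :: "'b::euclidean_space \<Rightarrow> real"
  assumes \<psi>: "smooth \<psi>" and h: "h > 0"
  shows "ennreal ((ball_average h \<psi> x - ball_average h \<psi> y)^2)
    \<le> ennreal ((norm (x - y))^2) * (NN z. ennreal ((norm (grad \<psi> z))^2)) / emeasure lborel (ball (0::'b) h)"
proof -
  have c: "continuous_on UNIV \<psi>" using \<psi> by (rule smooth_continuous)
  have ct: "continuous_on UNIV (\<lambda>z. \<psi> (a + z))" for a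
    by (rule continuous_on_compose2[OF c]) (auto intro!: continuous_intros)
  have eq: "ball_average h \<psi> x - ball_average h \<psi> y = ball_average h (\<lambda>z. \<psi> (z + (x - y)) - \<psi> z) y"
  proof -
    have "ball_average h \<psi> x = ball_average h (\<lambda>z. \<psi> (z + (x - y))) y"
      unfolding ball_average_def by (simp add: algebra_simps)
    moreover have "ball_average h (\<lambda>z. \<psi> (z + (x - y)) - \<psi> z) y
        = ball_average h (\<lambda>z. \<psi> (z + (x - y))) y - ball_average h \<psi> y"
      using ct[of "x - y"] by (intro ball_average_diff c h) (simp add: add.commute)
    ultimately show ?thesis by simp
  qed
  have "ennreal ((ball_average h \<psi> x - ball_average h \<psi> y)^2)
    \<le> (NN z. ennreal ((\<psi> (z + (x - y)) - \<psi> z)^2)) / emeasure lborel (ball (0::'b) h)"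
    unfolding eq using ct[of "x - y"] by (intro ball_average_le h continuous_intros c) (simp add: add.commute)
  also have "\<dots> \<le> ennreal ((norm (x - y))^2) * (NN z. ennreal ((norm (grad \<psi> z))^2)) / emeasure lborel (ball (0::'b) h)"
    by (intro divide_right_mono_ennreal translation_estimate \<psi>)
  finally show ?thesis .
qed

lemma ball_average_error:
  fixes \<psi> :: "'b::euclidean_space \<Rightarrow> real"
  assumes \<psi>: "smooth \<psi>" and h: "h > 0"
  shows "(NN x. ennreal ((ball_average h \<psi> x - \<psi> x)^2))
    \<le> ennreal (h^2) * (NN z. ennreal ((norm (grad \<psi> z))^2))"
proof -
  define \<nu> where "\<nu> = uniform_measure lborel (ball (0::'b) h)"
  define M where "M = (NN z. ennreal ((norm (grad \<psi> z))^2))"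
  have vol: "emeasure lborel (ball (0::'b) h) \<noteq> 0" "emeasure lborel (ball (0::'b) h) < top"
    using h by (auto simp: emeasure_ball ennreal_eq_0_iff not_le)
  interpret nu: finite_measure \<nu>
    unfolding \<nu>_def by (rule finite_measureI) (use vol in simp)
  interpret pair_sigma_finite \<nu> "lborel :: 'b measure" ..
  have total: "emeasure \<nu> (space \<nu>) = 1" unfolding \<nu>_def using vol by simp
  have c: "continuous_on UNIV \<psi>" using \<psi> by (rule smooth_continuous)
  have [measurable]: "\<psi> \<in> borel_measurable borel" using c by (rule borel_measurable_continuous_onI)
  have sets_nu [measurable_cong]: "sets \<nu> = sets borel" by (simp add: \<nu>_def)
  have ct: "continuous_on UNIV (\<lambda>z. \<psi> (a + z) - \<psi> a)" for a
    by (intro continuous_intros continuous_on_compose2[OF c]) auto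
  have eq: "ball_average h \<psi> x - \<psi> x = (\<integral>z. \<psi> (x + z) - \<psi> x \<partial>\<nu>)" for x
  proof -
    have 1: "integrable \<nu> (\<lambda>z. \<psi> (x + z))"
      unfolding \<nu>_def by (intro ball_jensen(1) h continuous_on_compose2[OF c]) (auto intro!: continuous_intros)
    have "(\<integral>z. \<psi> x \<partial>\<nu>) = \<psi> x" using total by (simp add: measure_def)
    then show ?thesis unfolding ball_average_def \<nu>_def[symmetric] using 1 by simp
  qed
  have "(NN x. ennreal ((ball_average h \<psi> x - \<psi> x)^2))
      \<le> (NN x. (\<integral>\<^sup>+z. ennreal ((\<psi> (x + z) - \<psi> x)^2) \<partial>\<nu>))"
    unfolding eq \<nu>_def by (intro nn_integral_mono ball_jensen(2) ct h)
  also have "\<dots> = (\<integral>\<^sup>+z. (NN x. ennreal ((\<psi> (x + z) - \<psi> x)^2)) \<partial>\<nu>)"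
    by (rule Fubini') measurable
  also have "\<dots> \<le> (\<integral>\<^sup>+z. ennreal (h^2) * M \<partial>\<nu>)"
  proof (rule nn_integral_mono_AE)
    have "AE z in \<nu>. z \<in> ball 0 h"
      unfolding \<nu>_def by (subst AE_uniform_measure) (use vol in auto)
    then show "AE z in \<nu>. (NN x. ennreal ((\<psi> (x + z) - \<psi> x)^2)) \<le> ennreal (h^2) * M"
    proof eventually_elim
      case (elim z)
      have "(NN x. ennreal ((\<psi> (x + z) - \<psi> x)^2)) \<le> ennreal ((norm z)^2) * M"
        unfolding M_def by (rule translation_estimate[OF \<psi>])
      also have "\<dots> \<le> ennreal (h^2) * M"
        using elim by (intro mult_right_mono ennreal_leI power_mono) auto
      finally show ?case .
    qed
  qed
  also have "\<dots> = ennreal (h^2) * M" using total by simp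
  finally show ?thesis by (simp add: M_def)
qed

text \<open>
  Rellich's compactness theorem. Replacing \<open>\<psi>\<close> by its averages over balls of radius \<open>h\<close> costs at
  most \<open>h |\<nabla>\<psi>|\<close> in the mean, and the averages of a bounded sequence are bounded and equicontinuous.
\<close>

lemma rellich_subsequence:
  fixes \<psi> :: "nat \<Rightarrow> 'b::euclidean_space \<Rightarrow> real"
  assumes sm: "\<And>n. smooth (\<psi> n)"
    and l2: "\<And>n. (NN x. ennreal ((\<psi> n x)^2)) \<le> ennreal M"
    and en: "\<And>n. (NN x. ennreal ((norm (grad (\<psi> n) x))^2)) \<le> ennreal M"
    and M: "M > 0" and e: "e > 0"
  shows "\<exists>r :: nat \<Rightarrow> nat. strict_mono r \<and>
    (\<forall>m n. (NN x. ennreal ((\<psi> (r m) x - \<psi> (r n) x)^2) * indicator (ball 0 R) x) \<le> ennreal e)"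
proof -
  \<comment> \<open>The two averaging errors and the difference of the averages contribute \<open>e/3\<close> each.\<close>
  define h where "h = sqrt (e / (12 * M))"
  have h: "h > 0" "h^2 = e / (12 * M)" using e M by (auto simp: h_def)
  define vol where "vol = measure lborel (ball (0::'b) h)"
  have vol_pos: "vol > 0" using h(1) by (simp add: vol_def content_ball)
  have vol_eq: "emeasure lborel (ball (0::'b) h) = ennreal vol"
    unfolding vol_def using h(1) by (simp add: content_ball emeasure_ball)
  define A where "A n = ball_average h (\<psi> n)" for n
  have A_bound: "norm (A n x) \<le> sqrt (M / vol)" for n x
  proof -
    have "ennreal ((A n x)^2) \<le> ennreal M / ennreal vol"
      unfolding A_def vol_eq[symmetric]
      by (rule order_trans[OF ball_average_le[OF smooth_continuous[OF sm] h(1)]]) (intro divide_right_mono_ennreal l2)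
    also have "\<dots> = ennreal (M / vol)" using M vol_pos by (intro divide_ennreal) auto
    finally have "(A n x)^2 \<le> M / vol" using M vol_pos by (subst (asm) ennreal_le_iff) auto
    then show ?thesis using real_le_rsqrt[of "\<bar>A n x\<bar>"] by simp
  qed
  have A_osc: "\<bar>A n x - A n y\<bar> \<le> norm (x - y) * sqrt (M / vol)" for n x y
  proof -
    have "ennreal ((A n x - A n y)^2) \<le> ennreal ((norm (x - y))^2) * ennreal M / ennreal vol"
      unfolding A_def vol_eq[symmetric]
      by (rule order_trans[OF ball_average_oscillation[OF sm h(1)]]) (intro divide_right_mono_ennreal mult_left_mono en, simp)
    also have "\<dots> = ennreal ((norm (x - y))^2 * M / vol)"
      using M vol_pos by (simp add: ennreal_mult[symmetric] divide_ennreal)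
    finally have "(A n x - A n y)^2 \<le> (norm (x - y))^2 * (M / vol)"
      using M vol_pos by (subst (asm) ennreal_le_iff) auto
    then have "\<bar>A n x - A n y\<bar> \<le> sqrt ((norm (x - y))^2 * (M / vol))" by (intro real_le_rsqrt) simp
    then show ?thesis by (simp only: real_sqrt_mult real_sqrt_abs abs_norm_cancel)
  qed
  have equi: "\<exists>d. 0 < d \<and> (\<forall>n y. y \<in> cball 0 R \<and> norm (x - y) < d \<longrightarrow> norm (A n x - A n y) < s)"
    if "s > 0" for x s
  proof (intro exI[of _ "s / (sqrt (M / vol) + 1)"] conjI allI impI)
    have p: "sqrt (M / vol) + 1 > 0" using M vol_pos by (simp add: add_nonneg_pos)
    then show "0 < s / (sqrt (M / vol) + 1)" using that by simp
    fix n y assume y: "y \<in> cball 0 R \<and> norm (x - y) < s / (sqrt (M / vol) + 1)"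
    have "norm (A n x - A n y) \<le> norm (x - y) * sqrt (M / vol)" using A_osc by simp
    also have "\<dots> \<le> norm (x - y) * (sqrt (M / vol) + 1)" by (intro mult_left_mono) auto
    also have "\<dots> < s" using y p by (simp add: pos_less_divide_eq)
    finally show "norm (A n x - A n y) < s" .
  qed
  obtain g k where k: "strict_mono (k :: nat \<Rightarrow> nat)"
    and lim: "\<And>s. 0 < s \<Longrightarrow> \<exists>N. \<forall>n x. n \<ge> N \<and> x \<in> cball (0::'b) R \<longrightarrow> norm (A (k n) x - g x) < s"
    using Arzela_Ascoli[of "cball (0::'b) R" A "sqrt (M / vol)"] A_bound equi by (metis compact_cball)
  define W where "W = measure lborel (ball (0::'b) R)"
  have W: "emeasure lborel (ball (0::'b) R) = ennreal W" "W \<ge> 0"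
    using emeasure_lborel_ball_finite[of "0::'b" R] by (simp_all add: W_def emeasure_eq_ennreal_measure less_top)
  define s where "s = sqrt (e / (24 * (W + 1)))"
  have s: "s > 0" "s^2 = e / (24 * (W + 1))" using e W by (auto simp: s_def)
  obtain N where N: "\<And>n x. n \<ge> N \<Longrightarrow> x \<in> cball 0 R \<Longrightarrow> norm (A (k n) x - g x) < s"
    using lim[OF s(1)] by blast
  define r where "r n = k (n + N)" for n
  have r: "strict_mono r" unfolding r_def using k by (auto simp: strict_mono_def)
  let ?e = "\<lambda>n x. (A (r n) x - \<psi> (r n) x)^2" and ?D = "\<lambda>m n x. ennreal ((\<psi> (r m) x - \<psi> (r n) x)^2)"
  let ?E = "\<lambda>n x. ennreal (?e n x)"
  have err: "(NN x. ennreal ((A n x - \<psi> n x)^2)) \<le> ennreal (e / 12)" for n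
  proof -
    have "(NN x. ennreal ((A n x - \<psi> n x)^2)) \<le> ennreal (h^2) * ennreal M"
      unfolding A_def
      by (rule order_trans[OF ball_average_error[OF sm h(1)]]) (intro mult_left_mono en, simp)
    also have "\<dots> = ennreal (e / 12)" using M e by (simp add: h(2) ennreal_mult[symmetric])
    finally show ?thesis .
  qed
  have "(NN x. ?D m n x * indicator (ball 0 R) x) \<le> ennreal e" for m n
  proof -
    have A_cont: "continuous_on UNIV (A n)" for n
    proof (rule continuous_onI)
      fix x :: 'b and s :: real assume "s > 0"
      have p: "sqrt (M / vol) + 1 > 0" using M vol_pos by (simp add: add_nonneg_pos)
      have "dist (A n y) (A n x) \<le> s" if "dist y x < s / (sqrt (M / vol) + 1)" for y
      proof -
        have "\<bar>A n y - A n x\<bar> \<le> norm (y - x) * (sqrt (M / vol) + 1)"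
          by (rule order_trans[OF A_osc]) (intro mult_left_mono, auto)
        also have "\<dots> \<le> s" using that p by (simp add: dist_norm pos_less_divide_eq)
        finally show ?thesis by (simp add: dist_real_def)
      qed
      then show "\<exists>d>0. \<forall>y\<in>UNIV. dist y x < d \<longrightarrow> dist (A n y) (A n x) \<le> s"
        using p \<open>s > 0\<close> by (intro exI[of _ "s / (sqrt (M / vol) + 1)"]) auto
    qed
    have [measurable]: "A n \<in> borel_measurable borel" for n
      by (rule borel_measurable_continuous_onI[OF A_cont])
    have [measurable]: "ball (0::'b) R \<in> sets borel" by simp
    have [measurable]: "\<psi> n \<in> borel_measurable borel" for n
      by (rule borel_measurable_continuous_onI[OF smooth_continuous[OF sm]])
    have pw: "(\<psi> (r m) x - \<psi> (r n) x)^2 \<le> 4 * ?e m x + 4 * ?e n x + 8 * s^2"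
      if x: "x \<in> ball 0 R" for x
    proof -
      have "\<bar>A (r m) x - A (r n) x\<bar> \<le> 2 * s"
        using N[of "m + N" x] N[of "n + N" x] x unfolding r_def by (auto simp: less_imp_le)
      then have "(A (r m) x - A (r n) x)^2 \<le> (2 * s)^2" using s(1) by (intro abs_le_square_iff[THEN iffD1]) auto
      then have 1: "(A (r m) x - A (r n) x)^2 \<le> 4 * s^2" by (simp add: power_mult_distrib)
      define a b c where "a = A (r m) x - \<psi> (r m) x" and "b = A (r n) x - \<psi> (r n) x" and "c = A (r m) x - A (r n) x"
      have "\<psi> (r m) x - \<psi> (r n) x = c + (b - a)" by (simp add: a_def b_def c_def)
      then have "(\<psi> (r m) x - \<psi> (r n) x)^2 = (c + (b - a))^2" by simp
      also have "\<dots> \<le> 2 * c^2 + 2 * (b - a)^2" using norm_add_power2_le[of c "b - a"] by simp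
      also have "(b - a)^2 \<le> 2 * b^2 + 2 * a^2" using norm_add_power2_le[of b "- a"] by simp
      finally show ?thesis using 1 by (simp add: a_def b_def c_def)
    qed
    have "(NN x. ?D m n x * indicator (ball 0 R) x)
        \<le> (NN x. ennreal 4 * ?E m x + ennreal 4 * ?E n x
             + ennreal (8 * s^2) * indicator (ball 0 R) x)"
    proof (rule nn_integral_mono)
      fix x
      show "?D m n x * indicator (ball 0 R) x
          \<le> ennreal 4 * ?E m x + ennreal 4 * ?E n x
             + ennreal (8 * s^2) * indicator (ball 0 R) x"
      proof (cases "x \<in> ball 0 R")
        case True
        have "?D m n x \<le> ennreal (4 * ?e m x + 4 * ?e n x + 8 * s^2)"
          by (rule ennreal_leI[OF pw[OF True]])
        also have "\<dots> = ennreal (4 * ?e m x) + ennreal (4 * ?e n x) + ennreal (8 * s^2)"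
          by (simp only: ennreal_plus zero_le_power2 mult_nonneg_nonneg add_nonneg_nonneg zero_le_numeral)
        also have "\<dots> = ennreal 4 * ?E m x + ennreal 4 * ?E n x + ennreal (8 * s^2)"
          by (simp only: ennreal_mult zero_le_power2 zero_le_numeral)
        finally show ?thesis using True by simp
      qed simp
    qed
    also have "\<dots> = ennreal 4 * (NN x. ?E m x)
        + ennreal 4 * (NN x. ?E n x) + ennreal (8 * s^2) * ennreal W"
      unfolding W(1)[symmetric]
      by (subst nn_integral_add, measurable, subst nn_integral_add, measurable)
         (simp add: nn_integral_cmult nn_integral_cmult_indicator)
    also have "\<dots> \<le> ennreal 4 * ennreal (e / 12) + ennreal 4 * ennreal (e / 12) + ennreal (8 * s^2) * ennreal W"
      by (intro add_mono mult_left_mono err) auto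
    also have "\<dots> = ennreal (4 * (e / 12) + 4 * (e / 12) + 8 * s^2 * W)"
      using e W(2)
      by (simp only: ennreal_mult ennreal_plus add_nonneg_nonneg mult_nonneg_nonneg zero_le_power2 zero_le_numeral
            zero_le_divide_iff less_imp_le simp_thms)
    also have "\<dots> \<le> ennreal e"
    proof (rule ennreal_leI)
      have "8 * s^2 * W = (e / 3) * (W / (W + 1))" unfolding s(2) using W(2) by (simp add: divide_simps)
      also have "\<dots> \<le> (e / 3) * 1" using W(2) e by (intro mult_left_mono) auto
      finally show "4 * (e / 12) + 4 * (e / 12) + 8 * s^2 * W \<le> e" by simp
    qed
    finally show ?thesis .
  qed
  with r show ?thesis by blast
qed

text \<open>
  The estimate holds on a subsequence for each tolerance; a diagonal sequence serves all tolerances at once.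
\<close>

lemma rellich:
  fixes \<psi> :: "nat \<Rightarrow> 'b::euclidean_space \<Rightarrow> real"
  assumes sm: "\<And>n. smooth (\<psi> n)"
    and l2: "\<And>n. (NN x. ennreal ((\<psi> n x)^2)) \<le> ennreal M"
    and en: "\<And>n. (NN x. ennreal ((norm (grad (\<psi> n) x))^2)) \<le> ennreal M"
    and M: "M > 0"
  obtains r :: "nat \<Rightarrow> nat" where "strict_mono r"
    "\<And>e. e > 0 \<Longrightarrow> \<exists>N. \<forall>m\<ge>N. \<forall>n\<ge>N.
        (NN x. ennreal ((\<psi> (r m) x - \<psi> (r n) x)^2) * indicator (ball 0 R) x) \<le> ennreal e"
proof -
  define P where "P k s \<longleftrightarrow> (\<forall>m n. (NN x. ennreal ((\<psi> (s m) x - \<psi> (s n) x)^2) * indicator (ball 0 R) x)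
      \<le> ennreal (1 / real (Suc k)))" for k :: nat and s :: "nat \<Rightarrow> nat"
  have P_D: "(NN x. ennreal ((\<psi> (s m) x - \<psi> (s n) x)^2) * indicator (ball 0 R) x)
      \<le> ennreal (1 / real (Suc k))" if "P k s" for k s m n
    using that by (simp add: P_def)
  interpret subseqs P
  proof
    fix k and s :: "nat \<Rightarrow> nat" assume "strict_mono s"
    have "\<exists>r :: nat \<Rightarrow> nat. strict_mono r \<and> (\<forall>m n. (NN x. ennreal ((\<psi> (s (r m)) x - \<psi> (s (r n)) x)^2) * indicator (ball 0 R) x)
      \<le> ennreal (1 / real (Suc k)))"
    proof (rule rellich_subsequence[of "\<lambda>n. \<psi> (s n)"])
      show "smooth (\<psi> (s n))" for n by (rule sm)
      show "(NN x. ennreal ((\<psi> (s n) x)^2)) \<le> ennreal M" for n by (rule l2)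
      show "(NN x. ennreal ((norm (grad (\<psi> (s n)) x))^2)) \<le> ennreal M" for n by (rule en)
    qed (use M in auto)
    then show "\<exists>r'. strict_mono r' \<and> P k (s \<circ> r')" unfolding P_def by (simp add: o_def)
  qed
  have hold: "P k (diagseq \<circ> ((+) (Suc k)))" for k
    by (rule diagseq_holds) (auto simp: P_def)
  show ?thesis
  proof (rule that[OF subseq_diagseq])
    fix e :: real assume e: "e > 0"
    obtain k where k: "1 / real (Suc k) < e" using nat_approx_posE[OF e] by metis
    show "\<exists>N. \<forall>m\<ge>N. \<forall>n\<ge>N. (NN x. ennreal ((\<psi> (diagseq m) x - \<psi> (diagseq n) x)^2) * indicator (ball 0 R) x) \<le> ennreal e"
    proof (intro exI[of _ "Suc k"] allI impI)
      fix m n assume "m \<ge> Suc k" "n \<ge> Suc k"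
      then have mn: "Suc k + (m - Suc k) = m" "Suc k + (n - Suc k) = n" by auto
      have "(NN x. ennreal ((\<psi> (diagseq m) x - \<psi> (diagseq n) x)^2) * indicator (ball 0 R) x) \<le> ennreal (1 / real (Suc k))"
        using P_D[OF hold[of k], of "m - Suc k" "n - Suc k"] by (simp only: o_def mn)
      also have "\<dots> \<le> ennreal e" using k by (intro ennreal_leI) simp
      finally show "(NN x. ennreal ((\<psi> (diagseq m) x - \<psi> (diagseq n) x)^2) * indicator (ball 0 R) x) \<le> ennreal e" .
    qed
  qed
qed


section \<open>The ground state of a bounded potential well\<close>

lemma H1_obtain:
  assumes "H1 u g"
  obtains \<psi> where "\<And>n. test_fun (\<psi> n)" "L2_limit lborel \<psi> u" "L2_limit lborel (\<lambda>n. grad (\<psi> n)) g"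
proof -
  obtain \<psi> G where *: "\<forall>n. smooth (\<psi> n) \<and> (\<exists>K. compact K \<and> (\<forall>x. x \<notin> K \<longrightarrow> \<psi> n x = 0))"
    "\<forall>n x. GDERIV (\<psi> n) x :> G n x" "L2_limit lborel \<psi> u" "L2_limit lborel G g"
    using assms unfolding H1_def by blast
  have "G = (\<lambda>n. grad (\<psi> n))" using *(2) grad_eq by (metis ext)
  with * show ?thesis by (intro that[of \<psi>]) (auto simp: test_fun_def)
qed

lemma H1_intro:
  assumes "\<And>n. test_fun (\<psi> n)" "L2_limit lborel \<psi> u" "L2_limit lborel (\<lambda>n. grad (\<psi> n)) g"
  shows "H1 u g"
  unfolding H1_def using assms smooth_GDERIV
  by (intro exI[of _ \<psi>] exI[of _ "\<lambda>n. grad (\<psi> n)"]) (auto simp: test_fun_def)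

lemma H1_L2: assumes "H1 u g" shows "u \<in> L2 lborel" "g \<in> L2 lborel"
  using assms by (auto elim!: H1_obtain dest: L2_limitD(1))

lemma test_fun_lincomb:
  assumes "test_fun f" "test_fun g"
  shows "test_fun (\<lambda>x. f x + t * g x)" "grad (\<lambda>x. f x + t * g x) = (\<lambda>x. grad f x + t *\<^sub>R grad g x)"
proof -
  show "test_fun (\<lambda>x. f x + t * g x)" by (intro test_fun_add test_fun_cmult assms)
  show "grad (\<lambda>x. f x + t * g x) = (\<lambda>x. grad f x + t *\<^sub>R grad g x)"
    using assms by (intro ext, subst grad_add) (auto simp: grad_cmult test_fun_cmult test_fun_smooth)
qed

lemma H1_add_scaled:
  assumes "H1 u g" "H1 v h"
  shows "H1 (\<lambda>x. u x + t * v x) (\<lambda>x. g x + t *\<^sub>R h x)"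
proof -
  obtain \<psi> where \<psi>: "\<And>n. test_fun (\<psi> n)" "L2_limit lborel \<psi> u" "L2_limit lborel (\<lambda>n. grad (\<psi> n)) g"
    using H1_obtain[OF assms(1)] by metis
  obtain \<xi> where \<xi>: "\<And>n. test_fun (\<xi> n)" "L2_limit lborel \<xi> v" "L2_limit lborel (\<lambda>n. grad (\<xi> n)) h"
    using H1_obtain[OF assms(2)] by metis
  show ?thesis
    using L2_limit_add[OF \<psi>(2) L2_limit_scaleR[OF \<xi>(2), of t]] L2_limit_add[OF \<psi>(3) L2_limit_scaleR[OF \<xi>(3), of t]]
    by (intro H1_intro[of "\<lambda>n x. \<psi> n x + t * \<xi> n x"] test_fun_lincomb \<psi> \<xi>)
       (simp_all add: test_fun_lincomb(2)[OF \<psi>(1) \<xi>(1)])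
qed

lemma quadratic_nonneg_imp_linear_zero:
  fixes b c :: real
  assumes "\<And>t. 0 \<le> 2 * t * b + t^2 * c" shows "b = 0"
proof -
  define f where "f t = 2 * t * b + t^2 * c" for t
  have "(f has_real_derivative 2 * b) (at 0)" unfolding f_def by (auto intro!: derivative_eq_intros)
  moreover have "\<forall>t. \<bar>0 - t\<bar> < 1 \<longrightarrow> f 0 \<le> f t" using assms by (simp add: f_def)
  ultimately have "2 * b = 0" by (intro DERIV_local_min[of f _ 0 1]) auto
  then show ?thesis by simp
qed

locale potential_well =
  fixes \<phi> :: "'b::euclidean_space \<Rightarrow> real" and B R :: real
  assumes \<phi>_borel [measurable]: "\<phi> \<in> borel_measurable borel"
    and \<phi>_nonneg: "\<And>x. 0 \<le> \<phi> x" and \<phi>_le: "\<And>x. \<phi> x \<le> B"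
    and \<phi>_support: "\<And>x. x \<notin> ball 0 R \<Longrightarrow> \<phi> x = 0"
begin

lemma B_nonneg: "0 \<le> B"
  using \<phi>_nonneg[of 0] \<phi>_le[of 0] by simp

lemma weight_L2: assumes "u \<in> L2 lborel" shows "(\<lambda>x. sqrt (\<phi> x) * u x) \<in> L2 lborel"
proof (rule L2_I)
  have [measurable]: "u \<in> borel_measurable borel" using L2_measurable[OF assms] by simp
  show "(\<lambda>x. sqrt (\<phi> x) * u x) \<in> borel_measurable lborel" by measurable
  show "integrable lborel (\<lambda>x. (norm (sqrt (\<phi> x) * u x))^2)"
  proof (rule Bochner_Integration.integrable_bound)
    show "integrable lborel (\<lambda>x. B * (norm (u x))^2)" by (intro integrable_mult_right L2_integrable assms)
    show "AE x in lborel. norm ((norm (sqrt (\<phi> x) * u x))^2) \<le> norm (B * (norm (u x))^2)"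
      using \<phi>_nonneg \<phi>_le B_nonneg by (intro AE_I2) (auto simp: power_mult_distrib intro!: mult_right_mono)
  qed measurable
qed

lemma weight_norm: "(norm (sqrt (\<phi> x) * u))^2 = \<phi> x * u^2"
  using \<phi>_nonneg[of x] by (simp add: power_mult_distrib)

lemma pot_integrable: "u \<in> L2 lborel \<Longrightarrow> integrable lborel (\<lambda>x. \<phi> x * (u x)^2)"
  using L2_integrable[OF weight_L2] unfolding weight_norm .

lemma pot_integrable2:
  assumes "u \<in> L2 lborel" "v \<in> L2 lborel" shows "integrable lborel (\<lambda>x. \<phi> x * u x * v x)"
proof -
  have eq: "(sqrt (\<phi> x) * u x) * (sqrt (\<phi> x) * v x) = \<phi> x * u x * v x" for x
  proof -
    have "(sqrt (\<phi> x) * u x) * (sqrt (\<phi> x) * v x) = (sqrt (\<phi> x) * sqrt (\<phi> x)) * u x * v x" by (simp only: mult_ac)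
    then show ?thesis using \<phi>_nonneg[of x] by simp
  qed
  show ?thesis using L2_mult_integrable[OF weight_L2[OF assms(1)] weight_L2[OF assms(2)]] unfolding eq .
qed

lemma pot_limit:
  assumes "L2_limit lborel F f" shows "(\<lambda>n. \<integral>x. \<phi> x * (F n x)^2 \<partial>lborel) \<longlonglongrightarrow> (LBINT x. \<phi> x * (f x)^2)"
proof -
  note L = L2_limitD[OF assms]
  have "(\<lambda>n. sqnorm lborel (\<lambda>x. sqrt (\<phi> x) * F n x - sqrt (\<phi> x) * f x)) \<longlonglongrightarrow> 0"
  proof (rule tendsto_sandwich[OF _ _ tendsto_const])
    show "(\<lambda>n. B * sqnorm lborel (\<lambda>x. F n x - f x)) \<longlonglongrightarrow> 0"
      using tendsto_mult[OF tendsto_const[of B] L(3)] by simp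
    have "sqnorm lborel (\<lambda>x. sqrt (\<phi> x) * F n x - sqrt (\<phi> x) * f x) \<le> (LBINT x. B * (norm (F n x - f x))^2)" for n
      unfolding right_diff_distrib[symmetric]
    proof (rule integral_mono)
      show "integrable lborel (\<lambda>x. (norm (sqrt (\<phi> x) * (F n x - f x)))^2)"
        by (rule L2_integrable[OF weight_L2[OF L2_diff[OF L(2) L(1)]]])
      show "integrable lborel (\<lambda>x. B * (norm (F n x - f x))^2)"
        by (intro integrable_mult_right L2_integrable L2_diff L)
      show "(norm (sqrt (\<phi> x) * (F n x - f x)))^2 \<le> B * (norm (F n x - f x))^2" for x
        unfolding weight_norm using \<phi>_le by (simp add: mult_right_mono)
    qed
    then show "\<forall>\<^sub>F n in sequentially. sqnorm lborel (\<lambda>x. sqrt (\<phi> x) * F n x - sqrt (\<phi> x) * f x)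
        \<le> B * sqnorm lborel (\<lambda>x. F n x - f x)" by simp
  qed auto
  then have "L2_limit lborel (\<lambda>n x. sqrt (\<phi> x) * F n x) (\<lambda>x. sqrt (\<phi> x) * f x)"
    using L by (auto simp: L2_limit_def intro: weight_L2)
  from L2_limit_norm[OF this] show ?thesis unfolding weight_norm .
qed

definition Q :: "('b \<Rightarrow> real) \<Rightarrow> ('b \<Rightarrow> 'b) \<Rightarrow> real" where
  "Q u g = sqnorm lborel g - (LBINT x. \<phi> x * (u x)^2)"

definition ground :: real where
  "ground = Inf {Q \<psi> (grad \<psi>) | \<psi>. test_fun \<psi> \<and> sqint lborel \<psi> = 1}"

lemma L2_real: "u \<in> L2 lborel \<Longrightarrow> integrable lborel (\<lambda>x. ((u x)::real)^2)"
  using L2_integrable[of u lborel] by simp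

lemma pot_le: assumes "u \<in> L2 lborel"
  shows "(LBINT x. \<phi> x * (u x)^2) \<le> B * sqint lborel u"
proof -
  have "(LBINT x. \<phi> x * (u x)^2) \<le> (LBINT x. B * (u x)^2)"
    using \<phi>_le by (intro integral_mono pot_integrable integrable_mult_right L2_real assms) (simp add: mult_right_mono)
  then show ?thesis by simp
qed

lemma Q_ge: "u \<in> L2 lborel \<Longrightarrow> - B * sqint lborel u \<le> Q u g"
proof -
  assume u: "u \<in> L2 lborel"
  have "0 \<le> sqnorm lborel g" by simp
  with pot_le[OF u] show ?thesis unfolding Q_def mult_minus_left by linarith
qed

lemma ground_bdd: "bdd_below {Q \<psi> (grad \<psi>) | \<psi>. test_fun \<psi> \<and> sqint lborel \<psi> = 1}"
proof (rule bdd_belowI[of _ "- B"])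
  fix z assume "z \<in> {Q \<psi> (grad \<psi>) | \<psi>. test_fun \<psi> \<and> sqint lborel \<psi> = 1}"
  then obtain \<psi> where "z = Q \<psi> (grad \<psi>)" "test_fun \<psi>" "sqint lborel \<psi> = 1" by blast
  then show "- B \<le> z" using Q_ge[OF test_fun_L2(1), of \<psi>] by simp
qed

lemma Q_scale: "Q (\<lambda>x. c * u x) (\<lambda>x. c *\<^sub>R g x) = c^2 * Q u g"
proof -
  have "(LBINT x. \<phi> x * (c * u x)^2) = c^2 * (LBINT x. \<phi> x * (u x)^2)"
    by (subst integral_mult_right_zero[symmetric]) (simp add: power_mult_distrib mult_ac)
  then show ?thesis by (simp add: Q_def power_mult_distrib algebra_simps)
qed

lemma grad_scale_fun: "test_fun \<psi> \<Longrightarrow> grad (\<lambda>x. c * \<psi> x) = (\<lambda>x. c *\<^sub>R grad \<psi> x)"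
  by (auto simp: fun_eq_iff grad_cmult test_fun_smooth)

lemma normalise:
  assumes "test_fun \<psi>" and pos: "sqint lborel \<psi> > 0"
  defines "N \<equiv> (sqint lborel \<psi>)"
  shows "Q \<psi> (grad \<psi>) / N \<in> {Q \<psi> (grad \<psi>) | \<psi>. test_fun \<psi> \<and> sqint lborel \<psi> = 1}"
proof -
  define c where "c = 1 / sqrt N"
  have c2: "c^2 = 1 / N" using pos by (simp add: c_def N_def power_divide)
  have "sqint lborel (\<lambda>x. c * \<psi> x) = 1"
    using pos by (simp add: power_mult_distrib c2 N_def)
  moreover have "Q (\<lambda>x. c * \<psi> x) (grad (\<lambda>x. c * \<psi> x)) = Q \<psi> (grad \<psi>) / N"
    unfolding grad_scale_fun[OF assms(1)] Q_scale c2 by simp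
  moreover have "test_fun (\<lambda>x. c * \<psi> x)" using assms(1) by (rule test_fun_cmult)
  ultimately show ?thesis by (intro CollectI exI[of _ "\<lambda>x. c * \<psi> x"]) simp
qed

lemma ground_le_test:
  assumes "test_fun \<psi>" shows "ground * sqint lborel \<psi> \<le> Q \<psi> (grad \<psi>)"
proof (cases "sqint lborel \<psi> > 0")
  case True
  have "ground \<le> Q \<psi> (grad \<psi>) / sqint lborel \<psi>"
    unfolding ground_def by (rule cInf_lower[OF normalise[OF assms True] ground_bdd])
  then show ?thesis using True by (simp add: pos_le_divide_eq)
next
  case False
  then have "sqint lborel \<psi> = 0" by (simp add: order_antisym not_less)
  then show ?thesis using Q_ge[OF test_fun_L2(1)[OF assms], of "grad \<psi>"] by simp
qed

lemma Q_limit: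
  assumes "L2_limit lborel F f" "L2_limit lborel G g"
  shows "(\<lambda>n. Q (F n) (G n)) \<longlonglongrightarrow> Q f g"
  unfolding Q_def by (intro tendsto_diff L2_limit_norm[OF assms(2)] pot_limit assms(1))

lemma ground_le:
  assumes "H1 u g" shows "ground * sqint lborel u \<le> Q u g"
proof -
  obtain \<psi> where \<psi>: "\<And>n. test_fun (\<psi> n)" "L2_limit lborel \<psi> u" "L2_limit lborel (\<lambda>n. grad (\<psi> n)) g"
    using H1_obtain[OF assms] by metis
  show ?thesis
  proof (rule LIMSEQ_le)
    show "(\<lambda>n. ground * sqint lborel (\<psi> n)) \<longlonglongrightarrow> ground * sqint lborel u"
      using L2_limit_norm[OF \<psi>(2)] by (intro tendsto_mult tendsto_const) simp
    show "(\<lambda>n. Q (\<psi> n) (grad (\<psi> n))) \<longlonglongrightarrow> Q u g" by (rule Q_limit[OF \<psi>(2,3)])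
  qed (use ground_le_test[OF \<psi>(1)] in blast)
qed

text \<open>
  A minimising sequence converges: the form \<open>Q - ground\<close> is nonnegative, so the parallelogram law
  makes it small on differences, and the potential term of a difference is small by Rellich's theorem.
\<close>

lemma ground_attained:
  fixes v :: "'b \<Rightarrow> real"
  assumes neg: "ground < 0" and ex: "test_fun v" "sqint lborel v > 0"
  obtains u g where "H1 u g" "sqint lborel u = 1" "Q u g = ground"
proof -
  let ?S = "{Q \<psi> (grad \<psi>) | \<psi>. test_fun \<psi> \<and> sqint lborel \<psi> = 1}"
  have ne: "?S \<noteq> {}" using normalise[OF ex] by blast
  have "\<exists>\<psi>. test_fun \<psi> \<and> sqint lborel \<psi> = 1 \<and> Q \<psi> (grad \<psi>) < ground + 1 / real (Suc n)" for n
  proof -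
    have "\<exists>y\<in>?S. y < ground + 1 / real (Suc n)"
      using ne ground_bdd unfolding ground_def by (subst cInf_less_iff[symmetric]) auto
    then show ?thesis by blast
  qed
  then obtain \<xi> where \<xi>: "\<And>n. test_fun (\<xi> n)" "\<And>n. sqint lborel (\<xi> n) = 1"
    "\<And>n. Q (\<xi> n) (grad (\<xi> n)) < ground + 1 / real (Suc n)" by metis
  define M where "M = B + 2"
  have M: "M > 0" "1 \<le> M" using B_nonneg by (auto simp: M_def)
  have nn: "(NN x. ennreal ((f x)^2)) = ennreal (sqint lborel f)" if "f \<in> L2 lborel" for f :: "'b \<Rightarrow> real"
    by (intro nn_integral_eq_integral L2_real that) auto
  have l2: "(NN x. ennreal ((\<xi> n x)^2)) \<le> ennreal M" for n
    unfolding nn[OF test_fun_L2(1)[OF \<xi>(1)]] \<xi>(2) using M by (intro ennreal_leI)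
  have en: "(NN x. ennreal ((norm (grad (\<xi> n) x))^2)) \<le> ennreal M" for n
  proof -
    have "1 / real (Suc n) \<le> 1" by simp
    moreover have "(LBINT x. \<phi> x * (\<xi> n x)^2) \<le> B" using pot_le[OF test_fun_L2(1)[OF \<xi>(1)[of n]]] \<xi>(2)[of n] by simp
    ultimately have "sqnorm lborel (grad (\<xi> n)) \<le> M"
      using \<xi>(3)[of n] neg unfolding Q_def M_def by linarith
    then show ?thesis
      by (subst nn_integral_eq_integral) (auto intro: L2_integrable[OF test_fun_L2(2)[OF \<xi>(1)]] ennreal_leI)
  qed
  obtain r where r: "strict_mono (r :: nat \<Rightarrow> nat)"
    "\<And>e. e > 0 \<Longrightarrow> \<exists>N. \<forall>m\<ge>N. \<forall>n\<ge>N.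
        (NN x. ennreal ((\<xi> (r m) x - \<xi> (r n) x)^2) * indicator (ball 0 R) x) \<le> ennreal e"
    by (rule rellich[of \<xi> M R, OF test_fun_smooth[OF \<xi>(1)] l2 en M(1)]) blast
  define \<psi> where "\<psi> n = \<xi> (r n)" for n
  let ?x = "\<lambda>m n x. ennreal ((\<xi> (r m) x - \<xi> (r n) x)^2)"
  have \<psi>: "test_fun (\<psi> n)" "sqint lborel (\<psi> n) = 1" for n
    using \<xi> by (auto simp: \<psi>_def)
  note \<psi>L = test_fun_L2[OF \<psi>(1)]
  define A where "A u g = Q u g - ground * sqint lborel u" for u g
  have A_lim: "(\<lambda>n. A (\<psi> n) (grad (\<psi> n))) \<longlonglongrightarrow> 0"
  proof (rule tendsto_sandwich[OF _ _ tendsto_const])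
    show "\<forall>\<^sub>F n in sequentially. 0 \<le> A (\<psi> n) (grad (\<psi> n))"
      using ground_le_test[OF \<psi>(1)] by (simp add: A_def)
    have "A (\<psi> n) (grad (\<psi> n)) \<le> 1 / real (Suc n)" for n
    proof -
      have "1 / real (Suc (r n)) \<le> 1 / real (Suc n)"
        using seq_suble[OF r(1), of n] by (intro divide_left_mono) auto
      then show ?thesis using \<xi>(3)[of "r n"] \<psi>(2)[of n] unfolding A_def \<psi>_def by simp
    qed
    then show "\<forall>\<^sub>F n in sequentially. A (\<psi> n) (grad (\<psi> n)) \<le> 1 / real (Suc n)" by simp
    show "(\<lambda>n. 1 / real (Suc n)) \<longlonglongrightarrow> 0" using LIMSEQ_inverse_real_of_nat by (simp add: inverse_eq_divide)
  qed
  define d where "d m n x = \<psi> m x + (- 1) * \<psi> n x" for m n x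
  define s where "s m n x = \<psi> m x + 1 * \<psi> n x" for m n x
  have d: "test_fun (d m n)" "grad (d m n) = (\<lambda>x. grad (\<psi> m) x + (- 1) *\<^sub>R grad (\<psi> n) x)" for m n
    unfolding d_def by (rule test_fun_lincomb[OF \<psi>(1) \<psi>(1)])+
  have s: "test_fun (s m n)" "grad (s m n) = (\<lambda>x. grad (\<psi> m) x + 1 *\<^sub>R grad (\<psi> n) x)" for m n
    unfolding s_def by (rule test_fun_lincomb[OF \<psi>(1) \<psi>(1)])+
  \<comment> \<open>The parallelogram law serves the function, its gradient and the potential term alike.\<close>
  have par: "sqnorm lborel (\<lambda>x. F x + (- 1) *\<^sub>R G x) + sqnorm lborel (\<lambda>x. F x + 1 *\<^sub>R G x)
      = 2 * sqnorm lborel F + 2 * sqnorm lborel G"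
    if F: "F \<in> L2 lborel" "G \<in> L2 lborel" for F G :: "'b \<Rightarrow> 'c::euclidean_space"
  proof -
    have "sqnorm lborel (\<lambda>x. F x + (- 1) *\<^sub>R G x) + sqnorm lborel (\<lambda>x. F x + 1 *\<^sub>R G x)
      = (LBINT x. (norm (F x + (- 1) *\<^sub>R G x))^2 + (norm (F x + 1 *\<^sub>R G x))^2)"
      by (rule Bochner_Integration.integral_add[symmetric]) (intro L2_integrable L2_add L2_scaleR that)+
    also have "\<dots> = (LBINT x. 2 * (norm (F x))^2 + 2 * (norm (G x))^2)"
      by (rule Bochner_Integration.integral_cong)
         (simp_all add: power2_norm_eq_inner inner_add_left inner_add_right inner_diff_left inner_diff_right inner_commute)
    also have "\<dots> = 2 * sqnorm lborel F + 2 * sqnorm lborel G"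
      by (subst Bochner_Integration.integral_add) (intro integrable_mult_right L2_integrable that | simp)+
    finally show ?thesis .
  qed
  have A_par: "A (d m n) (grad (d m n)) \<le> 2 * A (\<psi> m) (grad (\<psi> m)) + 2 * A (\<psi> n) (grad (\<psi> n))" for m n
  proof -
    have 1: "sqint lborel (d m n) + sqint lborel (s m n) = 2 * sqint lborel (\<psi> m) + 2 * sqint lborel (\<psi> n)"
      using par[OF \<psi>L(1) \<psi>L(1), of m n] by (simp add: d_def s_def)
    have 2: "sqnorm lborel (grad (d m n)) + sqnorm lborel (grad (s m n))
        = 2 * sqnorm lborel (grad (\<psi> m)) + 2 * sqnorm lborel (grad (\<psi> n))"
      unfolding d(2) s(2) by (rule par[OF \<psi>L(2) \<psi>L(2)])
    have 3: "(LBINT x. \<phi> x * (d m n x)^2) + (LBINT x. \<phi> x * (s m n x)^2)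
        = 2 * (LBINT x. \<phi> x * (\<psi> m x)^2) + 2 * (LBINT x. \<phi> x * (\<psi> n x)^2)"
    proof -
      have "sqrt (\<phi> x) * \<psi> m x + (- 1) *\<^sub>R (sqrt (\<phi> x) * \<psi> n x) = sqrt (\<phi> x) * d m n x"
        "sqrt (\<phi> x) * \<psi> m x + 1 *\<^sub>R (sqrt (\<phi> x) * \<psi> n x) = sqrt (\<phi> x) * s m n x" for x
        by (simp_all add: d_def s_def algebra_simps)
      with par[OF weight_L2[OF \<psi>L(1)] weight_L2[OF \<psi>L(1)], of m n] show ?thesis
        by (simp only: weight_norm)
    qed
    have "0 \<le> A (s m n) (grad (s m n))" using ground_le_test[OF s(1)] by (simp add: A_def)
    moreover have "A (d m n) (grad (d m n)) + A (s m n) (grad (s m n)) = 2 * A (\<psi> m) (grad (\<psi> m)) + 2 * A (\<psi> n) (grad (\<psi> n))"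
    proof -
      have alg: "(x1 - x2 - x3) + (y1 - y2 - y3) = 2 * (z1 - z2 - z3) + 2 * (w1 - w2 - w3)"
        if "x3 + y3 = 2 * z3 + 2 * w3" "x1 + y1 = 2 * z1 + 2 * w1" "x2 + y2 = 2 * z2 + 2 * w2"
        for x1 x2 x3 y1 y2 y3 z1 z2 z3 w1 w2 w3 :: real
      proof -
        have "(x1 - x2 - x3) + (y1 - y2 - y3) = (x1 + y1) - (x2 + y2) - (x3 + y3)" by simp
        then show ?thesis unfolding that by simp
      qed
      have "ground * sqint lborel (d m n) + ground * sqint lborel (s m n)
          = 2 * (ground * sqint lborel (\<psi> m)) + 2 * (ground * sqint lborel (\<psi> n))"
        using arg_cong[OF 1, of "\<lambda>t. ground * t"] by (simp only: distrib_left mult.left_commute)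
      then show ?thesis unfolding A_def Q_def by (rule alg[OF _ 2 3])
    qed
    ultimately show ?thesis by linarith
  qed
  have small: "\<exists>N. \<forall>m\<ge>N. \<forall>n\<ge>N. sqnorm lborel (grad (d m n)) - ground * sqint lborel (d m n) < e"
    if e: "e > 0" for e
  proof -
    have "eventually (\<lambda>n. A (\<psi> n) (grad (\<psi> n)) < e / 8) sequentially"
      using e by (intro order_tendstoD(2)[OF A_lim]) simp
    then obtain N1 where N1: "\<And>n. n \<ge> N1 \<Longrightarrow> A (\<psi> n) (grad (\<psi> n)) < e / 8" by (auto simp: eventually_sequentially)
    have "e / (4 * (B + 1)) > 0" using e B_nonneg by simp
    from r(2)[OF this] obtain N2 where N2: "\<And>m n. m \<ge> N2 \<Longrightarrow> n \<ge> N2 \<Longrightarrow>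
        (NN x. ?x m n x * indicator (ball 0 R) x) \<le> ennreal (e / (4 * (B + 1)))" by blast
    have pot: "(LBINT x. \<phi> x * (d m n x)^2) \<le> e / 4" if "m \<ge> N2" "n \<ge> N2" for m n
    proof -
      have [measurable]: "d m n \<in> borel_measurable borel"
        using L2_measurable[OF test_fun_L2(1)[OF d(1)]] by simp
      have "ennreal (LBINT x. \<phi> x * (d m n x)^2) = (NN x. ennreal (\<phi> x * (d m n x)^2))"
        using \<phi>_nonneg by (intro nn_integral_eq_integral[symmetric] pot_integrable test_fun_L2 d) auto
      also have "\<dots> \<le> (NN x. ennreal B * (?x m n x * indicator (ball 0 R) x))"
      proof (rule nn_integral_mono)
        fix x
        show "ennreal (\<phi> x * (d m n x)^2) \<le> ennreal B * (?x m n x * indicator (ball 0 R) x)"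
        proof (cases "x \<in> ball 0 R")
          case True
          have "ennreal (\<phi> x * (d m n x)^2) \<le> ennreal (B * (d m n x)^2)"
            using \<phi>_le by (intro ennreal_leI mult_right_mono) auto
          then show ?thesis using True B_nonneg by (simp add: ennreal_mult d_def \<psi>_def)
        qed (simp add: \<phi>_support)
      qed
      also have "\<dots> = ennreal B * (NN x. ?x m n x * indicator (ball 0 R) x)"
      proof (rule nn_integral_cmult)
        have "(\<lambda>x. ?x m n x * indicator (ball 0 R) x) = (\<lambda>x. ennreal ((d m n x)^2) * indicator (ball 0 R) x)"
          by (simp add: d_def \<psi>_def)
        also have "\<dots> \<in> borel_measurable lborel"
          by (intro borel_measurable_times_ennreal borel_measurable_indicator) simp_all
        finally show "(\<lambda>x. ?x m n x * indicator (ball 0 R) x) \<in> borel_measurable lborel" .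
      qed
      also have "\<dots> \<le> ennreal B * ennreal (e / (4 * (B + 1)))" by (intro mult_left_mono N2 that) auto
      also have "\<dots> = ennreal (B * (e / (4 * (B + 1))))" using B_nonneg e by (intro ennreal_mult[symmetric]) auto
      finally have "(LBINT x. \<phi> x * (d m n x)^2) \<le> B * (e / (4 * (B + 1)))"
        using B_nonneg e by (subst (asm) ennreal_le_iff) auto
      also have "\<dots> = (e / 4) * (B / (B + 1))" using B_nonneg by (simp add: divide_simps)
      also have "\<dots> \<le> (e / 4) * 1" using B_nonneg e by (intro mult_left_mono) auto
      finally show ?thesis by simp
    qed
    show ?thesis
    proof (intro exI[of _ "max N1 N2"] allI impI)
      fix m n assume "m \<ge> max N1 N2" "n \<ge> max N1 N2"
      then have "A (\<psi> m) (grad (\<psi> m)) < e / 8" "A (\<psi> n) (grad (\<psi> n)) < e / 8" "(LBINT x. \<phi> x * (d m n x)^2) \<le> e / 4"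
        using N1 pot by auto
      note * = this
      have "A (d m n) (grad (d m n)) < e / 2" using A_par[of m n] *(1,2) by linarith
      moreover have "A (d m n) (grad (d m n)) = (sqnorm lborel (grad (d m n)) - ground * sqint lborel (d m n))
          - (LBINT x. \<phi> x * (d m n x)^2)" by (simp add: A_def Q_def)
      moreover have "y < e" if "a < e / 2" "a = y - z" "z \<le> e / 4" for a y z
        using that e by linarith
      ultimately show "sqnorm lborel (grad (d m n)) - ground * sqint lborel (d m n) < e"
        using *(3) by blast
    qed
  qed
  have pos1: "0 \<le> sqnorm lborel (grad (d m n))" "0 \<le> - ground * sqint lborel (d m n)" for m n
    using neg by (auto intro!: mult_nonpos_nonneg simp: mult_le_0_iff)
  obtain u where u: "L2_limit lborel \<psi> u"
  proof (rule L2_complete[of \<psi> lborel])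
    show "\<psi> n \<in> L2 lborel" for n by (rule \<psi>L)
    fix e :: real assume "e > 0"
    then have "- ground * e > 0" using neg by (intro mult_pos_pos) simp_all
    from small[OF this] obtain N where N: "\<And>m n. m \<ge> N \<Longrightarrow> n \<ge> N \<Longrightarrow>
        sqnorm lborel (grad (d m n)) - ground * sqint lborel (d m n) < - ground * e" by blast
    have "sqnorm lborel (\<lambda>x. \<psi> m x - \<psi> n x) < e" if "m \<ge> N" "n \<ge> N" for m n
    proof -
      have "- ground * sqint lborel (d m n) < - ground * e" using N[OF that] pos1(1)[of m n] by linarith
      then have "sqint lborel (d m n) < e" using neg by (simp add: mult_less_cancel_left)
      then show ?thesis by (simp add: d_def)
    qed
    then show "\<exists>N. \<forall>m\<ge>N. \<forall>n\<ge>N. sqnorm lborel (\<lambda>x. \<psi> m x - \<psi> n x) < e" by blast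
  qed
  obtain g where g: "L2_limit lborel (\<lambda>n. grad (\<psi> n)) g"
  proof (rule L2_complete[of "\<lambda>n. grad (\<psi> n)" lborel])
    show "grad (\<psi> n) \<in> L2 lborel" for n by (rule \<psi>L)
    fix e :: real assume "e > 0"
    from small[OF this] obtain N where N: "\<And>m n. m \<ge> N \<Longrightarrow> n \<ge> N \<Longrightarrow>
        sqnorm lborel (grad (d m n)) - ground * sqint lborel (d m n) < e" by blast
    have "sqnorm lborel (\<lambda>x. grad (\<psi> m) x - grad (\<psi> n) x) < e" if "m \<ge> N" "n \<ge> N" for m n
    proof -
      have "sqnorm lborel (grad (d m n)) < e" using N[OF that] pos1(2)[of m n] by linarith
      then show ?thesis by (simp add: d(2))
    qed
    then show "\<exists>N. \<forall>m\<ge>N. \<forall>n\<ge>N. sqnorm lborel (\<lambda>x. grad (\<psi> m) x - grad (\<psi> n) x) < e" by blast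
  qed
  have "H1 u g" by (rule H1_intro[OF \<psi>(1) u g])
  moreover have u1: "sqint lborel u = 1"
    using L2_limit_norm[OF u] \<psi>(2) by (simp add: LIMSEQ_const_iff)
  moreover have "Q u g = ground"
  proof (rule LIMSEQ_unique[OF Q_limit[OF u g]])
    have "(\<lambda>n. A (\<psi> n) (grad (\<psi> n)) + ground) \<longlonglongrightarrow> 0 + ground" by (intro tendsto_add A_lim tendsto_const)
    then show "(\<lambda>n. Q (\<psi> n) (grad (\<psi> n))) \<longlonglongrightarrow> ground" by (simp add: A_def \<psi>(2))
  qed
  ultimately show ?thesis by (rule that)
qed

text \<open>
  Varying the minimiser in the direction \<open>v\<close> gives a nonnegative quadratic polynomial that vanishes at \<open>0\<close>, so
  its linear coefficient, the weak eigenvalue equation, is zero. Conversely, an eigenfunction inserted into its own equation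
  shows that no eigenvalue lies below the infimum of the form.
\<close>

lemma lambda1_eq_ground:
  fixes v :: "'b \<Rightarrow> real"
  assumes neg: "ground < 0" and ex: "test_fun v" "sqint lborel v > 0"
  shows "lambda1 \<phi> = ground"
proof -
  obtain u g where ug: "H1 u g" "sqint lborel u = 1" "Q u g = ground"
    using ground_attained[OF assms] by metis
  note uL = H1_L2[OF ug(1)]
  have EL: "(LBINT x. g x \<bullet> h x) - (LBINT x. \<phi> x * u x * v x) = (LBINT x. ground * u x * v x)"
    if vh: "H1 v h" for v h
  proof -
    note vL = H1_L2[OF vh]
    define b where "b = (LBINT x. g x \<bullet> h x) - (LBINT x. \<phi> x * u x * v x) - ground * (LBINT x. u x * v x)"
    define c where "c = Q v h - ground * sqint lborel v"
    have "0 \<le> 2 * t * b + t^2 * c" for t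
    proof -
      have 1: "sqnorm lborel (\<lambda>x. g x + t *\<^sub>R h x) = sqnorm lborel g + 2 * t * (LBINT x. g x \<bullet> h x) + t^2 * sqnorm lborel h"
      proof -
        have "sqnorm lborel (\<lambda>x. g x + t *\<^sub>R h x) = (LBINT x. (norm (g x))^2 + 2 * t * (g x \<bullet> h x) + t^2 * (norm (h x))^2)"
          unfolding power2_norm_eq_inner
          by (rule Bochner_Integration.integral_cong)
             (simp_all add: inner_add_left inner_add_right inner_commute power2_eq_square algebra_simps)
        also have "\<dots> = sqnorm lborel g + 2 * t * (LBINT x. g x \<bullet> h x) + t^2 * sqnorm lborel h"
          by (subst Bochner_Integration.integral_add, (intro Bochner_Integration.integrable_add integrable_mult_right L2_integrable L2_inner_integrable uL vL)+,
              subst Bochner_Integration.integral_add, (intro integrable_mult_right L2_integrable L2_inner_integrable uL vL)+) simp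
        finally show ?thesis .
      qed
      have 2: "(LBINT x. \<phi> x * (u x + t * v x)^2) = (LBINT x. \<phi> x * (u x)^2) + 2 * t * (LBINT x. \<phi> x * u x * v x) + t^2 * (LBINT x. \<phi> x * (v x)^2)"
      proof -
        have "(LBINT x. \<phi> x * (u x + t * v x)^2) = (LBINT x. \<phi> x * (u x)^2 + 2 * t * (\<phi> x * u x * v x) + t^2 * (\<phi> x * (v x)^2))"
          by (rule Bochner_Integration.integral_cong) (simp_all add: algebra_simps power2_eq_square)
        also have "\<dots> = (LBINT x. \<phi> x * (u x)^2) + 2 * t * (LBINT x. \<phi> x * u x * v x) + t^2 * (LBINT x. \<phi> x * (v x)^2)"
          by (subst Bochner_Integration.integral_add, (intro Bochner_Integration.integrable_add integrable_mult_right pot_integrable pot_integrable2 uL vL)+,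
              subst Bochner_Integration.integral_add, (intro integrable_mult_right pot_integrable pot_integrable2 uL vL)+) simp
        finally show ?thesis .
      qed
      have 3: "sqint lborel (\<lambda>x. u x + t * v x) = sqint lborel u + 2 * t * (LBINT x. u x * v x) + t^2 * sqint lborel v"
      proof -
        have "sqint lborel (\<lambda>x. u x + t * v x) = (LBINT x. (u x)^2 + 2 * t * (u x * v x) + t^2 * (v x)^2)"
          by (rule Bochner_Integration.integral_cong) (simp_all add: algebra_simps power2_eq_square)
        also have "\<dots> = sqint lborel u + 2 * t * (LBINT x. u x * v x) + t^2 * sqint lborel v"
          by (subst Bochner_Integration.integral_add, (intro Bochner_Integration.integrable_add integrable_mult_right L2_real L2_mult_integrable uL vL)+,
              subst Bochner_Integration.integral_add, (intro integrable_mult_right L2_real L2_mult_integrable uL vL)+) simp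
        finally show ?thesis .
      qed
      have "ground * sqint lborel (\<lambda>x. u x + t * v x) \<le> Q (\<lambda>x. u x + t * v x) (\<lambda>x. g x + t *\<^sub>R h x)"
        by (rule ground_le[OF H1_add_scaled[OF ug(1) vh]])
      then have "0 \<le> (Q u g - ground * sqint lborel u) + 2 * t * b + t^2 * c"
        unfolding Q_def 1 2 3 b_def c_def by (simp add: algebra_simps)
      then show ?thesis using ug by simp
    qed
    then have "b = 0" by (rule quadratic_nonneg_imp_linear_zero)
    then show ?thesis by (simp add: b_def mult.assoc)
  qed
  have eig: "eigenvalue \<phi> ground"
    unfolding eigenvalue_def schroedinger_def form_domain_def
  proof (intro exI[of _ u] conjI exI[of _ g] allI impI)
    show "\<not> (AE x in lborel. u x = 0)"
    proof
      assume "AE x in lborel. u x = 0"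
      then have "sqint lborel u = 0" by (intro integral_eq_zero_AE) (auto elim: eventually_mono)
      with ug(2) show False by simp
    qed
    show "(\<lambda>x. ground * u x) \<in> L2 lborel" using L2_scaleR[OF uL(1), of ground] by simp
  qed (use ug(1) pot_integrable[OF uL(1)] EL in auto)
  have least: "ground \<le> E" if "eigenvalue \<phi> E" for E
  proof -
    obtain w k where w: "\<not> (AE x in lborel. w x = 0)" "form_domain \<phi> w k"
      and eq: "\<And>v h. form_domain \<phi> v h \<Longrightarrow>
         (LBINT x. k x \<bullet> h x) - (LBINT x. \<phi> x * w x * v x) = (LBINT x. E * w x * v x)"
      using \<open>eigenvalue \<phi> E\<close> unfolding eigenvalue_def schroedinger_def by blast
    have wk: "H1 w k" using w(2) by (simp add: form_domain_def)
    note wL = H1_L2[OF wk]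
    have "Q w k = E * sqint lborel w"
    proof -
      have "(LBINT x. \<phi> x * (w x)^2) = (LBINT x. \<phi> x * w x * w x)" by (simp add: power2_eq_square mult.assoc)
      moreover have "(LBINT x. E * w x * w x) = E * sqint lborel w" by (simp add: power2_eq_square mult.assoc)
      ultimately show ?thesis using eq[OF w(2)] unfolding Q_def power2_norm_eq_inner by simp
    qed
    then have "ground * sqint lborel w \<le> E * sqint lborel w" using ground_le[OF wk] by simp
    moreover have "sqint lborel w > 0"
    proof -
      have "sqint lborel w \<noteq> 0"
        using integral_nonneg_eq_0_iff_AE[OF L2_real[OF wL(1)]] w(1) by simp
      then show ?thesis by (simp add: order_less_le)
    qed
    ultimately show ?thesis by simp
  qed
  have "(LEAST E. E < 0 \<and> eigenvalue \<phi> E) = ground"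
    using neg eig least by (intro Least_equality) auto
  then show ?thesis unfolding lambda1_def using neg eig least by auto
qed

text \<open>
  If the form takes negative values, its infimum is \<open>\<lambda>\<^sub>1\<close>, to which the Keller--Lieb--Thirring inequality
  applies; otherwise there is nothing to prove.
\<close>

theorem KLT_form_bound:
  assumes KLT: "KLT_const TYPE('b) \<gamma> = ennreal L" and L: "L \<ge> 0" and \<gamma>: "\<gamma> > 0" and v: "test_fun v"
  shows "(LBINT x. \<phi> x * (v x)^2) \<le> sqnorm lborel (grad v)
    + (L * (LBINT x. \<phi> x powr (\<gamma> + DIM('b) / 2))) powr (1 / \<gamma>) * sqint lborel v"
proof -
  define p where "p = \<gamma> + DIM('b) / 2"
  have p: "p > 0" using \<gamma> by (simp add: p_def add_pos_nonneg)
  define J where "J = (LBINT x. \<phi> x powr p)"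
  have J: "J \<ge> 0" by (simp add: J_def)
  have J_int: "integrable lborel (\<lambda>x. \<phi> x powr p)"
  proof (rule Bochner_Integration.integrable_bound)
    show "integrable lborel (\<lambda>x. B powr p * indicator (ball 0 R) x)"
      by (intro integrable_mult_right integrable_real_indicator) (auto simp: emeasure_lborel_ball_finite[unfolded infinity_ennreal_def])
    show "AE x in lborel. norm (\<phi> x powr p) \<le> norm (B powr p * indicator (ball 0 R) x)"
    proof (rule AE_I2)
      fix x show "norm (\<phi> x powr p) \<le> norm (B powr p * indicator (ball 0 R) x)"
        using \<phi>_support[of x] powr_mono2[of p "\<phi> x" B] \<phi>_nonneg[of x] \<phi>_le[of x] p by (cases "x \<in> ball 0 R") auto
    qed
  qed measurable
  have v0: "sqint lborel v \<ge> 0" by simp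
  consider "sqint lborel v = 0" | "ground \<ge> 0" | "ground < 0" "sqint lborel v > 0"
    using v0 by linarith
  then have "- ((L * J) powr (1 / \<gamma>)) * sqint lborel v \<le> Q v (grad v)"
  proof cases
    case 1
    then show ?thesis using ground_le_test[OF v] by simp
  next
    case 2
    then have "0 \<le> ground * sqint lborel v" by simp
    also have "\<dots> \<le> Q v (grad v)" by (rule ground_le_test[OF v])
    finally have "0 \<le> Q v (grad v)" .
    moreover have "0 \<le> (L * J) powr (1 / \<gamma>) * sqint lborel v" using v0 by (intro mult_nonneg_nonneg) auto
    ultimately show ?thesis unfolding mult_minus_left by linarith
  next
    case 3
    let ?C = "{C. \<forall>\<phi>\<in>borel_measurable borel.
     ennreal (\<bar>lambda1 (\<phi> :: 'b \<Rightarrow> real)\<bar> powr \<gamma>)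
       \<le> C * (NN x. ennreal (max 0 (\<phi> x) powr (\<gamma> + DIM('b) / 2)))}"
    have J_nn: "(NN x. ennreal (max 0 (\<phi> x) powr (\<gamma> + DIM('b) / 2))) = ennreal J"
      unfolding J_def using \<phi>_nonneg J_int
      by (subst nn_integral_eq_integral[symmetric]) (auto simp: p_def max_def intro!: nn_integral_cong)
    have all: "ennreal (\<bar>ground\<bar> powr \<gamma>) \<le> C * ennreal J" if "C \<in> ?C" for C
    proof -
      from that have "\<forall>\<phi>\<in>borel_measurable borel. ennreal (\<bar>lambda1 (\<phi> :: 'b \<Rightarrow> real)\<bar> powr \<gamma>)
         \<le> C * (NN x. ennreal (max 0 (\<phi> x) powr (\<gamma> + DIM('b) / 2)))" by simp
      from bspec[OF this \<phi>_borel] show ?thesis unfolding J_nn lambda1_eq_ground[OF 3(1) v 3(2)] .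
    qed
    have Inf_C: "Inf ?C = ennreal L" using KLT by (simp add: KLT_const_def)
    have "ennreal (\<bar>ground\<bar> powr \<gamma>) \<le> ennreal L * ennreal J"
    proof (cases "J = 0")
      case True
      have "?C \<noteq> {}" using Inf_C by (metis Inf_empty ennreal_neq_top)
      then show ?thesis using all True by auto
    next
      case False
      then have Jp: "J > 0" using J by simp
      have "ennreal (\<bar>ground\<bar> powr \<gamma> / J) \<le> C" if "C \<in> ?C" for C
      proof -
        have "ennreal (\<bar>ground\<bar> powr \<gamma>) / ennreal J \<le> C"
          using all[OF that] Jp by (subst divide_le_posI_ennreal) (auto simp: mult.commute)
        then show ?thesis using Jp by (simp add: divide_ennreal)
      qed
      then have "ennreal (\<bar>ground\<bar> powr \<gamma> / J) \<le> ennreal L" unfolding Inf_C[symmetric] by (intro Inf_greatest)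
      then have "\<bar>ground\<bar> powr \<gamma> / J \<le> L" using L by (simp add: ennreal_le_iff)
      then have "\<bar>ground\<bar> powr \<gamma> \<le> L * J" using Jp by (simp add: pos_divide_le_eq)
      then show ?thesis using L J by (simp add: ennreal_mult[symmetric] ennreal_leI)
    qed
    then have "\<bar>ground\<bar> powr \<gamma> \<le> L * J" using L J by (simp add: ennreal_mult[symmetric] ennreal_le_iff)
    then have "(\<bar>ground\<bar> powr \<gamma>) powr (1 / \<gamma>) \<le> (L * J) powr (1 / \<gamma>)" using \<gamma> by (intro powr_mono2) auto
    then have "- ((L * J) powr (1 / \<gamma>)) \<le> ground" using \<gamma> 3 by (simp add: powr_powr)
    then have "- ((L * J) powr (1 / \<gamma>)) * sqint lborel v \<le> ground * sqint lborel v"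
      using v0 by (rule mult_right_mono)
    also have "\<dots> \<le> Q v (grad v)" by (rule ground_le_test[OF v])
    finally show ?thesis .
  qed
  then show ?thesis unfolding Q_def J_def p_def by simp
qed

end


section \<open>Eigenvalue bounds on the sphere from smooth functions\<close>

abbreviation sphere_area :: "'a::euclidean_space itself \<Rightarrow> real" where
  "sphere_area _ \<equiv> measure (sphere_measure :: 'a measure) (sphere 0 1)"

lemma sphere_in_sets: "sphere 0 1 \<in> sets (sphere_measure :: 'a::euclidean_space measure)"
  using sets.top[of "sphere_measure :: 'a measure"] by (simp add: space_sphere_measure)

lemma sphere_area:
  shows "emeasure (sphere_measure :: 'a::euclidean_space measure) (sphere 0 1) = ennreal (sphere_area TYPE('a))"
    and "sphere_area TYPE('a) > 0"
proof -
  have "{x \<in> ball 0 1 - {0}. sgn x \<in> sphere 0 1} = ball (0::'a) 1 - {0}"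
    by (auto simp: norm_sgn)
  then have "emeasure (sphere_measure :: 'a measure) (sphere 0 1) = of_nat DIM('a) * emeasure lborel (ball (0::'a) 1 - {0})"
    using emeasure_sphere_measure[OF sphere_in_sets, where 'a='a] by (simp only:)
  also have "emeasure lborel (ball (0::'a) 1 - {0}) = emeasure lborel (ball (0::'a) 1)"
    by (intro emeasure_Diff_null_set) auto
  also have "\<dots> = ennreal (unit_ball_vol DIM('a))" by (simp add: emeasure_ball)
  also have "of_nat DIM('a) * \<dots> = ennreal (DIM('a) * unit_ball_vol DIM('a))"
    by (simp add: ennreal_mult' ennreal_of_nat_eq_real_of_nat)
  finally have *: "emeasure (sphere_measure :: 'a measure) (sphere 0 1) = ennreal (DIM('a) * unit_ball_vol DIM('a))" .
  have pos: "DIM('a) * unit_ball_vol DIM('a) > 0" by (intro mult_pos_pos) auto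
  have eq: "sphere_area TYPE('a) = DIM('a) * unit_ball_vol DIM('a)" using * pos by (simp add: measure_def)
  show "emeasure (sphere_measure :: 'a measure) (sphere 0 1) = ennreal (sphere_area TYPE('a))" unfolding eq by (rule *)
  show "sphere_area TYPE('a) > 0" unfolding eq by (rule pos)
qed

interpretation sphere_measure: finite_measure "sphere_measure :: 'a::euclidean_space measure"
  by (rule finite_measureI) (simp add: sphere_area(1))

lemma sphere_prob_eq_density:
  "(sphere_prob :: 'a::euclidean_space measure) = density sphere_measure (\<lambda>_. ennreal (1 / sphere_area TYPE('a)))"
  unfolding sphere_prob_def uniform_measure_def
proof -
  have "1 / emeasure (sphere_measure :: 'a measure) (sphere 0 1) = ennreal (1 / sphere_area TYPE('a))"
    using sphere_area(2)[where 'a='a] unfolding sphere_area(1)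
    by (simp add: divide_ennreal ennreal_1[symmetric] del: ennreal_1)
  then show "density (sphere_measure :: 'a measure) (\<lambda>x. indicator (sphere 0 1) x / emeasure (sphere_measure :: 'a measure) (sphere 0 1))
      = density sphere_measure (\<lambda>_. ennreal (1 / sphere_area TYPE('a)))"
    using sphere_in_sets[where 'a='a]
    by (intro density_cong AE_I2 borel_measurable_divide_ennreal borel_measurable_indicator borel_measurable_const) auto
qed

lemma space_sphere_prob: "space sphere_prob = sphere 0 1"
  and sets_sphere_prob: "sets sphere_prob = sets sphere_measure"
  by (simp_all add: sphere_prob_eq_density)

lemma measurable_sphere_prob: "borel_measurable sphere_prob = borel_measurable sphere_measure"
  by (rule measurable_cong_sets) (simp_all add: sets_sphere_prob)

lemma nn_integral_sphere_prob:
  fixes f :: "'a::euclidean_space \<Rightarrow> ennreal"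
  assumes "f \<in> borel_measurable sphere_measure"
  shows "(\<integral>\<^sup>+x. f x \<partial>sphere_prob) = ennreal (1 / sphere_area TYPE('a)) * (\<integral>\<^sup>+x. f x \<partial>sphere_measure)"
  unfolding sphere_prob_eq_density using assms
  by (subst nn_integral_density) (auto simp: nn_integral_cmult)

lemma integral_sphere_prob:
  fixes f :: "'a::euclidean_space \<Rightarrow> real"
  assumes "f \<in> borel_measurable sphere_measure"
  shows "(LINT x|sphere_prob. f x) = (LINT x|sphere_measure. f x) / sphere_area TYPE('a)"
  unfolding sphere_prob_eq_density using assms sphere_area(2)[where 'a='a]
  by (subst integral_density) auto

lemma integrable_sphere_prob:
  fixes f :: "'a::euclidean_space \<Rightarrow> real"
  assumes "f \<in> borel_measurable sphere_measure"
  shows "integrable sphere_prob f \<longleftrightarrow> integrable sphere_measure f"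
proof -
  have "integrable sphere_prob f \<longleftrightarrow> integrable sphere_measure (\<lambda>x. (1 / sphere_area TYPE('a)) *\<^sub>R f x)"
    unfolding sphere_prob_eq_density using assms by (intro integrable_density) auto
  also have "\<dots> \<longleftrightarrow> integrable sphere_measure f"
    using sphere_area(2)[where 'a='a] unfolding real_scaleR_def integrable_mult_left_iff by simp
  finally show ?thesis .
qed

lemma emeasure_sphere_prob: "emeasure (sphere_prob :: 'a::euclidean_space measure) (sphere 0 1) = 1"
proof -
  have "emeasure (sphere_prob :: 'a measure) (sphere 0 1) = (\<integral>\<^sup>+x. 1 \<partial>(sphere_prob :: 'a measure))"
    by (simp add: space_sphere_prob)
  also have "\<dots> = 1"
    using sphere_area[where 'a='a] by (subst nn_integral_sphere_prob) (auto simp: ennreal_mult[symmetric])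
  finally show ?thesis .
qed

interpretation sphere_prob: finite_measure "sphere_prob :: 'a::euclidean_space measure"
  by (rule finite_measureI) (simp add: space_sphere_prob emeasure_sphere_prob)

lemma measure_sphere_prob: "measure (sphere_prob :: 'a::euclidean_space measure) (sphere 0 1) = 1"
  by (simp add: measure_def emeasure_sphere_prob)

lemma integral_sphere_const: "(LINT x|(sphere_prob :: 'a::euclidean_space measure). c) = (c::real)"
  by (simp add: space_sphere_prob measure_sphere_prob)

lemma sphere_continuous_measurable:
  fixes f :: "'a::euclidean_space \<Rightarrow> 'b::topological_space"
  assumes "continuous_on (sphere 0 1) f" shows "f \<in> borel_measurable sphere_measure"
proof -
  have "f \<in> borel_measurable (restrict_space borel (sphere 0 1))"
    using assms by (rule borel_measurable_continuous_on_restrict)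
  then show ?thesis by (simp cong: measurable_cong_sets)
qed

lemma sphere_continuous_bounded:
  fixes f :: "'a::euclidean_space \<Rightarrow> 'b::real_normed_vector"
  assumes "continuous_on (sphere 0 1) f"
  obtains B where "B \<ge> 0" "\<And>x. x \<in> sphere 0 1 \<Longrightarrow> norm (f x) \<le> B"
proof -
  have "bounded (f ` sphere 0 1)" using assms by (intro compact_imp_bounded compact_continuous_image) auto
  then obtain B where "\<forall>y\<in>f ` sphere 0 1. norm y \<le> B" unfolding bounded_iff by blast
  then show ?thesis by (intro that[of "max B 0"]) force+
qed

lemma sphere_continuous_integrable:
  fixes f :: "'a::euclidean_space \<Rightarrow> real"
  assumes "continuous_on (sphere 0 1) f" shows "integrable sphere_prob f" "integrable sphere_measure f"
proof -
  obtain B where B: "\<And>x. x \<in> sphere 0 1 \<Longrightarrow> norm (f x) \<le> B" using sphere_continuous_bounded[OF assms] by blast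
  show "integrable sphere_measure f"
    by (rule sphere_measure.integrable_const_bound[of _ B])
       (auto intro!: AE_I2 sphere_continuous_measurable assms simp: B[unfolded real_norm_def])
  then show "integrable sphere_prob f"
    using integrable_sphere_prob[OF sphere_continuous_measurable[OF assms]] by simp
qed

lemma sphere_continuous_L2:
  fixes f :: "'a::euclidean_space \<Rightarrow> 'b::euclidean_space"
  assumes "continuous_on (sphere 0 1) f" shows "f \<in> L2 sphere_prob"
  by (rule L2_I)
     (auto simp: measurable_sphere_prob intro!: sphere_continuous_measurable sphere_continuous_integrable continuous_intros assms)

definition tangential_grad :: "('a::euclidean_space \<Rightarrow> real) \<Rightarrow> 'a \<Rightarrow> 'a" where
  "tangential_grad f x = grad f x - (x \<bullet> grad f x) *\<^sub>R x"

definition energy :: "('a::euclidean_space \<Rightarrow> real) \<Rightarrow> real" where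
  "energy f = sqnorm sphere_prob (tangential_grad f)"

lemma tangential_grad_continuous: "smooth f \<Longrightarrow> continuous_on S (tangential_grad f)"
  unfolding tangential_grad_def[abs_def]
  by (intro continuous_intros smooth_continuous smooth_grad)

lemma H1_sphere_obtain:
  assumes "H1_sphere u g"
  obtains \<psi> where "\<And>n. smooth (\<psi> n)" "L2_limit sphere_prob \<psi> u"
    "L2_limit sphere_prob (\<lambda>n. tangential_grad (\<psi> n)) g"
proof -
  obtain \<psi> G where *: "\<forall>n. smooth (\<psi> n)" "\<forall>n x. GDERIV (\<psi> n) x :> G n x" "L2_limit sphere_prob \<psi> u"
    "L2_limit sphere_prob (\<lambda>n x. G n x - (x \<bullet> G n x) *\<^sub>R x) g"
    using assms unfolding H1_sphere_def by blast
  have "G n x = grad (\<psi> n) x" for n x using *(2) grad_eq by metis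
  with * show ?thesis by (intro that[of \<psi>]) (auto simp: tangential_grad_def[abs_def])
qed

lemma H1_sphere_const: "H1_sphere (\<lambda>_::'a::euclidean_space. c) (\<lambda>_. 0)"
  unfolding H1_sphere_def
proof (intro exI[of _ "\<lambda>_ _. c"] exI[of _ "\<lambda>_ _. 0"] conjI allI)
  show "GDERIV (\<lambda>_. c) x :> 0" for x :: 'a by (simp add: gderiv_def)
qed (auto intro!: smooth_const L2_limit_const sphere_continuous_L2)

definition form_bound :: "('a::euclidean_space \<Rightarrow> real) \<Rightarrow> real \<Rightarrow> bool" where
  "form_bound V \<Lambda> \<longleftrightarrow> (\<forall>\<psi>. smooth \<psi> \<longrightarrow> (LINT x|sphere_prob. V x * (\<psi> x)^2) \<le> energy \<psi> + \<Lambda> * sqint sphere_prob \<psi>)"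

lemma form_boundD:
  "form_bound V \<Lambda> \<Longrightarrow> smooth \<psi> \<Longrightarrow> (LINT x|sphere_prob. V x * (\<psi> x)^2) \<le> energy \<psi> + \<Lambda> * sqint sphere_prob \<psi>"
  by (simp add: form_bound_def)

lemma form_bound_mono:
  assumes "form_bound V \<Lambda>" "\<Lambda> \<le> \<Lambda>'" shows "form_bound V \<Lambda>'"
  unfolding form_bound_def
proof (intro allI impI order_trans[OF form_boundD[OF assms(1)]])
  show "energy \<psi> + \<Lambda> * sqint sphere_prob \<psi> \<le> energy \<psi> + \<Lambda>' * sqint sphere_prob \<psi>" for \<psi> :: "'a \<Rightarrow> real"
    using assms(2) by (simp add: mult_right_mono)
qed

lemma energy_nonneg: "0 \<le> energy \<psi>"
  unfolding energy_def by (intro integral_nonneg_AE AE_I2) auto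

lemma integrable_mult_smooth:
  fixes V :: "'a::euclidean_space \<Rightarrow> real"
  assumes V: "V \<in> borel_measurable sphere_measure" "integrable sphere_prob V" and \<psi>: "smooth \<psi>"
  shows "integrable sphere_prob (\<lambda>x. V x * (\<psi> x)^2)"
proof -
  have [measurable]: "V \<in> borel_measurable sphere_prob" "\<psi> \<in> borel_measurable sphere_prob"
    using V sphere_continuous_measurable[OF smooth_continuous[OF \<psi>]] by (simp_all add: measurable_sphere_prob)
  obtain B where B: "\<And>x. x \<in> sphere 0 1 \<Longrightarrow> norm (\<psi> x) \<le> B" "B \<ge> 0"
    using sphere_continuous_bounded[OF smooth_continuous[OF \<psi>]] by blast
  show ?thesis
  proof (rule Bochner_Integration.integrable_bound)
    show "integrable sphere_prob (\<lambda>x. B^2 * V x)" using V(2) by simp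
    show "AE x in sphere_prob. norm (V x * (\<psi> x)^2) \<le> norm (B^2 * V x)"
    proof (rule AE_I2)
      fix x :: 'a assume "x \<in> space sphere_prob"
      then have "(\<psi> x)^2 \<le> B^2" using B by (simp add: abs_le_square_iff[symmetric] space_sphere_prob)
      then show "norm (V x * (\<psi> x)^2) \<le> norm (B^2 * V x)"
        by (simp add: abs_mult mult_left_mono mult.commute)
    qed
  qed measurable
qed

lemma sphere_bounded_integrable:
  fixes f :: "'a::euclidean_space \<Rightarrow> real"
  assumes "f \<in> borel_measurable sphere_measure" "\<And>x. x \<in> sphere 0 1 \<Longrightarrow> \<bar>f x\<bar> \<le> B"
  shows "integrable sphere_measure f"
  by (rule sphere_measure.integrable_const_bound[of _ B]) (use assms in \<open>auto intro!: AE_I2\<close>)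

lemma bounded_mult_smooth_integrable:
  fixes V :: "'a::euclidean_space \<Rightarrow> real"
  assumes V: "V \<in> borel_measurable sphere_measure" "\<And>x. x \<in> sphere 0 1 \<Longrightarrow> 0 \<le> V x" "\<And>x. x \<in> sphere 0 1 \<Longrightarrow> V x \<le> B"
    and \<psi>: "smooth \<psi>"
  shows "integrable sphere_measure (\<lambda>x. V x * (\<psi> x)^2)"
proof -
  have [measurable]: "\<psi> \<in> borel_measurable sphere_measure" by (rule sphere_continuous_measurable[OF smooth_continuous[OF \<psi>]])
  have "integrable sphere_measure V"
    by (rule sphere_bounded_integrable[of _ B]) (use V in auto)
  then have "integrable sphere_prob (\<lambda>x. V x * (\<psi> x)^2)"
    using V(1) \<psi> by (intro integrable_mult_smooth) (auto simp: integrable_sphere_prob)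
  from this borel_measurable_integrable[OF this] show ?thesis by (simp add: integrable_sphere_prob measurable_sphere_prob)
qed

lemma form_bound_truncate:
  fixes V :: "'a::euclidean_space \<Rightarrow> real"
  assumes V: "V \<in> borel_measurable sphere_measure" "\<And>x. x \<in> sphere 0 1 \<Longrightarrow> 0 \<le> V x" "integrable sphere_prob V"
    and bound: "\<And>N. form_bound (\<lambda>x. min (V x) (real N)) \<Lambda>"
  shows "form_bound V \<Lambda>"
  unfolding form_bound_def
proof (intro allI impI)
  fix \<psi> :: "'a \<Rightarrow> real" assume \<psi>: "smooth \<psi>"
  have [measurable]: "V \<in> borel_measurable sphere_prob" "\<psi> \<in> borel_measurable sphere_prob"
    using V(1) sphere_continuous_measurable[OF smooth_continuous[OF \<psi>]] by (simp_all add: measurable_sphere_prob)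
  have "(\<lambda>N. LINT x|sphere_prob. min (V x) (real N) * (\<psi> x)^2) \<longlonglongrightarrow> (LINT x|sphere_prob. V x * (\<psi> x)^2)"
  proof (rule integral_dominated_convergence[OF _ _ integrable_mult_smooth[OF V(1,3) \<psi>]])
    show "AE x in sphere_prob. (\<lambda>N. min (V x) (real N) * (\<psi> x)^2) \<longlonglongrightarrow> V x * (\<psi> x)^2"
    proof (intro AE_I2 tendsto_mult tendsto_const tendsto_eventually)
      show "\<forall>\<^sub>F N in sequentially. min (V x) (real N) = V x" for x
        using eventually_ge_at_top[of "nat \<lceil>V x\<rceil>"] by eventually_elim linarith
    qed
    show "AE x in sphere_prob. norm (min (V x) (real N) * (\<psi> x)^2) \<le> V x * (\<psi> x)^2" for N
      using V(2) by (intro AE_I2) (auto simp: space_sphere_prob abs_mult intro!: mult_right_mono)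
  qed measurable
  then show "(LINT x|sphere_prob. V x * (\<psi> x)^2) \<le> energy \<psi> + \<Lambda> * sqint sphere_prob \<psi>"
    by (rule LIMSEQ_le_const2) (use form_boundD[OF bound \<psi>] in blast)
qed

text \<open>
  Only smooth trial functions have to be tested: for a general element of the form domain the
  potential term passes to the limit by Fatou's lemma.
\<close>

lemma lambda1_sphere_ge:
  fixes V :: "'a::euclidean_space \<Rightarrow> real"
  assumes V: "V \<in> borel_measurable sphere_measure" "\<And>x. x \<in> sphere 0 1 \<Longrightarrow> 0 \<le> V x" "integrable sphere_prob V"
    and bound: "form_bound V \<Lambda>"
  shows "- \<Lambda> \<le> lambda1_sphere V" "lambda1_sphere V \<le> - (LINT x|sphere_prob. V x)"
proof -
  let ?S = "{(sqnorm sphere_prob g) - (LINT x|sphere_prob. V x * (u x)^2) | u g.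
     H1_sphere u g \<and> integrable sphere_prob (\<lambda>x. V x * (u x)^2) \<and> sqint sphere_prob u = 1}"
  have [measurable]: "V \<in> borel_measurable sphere_prob" using V by (simp add: measurable_sphere_prob)
  have "- (LINT x|sphere_prob. V x) \<in> ?S"
    using H1_sphere_const[of 1] V(3)
    by (intro CollectI exI[of _ "\<lambda>_. 1"] exI[of _ "\<lambda>_. 0"]) (auto simp: space_sphere_prob measure_sphere_prob)
  moreover have lower: "- \<Lambda> \<le> z" if zS: "z \<in> ?S" for z
  proof -
    obtain u g where z: "z = sqnorm sphere_prob g - (LINT x|sphere_prob. V x * (u x)^2)"
      and ug: "H1_sphere u g" and int: "integrable sphere_prob (\<lambda>x. V x * (u x)^2)"
      and u1: "sqint sphere_prob u = 1"
      using zS by blast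
    obtain \<psi> where \<psi>: "\<And>n. smooth (\<psi> n)" "L2_limit sphere_prob \<psi> u"
      "L2_limit sphere_prob (\<lambda>n. tangential_grad (\<psi> n)) g" using H1_sphere_obtain[OF ug] by metis
    obtain r where r: "strict_mono r" "AE x in sphere_prob. (\<lambda>n. \<psi> (r n) x) \<longlonglongrightarrow> u x"
      using L2_limit_AE_subseq[OF \<psi>(2)] by metis
    define E where "E n = energy (\<psi> (r n)) + \<Lambda> * sqint sphere_prob (\<psi> (r n))" for n
    have E_lim: "E \<longlonglongrightarrow> sqnorm sphere_prob g + \<Lambda> * 1"
      unfolding E_def u1[symmetric]
    proof (intro tendsto_add tendsto_mult tendsto_const)
      show "(\<lambda>n. energy (\<psi> (r n))) \<longlonglongrightarrow> sqnorm sphere_prob g"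
        unfolding energy_def using L2_limit_norm[OF L2_limit_subseq[OF \<psi>(3) r(1)]] .
      show "(\<lambda>n. sqint sphere_prob (\<psi> (r n))) \<longlonglongrightarrow> sqint sphere_prob u"
        using L2_limit_norm[OF L2_limit_subseq[OF \<psi>(2) r(1)]] by simp
    qed
    have [measurable]: "\<psi> n \<in> borel_measurable sphere_prob" for n
      by (rule L2_measurable[OF L2_limitD(2)[OF \<psi>(2)]])
    have nn: "(\<integral>\<^sup>+x. ennreal (V x * (\<psi> (r n) x)^2) \<partial>sphere_prob) \<le> ennreal (E n)" for n
    proof -
      have i: "integrable sphere_prob (\<lambda>x. V x * (\<psi> (r n) x)^2)"
        by (rule integrable_mult_smooth[OF V(1,3) \<psi>(1)])
      have "(\<integral>\<^sup>+x. ennreal (V x * (\<psi> (r n) x)^2) \<partial>sphere_prob) = ennreal (LINT x|sphere_prob. V x * (\<psi> (r n) x)^2)"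
        using V(2) by (intro nn_integral_eq_integral i AE_I2) (auto simp: space_sphere_prob)
      then show ?thesis unfolding E_def using form_boundD[OF bound \<psi>(1)] by (simp add: ennreal_leI)
    qed
    have "ennreal (LINT x|sphere_prob. V x * (u x)^2) = (\<integral>\<^sup>+x. ennreal (V x * (u x)^2) \<partial>sphere_prob)"
      using V(2) by (intro nn_integral_eq_integral[symmetric] int AE_I2) (auto simp: space_sphere_prob)
    also have "\<dots> = (\<integral>\<^sup>+x. liminf (\<lambda>n. ennreal (V x * (\<psi> (r n) x)^2)) \<partial>sphere_prob)"
    proof (rule nn_integral_cong_AE, use r(2) in \<open>rule AE_mp\<close>, intro AE_I2 impI)
      fix x assume "(\<lambda>n. \<psi> (r n) x) \<longlonglongrightarrow> u x"
      then have "(\<lambda>n. ennreal (V x * (\<psi> (r n) x)^2)) \<longlonglongrightarrow> ennreal (V x * (u x)^2)" by (intro tendsto_intros)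
      then show "ennreal (V x * (u x)^2) = liminf (\<lambda>n. ennreal (V x * (\<psi> (r n) x)^2))"
        by (rule lim_imp_Liminf[OF sequentially_bot, symmetric])
    qed
    also have "\<dots> \<le> liminf (\<lambda>n. \<integral>\<^sup>+x. ennreal (V x * (\<psi> (r n) x)^2) \<partial>sphere_prob)"
      by (rule nn_integral_liminf) measurable
    also have "\<dots> \<le> liminf (\<lambda>n. ennreal (E n))" by (intro Liminf_mono always_eventually allI nn)
    also have "\<dots> = ennreal (sqnorm sphere_prob g + \<Lambda> * 1)"
      using E_lim by (intro lim_imp_Liminf tendsto_ennrealI) auto
    finally have *: "ennreal (LINT x|sphere_prob. V x * (u x)^2) \<le> ennreal (sqnorm sphere_prob g + \<Lambda> * 1)" .
    have "0 \<le> E n" for n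
    proof -
      have "0 \<le> (LINT x|sphere_prob. V x * (\<psi> (r n) x)^2)"
        using V(2) by (intro integral_nonneg_AE AE_I2) (auto simp: space_sphere_prob)
      then show ?thesis unfolding E_def using form_boundD[OF bound \<psi>(1)] by (rule order_trans)
    qed
    then have "0 \<le> sqnorm sphere_prob g + \<Lambda> * 1"
      using E_lim by (intro LIMSEQ_le_const) auto
    with * show ?thesis unfolding z by (simp add: ennreal_le_iff)
  qed
  ultimately show "- \<Lambda> \<le> lambda1_sphere V" "lambda1_sphere V \<le> - (LINT x|sphere_prob. V x)"
    unfolding lambda1_sphere_def by (auto intro!: cInf_greatest cInf_lower bdd_belowI[of _ "- \<Lambda>"])
qed

lemma lambda1_sphere_abs_le:
  fixes V :: "'a::euclidean_space \<Rightarrow> real"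
  assumes V: "V \<in> borel_measurable sphere_measure" "\<And>x. x \<in> sphere 0 1 \<Longrightarrow> 0 \<le> V x" "integrable sphere_prob V"
    and bound: "form_bound V \<Lambda>"
  shows "\<bar>lambda1_sphere V\<bar> \<le> \<Lambda>"
proof -
  have "0 \<le> (LINT x|sphere_prob. V x)"
    using V(2) by (intro integral_nonneg_AE AE_I2) (auto simp: space_sphere_prob)
  with lambda1_sphere_ge[OF assms] show ?thesis by linarith
qed

lemma lambda1_sphere_const:
  fixes \<mu> :: real
  assumes "\<mu> \<ge> 0" shows "lambda1_sphere (\<lambda>_::'a::euclidean_space. \<mu>) = - \<mu>"
proof -
  have int: "integrable sphere_prob (\<lambda>_::'a. \<mu>)" by simp
  have bd: "form_bound (\<lambda>_::'a. \<mu>) \<mu>" by (simp add: form_bound_def energy_nonneg)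
  have "- \<mu> \<le> lambda1_sphere (\<lambda>_::'a. \<mu>)" "lambda1_sphere (\<lambda>_::'a. \<mu>) \<le> - (LINT x|(sphere_prob :: 'a measure). \<mu>)"
    by (rule lambda1_sphere_ge[OF borel_measurable_const assms int bd])+
  then show ?thesis unfolding integral_sphere_const by simp
qed

lemma nonneg_Lp_integrable:
  fixes V :: "'a::euclidean_space \<Rightarrow> real"
  assumes V: "V \<in> nonneg_Lp p" and p: "p \<ge> 1"
  shows "V \<in> borel_measurable sphere_measure" "\<And>x. x \<in> sphere 0 1 \<Longrightarrow> 0 \<le> V x" "integrable sphere_prob V"
    and "integrable sphere_prob (\<lambda>x. V x powr p)"
proof -
  show Vm: "V \<in> borel_measurable sphere_measure" and V0: "\<And>x. x \<in> sphere 0 1 \<Longrightarrow> 0 \<le> V x"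
    using V by (auto simp: nonneg_Lp_def)
  have Vp: "integrable sphere_measure (\<lambda>x. V x powr p)" using V by (auto simp: nonneg_Lp_def)
  have "(\<lambda>x. V x powr p) \<in> borel_measurable sphere_measure" using Vm by measurable
  then show Vp': "integrable sphere_prob (\<lambda>x. V x powr p)" using Vp integrable_sphere_prob by blast
  show "integrable sphere_prob V"
  proof (rule Bochner_Integration.integrable_bound)
    show "integrable sphere_prob (\<lambda>x. 1 + V x powr p)" using Vp' by simp
    show "V \<in> borel_measurable sphere_prob" using Vm by (simp add: measurable_sphere_prob)
    show "AE x in sphere_prob. norm (V x) \<le> norm (1 + V x powr p)"
    proof (rule AE_I2)
      fix x :: 'a assume "x \<in> space sphere_prob"
      then have v: "0 \<le> V x" using V0 by (simp add: space_sphere_prob)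
      show "norm (V x) \<le> norm (1 + V x powr p)"
      proof (cases "V x \<le> 1")
        case True then show ?thesis using v by (simp add: add_increasing2)
      next
        case False
        then have "V x powr 1 \<le> V x powr p" using p by (intro powr_mono) auto
        then show ?thesis using v False by simp
      qed
    qed
  qed
qed


section \<open>Localisation on small caps\<close>

lemma derivative_gnomonic:
  fixes e :: "'a::euclidean_space" and J :: "'b::euclidean_space \<Rightarrow> 'a"
  assumes e: "norm e = 1" and J: "linear J" "\<And>y. norm (J y) = norm y" "\<And>y. e \<bullet> J y = 0"
  defines "\<rho> \<equiv> \<lambda>y. sqrt (1 + (norm y)^2)" and "s \<equiv> \<lambda>y. sgn (e + J y)"
  shows "smooth s"
    and "(s has_derivative (\<lambda>h. (1 / \<rho> y) *\<^sub>R (J h - (s y \<bullet> J h) *\<^sub>R s y))) (at y)"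
    and "s y \<bullet> e = 1 / \<rho> y" and "norm (s y) = 1" and "\<rho> y \<ge> 1"
proof -
  have bl: "bounded_linear J" using J(1) by (simp add: linear_conv_bounded_linear)
  have nrm: "norm (e + J y) = \<rho> y" for y
    using norm_add_hyperplane[OF e J(2,3), of 1 y] by (simp add: \<rho>_def)
  have \<rho>1: "\<rho> y \<ge> 1" for y by (simp add: \<rho>_def)
  have \<rho>: "\<rho> y > 0" for y using \<rho>1[of y] by linarith
  have s_eq: "s y = (1 / \<rho> y) *\<^sub>R (e + J y)" for y
    unfolding s_def sgn_div_norm nrm by (simp add: inverse_eq_divide)
  have s_powr: "s = (\<lambda>y. ((1 + y \<bullet> y) powr (- 1 / 2)) *\<^sub>R (e + J y))"
  proof (rule ext)
    fix y
    have "(1 + y \<bullet> y) powr (- 1 / 2) = 1 / \<rho> y"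
      by (simp add: \<rho>_def powr_minus powr_half_sqrt power2_norm_eq_inner inverse_eq_divide add_nonneg_nonneg)
    then show "s y = ((1 + y \<bullet> y) powr (- 1 / 2)) *\<^sub>R (e + J y)" by (simp add: s_eq)
  qed
  show "smooth s"
    unfolding s_powr
  proof (intro smooth_scaleR smooth_powr smooth_add smooth_const smooth_inner)
    show "smooth (\<lambda>y::'b. y)" by (rule smooth_bounded_linear) (rule bounded_linear_ident)
    show "smooth J" by (rule smooth_bounded_linear[OF bl])
    show "0 < 1 + x \<bullet> x" for x :: 'b by (simp add: add_pos_nonneg)
  qed (rule smooth_bounded_linear, rule bounded_linear_ident)
  have d\<rho>: "(\<rho> has_derivative (\<lambda>h. (y \<bullet> h) / \<rho> y)) (at y)"
  proof -
    have "((\<lambda>y. sqrt (1 + y \<bullet> y)) has_derivative (\<lambda>h. (y \<bullet> h + h \<bullet> y) * (inverse (sqrt (1 + y \<bullet> y)) / 2))) (at y)"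
      by (rule has_derivative_real_sqrt[THEN has_derivative_eq_rhs])
         (auto intro!: derivative_eq_intros simp: add_pos_nonneg)
    then show ?thesis
      unfolding \<rho>_def power2_norm_eq_inner by (simp add: inner_commute inverse_eq_divide)
  qed
  have dJ: "((\<lambda>y. e + J y) has_derivative J) (at y)"
    using has_derivative_add[OF has_derivative_const[of e] bounded_linear_imp_has_derivative[OF bl]] by simp
  have sJ: "s y \<bullet> J h = (y \<bullet> h) / \<rho> y" for h
    unfolding s_eq by (simp add: inner_add_left J linear_isometry_inner[OF J(1,2)])
  have "((\<lambda>y. inverse (\<rho> y) *\<^sub>R (e + J y)) has_derivative
      (\<lambda>h. inverse (\<rho> y) *\<^sub>R J h + (- (inverse (\<rho> y) * ((y \<bullet> h) / \<rho> y) * inverse (\<rho> y))) *\<^sub>R (e + J y))) (at y)"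
    using has_derivative_scaleR[OF Deriv.has_derivative_inverse[OF _ d\<rho>] dJ] \<rho>[of y] by simp
  moreover have "inverse (\<rho> y) *\<^sub>R J h + (- (inverse (\<rho> y) * ((y \<bullet> h) / \<rho> y) * inverse (\<rho> y))) *\<^sub>R (e + J y)
      = (1 / \<rho> y) *\<^sub>R (J h - (s y \<bullet> J h) *\<^sub>R s y)" for h
    unfolding sJ unfolding s_eq by (simp add: scaleR_diff_right divide_inverse mult_ac)
  moreover have "(\<lambda>y. inverse (\<rho> y) *\<^sub>R (e + J y)) = s" by (auto simp: s_eq inverse_eq_divide)
  ultimately show "(s has_derivative (\<lambda>h. (1 / \<rho> y) *\<^sub>R (J h - (s y \<bullet> J h) *\<^sub>R s y))) (at y)" by simp
  have "e \<bullet> e = 1" using e by (simp add: norm_eq_1)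
  then show "s y \<bullet> e = 1 / \<rho> y" unfolding s_eq using J(3)[of y] by (simp add: inner_add_left inner_commute[of "J y" e])
  show "norm (s y) = 1" unfolding s_def using nrm[of y] \<rho>[of y] by (simp add: norm_sgn) (metis norm_zero less_irrefl)
  show "\<rho> y \<ge> 1" by (rule \<rho>1)
qed

text \<open>
  The derivative of the projection is \<open>1 / \<rho> \<le> 1\<close> times an orthogonal projection of \<open>J\<close>, so lengths do not
  increase, and neither do gradients of functions pulled back.
\<close>

lemma grad_gnomonic_le:
  fixes e :: "'a::euclidean_space" and J :: "'b::euclidean_space \<Rightarrow> 'a"
  assumes e: "norm e = 1" and J: "linear J" "\<And>y. norm (J y) = norm y" "\<And>y. e \<bullet> J y = 0"
    and w: "smooth w"
  shows "norm (grad (\<lambda>y. w (sgn (e + J y))) y) \<le> norm (tangential_grad w (sgn (e + J y)))"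
proof -
  define \<rho> where "\<rho> y = sqrt (1 + (norm y)^2)" for y :: 'b
  define s where "s y = sgn (e + J y)" for y
  note G = derivative_gnomonic[OF e J, folded \<rho>_def s_def]
  define g where "g = grad (\<lambda>y. w (s y)) y"
  have sm: "smooth (\<lambda>y. w (s y))" by (rule smooth_compose[OF w G(1)])
  have "((\<lambda>y. w (s y)) has_derivative (\<lambda>h. grad w (s y) \<bullet> ((1 / \<rho> y) *\<^sub>R (J h - (s y \<bullet> J h) *\<^sub>R s y)))) (at y)"
    using diff_chain_at[OF G(2) smooth_grad_has_derivative[OF w]] by (simp add: o_def)
  from has_derivative_unique[OF smooth_grad_has_derivative[OF sm] this]
  have "g \<bullet> g = grad w (s y) \<bullet> ((1 / \<rho> y) *\<^sub>R (J g - (s y \<bullet> J g) *\<^sub>R s y))"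
    unfolding g_def by (metis (no_types, lifting))
  also have "\<dots> = (1 / \<rho> y) * (tangential_grad w (s y) \<bullet> J g)"
    by (simp add: tangential_grad_def inner_diff_left inner_diff_right inner_commute algebra_simps)
  also have "\<dots> \<le> 1 * (norm (tangential_grad w (s y)) * norm (J g))"
  proof -
    have "(1 / \<rho> y) * (tangential_grad w (s y) \<bullet> J g) \<le> (1 / \<rho> y) * (norm (tangential_grad w (s y)) * norm (J g))"
      using G(5)[of y] norm_cauchy_schwarz by (intro mult_left_mono) auto
    also have "\<dots> \<le> 1 * (norm (tangential_grad w (s y)) * norm (J g))"
      using G(5)[of y] by (intro mult_right_mono) auto
    finally show ?thesis .
  qed
  finally have "norm g * norm g \<le> norm (tangential_grad w (s y)) * norm g"
    by (simp add: J power2_norm_eq_inner[symmetric] power2_eq_square)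
  then have "norm g \<le> norm (tangential_grad w (s y))"
    by (cases "g = 0") (simp_all add: mult_le_cancel_right)
  then show ?thesis by (simp add: g_def s_def)
qed

text \<open>
  The density \<open>\<rho>\<^sup>-\<^sup>d\<^sup>-\<^sup>1\<close> of the projected measure lies between \<open>1 / \<kappa>\<close> and \<open>1\<close> over the cap. The potential
  term on the left is therefore at most its Euclidean counterpart, and each Euclidean integral on the right is at most \<open>\<kappa>\<close>
  times the one on the cap.
\<close>

lemma cap_form_bound:
  fixes e :: "'a::euclidean_space" and V :: "'a \<Rightarrow> real"
  assumes dim: "DIM('a) = DIM('b::euclidean_space) + 1" and e: "norm e = 1" and c: "0 < c" "c < 1"
    and KLT: "KLT_const TYPE('b) \<gamma> = ennreal L" and L: "L \<ge> 0" and \<gamma>: "\<gamma> > 0"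
    and w: "smooth w" and supp: "\<And>x. x \<in> sphere 0 1 \<Longrightarrow> x \<bullet> e \<le> c \<Longrightarrow> w x = 0"
    and V: "V \<in> borel_measurable sphere_measure" "\<And>x. x \<in> sphere 0 1 \<Longrightarrow> 0 \<le> V x" "\<And>x. x \<in> sphere 0 1 \<Longrightarrow> V x \<le> B"
  defines "\<kappa> \<equiv> (1 / c) ^ DIM('a)" and "p \<equiv> \<gamma> + DIM('b) / 2"
  shows "(LINT x|sphere_measure. V x * (w x)^2) \<le> \<kappa> * sqnorm sphere_measure (tangential_grad w)
    + \<kappa> * (L * (\<kappa> * (LINT x|sphere_measure. V x powr p))) powr (1 / \<gamma>) * sqint sphere_measure w"
proof -
  obtain J :: "'b \<Rightarrow> 'a" where J: "linear J" "\<And>y. norm (J y) = norm y" "\<And>y. e \<bullet> J y = 0"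
    using hyperplane_isometry[OF dim e] by metis
  define \<rho> where "\<rho> y = sqrt (1 + (norm y)^2)" for y :: 'b
  define s where "s y = sgn (e + J y)" for y
  let ?w = "\<lambda>y. ennreal (1 / \<rho> y ^ DIM('a))"
  note G = derivative_gnomonic[OF e J, folded \<rho>_def s_def]
  have p: "p > 0" using \<gamma> by (simp add: p_def add_pos_nonneg)
  have B: "B \<ge> 0" using V(2,3)[of e] e by (force simp: dist_norm)
  have \<kappa>: "\<kappa> > 0" using c by (simp add: \<kappa>_def)
  have s_sphere: "s y \<in> sphere 0 1" for y using G(4)[of y] by simp
  have [measurable]: "J \<in> borel_measurable borel"
    by (rule linear_borel_measurable) (rule J(1))
  have [measurable]: "\<rho> \<in> borel_measurable borel" unfolding \<rho>_def by measurable
  have ne: "e + J y \<noteq> 0" for y using G(4)[of y] by (auto simp: s_def)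
  have ext: "sphere_ext F (e + J y) = F (s y)" for F :: "'a \<Rightarrow> 'c::zero" and y
    using ne[of y] by (simp add: sphere_ext_def s_def)
  have meas: "(\<lambda>y. F (s y)) \<in> borel_measurable borel" if "F \<in> borel_measurable sphere_measure" for F :: "'a \<Rightarrow> 'c::{topological_space, zero}"
  proof -
    have [measurable]: "sphere_ext F \<in> borel_measurable borel" by (rule sphere_ext_measurable[OF that])
    have "(\<lambda>y. sphere_ext F (e + J y)) \<in> borel_measurable borel" by measurable
    then show ?thesis by (simp add: ext)
  qed
  have inner_e: "continuous_on S (\<lambda>x. x \<bullet> e)" for S by (intro continuous_intros)
  have cap_meas: "(\<lambda>x. indicator {x. c \<le> x \<bullet> e} x :: ennreal) \<in> borel_measurable sphere_measure"
  proof -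
    have [measurable]: "(\<lambda>x. x \<bullet> e) \<in> borel_measurable sphere_measure" by (rule sphere_continuous_measurable[OF inner_e])
    have "(\<lambda>x. if c \<le> x \<bullet> e then 1 else 0 :: ennreal) \<in> borel_measurable sphere_measure" by measurable
    then show ?thesis by (simp add: indicator_def of_bool_def)
  qed
  have cap: "c \<le> s y \<bullet> e \<longleftrightarrow> \<rho> y \<le> 1 / c" for y
    unfolding G(3) using c G(5)[of y] by (simp add: field_simps)
  \<comment> \<open>Over the cap the projection increases volumes by at most the factor \<open>\<kappa>\<close>.\<close>
  have pull: "(NN y. F (s y) * indicator {y. \<rho> y \<le> 1 / c} y) \<le> ennreal \<kappa> * (\<integral>\<^sup>+x. F x \<partial>sphere_measure)"
    if F: "F \<in> borel_measurable sphere_measure" for F :: "'a \<Rightarrow> ennreal"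
  proof -
    define F' where "F' x = F x * indicator {x. c \<le> x \<bullet> e} x" for x
    have F': "F' \<in> borel_measurable sphere_measure"
      unfolding F'_def by (rule borel_measurable_times_ennreal[OF F cap_meas])
    have "F (s y) * indicator {y. \<rho> y \<le> 1 / c} y \<le> ennreal \<kappa> * (F' (s y) * ?w y)" for y
    proof (cases "\<rho> y \<le> 1 / c")
      case True
      have "1 \<le> \<kappa> * (1 / \<rho> y ^ DIM('a))"
        unfolding \<kappa>_def using True G(5)[of y] by (simp add: power_mono)
      then have "ennreal 1 \<le> ennreal (\<kappa> * (1 / \<rho> y ^ DIM('a)))" by (rule ennreal_leI)
      also have "\<dots> = ennreal \<kappa> * ?w y" using \<kappa> G(5)[of y] by (intro ennreal_mult) auto
      finally have "F (s y) * 1 \<le> F (s y) * (ennreal \<kappa> * ?w y)"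
        by (intro mult_left_mono) auto
      also have "\<dots> = ennreal \<kappa> * (F' (s y) * ?w y)"
        using True cap[of y] by (simp add: F'_def mult_ac)
      finally show ?thesis using True by simp
    qed simp
    then have "(NN y. F (s y) * indicator {y. \<rho> y \<le> 1 / c} y)
        \<le> (NN y. ennreal \<kappa> * (F' (s y) * ?w y))"
      by (intro nn_integral_mono)
    also have "\<dots> = ennreal \<kappa> * (NN y. F' (s y) * ?w y)"
    proof (rule nn_integral_cmult)
      have [measurable]: "(\<lambda>y. F' (s y)) \<in> borel_measurable borel" by (rule meas[OF F'])
      show "(\<lambda>y. F' (s y) * ?w y) \<in> borel_measurable lborel" by measurable
    qed
    also have "(NN y. F' (s y) * ?w y) = (\<integral>\<^sup>+x. F' x \<partial>sphere_measure)"
      unfolding s_def \<rho>_def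
      by (rule nn_integral_gnomonic[OF dim e J F', symmetric]) (use c in \<open>simp add: F'_def\<close>)
    also have "\<dots> \<le> (\<integral>\<^sup>+x. F x \<partial>sphere_measure)"
      by (intro nn_integral_mono) (simp add: F'_def indicator_def)
    finally show ?thesis by (simp add: mult_left_mono)
  qed
  define v where "v y = w (s y)" for y
  have v_zero: "v y = 0" if "\<rho> y \<ge> 1 / c" for y
  proof -
    have "s y \<bullet> e \<le> c" unfolding G(3) using that c G(5)[of y] by (simp add: field_simps)
    then show ?thesis unfolding v_def by (rule supp[OF s_sphere])
  qed
  have \<rho>_cont: "continuous_on S \<rho>" for S unfolding \<rho>_def by (intro continuous_intros)
  define K where "K = {y. \<rho> y \<le> 1 / c}"
  have "norm y \<le> \<rho> y" for y unfolding \<rho>_def by (intro real_le_rsqrt) simp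
  then have "norm y \<le> 1 / c" if "\<rho> y \<le> 1 / c" for y using that order_trans by blast
  then have K_sub: "K \<subseteq> cball 0 (1 / c)" unfolding K_def by auto
  have "closed K" unfolding K_def by (intro closed_Collect_le \<rho>_cont continuous_on_const)
  then have K: "compact K" using K_sub bounded_subset[OF bounded_cball] by (auto simp: compact_eq_bounded_closed)
  have v_smooth: "smooth v" unfolding v_def by (rule smooth_compose[OF w G(1)])
  have v_K: "v y = 0" if "y \<notin> K" for y using that v_zero by (auto simp: K_def)
  have v: "test_fun v" unfolding test_fun_def using v_smooth K v_K by blast
  have grad_K: "grad v y = 0" if "y \<notin> K" for y
  proof (rule has_derivative_inner_imp_grad)
    have "open (- K)" using K by (simp add: compact_imp_closed open_Compl)
    then have "(v has_derivative (\<lambda>h. 0)) (at y)"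
      by (rule has_derivative_transform_within_open[OF has_derivative_const[of 0]]) (use that v_K in auto)
    then show "(v has_derivative (\<lambda>h. 0 \<bullet> h)) (at y)" by simp
  qed
  define \<phi> where "\<phi> y = V (s y) * indicator K y" for y
  have K_meas [measurable]: "K \<in> sets borel" using \<open>closed K\<close> by (rule borel_closed)
  have [measurable]: "(\<lambda>y. V (s y)) \<in> borel_measurable borel" by (rule meas[OF V(1)])
  interpret potential_well \<phi> B "1 / c + 1"
  proof
    show "\<phi> \<in> borel_measurable borel" unfolding \<phi>_def by measurable
    show "0 \<le> \<phi> y" "\<phi> y \<le> B" for y using V(2,3)[OF s_sphere[of y]] B by (auto simp: \<phi>_def indicator_def)
    show "\<phi> y = 0" if "y \<notin> ball 0 (1 / c + 1)" for y
      using that K_sub by (fastforce simp: \<phi>_def indicator_def)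
  qed
  note vL = test_fun_L2[OF v]
  have w_cont: "continuous_on S w" for S using w by (rule smooth_continuous)
  have tg_cont: "continuous_on S (tangential_grad w)" for S by (rule tangential_grad_continuous[OF w])
  have est: "(LBINT y. f y) \<le> \<kappa> * (LINT x|sphere_measure. F x)"
    if f: "f \<in> borel_measurable borel" "\<And>y. 0 \<le> f y" "\<And>y. f y \<le> F (s y) * indicator K y"
      and F: "integrable sphere_measure F" "\<And>x. x \<in> sphere 0 1 \<Longrightarrow> 0 \<le> F x"
    for f :: "'b \<Rightarrow> real" and F
  proof -
    have Fm: "(\<lambda>x. ennreal (F x)) \<in> borel_measurable sphere_measure" using F(1) by simp
    have "(NN y. ennreal (f y)) \<le> (NN y. ennreal (F (s y)) * indicator {y. \<rho> y \<le> 1 / c} y)"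
    proof (rule nn_integral_mono)
      fix y
      have "ennreal (f y) \<le> ennreal (F (s y) * indicator K y)" by (rule ennreal_leI[OF f(3)])
      then show "ennreal (f y) \<le> ennreal (F (s y)) * indicator {y. \<rho> y \<le> 1 / c} y"
        by (auto simp: K_def indicator_def split: if_splits)
    qed
    also have "\<dots> \<le> ennreal \<kappa> * (\<integral>\<^sup>+x. ennreal (F x) \<partial>sphere_measure)" by (rule pull[OF Fm])
    also have "(\<integral>\<^sup>+x. ennreal (F x) \<partial>sphere_measure) = ennreal (LINT x|sphere_measure. F x)"
      using F by (intro nn_integral_eq_integral AE_I2) auto
    also have "ennreal \<kappa> * \<dots> = ennreal (\<kappa> * (LINT x|sphere_measure. F x))"
      using \<kappa> F(2) by (intro ennreal_mult[symmetric] integral_nonneg_AE AE_I2) auto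
    finally have *: "(NN y. ennreal (f y)) \<le> ennreal (\<kappa> * (LINT x|sphere_measure. F x))" .
    have "integrable lborel f"
      by (rule integrableI_bounded) (use f(1,2) order_le_less_trans[OF *] in auto)
    then have "(NN y. ennreal (f y)) = ennreal (LBINT y. f y)"
      using f(2) by (intro nn_integral_eq_integral) auto
    moreover have "0 \<le> \<kappa> * (LINT x|sphere_measure. F x)"
      using \<kappa> F(2) by (intro mult_nonneg_nonneg integral_nonneg_AE AE_I2) auto
    ultimately show ?thesis using * by (simp add: ennreal_le_iff)
  qed
  have 1: "sqnorm lborel (grad v) \<le> \<kappa> * sqnorm sphere_measure (tangential_grad w)"
  proof (rule est)
    show "(\<lambda>y. (norm (grad v y))^2) \<in> borel_measurable borel" using L2_integrable[OF vL(2)] by simp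
    show "integrable sphere_measure (\<lambda>x. (norm (tangential_grad w x))^2)"
      by (intro sphere_continuous_integrable continuous_intros tg_cont)
    show "(norm (grad v y))^2 \<le> (norm (tangential_grad w (s y)))^2 * indicator K y" for y
      using grad_gnomonic_le[OF e J w, of y] grad_K[of y]
      by (cases "y \<in> K") (auto simp: v_def[abs_def] s_def[abs_def] intro!: power_mono)
  qed auto
  have 2: "sqint lborel v \<le> \<kappa> * sqint sphere_measure w"
  proof (rule est)
    show "(\<lambda>y. (v y)^2) \<in> borel_measurable borel" using L2_real[OF vL(1)] by simp
    show "integrable sphere_measure (\<lambda>x. (w x)^2)"
      by (intro sphere_continuous_integrable continuous_intros w_cont)
    show "(v y)^2 \<le> (w (s y))^2 * indicator K y" for y
      using v_K[of y] by (cases "y \<in> K") (auto simp: v_def)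
  qed auto
  have Vp_int: "integrable sphere_measure (\<lambda>x. V x powr p)"
  proof (rule sphere_bounded_integrable)
    show "(\<lambda>x. V x powr p) \<in> borel_measurable sphere_measure" using V(1) by measurable
    show "\<bar>V x powr p\<bar> \<le> B powr p" if "x \<in> sphere 0 1" for x
      using V(2,3)[OF that] p by (simp add: powr_mono2)
  qed
  have 3: "(LBINT y. \<phi> y powr p) \<le> \<kappa> * (LINT x|sphere_measure. V x powr p)"
  proof (rule est)
    show "(\<lambda>y. \<phi> y powr p) \<in> borel_measurable borel" by measurable
    show "\<phi> y powr p \<le> V (s y) powr p * indicator K y" for y
      by (cases "y \<in> K") (auto simp: \<phi>_def)
  qed (use Vp_int in auto)
  have Vw_int: "integrable sphere_measure (\<lambda>x. V x * (w x)^2)"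
    by (rule bounded_mult_smooth_integrable[OF V w])
  have 4: "(LINT x|sphere_measure. V x * (w x)^2) \<le> (LBINT y. \<phi> y * (v y)^2)"
  proof -
    have Vw0: "0 \<le> V x * (w x)^2" if "x \<in> sphere 0 1" for x using V(2)[OF that] by simp
    have "ennreal (LINT x|sphere_measure. V x * (w x)^2) = (\<integral>\<^sup>+x. ennreal (V x * (w x)^2) \<partial>sphere_measure)"
      using Vw0 by (intro nn_integral_eq_integral[symmetric] Vw_int AE_I2) auto
    also have "\<dots> = (NN y. ennreal (V (s y) * (w (s y))^2) * ?w y)"
      unfolding s_def \<rho>_def
    proof (rule nn_integral_gnomonic[OF dim e J])
      show "(\<lambda>x. ennreal (V x * (w x)^2)) \<in> borel_measurable sphere_measure" using Vw_int by simp
      show "ennreal (V x * (w x)^2) = 0" if "x \<in> sphere 0 1" "x \<bullet> e \<le> 0" for x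
        using supp[OF that(1)] that(2) c by simp
    qed
    also have "\<dots> \<le> (NN y. ennreal (\<phi> y * (v y)^2))"
    proof (rule nn_integral_mono)
      fix y
      have eq: "\<phi> y * (v y)^2 = V (s y) * (w (s y))^2"
        using v_K[of y] by (cases "y \<in> K") (auto simp: \<phi>_def v_def)
      have "1 / \<rho> y ^ DIM('a) \<le> 1" using G(5)[of y] by (simp add: one_le_power)
      then have "ennreal (V (s y) * (w (s y))^2) * ?w y \<le> ennreal (V (s y) * (w (s y))^2) * ennreal 1"
        by (intro mult_left_mono ennreal_leI) auto
      then show "ennreal (V (s y) * (w (s y))^2) * ?w y \<le> ennreal (\<phi> y * (v y)^2)"
        by (simp add: eq)
    qed
    also have "\<dots> = ennreal (LBINT y. \<phi> y * (v y)^2)"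
      using \<phi>_nonneg by (intro nn_integral_eq_integral pot_integrable vL) auto
    finally show ?thesis
      using \<phi>_nonneg by (subst (asm) ennreal_le_iff) (auto intro!: integral_nonneg_AE)
  qed
  have "(LINT x|sphere_measure. V x * (w x)^2) \<le> sqnorm lborel (grad v)
      + (L * (LBINT y. \<phi> y powr p)) powr (1 / \<gamma>) * sqint lborel v"
    using 4 KLT_form_bound[OF KLT L \<gamma> v] unfolding p_def by (rule order_trans)
  also have "\<dots> \<le> \<kappa> * sqnorm sphere_measure (tangential_grad w)
    + (L * (\<kappa> * (LINT x|sphere_measure. V x powr p))) powr (1 / \<gamma>) * (\<kappa> * sqint sphere_measure w)"
    using 1 2 3 L \<gamma> by (intro add_mono mult_mono powr_mono2 mult_left_mono) auto
  finally show ?thesis by (simp add: mult_ac)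
qed


section \<open>Gluing the caps together\<close>

lemma smooth_ident: "smooth (\<lambda>x. x)"
  by (rule smooth_bounded_linear) (rule bounded_linear_ident)

lemma tangential_grad_mult:
  "smooth f \<Longrightarrow> smooth g \<Longrightarrow>
    tangential_grad (\<lambda>x. f x * g x) x = f x *\<^sub>R tangential_grad g x + g x *\<^sub>R tangential_grad f x"
  by (simp add: tangential_grad_def grad_mult algebra_simps)

lemma grad_zero_at_max:
  assumes "smooth f" "\<And>y. f y \<le> f x" shows "grad f x = 0"
proof -
  have "(\<lambda>h. grad f x \<bullet> h) = (\<lambda>h. 0)"
    by (rule differential_zero_maxmin[OF _ open_UNIV smooth_grad_has_derivative[OF assms(1)]]) (use assms(2) in auto)
  then have "grad f x \<bullet> grad f x = 0" by meson
  then show ?thesis by simp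
qed

text \<open>
  The squares are normalised by \<open>\<Sum> \<eta>\<^sub>e\<^sup>2 + (|x|\<^sup>2 - 1)\<^sup>2\<close>, which is positive on the whole space. As a result
  the sum of squares of the partition is at most \<open>1\<close> everywhere and is \<open>1\<close> on the sphere, so that its
  gradient vanishes there.
\<close>

lemma sphere_partition:
  fixes c :: real
  assumes c: "c < 1"
  obtains E :: "'a::euclidean_space set" and \<zeta> where "finite E" "\<And>e. e \<in> E \<Longrightarrow> norm e = 1" "\<And>e. smooth (\<zeta> e)"
    "\<And>e x. x \<bullet> e \<le> c \<Longrightarrow> \<zeta> e x = (0::real)" "\<And>x. x \<in> sphere 0 1 \<Longrightarrow> (\<Sum>e\<in>E. (\<zeta> e x)^2) = 1"
    "\<And>x. x \<in> sphere 0 1 \<Longrightarrow> (\<Sum>e\<in>E. \<zeta> e x *\<^sub>R tangential_grad (\<zeta> e) x) = 0"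
proof -
  have "compact (sphere (0::'a) 1)" by simp
  moreover have "open {x. c < x \<bullet> e}" for e :: 'a by (intro open_Collect_less continuous_intros)
  moreover have "sphere 0 1 \<subseteq> (\<Union>e\<in>sphere (0::'a) 1. {x. c < x \<bullet> e})"
    using c by (force simp: norm_eq_1)
  ultimately obtain E where E: "E \<subseteq> sphere (0::'a) 1" "finite E" "sphere 0 1 \<subseteq> (\<Union>e\<in>E. {x. c < x \<bullet> e})"
    by (rule compactE_image)
  define \<eta> where "\<eta> e x = flat_exp 0 (x \<bullet> e - c)" for e x :: 'a
  define D where "D x = (\<Sum>e\<in>E. (\<eta> e x)^2) + (x \<bullet> x - 1)^2" for x :: 'a
  define \<zeta> where "\<zeta> e x = D x powr (- 1 / 2) * \<eta> e x" for e x
  have \<eta>: "smooth (\<eta> e)" for e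
    unfolding \<eta>_def[abs_def] by (intro smooth_compose[OF smooth_flat_exp] smooth_diff smooth_inner smooth_ident smooth_const)
  have D: "smooth D"
    unfolding D_def[abs_def] by (intro smooth_add smooth_sum smooth_power2 \<eta> smooth_diff smooth_inner smooth_ident smooth_const)
  have Dpos: "D x > 0" for x
  proof (cases "x \<in> sphere 0 1")
    case True
    then obtain e where e: "e \<in> E" "c < x \<bullet> e" using E(3) by blast
    then have "0 < (\<Sum>e\<in>E. (\<eta> e x)^2)"
      using flat_exp_pos[of "x \<bullet> e - c" 0] E(2) by (intro sum_pos2[of _ e]) (auto simp: \<eta>_def)
    then show ?thesis unfolding D_def by (rule add_pos_nonneg) simp
  next
    case False
    then have "(x \<bullet> x - 1)^2 > 0" by (simp add: norm_eq_1)
    then show ?thesis unfolding D_def by (intro add_nonneg_pos sum_nonneg) auto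
  qed
  have \<zeta>: "smooth (\<zeta> e)" for e
    unfolding \<zeta>_def[abs_def] by (intro smooth_mult smooth_powr D Dpos \<eta>)
  have "(D x powr (- 1 / 2))^2 = 1 / D x" for x
    using Dpos[of x] by (simp add: power2_eq_square powr_add[symmetric] powr_minus_divide)
  then have sum: "(\<Sum>e\<in>E. (\<zeta> e x)^2) = (D x - (x \<bullet> x - 1)^2) / D x" for x
    unfolding \<zeta>_def power_mult_distrib sum_distrib_left[symmetric] by (simp add: D_def)
  have le: "(\<Sum>e\<in>E. (\<zeta> e x)^2) \<le> 1" for x
    unfolding sum using Dpos[of x] by simp
  have eq: "(\<Sum>e\<in>E. (\<zeta> e x)^2) = 1" if "x \<in> sphere 0 1" for x
    unfolding sum using Dpos[of x] that by (simp add: norm_eq_1)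
  have gz: "(\<Sum>e\<in>E. \<zeta> e x *\<^sub>R grad (\<zeta> e) x) = 0" if x: "x \<in> sphere 0 1" for x
  proof -
    have "((\<lambda>x. \<Sum>e\<in>E. (\<zeta> e x)^2) has_derivative (\<lambda>h. \<Sum>e\<in>E. 2 * \<zeta> e x * (grad (\<zeta> e) x \<bullet> h))) (at x)"
      by (rule has_derivative_sum, rule has_derivative_eq_rhs, rule has_derivative_power[OF smooth_grad_has_derivative[OF \<zeta>]]) auto
    then have "((\<lambda>x. \<Sum>e\<in>E. (\<zeta> e x)^2) has_derivative (\<lambda>h. (2 *\<^sub>R (\<Sum>e\<in>E. \<zeta> e x *\<^sub>R grad (\<zeta> e) x)) \<bullet> h)) (at x)"
      by (simp add: inner_sum_left sum_distrib_left mult.assoc)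
    from has_derivative_inner_imp_grad[OF this]
    have "2 *\<^sub>R (\<Sum>e\<in>E. \<zeta> e x *\<^sub>R grad (\<zeta> e) x) = grad (\<lambda>x. \<Sum>e\<in>E. (\<zeta> e x)^2) x" by simp
    also have "\<dots> = 0"
      by (rule grad_zero_at_max) (use le eq[OF x] in \<open>auto intro!: smooth_sum smooth_power2 \<zeta>\<close>)
    finally show ?thesis by simp
  qed
  show ?thesis
  proof (rule that[of E \<zeta>])
    show "norm e = 1" if "e \<in> E" for e using that E(1) by auto
    show "\<zeta> e x = 0" if "x \<bullet> e \<le> c" for e x using that by (simp add: \<zeta>_def \<eta>_def flat_exp_nonpos)
    show "(\<Sum>e\<in>E. \<zeta> e x *\<^sub>R tangential_grad (\<zeta> e) x) = 0" if "x \<in> sphere 0 1" for x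
    proof -
      have "(\<Sum>e\<in>E. \<zeta> e x *\<^sub>R tangential_grad (\<zeta> e) x) = (\<Sum>e\<in>E. \<zeta> e x *\<^sub>R grad (\<zeta> e) x)
          - (x \<bullet> (\<Sum>e\<in>E. \<zeta> e x *\<^sub>R grad (\<zeta> e) x)) *\<^sub>R x"
        by (simp add: tangential_grad_def scaleR_diff_right sum_subtractf inner_sum_right scaleR_left.sum)
      then show ?thesis by (simp add: gz[OF that])
    qed
  qed (use E \<zeta> eq in auto)
qed

text \<open>
  The cap estimate is applied to \<open>\<kappa> V\<close> and to the pieces \<open>\<zeta>\<^sub>e \<psi>\<close>. The cross terms of
  \<open>\<Sum> |\<nabla>(\<zeta>\<^sub>e \<psi>)|\<^sup>2\<close> cancel, and the price of localisation is the constant bound \<open>C\<close> of \<open>\<Sum> |\<nabla>\<zeta>\<^sub>e|\<^sup>2\<close>.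
\<close>

lemma sphere_form_bound_bounded:
  fixes c L \<gamma> :: real
  assumes dim: "DIM('a::euclidean_space) = DIM('b::euclidean_space) + 1" and c: "0 < c" "c < 1"
    and KLT: "KLT_const TYPE('b) \<gamma> = ennreal L" and L: "L \<ge> 0" and \<gamma>: "\<gamma> > 0"
  defines "\<kappa> \<equiv> (1 / c) ^ DIM('a)" and "p \<equiv> \<gamma> + DIM('b) / 2"
  obtains C where "C \<ge> 0" "\<And>(V :: 'a \<Rightarrow> real) B. V \<in> borel_measurable sphere_measure \<Longrightarrow> (\<And>x. x \<in> sphere 0 1 \<Longrightarrow> 0 \<le> V x) \<Longrightarrow>
    (\<And>x. x \<in> sphere 0 1 \<Longrightarrow> V x \<le> B) \<Longrightarrow>
    form_bound V (C + (L * \<kappa> powr (1 + p) * (LINT x|sphere_measure. V x powr p)) powr (1 / \<gamma>))"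
proof -
  obtain E :: "'a set" and \<zeta> where E: "finite E" "\<And>e. e \<in> E \<Longrightarrow> norm e = 1" and \<zeta>: "\<And>e. smooth (\<zeta> e)"
    and supp: "\<And>e x. x \<bullet> e \<le> c \<Longrightarrow> \<zeta> e x = (0::real)"
    and one: "\<And>x. x \<in> sphere 0 1 \<Longrightarrow> (\<Sum>e\<in>E. (\<zeta> e x)^2) = 1"
    and zero: "\<And>x. x \<in> sphere 0 1 \<Longrightarrow> (\<Sum>e\<in>E. \<zeta> e x *\<^sub>R tangential_grad (\<zeta> e) x) = 0"
    by (rule sphere_partition[OF c(2), where 'a='a]) blast
  have "continuous_on (sphere 0 1) (\<lambda>x. \<Sum>e\<in>E. (norm (tangential_grad (\<zeta> e) x))^2)"
    by (intro continuous_intros tangential_grad_continuous \<zeta>)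
  then obtain C where C: "C \<ge> 0" "\<And>x. x \<in> sphere 0 1 \<Longrightarrow> norm (\<Sum>e\<in>E. (norm (tangential_grad (\<zeta> e) x))^2) \<le> C"
    by (rule sphere_continuous_bounded) blast
  have \<kappa>: "\<kappa> > 0" using c by (simp add: \<kappa>_def)
  have p: "p > 0" using \<gamma> by (simp add: p_def add_pos_nonneg)
  show ?thesis
  proof (rule that[OF C(1)])
    fix V :: "'a \<Rightarrow> real" and B :: real
    assume V: "V \<in> borel_measurable sphere_measure" "\<And>x. x \<in> sphere 0 1 \<Longrightarrow> 0 \<le> V x" "\<And>x. x \<in> sphere 0 1 \<Longrightarrow> V x \<le> B"
    define \<Lambda> where "\<Lambda> = (L * \<kappa> powr (1 + p) * (LINT x|sphere_measure. V x powr p)) powr (1 / \<gamma>)"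
    show "form_bound V (C + (L * \<kappa> powr (1 + p) * (LINT x|sphere_measure. V x powr p)) powr (1 / \<gamma>))"
      unfolding form_bound_def \<Lambda>_def[symmetric]
    proof (intro allI impI)
      fix \<psi> :: "'a \<Rightarrow> real" assume \<psi>: "smooth \<psi>"
      let ?w = "\<lambda>e x. \<zeta> e x * \<psi> x"
      have w: "smooth (?w e)" for e by (intro smooth_mult \<zeta> \<psi>)
      have cint: "integrable sphere_measure f" if "continuous_on UNIV f" for f :: "'a \<Rightarrow> real"
        by (rule sphere_continuous_integrable(2)) (rule continuous_on_subset[OF that subset_UNIV])
      have ig: "integrable sphere_measure (\<lambda>x. (norm (tangential_grad f x))^2)" if "smooth f" for f :: "'a \<Rightarrow> real"
        by (intro cint continuous_intros tangential_grad_continuous that)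
      have i2: "integrable sphere_measure (\<lambda>x. (f x)^2)" if "smooth f" for f :: "'a \<Rightarrow> real"
        by (intro cint continuous_intros smooth_continuous that)
      have iV: "integrable sphere_measure (\<lambda>x. V x * (f x)^2)" if "smooth f" for f :: "'a \<Rightarrow> real"
        by (rule bounded_mult_smooth_integrable[OF V that])
      have piece: "(LINT x|sphere_measure. V x * (?w e x)^2) \<le> sqnorm sphere_measure (tangential_grad (?w e))
          + \<Lambda> * sqint sphere_measure (?w e)" if e: "e \<in> E" for e
      proof -
        have "(LINT x|sphere_measure. (\<kappa> * V x) powr p) = (LINT x|sphere_measure. \<kappa> powr p * V x powr p)"
          using \<kappa> V(2) by (intro Bochner_Integration.integral_cong) (auto simp: powr_mult)
        then have pw: "L * (\<kappa> * (LINT x|sphere_measure. (\<kappa> * V x) powr p)) = L * \<kappa> powr (1 + p) * (LINT x|sphere_measure. V x powr p)"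
          using \<kappa> by (simp add: powr_add)
        have "(LINT x|sphere_measure. (\<kappa> * V x) * (?w e x)^2) \<le> \<kappa> * sqnorm sphere_measure (tangential_grad (?w e))
            + \<kappa> * (L * (\<kappa> * (LINT x|sphere_measure. (\<kappa> * V x) powr p))) powr (1 / \<gamma>) * sqint sphere_measure (?w e)"
          unfolding \<kappa>_def p_def
          by (rule cap_form_bound[OF dim E(2)[OF e] c KLT L \<gamma> w, where B = "\<kappa> * B"])
             (use V \<kappa> supp in \<open>auto simp: \<kappa>_def[symmetric] intro!: mult_left_mono\<close>)
        also have "(LINT x|sphere_measure. (\<kappa> * V x) * (?w e x)^2) = \<kappa> * (LINT x|sphere_measure. V x * (?w e x)^2)"
          by (simp add: mult.assoc)
        finally have "\<kappa> * (LINT x|sphere_measure. V x * (?w e x)^2) \<le> \<kappa> * (sqnorm sphere_measure (tangential_grad (?w e))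
          + \<Lambda> * sqint sphere_measure (?w e))"
          unfolding pw \<Lambda>_def by (simp add: distrib_left mult.assoc)
        then show ?thesis using \<kappa> by (simp only: mult_le_cancel_left_pos)
      qed
      have sum2: "(\<Sum>e\<in>E. (?w e x)^2) = (\<psi> x)^2" if "x \<in> sphere 0 1" for x
        using one[OF that] by (simp add: power_mult_distrib sum_distrib_right[symmetric])
      have sumg: "(\<Sum>e\<in>E. (norm (tangential_grad (?w e) x))^2) \<le> (norm (tangential_grad \<psi> x))^2 + C * (\<psi> x)^2"
        if x: "x \<in> sphere 0 1" for x
      proof -
        let ?g = "tangential_grad \<psi> x" and ?z = "\<lambda>e. tangential_grad (\<zeta> e) x"
        have "(norm (tangential_grad (?w e) x))^2
            = (\<zeta> e x)^2 * (norm ?g)^2 + 2 * \<psi> x * (?g \<bullet> (\<zeta> e x *\<^sub>R ?z e)) + (\<psi> x)^2 * (norm (?z e))^2" for e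
          unfolding tangential_grad_mult[OF \<zeta> \<psi>] power2_norm_eq_inner
          by (simp add: inner_add_left inner_add_right inner_commute power2_eq_square algebra_simps)
        then have "(\<Sum>e\<in>E. (norm (tangential_grad (?w e) x))^2)
            = (\<Sum>e\<in>E. (\<zeta> e x)^2) * (norm ?g)^2 + 2 * \<psi> x * (?g \<bullet> (\<Sum>e\<in>E. \<zeta> e x *\<^sub>R ?z e))
              + (\<psi> x)^2 * (\<Sum>e\<in>E. (norm (?z e))^2)"
          by (simp only: sum.distrib sum_distrib_left sum_distrib_right inner_sum_right)
        also have "\<dots> \<le> (norm ?g)^2 + C * (\<psi> x)^2"
          unfolding one[OF x] zero[OF x] using mult_left_mono[OF order_trans[OF abs_ge_self C(2)[OF x, unfolded real_norm_def]], of "(\<psi> x)^2"]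
          by (simp add: mult.commute)
        finally show ?thesis .
      qed
      have "(LINT x|sphere_measure. V x * (\<psi> x)^2) = (LINT x|sphere_measure. (\<Sum>e\<in>E. V x * (?w e x)^2))"
        by (intro Bochner_Integration.integral_cong) (simp_all add: sum2[symmetric] sum_distrib_left)
      also have "\<dots> = (\<Sum>e\<in>E. \<integral>x. V x * (?w e x)^2 \<partial>sphere_measure)"
        by (rule Bochner_Integration.integral_sum) (rule iV[OF w])
      also have "\<dots> \<le> (\<Sum>e\<in>E. sqnorm sphere_measure (tangential_grad (?w e))
          + \<Lambda> * sqint sphere_measure (?w e))"
        by (intro sum_mono piece)
      also have "\<dots> = (LINT x|sphere_measure. (\<Sum>e\<in>E. (norm (tangential_grad (?w e) x))^2))
          + \<Lambda> * (LINT x|sphere_measure. (\<Sum>e\<in>E. (?w e x)^2))"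
        by (simp only: sum.distrib sum_distrib_left[symmetric] Bochner_Integration.integral_sum[OF ig[OF w]] Bochner_Integration.integral_sum[OF i2[OF w]])
      also have "(LINT x|sphere_measure. (\<Sum>e\<in>E. (?w e x)^2)) = sqint sphere_measure \<psi>"
        by (intro Bochner_Integration.integral_cong) (simp_all add: sum2)
      also have "(LINT x|sphere_measure. (\<Sum>e\<in>E. (norm (tangential_grad (?w e) x))^2))
          \<le> (LINT x|sphere_measure. (norm (tangential_grad \<psi> x))^2 + C * (\<psi> x)^2)"
        using sumg by (intro integral_mono Bochner_Integration.integrable_sum ig w Bochner_Integration.integrable_add
            integrable_mult_right i2 \<psi>) auto
      also have "\<dots> = sqnorm sphere_measure (tangential_grad \<psi>) + C * sqint sphere_measure \<psi>"
        using ig[OF \<psi>] i2[OF \<psi>] by simp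
      finally have main: "(LINT x|sphere_measure. V x * (\<psi> x)^2) \<le> sqnorm sphere_measure (tangential_grad \<psi>)
          + (C + \<Lambda>) * sqint sphere_measure \<psi>" by (simp add: distrib_right)
      show "(LINT x|sphere_prob. V x * (\<psi> x)^2) \<le> energy \<psi> + (C + \<Lambda>) * sqint sphere_prob \<psi>"
        unfolding energy_def
          integral_sphere_prob[OF borel_measurable_integrable[OF iV[OF \<psi>]]]
          integral_sphere_prob[OF borel_measurable_integrable[OF i2[OF \<psi>]]]
          integral_sphere_prob[OF borel_measurable_integrable[OF ig[OF \<psi>]]]
        using divide_right_mono[OF main less_imp_le[OF sphere_area(2)[where 'a='a]]]
        by (simp add: add_divide_distrib)
    qed
  qed
qed

lemma lambda1_sphere_localised:
  fixes c L \<gamma> :: real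
  assumes dim: "DIM('a::euclidean_space) = DIM('b::euclidean_space) + 1" and c: "0 < c" "c < 1"
    and KLT: "KLT_const TYPE('b) \<gamma> = ennreal L" and L: "L \<ge> 0" and \<gamma>: "\<gamma> > 0"
  defines "\<kappa> \<equiv> (1 / c) ^ DIM('a)" and "p \<equiv> \<gamma> + DIM('b) / 2"
  assumes p1: "p \<ge> 1"
  obtains C where "C \<ge> 0" "\<And>(V :: 'a \<Rightarrow> real). V \<in> nonneg_Lp p \<Longrightarrow>
    \<bar>lambda1_sphere V\<bar> \<le> C + (L * \<kappa> powr (1 + p) * (LINT x|sphere_measure. V x powr p)) powr (1 / \<gamma>)"
proof -
  obtain C where C: "C \<ge> 0" and bd: "\<And>(V :: 'a \<Rightarrow> real) B. V \<in> borel_measurable sphere_measure \<Longrightarrow> (\<And>x. x \<in> sphere 0 1 \<Longrightarrow> 0 \<le> V x) \<Longrightarrow>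
    (\<And>x. x \<in> sphere 0 1 \<Longrightarrow> V x \<le> B) \<Longrightarrow>
    form_bound V (C + (L * \<kappa> powr (1 + p) * (LINT x|sphere_measure. V x powr p)) powr (1 / \<gamma>))"
    unfolding \<kappa>_def p_def by (rule sphere_form_bound_bounded[OF dim c KLT L \<gamma>]) blast
  show ?thesis
  proof (rule that[OF C], rule lambda1_sphere_abs_le)
    fix V :: "'a \<Rightarrow> real" assume V: "V \<in> nonneg_Lp p"
    note Vi = nonneg_Lp_integrable[OF V p1]
    show "V \<in> borel_measurable sphere_measure" "\<And>x. x \<in> sphere 0 1 \<Longrightarrow> 0 \<le> V x" "integrable sphere_prob V"
      by (fact Vi)+
    have Vp: "integrable sphere_measure (\<lambda>x. V x powr p)" using V by (simp add: nonneg_Lp_def)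
    have [measurable]: "V \<in> borel_measurable sphere_measure" by (rule Vi(1))
    show "form_bound V (C + (L * \<kappa> powr (1 + p) * (LINT x|sphere_measure. V x powr p)) powr (1 / \<gamma>))"
    proof (rule form_bound_truncate[OF Vi(1-3)])
      fix N :: nat
      let ?V = "\<lambda>x. min (V x) (real N)"
      have "(LINT x|sphere_measure. ?V x powr p) \<le> (LINT x|sphere_measure. V x powr p)"
      proof (rule integral_mono_AE)
        have pw: "?V x powr p \<le> V x powr p" if "x \<in> sphere 0 1" for x
          using Vi(2)[OF that] p1 by (intro powr_mono2) auto
        then show "AE x in sphere_measure. ?V x powr p \<le> V x powr p" by (intro AE_I2) auto
        show "integrable sphere_measure (\<lambda>x. ?V x powr p)"
          by (rule Bochner_Integration.integrable_bound[OF Vp]) (use pw in \<open>auto intro!: AE_I2\<close>)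
      qed (rule Vp)
      then have "(L * \<kappa> powr (1 + p) * (LINT x|sphere_measure. ?V x powr p)) powr (1 / \<gamma>)
          \<le> (L * \<kappa> powr (1 + p) * (LINT x|sphere_measure. V x powr p)) powr (1 / \<gamma>)"
        using L \<gamma> by (intro powr_mono2 mult_left_mono mult_nonneg_nonneg integral_nonneg_AE AE_I2) auto
      then show "form_bound ?V (C + (L * \<kappa> powr (1 + p) * (LINT x|sphere_measure. V x powr p)) powr (1 / \<gamma>))"
        by (intro form_bound_mono[OF bd[of ?V "real N"]]) (use Vi(2) in \<open>auto\<close>)
    qed
  qed
qed

lemma KLT_const_nonzero:
  assumes dim: "DIM('a::euclidean_space) = DIM('b::euclidean_space) + 1" and \<gamma>: "\<gamma> > 0"
    and p: "\<gamma> + DIM('b) / 2 \<ge> 1"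
  shows "KLT_const TYPE('b) \<gamma> \<noteq> 0"
proof
  assume "KLT_const TYPE('b) \<gamma> = 0"
  then have 0: "KLT_const TYPE('b) \<gamma> = ennreal 0" by simp
  \<comment> \<open>With constant \<open>0\<close> the bound would be uniform in \<open>V\<close>, which a large constant potential refutes.\<close>
  obtain C where C: "C \<ge> 0" "\<And>(V :: 'a \<Rightarrow> real). V \<in> nonneg_Lp (\<gamma> + DIM('b) / 2) \<Longrightarrow> \<bar>lambda1_sphere V\<bar> \<le> C"
    by (rule lambda1_sphere_localised[OF dim _ _ 0 order_refl \<gamma> p, of "1 / 2"]) (simp, simp, simp)
  moreover have "(\<lambda>_::'a. C + 1) \<in> nonneg_Lp (\<gamma> + DIM('b) / 2)" using C(1) by (simp add: nonneg_Lp_def)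
  ultimately show False using lambda1_sphere_const[of "C + 1", where 'a='a] by fastforce
qed

lemma INF_tendsto_one:
  fixes F :: "nat \<Rightarrow> real \<Rightarrow> real"
  assumes ge: "\<And>k t. t > 0 \<Longrightarrow> 1 \<le> F k t" and lim: "\<And>k. (F k \<longlongrightarrow> l k) at_top" and l: "l \<longlonglongrightarrow> 1"
  shows "((\<lambda>t. INF k. F k t) \<longlongrightarrow> 1) at_top"
proof (rule order_tendstoI)
  have bdd: "bdd_below (range (\<lambda>k. F k t))" if "t > 0" for t
    using ge[OF that] by (intro bdd_belowI[of _ 1]) auto
  fix a :: real
  {
    assume a: "a < 1"
    show "\<forall>\<^sub>F t in at_top. a < (INF k. F k t)"
      using eventually_gt_at_top[of 0]
    proof eventually_elim
      case (elim t)
      have "1 \<le> (INF k. F k t)" using ge[OF elim] by (intro cINF_greatest) auto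
      with a show ?case by linarith
    qed
  next
    assume a: "1 < a"
    have "\<forall>\<^sub>F k in sequentially. l k < a" using l a by (rule order_tendstoD(2))
    then obtain k where k: "l k < a" using eventually_happens[of _ sequentially] by auto
    show "\<forall>\<^sub>F t in at_top. (INF k. F k t) < a"
      using order_tendstoD(2)[OF lim k] eventually_gt_at_top[of 0]
    proof eventually_elim
      case (elim t)
      have "(INF k. F k t) \<le> F k t" by (rule cINF_lower[OF bdd[OF elim(2)]]) auto
      with elim show ?case by linarith
    qed
  }
qed

lemma Lp_norm_sphere_powr:
  fixes V :: "'a::euclidean_space \<Rightarrow> real"
  assumes V: "V \<in> nonneg_Lp p" and p: "p > 0"
  shows "(LINT x|sphere_prob. V x powr p) = Lp_norm sphere_prob p V powr p"
    and "(LINT x|sphere_measure. V x powr p) = sphere_area TYPE('a) * Lp_norm sphere_prob p V powr p"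
    and "(\<integral>\<^sup>+x. ennreal (V x powr p) \<partial>sphere_measure) = ennreal (sphere_area TYPE('a) * Lp_norm sphere_prob p V powr p)"
proof -
  have V': "\<And>x. x \<in> sphere 0 1 \<Longrightarrow> 0 \<le> V x" "integrable sphere_measure (\<lambda>x. V x powr p)"
    using V by (auto simp: nonneg_Lp_def)
  have "(LINT x|sphere_prob. \<bar>V x\<bar> powr p) = (LINT x|sphere_prob. V x powr p)"
    using V'(1) by (intro Bochner_Integration.integral_cong) (auto simp: space_sphere_prob)
  moreover have "0 \<le> (LINT x|sphere_prob. V x powr p)" by (intro integral_nonneg_AE AE_I2) auto
  ultimately show 1: "(LINT x|sphere_prob. V x powr p) = Lp_norm sphere_prob p V powr p"
    using p by (simp add: Lp_norm_def powr_powr)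
  show 2: "(LINT x|sphere_measure. V x powr p) = sphere_area TYPE('a) * Lp_norm sphere_prob p V powr p"
    using 1 sphere_area(2)[where 'a='a] unfolding integral_sphere_prob[OF borel_measurable_integrable[OF V'(2)]]
    by (simp add: field_simps)
  show "(\<integral>\<^sup>+x. ennreal (V x powr p) \<partial>sphere_measure) = ennreal (sphere_area TYPE('a) * Lp_norm sphere_prob p V powr p)"
    unfolding 2[symmetric] by (intro nn_integral_eq_integral V'(2) AE_I2) auto
qed

text \<open>
  With \<open>M = \<integral> V\<^sup>p\<close>, the localised bound for the distortion \<open>\<kappa>\<close> is \<open>(L M)\<^sup>1\<^sup>/\<^sup>\<gamma>\<close> times a factor that tends to a
  power of \<open>\<kappa>\<close> as \<open>M\<close> grows. The infimum over a sequence of \<open>\<kappa>\<close> decreasing to \<open>1\<close> is the required correction. An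
  infinite constant \<open>L\<close> makes the right-hand side infinite, and \<open>L = 0\<close> is impossible.
\<close>

theorem lambda1_sphere_asymptotic:
  assumes dim: "DIM('a::euclidean_space) = DIM('b::euclidean_space) + 1" and \<gamma>: "\<gamma> > 0"
  defines "p \<equiv> \<gamma> + DIM('b) / 2"
  assumes p1: "p \<ge> 1"
  shows "\<exists>c :: real \<Rightarrow> real. (c \<longlongrightarrow> 1) at_top \<and>
    (\<forall>\<^sub>F \<mu> in at_top. \<forall>V \<in> nonneg_Lp p. Lp_norm sphere_prob p (V :: 'a \<Rightarrow> real) = \<mu> \<longrightarrow>
      ennreal (\<bar>lambda1_sphere V\<bar> powr \<gamma>)
        \<le> ennreal (c \<mu>) * KLT_const TYPE('b) \<gamma> * (\<integral>\<^sup>+x. ennreal (V x powr p) \<partial>sphere_measure))"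
proof (cases "KLT_const TYPE('b) \<gamma> = \<infinity>")
  case True
  have p0: "p > 0" using p1 by simp
  show ?thesis
  proof (intro exI[of _ "\<lambda>_. 1"] conjI tendsto_const eventually_mono[OF eventually_gt_at_top[of 0]] ballI impI)
    fix \<mu> :: real and V :: "'a \<Rightarrow> real"
    assume \<mu>: "\<mu> > 0" and V: "V \<in> nonneg_Lp p" "Lp_norm sphere_prob p V = \<mu>"
    have "sphere_area TYPE('a) * \<mu> powr p > 0" using \<mu> sphere_area(2)[where 'a='a] by simp
    then have "(\<integral>\<^sup>+x. ennreal (V x powr p) \<partial>sphere_measure) \<noteq> 0"
      unfolding Lp_norm_sphere_powr(3)[OF V(1) p0] V(2) by (simp del: ennreal_eq_0_iff add: ennreal_eq_0_iff not_le)
    then show "ennreal (\<bar>lambda1_sphere V\<bar> powr \<gamma>)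
        \<le> ennreal 1 * KLT_const TYPE('b) \<gamma> * (\<integral>\<^sup>+x. ennreal (V x powr p) \<partial>sphere_measure)"
      by (simp add: True ennreal_top_mult)
  qed
next
  case False
  then obtain L where KLT: "KLT_const TYPE('b) \<gamma> = ennreal L" and L0: "L \<ge> 0"
    by (cases "KLT_const TYPE('b) \<gamma>") auto
  have L: "L > 0" using KLT_const_nonzero[OF dim \<gamma> p1[unfolded p_def]] KLT L0 by (cases "L = 0") auto
  have p0: "p > 0" using p1 by simp
  define c where "c k = 1 - 1 / (real k + 2)" for k
  have c: "0 < c k" "c k < 1" for k by (simp_all add: c_def field_simps)
  define \<kappa> where "\<kappa> k = (1 / c k) ^ DIM('a)" for k
  have \<kappa>: "\<kappa> k \<ge> 1" for k unfolding \<kappa>_def using c[of k] by (intro one_le_power) (simp add: field_simps)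
  have "\<exists>C\<ge>0. \<forall>V :: 'a \<Rightarrow> real. V \<in> nonneg_Lp p \<longrightarrow>
      \<bar>lambda1_sphere V\<bar> \<le> C + (L * \<kappa> k powr (1 + p) * (LINT x|sphere_measure. V x powr p)) powr (1 / \<gamma>)" for k
    unfolding \<kappa>_def p_def
    by (rule lambda1_sphere_localised[OF dim c KLT L0 \<gamma> p1[unfolded p_def], of k]) blast
  then obtain C where C: "\<And>k. C k \<ge> 0" and bd: "\<And>k (V :: 'a \<Rightarrow> real). V \<in> nonneg_Lp p \<Longrightarrow>
      \<bar>lambda1_sphere V\<bar> \<le> C k + (L * \<kappa> k powr (1 + p) * (LINT x|sphere_measure. V x powr p)) powr (1 / \<gamma>)"
    by metis
  define S where "S = sphere_area TYPE('a)"
  have S: "S > 0" unfolding S_def by (rule sphere_area(2))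
  define M where "M \<mu> = L * S * \<mu> powr p" for \<mu>
  have M: "M \<mu> > 0" if "\<mu> > 0" for \<mu> using that L S by (simp add: M_def)
  define F where "F k \<mu> = (C k / M \<mu> powr (1 / \<gamma>) + \<kappa> k powr ((1 + p) / \<gamma>)) powr \<gamma>" for k \<mu>
  have F1: "1 \<le> F k \<mu>" if "\<mu> > 0" for k \<mu>
  proof -
    have "1 \<le> \<kappa> k powr ((1 + p) / \<gamma>)" using \<kappa>[of k] \<gamma> p0 by (intro ge_one_powr_ge_zero) auto
    then have "1 \<le> C k / M \<mu> powr (1 / \<gamma>) + \<kappa> k powr ((1 + p) / \<gamma>)"
      using C[of k] by (intro add_increasing) auto
    then show ?thesis unfolding F_def using \<gamma> by (intro ge_one_powr_ge_zero) auto
  qed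
  have Flim: "(F k \<longlongrightarrow> \<kappa> k powr (1 + p)) at_top" for k
  proof -
    have "filterlim (\<lambda>\<mu>. \<mu> powr (p * (1 / \<gamma>))) at_top at_top"
      using p0 \<gamma> by real_asymp
    then have "filterlim (\<lambda>\<mu>. (L * S) powr (1 / \<gamma>) * \<mu> powr (p * (1 / \<gamma>))) at_top at_top"
      using L S by (intro filterlim_tendsto_pos_mult_at_top[OF tendsto_const]) auto
    then have "filterlim (\<lambda>\<mu>. M \<mu> powr (1 / \<gamma>)) at_top at_top"
      unfolding M_def using L S by (simp add: powr_mult powr_powr)
    then have "((\<lambda>\<mu>. C k / M \<mu> powr (1 / \<gamma>)) \<longlongrightarrow> 0) at_top"
      by (intro real_tendsto_divide_at_top[OF tendsto_const])
    then have "((\<lambda>\<mu>. (C k / M \<mu> powr (1 / \<gamma>) + \<kappa> k powr ((1 + p) / \<gamma>)) powr \<gamma>) \<longlongrightarrow> (0 + \<kappa> k powr ((1 + p) / \<gamma>)) powr \<gamma>) at_top"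
      using \<kappa>[of k] by (intro tendsto_powr tendsto_add tendsto_const) auto
    then show ?thesis unfolding F_def[abs_def] using \<gamma> by (simp add: powr_powr)
  qed
  have \<kappa>lim: "(\<lambda>k. \<kappa> k powr (1 + p)) \<longlonglongrightarrow> 1"
  proof -
    have "(\<lambda>k. 1 / (real k + 2)) \<longlonglongrightarrow> 0" by real_asymp
    then have "(\<lambda>k. ((1 / (1 - 1 / (real k + 2))) ^ DIM('a)) powr (1 + p)) \<longlonglongrightarrow> ((1 / (1 - 0)) ^ DIM('a)) powr (1 + p)"
      by (intro tendsto_intros) auto
    then show ?thesis by (simp add: \<kappa>_def c_def)
  qed
  show ?thesis
  proof (intro exI[of _ "\<lambda>\<mu>. INF k. F k \<mu>"] conjI eventually_mono[OF eventually_gt_at_top[of 0]] ballI impI)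
    show "((\<lambda>\<mu>. INF k. F k \<mu>) \<longlongrightarrow> 1) at_top" by (rule INF_tendsto_one[OF F1 Flim \<kappa>lim])
    fix \<mu> :: real and V :: "'a \<Rightarrow> real"
    assume \<mu>: "\<mu> > 0" and V: "V \<in> nonneg_Lp p" "Lp_norm sphere_prob p V = \<mu>"
    let ?l = "\<bar>lambda1_sphere V\<bar> powr \<gamma>"
    have M\<mu>: "L * (LINT x|sphere_measure. V x powr p) = M \<mu>"
      unfolding Lp_norm_sphere_powr(2)[OF V(1) p0] V(2) by (simp add: M_def S_def)
    have "?l / M \<mu> \<le> F k \<mu>" for k
    proof -
      have "L * \<kappa> k powr (1 + p) * (LINT x|sphere_measure. V x powr p) = M \<mu> * \<kappa> k powr (1 + p)"
        unfolding M\<mu>[symmetric] by simp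
      then have "\<bar>lambda1_sphere V\<bar> \<le> C k + (M \<mu> * \<kappa> k powr (1 + p)) powr (1 / \<gamma>)"
        using bd[OF V(1), of k] by (simp only:)
      also have "\<dots> = M \<mu> powr (1 / \<gamma>) * (C k / M \<mu> powr (1 / \<gamma>) + \<kappa> k powr ((1 + p) / \<gamma>))"
        using M[OF \<mu>] \<gamma> by (simp add: powr_mult powr_powr distrib_left)
      finally have "?l \<le> (M \<mu> powr (1 / \<gamma>) * (C k / M \<mu> powr (1 / \<gamma>) + \<kappa> k powr ((1 + p) / \<gamma>))) powr \<gamma>"
        using \<gamma> by (intro powr_mono2) auto
      also have "\<dots> = M \<mu> * F k \<mu>"
        unfolding F_def using M[OF \<mu>] C[of k] \<gamma> by (simp add: powr_mult powr_powr)
      finally show ?thesis using M[OF \<mu>] by (simp add: field_simps)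
    qed
    then have "?l / M \<mu> \<le> (INF k. F k \<mu>)" by (intro cINF_greatest) auto
    then have "?l \<le> (INF k. F k \<mu>) * M \<mu>" using M[OF \<mu>] by (simp add: field_simps)
    then have "ennreal ?l \<le> ennreal ((INF k. F k \<mu>) * M \<mu>)" by (rule ennreal_leI)
    also have "0 \<le> (INF k. F k \<mu>)"
      by (rule order_trans[of _ 1]) (use F1[OF \<mu>] in \<open>auto intro!: cINF_greatest\<close>)
    then have "ennreal ((INF k. F k \<mu>) * M \<mu>) = ennreal (INF k. F k \<mu>) * (ennreal L * ennreal (S * \<mu> powr p))"
      using M[OF \<mu>] L S by (simp add: ennreal_mult M_def mult.assoc)
    finally show "ennreal ?l \<le> ennreal (INF k. F k \<mu>) * KLT_const TYPE('b) \<gamma> * (\<integral>\<^sup>+x. ennreal (V x powr p) \<partial>sphere_measure)"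
      unfolding Lp_norm_sphere_powr(3)[OF V(1) p0] V(2) KLT S_def[symmetric] by (simp add: mult.assoc)
  qed
qed


section \<open>Polarisation\<close>

definition reflect :: "'a::euclidean_space \<Rightarrow> 'a \<Rightarrow> 'a" where
  "reflect n x = x - (2 * (x \<bullet> n)) *\<^sub>R n"

lemma reflect_linear: "linear (reflect n)"
  by (rule linearI) (simp_all add: reflect_def inner_add_left algebra_simps scaleR_add_left)

lemma reflect_inner_normal: "norm n = 1 \<Longrightarrow> reflect n x \<bullet> n = - (x \<bullet> n)"
  by (simp add: reflect_def inner_diff_left norm_eq_1)

lemma reflect_reflect: "norm n = 1 \<Longrightarrow> reflect n (reflect n x) = x"
  using reflect_inner_normal[of n x] by (simp add: reflect_def[of n "reflect n x"]) (simp add: reflect_def)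

lemma reflect_inner: "reflect n x \<bullet> y = x \<bullet> reflect n y"
  by (simp add: reflect_def inner_diff_left inner_diff_right inner_commute)

lemma norm_reflect: "norm n = 1 \<Longrightarrow> norm (reflect n x) = norm x"
  by (simp add: norm_eq reflect_inner reflect_reflect)

lemma reflect_eq_self: "x \<bullet> n = 0 \<Longrightarrow> reflect n x = x"
  by (simp add: reflect_def)

lemma smooth_reflect: "smooth (reflect n)"
  using reflect_linear[of n] by (intro smooth_bounded_linear) (simp add: linear_conv_bounded_linear)

lemma continuous_on_reflect: "continuous_on S (reflect n)"
  by (rule smooth_continuous[OF smooth_reflect])

lemma grad_reflect:
  assumes "smooth f" shows "grad (\<lambda>x. f (reflect n x)) x = reflect n (grad f (reflect n x))"
proof (rule has_derivative_inner_imp_grad)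
  have "(reflect n has_derivative reflect n) (at x)"
    using reflect_linear[of n] by (intro bounded_linear_imp_has_derivative) (simp add: linear_conv_bounded_linear)
  from diff_chain_at[OF this smooth_grad_has_derivative[OF assms]]
  show "((\<lambda>x. f (reflect n x)) has_derivative (\<lambda>h. reflect n (grad f (reflect n x)) \<bullet> h)) (at x)"
    by (simp add: o_def reflect_inner)
qed

lemma tangential_grad_reflect:
  assumes "smooth f" and n: "norm n = 1"
  shows "tangential_grad (\<lambda>x. f (reflect n x)) x = reflect n (tangential_grad f (reflect n x))"
proof -
  interpret linear "reflect n" by (rule reflect_linear)
  show ?thesis
    using reflect_inner[of n x "grad f (reflect n x)"] reflect_reflect[OF n, of x]
    by (simp add: tangential_grad_def grad_reflect[OF assms(1)] diff scale)
qed

lemma integral_sphere_isometry: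
  fixes f :: "'a::euclidean_space \<Rightarrow> real" and R :: "'a \<Rightarrow> 'a"
  assumes f: "continuous_on (sphere 0 1) f" and R: "linear R" "\<And>x. norm (R x) = norm x"
  shows "(LINT x|sphere_prob. f (R x)) = (LINT x|sphere_prob. f x)"
proof -
  obtain B where B: "B \<ge> 0" "\<And>x. x \<in> sphere 0 1 \<Longrightarrow> norm (f x) \<le> B"
    using sphere_continuous_bounded[OF f] by blast
  have "continuous_on (sphere 0 1) R"
    using R(1) by (intro linear_continuous_on) (simp add: linear_conv_bounded_linear)
  then have fR: "continuous_on (sphere 0 1) (\<lambda>x. f (R x))"
    by (rule continuous_on_compose2[OF f]) (use R(2) in auto)
  have nonneg: "0 \<le> f x + B" if "x \<in> sphere 0 1" for x using B(2)[OF that] by (simp add: abs_le_iff)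
  have RS: "R x \<in> sphere 0 1" if "x \<in> sphere 0 1" for x using that R(2)[of x] by simp
  have m: "(\<lambda>x. f x + B) \<in> borel_measurable sphere_measure"
    by (intro sphere_continuous_measurable continuous_intros f)
  have mR: "(\<lambda>x. f (R x) + B) \<in> borel_measurable sphere_measure"
    by (intro sphere_continuous_measurable continuous_intros fR)
  have "(LINT x|sphere_measure. f (R x) + B) = (LINT x|sphere_measure. f x + B)"
    using nn_integral_sphere_isometry(2)[OF _ R, of "\<lambda>x. ennreal (f x + B)"] m
    by (subst (1 2) integral_eq_nn_integral) (auto intro!: m mR AE_I2 nonneg simp: RS[unfolded mem_sphere_0] R(2))
  then have "(LINT x|sphere_prob. f (R x) + B) = (LINT x|sphere_prob. f x + B)"
    by (simp add: integral_sphere_prob[OF m] integral_sphere_prob[OF mR])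
  then show ?thesis
    using sphere_continuous_integrable(1)[OF f] sphere_continuous_integrable(1)[OF fR] by simp
qed

lemma integral_sphere_reflect:
  fixes f :: "'a::euclidean_space \<Rightarrow> real"
  assumes f: "continuous_on (sphere 0 1) f" and n: "norm n = 1"
  shows "2 * (LINT x|sphere_prob. f x) = (LINT x|sphere_prob. f x + f (reflect n x))"
proof -
  have fR: "continuous_on (sphere 0 1) (\<lambda>x. f (reflect n x))"
    by (rule continuous_on_compose2[OF f continuous_on_reflect]) (use norm_reflect[OF n] in auto)
  show ?thesis
    using integral_sphere_isometry[OF f reflect_linear norm_reflect[OF n]]
      sphere_continuous_integrable(1)[OF f] sphere_continuous_integrable(1)[OF fR] by simp
qed

text \<open>
  The function \<open>b(t) = t exp(-1/t)\<close> for \<open>t > 0\<close> has slopes between \<open>0\<close> and \<open>1\<close>, because \<open>1 + s \<le> exp s\<close>, and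
  \<open>t - 1 \<le> b(t) \<le> t\<close>. Two mirrored copies of it, scaled by \<open>\<eta>\<close> and shifted by \<open>\<eta>\<close>, approximate the absolute value.
\<close>

lemma smooth_abs_approx:
  fixes \<eta> :: real
  assumes \<eta>: "\<eta> > 0"
  obtains j j' :: "real \<Rightarrow> real" where "smooth j" "\<And>w. (j has_real_derivative j' w) (at w)" "\<And>w. \<bar>j' w\<bar> \<le> 1"
    "\<And>w. j (- w) = j w" "\<And>w. j' (- w) = - j' w" "\<And>w. \<bar>j w - \<bar>w\<bar>\<bar> \<le> 2 * \<eta>" "\<And>w. \<bar>w\<bar> < \<eta> \<Longrightarrow> j w = 0"
proof -
  define b where "b t = t * flat_exp 0 t" for t
  define b' where "b' t = flat_exp 0 t + t * flat_exp 2 t" for t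
  have b_nonpos: "b t = 0" "b' t = 0" if "t \<le> 0" for t using that by (auto simp: b_def b'_def flat_exp_nonpos)
  have b: "(b has_real_derivative b' t) (at t)" for t
  proof -
    have "(b has_real_derivative 1 * flat_exp 0 t + (flat_exp (0 + 2) t - 0 * flat_exp (0 + 1) t) * t) (at t)"
      unfolding b_def using DERIV_mult[OF DERIV_ident flat_exp_deriv[of 0 t]] by simp
    then show ?thesis by (simp add: b'_def mult.commute numeral_2_eq_2)
  qed
  have b'_bounds: "0 \<le> b' t \<and> b' t \<le> 1" for t
  proof (cases "t > 0")
    case True
    have "b' t = exp (- (1 / t)) * (1 + 1 / t)"
      using True by (simp add: b'_def flat_exp_def power2_eq_square field_simps)
    also have "\<dots> \<le> exp (- (1 / t)) * exp (1 / t)" by (intro mult_left_mono) (auto simp: add.commute intro: exp_ge_add_one_self)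
    finally show ?thesis using True by (simp add: exp_minus b'_def flat_exp_nonneg)
  qed (simp add: b_nonpos)
  have b_bounds: "t - 1 \<le> b t \<and> b t \<le> t" if "t > 0" for t
  proof -
    have "1 - 1 / t \<le> exp (- (1 / t))" using exp_ge_add_one_self[of "- (1 / t)"] by simp
    from mult_left_mono[OF this, of t] show ?thesis
      using that by (auto simp: b_def flat_exp_def algebra_simps)
  qed
  have sb: "smooth b" unfolding b_def by (intro smooth_mult smooth_ident smooth_flat_exp)
  define j where "j w = \<eta> * (b (w / \<eta> - 1) + b (- w / \<eta> - 1))" for w
  define j' where "j' w = b' (w / \<eta> - 1) - b' (- w / \<eta> - 1)" for w
  have one: "w / \<eta> - 1 \<le> 0 \<or> - w / \<eta> - 1 \<le> 0" for w
    using \<eta> by (cases "w \<ge> 0") (auto simp: field_simps)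
  show ?thesis
  proof (rule that[of j j'])
    have "smooth (\<lambda>w. b ((1 / \<eta>) * w - 1))" "smooth (\<lambda>w. b ((- 1 / \<eta>) * w - 1))"
      by (intro smooth_compose[OF sb] smooth_diff smooth_mult smooth_const smooth_ident)+
    then show "smooth j" unfolding j_def[abs_def]
      by (intro smooth_mult smooth_add smooth_const) (simp_all add: mult.commute)
    show "(j has_real_derivative j' w) (at w)" for w
    proof -
      have 1: "((\<lambda>w. b (w / \<eta> - 1)) has_real_derivative b' (w / \<eta> - 1) * (1 / \<eta>)) (at w)"
        by (rule DERIV_chain2[OF b]) (use \<eta> in \<open>auto intro!: derivative_eq_intros\<close>)
      have 2: "((\<lambda>w. b (- w / \<eta> - 1)) has_real_derivative b' (- w / \<eta> - 1) * (- 1 / \<eta>)) (at w)"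
        by (rule DERIV_chain2[OF b]) (use \<eta> in \<open>auto intro!: derivative_eq_intros\<close>)
      show ?thesis unfolding j_def[abs_def] j'_def
        by (rule DERIV_cong[OF DERIV_cmult[OF DERIV_add[OF 1 2]]]) (use \<eta> in \<open>simp add: field_simps\<close>)
    qed
    show "\<bar>j' w\<bar> \<le> 1" for w
      using b'_bounds[of "w / \<eta> - 1"] b'_bounds[of "- w / \<eta> - 1"] unfolding j'_def by linarith
    show "j (- w) = j w" "j' (- w) = - j' w" for w by (simp_all add: j_def j'_def)
    have pos: "\<bar>j w - w\<bar> \<le> 2 * \<eta>" if w: "w \<ge> 0" for w
    proof (cases "w \<le> \<eta>")
      case True
      then have "j w = 0" using w \<eta> by (simp add: j_def b_nonpos field_simps)
      then show ?thesis using w True \<eta> by simp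
    next
      case False
      then have "j w = \<eta> * b (w / \<eta> - 1)" using w \<eta> by (simp add: j_def b_nonpos field_simps)
      moreover have "w / \<eta> - 1 - 1 \<le> b (w / \<eta> - 1) \<and> b (w / \<eta> - 1) \<le> w / \<eta> - 1"
        using False \<eta> by (intro b_bounds) (simp add: field_simps)
      then have "\<eta> * (w / \<eta> - 1 - 1) \<le> \<eta> * b (w / \<eta> - 1)" "\<eta> * b (w / \<eta> - 1) \<le> \<eta> * (w / \<eta> - 1)"
        using \<eta> by (auto intro!: mult_left_mono)
      ultimately show ?thesis using \<eta> by (simp add: algebra_simps abs_le_iff)
    qed
    show "\<bar>j w - \<bar>w\<bar>\<bar> \<le> 2 * \<eta>" for w
      using pos[of w] pos[of "- w"] by (cases "w \<ge> 0") (simp_all add: j_def add.commute)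
    show "j w = 0" if "\<bar>w\<bar> < \<eta>" for w
      using that \<eta> by (simp add: j_def b_nonpos field_simps abs_less_iff)
  qed
qed

text \<open>Off the hyperplane the sign is locally constant, and near it the product vanishes.\<close>

lemma sgn_mult_has_derivative:
  fixes f :: "'a::euclidean_space \<Rightarrow> real"
  assumes f: "(f has_derivative f') (at x)" and U: "open U" "{x. x \<bullet> n = 0} \<subseteq> U" "\<And>x. x \<in> U \<Longrightarrow> f x = 0"
  shows "((\<lambda>x. sgn (x \<bullet> n) * f x) has_derivative (\<lambda>h. sgn (x \<bullet> n) * f' h)) (at x)"
proof (cases "x \<bullet> n = 0")
  case True
  then have "x \<in> U" using U by auto
  have "((\<lambda>x. sgn (x \<bullet> n) * f x) has_derivative (\<lambda>h. 0)) (at x)"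
    by (rule has_derivative_transform_within_open[OF has_derivative_const[of 0] U(1) \<open>x \<in> U\<close>]) (simp add: U(3))
  then show ?thesis using True by simp
next
  case False
  define s where "s = sgn (x \<bullet> n)"
  have "((\<lambda>x. s * f x) has_derivative (\<lambda>h. s * f' h)) (at x)" by (rule has_derivative_mult_right[OF f])
  then show ?thesis unfolding s_def[symmetric]
  proof (rule has_derivative_transform_within_open)
    show "open {y. 0 < s * (y \<bullet> n)}" by (intro open_Collect_less continuous_intros)
    show "x \<in> {y. 0 < s * (y \<bullet> n)}" using False by (simp add: s_def sgn_mult_self_eq abs_sgn_eq mult.commute flip: abs_sgn)
    show "s * f y = sgn (y \<bullet> n) * f y" if "y \<in> {y. 0 < s * (y \<bullet> n)}" for y
      using that False by (auto simp: s_def sgn_if zero_less_mult_iff split: if_splits)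
  qed
qed

lemma times_diff_sgn_mult:
  fixes f :: "'a::euclidean_space \<Rightarrow> real"
  assumes "times_diff k f" and U: "open U" "{x. x \<bullet> n = 0} \<subseteq> U" and "\<And>x. x \<in> U \<Longrightarrow> f x = 0"
  shows "times_diff k (\<lambda>x. sgn (x \<bullet> n) * f x)"
  using assms(1,4)
proof (induction k arbitrary: f)
  case 0
  have f: "continuous_on UNIV f" using 0 by simp
  have 1: "continuous_on U (\<lambda>x. sgn (x \<bullet> n) * f x)"
    by (rule continuous_on_eq[of _ "\<lambda>_. 0"]) (auto simp: 0)
  have 2: "continuous_on (- {x. x \<bullet> n = 0}) (\<lambda>x. sgn (x \<bullet> n) * f x)"
    by (intro continuous_on_mult continuous_on_sgn continuous_on_inner continuous_on_id continuous_on_const continuous_on_subset[OF f]) (auto simp: sgn_zero_iff)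
  have 3: "closed {x. x \<bullet> n = 0}" by (intro closed_Collect_eq continuous_intros)
  have "continuous_on (U \<union> - {x. x \<bullet> n = 0}) (\<lambda>x. sgn (x \<bullet> n) * f x)"
    by (rule continuous_on_open_Un[OF U(1) _ 1 2]) (use 3 in auto)
  moreover have "U \<union> - {x. x \<bullet> n = 0} = UNIV" using U by auto
  ultimately show ?case by simp
next
  case (Suc k)
  obtain f' where f': "\<And>x. (f has_derivative f' x) (at x)" "\<And>v. times_diff k (\<lambda>x. f' x v)"
    using Suc.prems(1) by auto
  have "f' x = (\<lambda>h. 0)" if "x \<in> U" for x
  proof (rule has_derivative_unique[OF f'(1)])
    show "(f has_derivative (\<lambda>h. 0)) (at x)"
      by (rule has_derivative_transform_within_open[OF has_derivative_const[of 0] U(1) that]) (simp add: Suc.prems(2))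
  qed
  then have "times_diff k (\<lambda>x. sgn (x \<bullet> n) * f' x v)" for v by (intro Suc.IH f'(2)) simp
  moreover have "((\<lambda>x. sgn (x \<bullet> n) * f x) has_derivative (\<lambda>h. sgn (x \<bullet> n) * f' x h)) (at x)" for x
    by (rule sgn_mult_has_derivative[OF f'(1) U Suc.prems(2)])
  ultimately show ?case by (auto intro!: exI[of _ "\<lambda>x h. sgn (x \<bullet> n) * f' x h"])
qed

text \<open>The larger of the two values at \<open>x\<close> and its mirror image is placed on the side of \<open>n\<close>.\<close>

definition polarise :: "'a::euclidean_space \<Rightarrow> ('a \<Rightarrow> real) \<Rightarrow> 'a \<Rightarrow> real" where
  "polarise n v x = (v x + v (reflect n x)) / 2 + sgn (x \<bullet> n) * \<bar>v x - v (reflect n x)\<bar> / 2"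

lemma polarise_diff_le:
  assumes "\<bar>u x - v x\<bar> \<le> \<delta>" "\<bar>u (reflect n x) - v (reflect n x)\<bar> \<le> \<delta>"
  shows "\<bar>polarise n u x - polarise n v x\<bar> \<le> \<delta>"
  using assms by (auto simp: polarise_def sgn_if abs_if field_simps split: if_splits)

lemma polarise_cases:
  assumes n: "norm n = 1"
  shows "polarise n v x = v x \<and> polarise n v (reflect n x) = v (reflect n x) \<or>
    polarise n v x = v (reflect n x) \<and> polarise n v (reflect n x) = v x"
  using reflect_eq_self[of x n]
  by (auto simp: polarise_def reflect_reflect[OF n] reflect_inner_normal[OF n] sgn_if abs_if field_simps split: if_splits)

lemma polarise_sign: "0 \<le> (polarise n v x - v x) * (x \<bullet> n)"
  using reflect_eq_self[of x n]
  by (auto simp: polarise_def sgn_if abs_if field_simps mult_nonneg_nonneg mult_nonpos_nonpos zero_le_mult_iff)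

lemma norm_convex_swap_le:
  fixes a b :: "'a::real_inner"
  assumes "\<theta> \<ge> 0" "\<mu> \<ge> 0" "\<theta> + \<mu> = 1"
  shows "(norm (\<theta> *\<^sub>R a + \<mu> *\<^sub>R b))^2 + (norm (\<theta> *\<^sub>R b + \<mu> *\<^sub>R a))^2 \<le> (norm a)^2 + (norm b)^2"
proof -
  have "(norm (\<theta> *\<^sub>R a + \<mu> *\<^sub>R b))^2 + (norm (\<theta> *\<^sub>R b + \<mu> *\<^sub>R a))^2 + 2 * (\<theta> * \<mu>) * (norm (a - b))^2
      = (\<theta> + \<mu>)^2 * ((norm a)^2 + (norm b)^2)"
    unfolding power2_norm_eq_inner
    by (simp add: inner_add_left inner_add_right inner_diff_left inner_diff_right inner_commute power2_eq_square algebra_simps)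
  moreover have "0 \<le> 2 * (\<theta> * \<mu>) * (norm (a - b))^2" using assms by simp
  ultimately show ?thesis using assms(3) by (simp only: power_one mult_1)
qed

text \<open>
  The polarisation of a smooth function is in general only Lipschitz. Replacing \<open>|w|\<close> by a smooth
  function that vanishes near \<open>0\<close> gives a smooth function nearby. Its gradient at \<open>x\<close> is
  a convex combination \<open>\<theta> a + (1 - \<theta>) b\<close> of the gradients at \<open>x\<close> and at the mirror image, and
  \<open>\<theta> b + (1 - \<theta>) a\<close> at the mirror image with the same weight \<open>\<theta>\<close>, so no energy is gained.
\<close>

lemma polarise_smooth:
  fixes \<psi> :: "'a::euclidean_space \<Rightarrow> real"
  assumes n: "norm n = 1" and \<psi>: "smooth \<psi>" and K: "\<And>x. x \<in> cball 0 1 \<Longrightarrow> norm (grad \<psi> x) \<le> K" and \<eta>: "\<eta> > 0"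
  obtains \<psi>' where "smooth \<psi>'" "\<And>x. x \<in> cball 0 1 \<Longrightarrow> norm (grad \<psi>' x) \<le> K" "energy \<psi>' \<le> energy \<psi>"
    "\<And>x. \<bar>\<psi>' x - polarise n \<psi> x\<bar> \<le> \<eta>"
proof -
  obtain j j' :: "real \<Rightarrow> real" where j: "smooth j" "\<And>w. (j has_real_derivative j' w) (at w)" "\<And>w. \<bar>j' w\<bar> \<le> 1"
    "\<And>w. j (- w) = j w" "\<And>w. j' (- w) = - j' w" "\<And>w. \<bar>j w - \<bar>w\<bar>\<bar> \<le> 2 * \<eta>" "\<And>w. \<bar>w\<bar> < \<eta> \<Longrightarrow> j w = 0"
    by (rule smooth_abs_approx[OF \<eta>]) blast
  define \<phi> where "\<phi> x = \<psi> (reflect n x)" for x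
  define w where "w x = \<psi> x - \<phi> x" for x
  define U where "U = {x. \<bar>w x\<bar> < \<eta>}"
  have \<phi>: "smooth \<phi>" unfolding \<phi>_def[abs_def] by (rule smooth_compose[OF \<psi> smooth_reflect])
  have w: "smooth w" unfolding w_def[abs_def] by (rule smooth_diff[OF \<psi> \<phi>])
  have jw: "smooth (\<lambda>x. j (w x))" by (rule smooth_compose[OF j(1) w])
  have U: "open U" unfolding U_def by (intro open_Collect_less continuous_intros smooth_continuous w)
  have U0: "{x. x \<bullet> n = 0} \<subseteq> U" using \<eta> by (auto simp: U_def w_def \<phi>_def reflect_eq_self)
  have UZ: "j (w x) = 0" if "x \<in> U" for x using that j(7) by (simp add: U_def)
  define \<psi>' where "\<psi>' x = (1 / 2) * (\<psi> x + \<phi> x) + (1 / 2) * (sgn (x \<bullet> n) * j (w x))" for x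
  have sj: "smooth (\<lambda>x. sgn (x \<bullet> n) * j (w x))"
    unfolding smooth_def using times_diff_sgn_mult[OF _ U U0 UZ] jw by (auto simp: smooth_def)
  have \<psi>': "smooth \<psi>'" unfolding \<psi>'_def[abs_def] by (intro smooth_add smooth_mult smooth_const \<psi> \<phi> sj)
  define \<theta> where "\<theta> x = (1 + sgn (x \<bullet> n) * j' (w x)) / 2" for x
  have \<theta>: "0 \<le> \<theta> x" "\<theta> x \<le> 1" for x
  proof -
    have "\<bar>sgn (x \<bullet> n) * j' (w x)\<bar> \<le> 1 * 1"
      unfolding abs_mult using j(3) by (intro mult_mono) (auto simp: abs_sgn_eq)
    then show "0 \<le> \<theta> x" "\<theta> x \<le> 1" by (simp_all add: \<theta>_def abs_le_iff)
  qed
  have \<theta>_reflect: "\<theta> (reflect n x) = \<theta> x" for x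
  proof -
    have "w (reflect n x) = - w x" by (simp add: w_def \<phi>_def reflect_reflect[OF n])
    then show ?thesis by (simp add: \<theta>_def reflect_inner_normal[OF n] j(5) sgn_minus)
  qed
  have g: "grad \<psi>' x = \<theta> x *\<^sub>R grad \<psi> x + (1 - \<theta> x) *\<^sub>R grad \<phi> x" for x
  proof (rule has_derivative_inner_imp_grad)
    let ?s = "sgn (x \<bullet> n)"
    have dw: "(w has_derivative (\<lambda>h. grad \<psi> x \<bullet> h - grad \<phi> x \<bullet> h)) (at x)"
      unfolding w_def[abs_def] by (intro has_derivative_diff smooth_grad_has_derivative \<psi> \<phi>)
    have "((\<lambda>x. j (w x)) has_derivative (\<lambda>h. (grad \<psi> x \<bullet> h - grad \<phi> x \<bullet> h) * j' (w x))) (at x)"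
      using has_derivative_compose[OF dw j(2)[of "w x", unfolded has_field_derivative_def]] by (simp add: mult.commute)
    note d = sgn_mult_has_derivative[OF this U U0 UZ]
    have "(\<psi>' has_derivative (\<lambda>h. (1 / 2) * (grad \<psi> x \<bullet> h + grad \<phi> x \<bullet> h)
        + (1 / 2) * (?s * ((grad \<psi> x \<bullet> h - grad \<phi> x \<bullet> h) * j' (w x))))) (at x)"
      unfolding \<psi>'_def[abs_def]
      by (intro has_derivative_add has_derivative_mult_right smooth_grad_has_derivative \<psi> \<phi> d)
    moreover have "(1 / 2) * (grad \<psi> x \<bullet> h + grad \<phi> x \<bullet> h) + (1 / 2) * (?s * ((grad \<psi> x \<bullet> h - grad \<phi> x \<bullet> h) * j' (w x)))
        = (\<theta> x *\<^sub>R grad \<psi> x + (1 - \<theta> x) *\<^sub>R grad \<phi> x) \<bullet> h" for h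
      by (simp add: \<theta>_def inner_add_left algebra_simps add_divide_distrib diff_divide_distrib)
    ultimately show "(\<psi>' has_derivative (\<lambda>h. (\<theta> x *\<^sub>R grad \<psi> x + (1 - \<theta> x) *\<^sub>R grad \<phi> x) \<bullet> h)) (at x)" by simp
  qed
  have tg: "tangential_grad \<psi>' x = \<theta> x *\<^sub>R tangential_grad \<psi> x + (1 - \<theta> x) *\<^sub>R tangential_grad \<phi> x" for x
    by (simp add: tangential_grad_def g inner_add_right algebra_simps)
  let ?T = "\<lambda>f x. (norm (tangential_grad f x))^2"
  have T_le: "?T \<psi>' x + ?T \<psi>' (reflect n x) \<le> ?T \<psi> x + ?T \<psi> (reflect n x)" for x
  proof -
    interpret linear "reflect n" by (rule reflect_linear)
    define a b where "a = tangential_grad \<psi> x" and "b = reflect n (tangential_grad \<psi> (reflect n x))"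
    have 1: "tangential_grad \<phi> x = b" unfolding \<phi>_def[abs_def] b_def by (rule tangential_grad_reflect[OF \<psi> n])
    have 2: "tangential_grad \<phi> (reflect n x) = reflect n a"
      unfolding \<phi>_def[abs_def] a_def tangential_grad_reflect[OF \<psi> n] by (simp add: reflect_reflect[OF n])
    have 3: "tangential_grad \<psi> (reflect n x) = reflect n b" by (simp add: b_def reflect_reflect[OF n])
    have "tangential_grad \<psi>' (reflect n x) = reflect n (\<theta> x *\<^sub>R b + (1 - \<theta> x) *\<^sub>R a)"
      unfolding tg \<theta>_reflect 2 3 by (simp add: add scale)
    then have "?T \<psi>' x + ?T \<psi>' (reflect n x)
        = (norm (\<theta> x *\<^sub>R a + (1 - \<theta> x) *\<^sub>R b))^2 + (norm (\<theta> x *\<^sub>R b + (1 - \<theta> x) *\<^sub>R a))^2"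
      unfolding tg[of x] 1 a_def[symmetric] by (simp add: norm_reflect[OF n])
    also have "\<dots> \<le> (norm a)^2 + (norm b)^2" by (rule norm_convex_swap_le) (use \<theta>[of x] in auto)
    also have "\<dots> = ?T \<psi> x + ?T \<psi> (reflect n x)" by (simp add: a_def b_def norm_reflect[OF n])
    finally show ?thesis .
  qed
  have Tc: "continuous_on UNIV (?T f)" if "smooth f" for f :: "'a \<Rightarrow> real"
    by (intro continuous_intros tangential_grad_continuous that)
  have Tr: "continuous_on (sphere 0 1) (\<lambda>x. ?T f x + ?T f (reflect n x))" if "smooth f" for f :: "'a \<Rightarrow> real"
    by (intro continuous_on_add continuous_on_compose2[OF Tc[OF that] continuous_on_reflect] continuous_on_subset[OF Tc[OF that]]) auto
  show ?thesis
  proof (rule that[OF \<psi>'])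
    show "norm (grad \<psi>' x) \<le> K" if x: "x \<in> cball 0 1" for x
    proof -
      have "norm (grad \<phi> x) \<le> K"
        using K[of "reflect n x"] x by (simp add: \<phi>_def[abs_def] grad_reflect[OF \<psi>] norm_reflect[OF n])
      then have "norm (grad \<psi>' x) \<le> \<theta> x * K + (1 - \<theta> x) * K"
        unfolding g using \<theta>[of x] K[OF x]
        by (intro order_trans[OF norm_triangle_ineq] add_mono) (auto intro!: mult_left_mono)
      then show ?thesis by (simp add: algebra_simps)
    qed
    have "2 * energy \<psi>' = (LINT x|sphere_prob. ?T \<psi>' x + ?T \<psi>' (reflect n x))"
      unfolding energy_def by (intro integral_sphere_reflect n continuous_on_subset[OF Tc[OF \<psi>']]) auto
    also have "\<dots> \<le> (LINT x|sphere_prob. ?T \<psi> x + ?T \<psi> (reflect n x))"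
      by (intro integral_mono sphere_continuous_integrable Tr \<psi> \<psi>' T_le)
    also have "\<dots> = 2 * energy \<psi>"
      unfolding energy_def by (intro integral_sphere_reflect[symmetric] n continuous_on_subset[OF Tc[OF \<psi>]]) auto
    finally show "energy \<psi>' \<le> energy \<psi>" by simp
    show "\<bar>\<psi>' x - polarise n \<psi> x\<bar> \<le> \<eta>" for x
    proof -
      have "\<psi>' x - polarise n \<psi> x = (1 / 2) * (sgn (x \<bullet> n) * (j (w x) - \<bar>w x\<bar>))"
        by (simp add: \<psi>'_def polarise_def w_def \<phi>_def algebra_simps)
      moreover have "\<bar>sgn (x \<bullet> n) * (j (w x) - \<bar>w x\<bar>)\<bar> \<le> 1 * (2 * \<eta>)"
        unfolding abs_mult using j(6)[of "w x"] by (intro mult_mono) (auto simp: abs_sgn_eq)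
      ultimately show ?thesis by simp
    qed
  qed
qed


section \<open>Symmetrisation on the sphere\<close>

text \<open>
  Functions with the same distribution as \<open>\<psi>\<^sub>0\<close> that are uniform limits of smooth functions obeying
  fixed bounds on gradient and energy. The class is compact for uniform convergence and closed
  under polarisation; the ambient gradient bound on the unit ball gives equicontinuity.
\<close>

definition rearranged :: "real \<Rightarrow> real \<Rightarrow> ('a::euclidean_space \<Rightarrow> real) \<Rightarrow> ('a \<Rightarrow> real) \<Rightarrow> bool" where
  "rearranged K B \<psi>\<^sub>0 v \<longleftrightarrow>
    (\<forall>h. continuous_on UNIV h \<longrightarrow> (LINT x|sphere_prob. h (v x)) = ((LINT x|sphere_prob. h (\<psi>\<^sub>0 x)) :: real)) \<and>
    (\<forall>x\<in>sphere 0 1. \<bar>v x\<bar> \<le> B) \<and>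
    (\<forall>\<epsilon>>0. \<exists>\<psi>. smooth \<psi> \<and> (\<forall>x\<in>cball 0 1. norm (grad \<psi> x) \<le> K) \<and> energy \<psi> \<le> energy \<psi>\<^sub>0 \<and>
      (\<forall>x\<in>sphere 0 1. \<bar>\<psi> x - v x\<bar> \<le> \<epsilon>))"

lemma rearranged_approx:
  assumes "rearranged K B \<psi>\<^sub>0 v" "\<epsilon> > 0"
  obtains \<psi> where "smooth \<psi>" "\<And>x. x \<in> cball 0 1 \<Longrightarrow> norm (grad \<psi> x) \<le> K" "energy \<psi> \<le> energy \<psi>\<^sub>0"
    "\<And>x. x \<in> sphere 0 1 \<Longrightarrow> \<bar>\<psi> x - v x\<bar> \<le> \<epsilon>"
  using assms unfolding rearranged_def by blast

lemma smooth_lipschitz: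
  assumes \<psi>: "smooth \<psi>" and K: "\<And>x. x \<in> cball 0 1 \<Longrightarrow> norm (grad \<psi> x) \<le> K"
    and "x \<in> sphere 0 1" "y \<in> sphere 0 1"
  shows "\<bar>\<psi> x - \<psi> y\<bar> \<le> K * norm (x - y)"
proof -
  have "norm (\<psi> x - \<psi> y) \<le> K * norm (x - y)"
  proof (rule differentiable_bound[OF convex_cball])
    show "(\<psi> has_derivative (\<lambda>h. grad \<psi> x \<bullet> h)) (at x within cball 0 1)" for x
      by (rule has_derivative_at_withinI[OF smooth_grad_has_derivative[OF \<psi>]])
    show "onorm (\<lambda>h. grad \<psi> x \<bullet> h) \<le> K" if "x \<in> cball 0 1" for x
    proof (rule onorm_le)
      fix h
      have "norm (grad \<psi> x \<bullet> h) \<le> norm (grad \<psi> x) * norm h" by (simp add: Cauchy_Schwarz_ineq2)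
      also have "\<dots> \<le> K * norm h" using K[OF that] by (rule mult_right_mono) simp
      finally show "norm (grad \<psi> x \<bullet> h) \<le> K * norm h" .
    qed
  qed (use assms(3,4) in auto)
  then show ?thesis by simp
qed

lemma rearranged_lipschitz:
  assumes v: "rearranged K B \<psi>\<^sub>0 v" and xy: "x \<in> sphere 0 1" "y \<in> sphere 0 1"
  shows "\<bar>v x - v y\<bar> \<le> K * norm (x - y)"
proof (rule field_le_epsilon)
  fix \<epsilon> :: real assume "\<epsilon> > 0"
  then have "\<epsilon> / 2 > 0" by simp
  from rearranged_approx[OF v this] obtain \<psi> where \<psi>: "smooth \<psi>" "\<And>x. x \<in> cball 0 1 \<Longrightarrow> norm (grad \<psi> x) \<le> K"
    "\<And>x. x \<in> sphere 0 1 \<Longrightarrow> \<bar>\<psi> x - v x\<bar> \<le> \<epsilon> / 2" by metis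
  show "\<bar>v x - v y\<bar> \<le> K * norm (x - y) + \<epsilon>"
    using smooth_lipschitz[OF \<psi>(1,2) xy] \<psi>(3)[OF xy(1)] \<psi>(3)[OF xy(2)] by linarith
qed

lemma lipschitz_sphere_continuous:
  fixes v :: "'a::euclidean_space \<Rightarrow> real"
  assumes "\<And>x y. x \<in> sphere 0 1 \<Longrightarrow> y \<in> sphere 0 1 \<Longrightarrow> \<bar>v x - v y\<bar> \<le> K * norm (x - y)"
  shows "continuous_on (sphere 0 1) v"
proof (rule lipschitz_on_continuous_on[OF lipschitz_onI])
  fix x y :: 'a assume xy: "x \<in> sphere 0 1" "y \<in> sphere 0 1"
  have "\<bar>v x - v y\<bar> \<le> max 0 K * norm (x - y)"
    using assms[OF xy] by (rule order_trans) (intro mult_right_mono, auto)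
  then show "dist (v x) (v y) \<le> max 0 K * dist x y" by (simp add: dist_norm)
qed simp

lemma rearranged_continuous: "rearranged K B \<psi>\<^sub>0 v \<Longrightarrow> continuous_on (sphere 0 1) v"
  by (rule lipschitz_sphere_continuous) (rule rearranged_lipschitz)

lemma sphere_integral_limit:
  fixes g :: "nat \<Rightarrow> 'a::euclidean_space \<Rightarrow> real"
  assumes "\<And>n. continuous_on (sphere 0 1) (g n)" "continuous_on (sphere 0 1) f"
    "\<And>n x. x \<in> sphere 0 1 \<Longrightarrow> \<bar>g n x\<bar> \<le> C" "\<And>x. x \<in> sphere 0 1 \<Longrightarrow> (\<lambda>n. g n x) \<longlonglongrightarrow> f x"
  shows "(\<lambda>n. \<integral>x. g n x \<partial>sphere_prob) \<longlonglongrightarrow> (LINT x|sphere_prob. f x)"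
proof (rule integral_dominated_convergence[where w = "\<lambda>_. C"])
  show "f \<in> borel_measurable sphere_prob" "g n \<in> borel_measurable sphere_prob" for n
    using assms(1,2) by (simp_all add: measurable_sphere_prob sphere_continuous_measurable)
qed (use assms(3,4) in \<open>auto intro!: AE_I2 simp: space_sphere_prob\<close>)

lemma rearranged_limit:
  fixes u :: "nat \<Rightarrow> 'a::euclidean_space \<Rightarrow> real"
  assumes u: "\<And>n. rearranged K B \<psi>\<^sub>0 (u n)" and v: "continuous_on (sphere 0 1) v"
    and lim: "\<And>\<epsilon>. \<epsilon> > 0 \<Longrightarrow> \<exists>N. \<forall>n x. n \<ge> N \<and> x \<in> sphere 0 1 \<longrightarrow> norm (u n x - v x) < \<epsilon>"
  shows "rearranged K B \<psi>\<^sub>0 v"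
  unfolding rearranged_def
proof (intro conjI allI impI ballI)
  have pt: "(\<lambda>n. u n x) \<longlonglongrightarrow> v x" if "x \<in> sphere 0 1" for x
  proof (rule LIMSEQ_I)
    fix r :: real assume "r > 0"
    from lim[OF this] show "\<exists>no. \<forall>n\<ge>no. norm (u n x - v x) < r" using that by blast
  qed
  have uB: "\<bar>u n x\<bar> \<le> B" if "x \<in> sphere 0 1" for n x using u[of n] that unfolding rearranged_def by blast
  show "\<bar>v x\<bar> \<le> B" if "x \<in> sphere 0 1" for x
    by (rule LIMSEQ_le_const2[OF tendsto_rabs[OF pt[OF that]]]) (use uB[OF that] in auto)
  show "(LINT x|sphere_prob. h (v x)) = (LINT x|sphere_prob. h (\<psi>\<^sub>0 x))" if h: "continuous_on UNIV h" for h :: "real \<Rightarrow> real"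
  proof -
    have "compact (h ` {-B..B})" by (intro compact_continuous_image continuous_on_subset[OF h]) auto
    then obtain C where C: "\<And>t. t \<in> {-B..B} \<Longrightarrow> \<bar>h t\<bar> \<le> C"
      using compact_imp_bounded bounded_iff by (metis imageI real_norm_def)
    have "(\<lambda>n. \<integral>x. h (u n x) \<partial>sphere_prob) \<longlonglongrightarrow> (LINT x|sphere_prob. h (v x))"
    proof (rule sphere_integral_limit)
      show "continuous_on (sphere 0 1) (\<lambda>x. h (u n x))" for n
        by (rule continuous_on_compose2[OF h rearranged_continuous[OF u]]) auto
      show "continuous_on (sphere 0 1) (\<lambda>x. h (v x))" by (rule continuous_on_compose2[OF h v]) auto
      show "\<bar>h (u n x)\<bar> \<le> C" if "x \<in> sphere 0 1" for n x using uB[OF that, of n] by (intro C) (auto simp: abs_le_iff)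
      show "(\<lambda>n. h (u n x)) \<longlonglongrightarrow> h (v x)" if "x \<in> sphere 0 1" for x
        by (rule continuous_on_tendsto_compose[OF h pt[OF that]]) auto
    qed
    moreover have "(LINT x|sphere_prob. h (u n x)) = (LINT x|sphere_prob. h (\<psi>\<^sub>0 x))" for n
      using u[of n] h unfolding rearranged_def by blast
    ultimately show ?thesis by (simp add: LIMSEQ_const_iff)
  qed
  show "\<exists>\<psi>. smooth \<psi> \<and> (\<forall>x\<in>cball 0 1. norm (grad \<psi> x) \<le> K) \<and> energy \<psi> \<le> energy \<psi>\<^sub>0 \<and>
      (\<forall>x\<in>sphere 0 1. \<bar>\<psi> x - v x\<bar> \<le> \<epsilon>)" if "\<epsilon> > 0" for \<epsilon>
  proof -
    have e: "\<epsilon> / 2 > 0" using that by simp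
    from lim[OF e] obtain N where N: "\<And>x. x \<in> sphere 0 1 \<Longrightarrow> norm (u N x - v x) < \<epsilon> / 2" by blast
    from rearranged_approx[OF u e] obtain \<psi> where \<psi>: "smooth \<psi>" "\<And>x. x \<in> cball 0 1 \<Longrightarrow> norm (grad \<psi> x) \<le> K"
      "energy \<psi> \<le> energy \<psi>\<^sub>0" "\<And>x. x \<in> sphere 0 1 \<Longrightarrow> \<bar>\<psi> x - u N x\<bar> \<le> \<epsilon> / 2" by metis
    have "\<bar>\<psi> x - v x\<bar> \<le> \<epsilon>" if "x \<in> sphere 0 1" for x
      using N[OF that] \<psi>(4)[OF that] unfolding real_norm_def by linarith
    with \<psi> show ?thesis by blast
  qed
qed

lemma rearranged_polarise:
  fixes v :: "'a::euclidean_space \<Rightarrow> real"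
  assumes v: "rearranged K B \<psi>\<^sub>0 v" and n: "norm n = 1"
  shows "rearranged K B \<psi>\<^sub>0 (polarise n v)"
proof -
  have R: "reflect n x \<in> sphere 0 1" if "x \<in> sphere 0 1" for x using that norm_reflect[OF n, of x] by simp
  have approx: "\<exists>\<psi>. smooth \<psi> \<and> (\<forall>x\<in>cball 0 1. norm (grad \<psi> x) \<le> K) \<and> energy \<psi> \<le> energy \<psi>\<^sub>0 \<and>
      (\<forall>x\<in>sphere 0 1. \<bar>\<psi> x - polarise n v x\<bar> \<le> \<epsilon>)" if "\<epsilon> > 0" for \<epsilon>
  proof -
    have e: "\<epsilon> / 2 > 0" using that by simp
    from rearranged_approx[OF v e] obtain \<psi> where \<psi>: "smooth \<psi>" "\<And>x. x \<in> cball 0 1 \<Longrightarrow> norm (grad \<psi> x) \<le> K"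
      "energy \<psi> \<le> energy \<psi>\<^sub>0" "\<And>x. x \<in> sphere 0 1 \<Longrightarrow> \<bar>\<psi> x - v x\<bar> \<le> \<epsilon> / 2" by metis
    obtain \<psi>' where \<psi>': "smooth \<psi>'" "\<And>x. x \<in> cball 0 1 \<Longrightarrow> norm (grad \<psi>' x) \<le> K" "energy \<psi>' \<le> energy \<psi>"
      "\<And>x. \<bar>\<psi>' x - polarise n \<psi> x\<bar> \<le> \<epsilon> / 2" using polarise_smooth[OF n \<psi>(1,2) e] by blast
    have "\<bar>\<psi>' x - polarise n v x\<bar> \<le> \<epsilon>" if "x \<in> sphere 0 1" for x
      using \<psi>'(4)[of x] polarise_diff_le[OF \<psi>(4)[OF that] \<psi>(4)[OF R[OF that]]] by linarith
    then show ?thesis using \<psi>' \<psi>(3) by (intro exI[of _ \<psi>']) auto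
  qed
  have pc: "continuous_on (sphere 0 1) (polarise n v)"
  proof (rule lipschitz_sphere_continuous)
    fix x y :: 'a assume xy: "x \<in> sphere 0 1" "y \<in> sphere 0 1"
    show "\<bar>polarise n v x - polarise n v y\<bar> \<le> K * norm (x - y)"
    proof (rule field_le_epsilon)
      fix \<epsilon> :: real assume "\<epsilon> > 0"
      then have "\<epsilon> / 2 > 0" by simp
      from approx[OF this] obtain \<psi> where \<psi>: "smooth \<psi>" "\<And>x. x \<in> cball 0 1 \<Longrightarrow> norm (grad \<psi> x) \<le> K"
        "\<And>x. x \<in> sphere 0 1 \<Longrightarrow> \<bar>\<psi> x - polarise n v x\<bar> \<le> \<epsilon> / 2" by blast
      show "\<bar>polarise n v x - polarise n v y\<bar> \<le> K * norm (x - y) + \<epsilon>"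
        using smooth_lipschitz[OF \<psi>(1,2) xy] \<psi>(3)[OF xy(1)] \<psi>(3)[OF xy(2)] by linarith
    qed
  qed
  show ?thesis
    unfolding rearranged_def
  proof (intro conjI allI impI ballI approx)
    have vB: "\<bar>v x\<bar> \<le> B" if "x \<in> sphere 0 1" for x using v that unfolding rearranged_def by blast
    show "\<bar>polarise n v x\<bar> \<le> B" if "x \<in> sphere 0 1" for x
      using polarise_cases[OF n, of v x] vB[OF that] vB[OF R[OF that]] by auto
    fix h :: "real \<Rightarrow> real" assume h: "continuous_on UNIV h"
    have "2 * (LINT x|sphere_prob. h (polarise n v x)) = (LINT x|sphere_prob. h (polarise n v x) + h (polarise n v (reflect n x)))"
      by (rule integral_sphere_reflect[OF continuous_on_compose2[OF h pc] n]) auto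
    also have "\<dots> = (LINT x|sphere_prob. h (v x) + h (v (reflect n x)))"
      using polarise_cases[OF n, of v] by (intro Bochner_Integration.integral_cong refl) (metis add.commute)
    also have "\<dots> = 2 * (LINT x|sphere_prob. h (v x))"
      by (rule integral_sphere_reflect[OF continuous_on_compose2[OF h rearranged_continuous[OF v]] n, symmetric]) auto
    also have "(LINT x|sphere_prob. h (v x)) = (LINT x|sphere_prob. h (\<psi>\<^sub>0 x))" using v h unfolding rearranged_def by blast
    finally show "(LINT x|sphere_prob. h (polarise n v x)) = (LINT x|sphere_prob. h (\<psi>\<^sub>0 x))" by simp
  qed
qed

lemma rearranged_maximiser:
  fixes e :: "'a::euclidean_space"
  assumes e: "norm e = 1" and \<psi>: "rearranged K B \<psi>\<^sub>0 \<psi>\<^sub>0"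
  obtains v where "rearranged K B \<psi>\<^sub>0 v"
    "\<And>u. rearranged K B \<psi>\<^sub>0 u \<Longrightarrow> (LINT x|sphere_prob. u x * (x \<bullet> e)) \<le> (LINT x|sphere_prob. v x * (x \<bullet> e))"
proof -
  define \<Phi> where "\<Phi> u = (LINT x|sphere_prob. u x * (x \<bullet> e))" for u :: "'a \<Rightarrow> real"
  define S where "S = Sup (\<Phi> ` {u. rearranged K B \<psi>\<^sub>0 u})"
  have cont: "continuous_on (sphere 0 1) (\<lambda>x. u x * (x \<bullet> e))" if "rearranged K B \<psi>\<^sub>0 u" for u
    by (intro continuous_intros rearranged_continuous[OF that])
  have bd: "\<bar>u x * (x \<bullet> e)\<bar> \<le> B" if "rearranged K B \<psi>\<^sub>0 u" "x \<in> sphere 0 1" for u x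
  proof -
    have "\<bar>u x\<bar> \<le> B" using that unfolding rearranged_def by blast
    moreover have "\<bar>x \<bullet> e\<bar> \<le> 1" using Cauchy_Schwarz_ineq2[of x e] e that(2) by simp
    ultimately have "\<bar>u x\<bar> * \<bar>x \<bullet> e\<bar> \<le> B * 1" by (intro mult_mono) auto
    then show ?thesis by (simp add: abs_mult)
  qed
  have \<Phi>B: "\<Phi> u \<le> B" if "rearranged K B \<psi>\<^sub>0 u" for u
  proof -
    have "\<Phi> u \<le> (LINT x|(sphere_prob :: 'a measure). B)"
      unfolding \<Phi>_def using bd[OF that]
      by (intro integral_mono_AE sphere_continuous_integrable cont[OF that] continuous_intros AE_I2)
         (auto simp: space_sphere_prob abs_le_iff)
    then show ?thesis unfolding integral_sphere_const .
  qed
  have bdd: "bdd_above (\<Phi> ` {u. rearranged K B \<psi>\<^sub>0 u})" using \<Phi>B by (intro bdd_aboveI[of _ B]) auto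
  have ne: "\<Phi> ` {u. rearranged K B \<psi>\<^sub>0 u} \<noteq> {}" using \<psi> by auto
  have "\<exists>u. rearranged K B \<psi>\<^sub>0 u \<and> S - 1 / real (Suc n) < \<Phi> u" for n
  proof -
    have "S - 1 / real (Suc n) < S" by simp
    then show ?thesis unfolding S_def less_cSup_iff[OF ne bdd] by auto
  qed
  then obtain u where u: "\<And>n. rearranged K B \<psi>\<^sub>0 (u n)" "\<And>n. S - 1 / real (Suc n) < \<Phi> (u n)" by metis
  obtain v k where v: "continuous_on (sphere 0 1) v" and k: "strict_mono (k :: nat \<Rightarrow> nat)"
    and lim: "\<And>\<epsilon>. 0 < \<epsilon> \<Longrightarrow> \<exists>N. \<forall>n x. n \<ge> N \<and> x \<in> sphere 0 1 \<longrightarrow> norm (u (k n) x - v x) < \<epsilon>"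
  proof (rule Arzela_Ascoli[of "sphere 0 1" u B])
    show "norm (u n x) \<le> B" if "x \<in> sphere 0 1" for n x using u(1)[of n] that unfolding rearranged_def by simp
    show "\<exists>d>0. \<forall>n y. y \<in> sphere 0 1 \<and> norm (x - y) < d \<longrightarrow> norm (u n x - u n y) < \<epsilon>"
      if x: "x \<in> sphere 0 1" and \<epsilon>: "\<epsilon> > 0" for x \<epsilon>
    proof (intro exI[of _ "\<epsilon> / (\<bar>K\<bar> + 1)"] conjI allI impI)
      fix n y assume y: "y \<in> sphere 0 1 \<and> norm (x - y) < \<epsilon> / (\<bar>K\<bar> + 1)"
      have "\<bar>u n x - u n y\<bar> \<le> K * norm (x - y)" using x y by (intro rearranged_lipschitz[OF u(1)]) auto
      also have "\<dots> \<le> (\<bar>K\<bar> + 1) * norm (x - y)" by (intro mult_right_mono) auto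
      also have "\<dots> < \<epsilon>" using y by (simp add: field_simps)
      finally show "norm (u n x - u n y) < \<epsilon>" by simp
    qed (use \<epsilon> in simp)
  qed (simp, blast)
  have rv: "rearranged K B \<psi>\<^sub>0 v" by (rule rearranged_limit[OF u(1) v lim])
  have "(\<lambda>n. \<Phi> (u (k n))) \<longlonglongrightarrow> \<Phi> v"
    unfolding \<Phi>_def
  proof (rule sphere_integral_limit)
    show "(\<lambda>n. u (k n) x * (x \<bullet> e)) \<longlonglongrightarrow> v x * (x \<bullet> e)" if "x \<in> sphere 0 1" for x
    proof (intro tendsto_mult tendsto_const LIMSEQ_I)
      fix r :: real assume "r > 0"
      from lim[OF this] show "\<exists>no. \<forall>n\<ge>no. norm (u (k n) x - v x) < r" using that by blast
    qed
  qed (use cont[OF u(1)] cont[OF rv] bd[OF u(1)] in auto)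
  moreover have "(\<lambda>n. S - 1 / real (Suc (k n))) \<longlonglongrightarrow> S"
    using LIMSEQ_subseq_LIMSEQ[OF LIMSEQ_inverse_real_of_nat_add_minus[of S] k]
    by (simp add: o_def inverse_eq_divide)
  moreover have "\<exists>N. \<forall>n\<ge>N. S - 1 / real (Suc (k n)) \<le> \<Phi> (u (k n))" using u(2) less_imp_le by blast
  ultimately have "S \<le> \<Phi> v" using LIMSEQ_le by blast
  then have "\<Phi> u \<le> \<Phi> v" if "rearranged K B \<psi>\<^sub>0 u" for u
    using cSup_upper[OF _ bdd, of "\<Phi> u"] that unfolding S_def by fastforce
  then show ?thesis unfolding \<Phi>_def by (rule that[OF rv])
qed

text \<open>
  The cone over a nonempty open subset of the sphere is open, so such subsets have positive measure.
\<close>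

lemma sphere_integral_zero:
  fixes f :: "'a::euclidean_space \<Rightarrow> real"
  assumes f: "continuous_on (sphere 0 1) f" "\<And>x. x \<in> sphere 0 1 \<Longrightarrow> 0 \<le> f x" and 0: "(LINT x|sphere_prob. f x) = 0"
    and z: "z \<in> sphere 0 1"
  shows "f z = 0"
proof (rule ccontr)
  assume "f z \<noteq> 0"
  then have fz: "f z > 0" using f(2)[OF z] by simp
  have fm: "f \<in> borel_measurable sphere_measure" by (rule sphere_continuous_measurable[OF f(1)])
  have "(LINT x|sphere_measure. f x) = 0"
    using 0 sphere_area(2)[where 'a='a] unfolding integral_sphere_prob[OF fm] by simp
  then have "AE x in sphere_measure. f x = 0"
    by (subst (asm) integral_nonneg_eq_0_iff_AE) (auto intro!: AE_I2 f sphere_continuous_integrable)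
  then have "(\<integral>\<^sup>+x. ennreal (f x) \<partial>sphere_measure) = 0"
    using fm by (subst nn_integral_0_iff_AE) (auto elim: AE_mp)
  moreover have em: "(\<lambda>x. ennreal (f x)) \<in> borel_measurable sphere_measure" using fm by simp
  ultimately have "(NN x. sphere_ext (\<lambda>x. ennreal (f x)) x * indicator (ball 0 1) x) = 0"
    by (simp add: nn_integral_sphere)
  then have "AE x in lborel. sphere_ext (\<lambda>x. ennreal (f x)) x * indicator (ball 0 1) x = 0"
    using borel_measurable_times_ennreal[OF sphere_ext_measurable[OF em] borel_measurable_indicator[of "ball 0 1" borel]]
    by (subst (asm) nn_integral_0_iff_AE) auto
  note null = this
  define W where "W = (ball 0 1 - {0::'a}) \<inter> (\<lambda>x. f (sgn x)) -` {0<..}"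
  have AE: "AE x in lborel. x \<notin> W"
    using null by eventually_elim (auto simp: W_def sphere_ext_def ennreal_eq_0_iff)
  have "continuous_on (ball 0 1 - {0::'a}) (\<lambda>x. f (sgn x))"
    by (rule continuous_on_compose2[OF f(1)]) (auto intro!: continuous_on_sgn continuous_on_id simp: norm_sgn split: if_splits)
  then have W: "open W" unfolding W_def by (intro continuous_open_preimage) auto
  have "sgn ((1 / 2) *\<^sub>R z) = z" using z by (simp add: sgn_div_norm)
  then have "(1 / 2) *\<^sub>R z \<in> W" using z fz by (auto simp: W_def)
  moreover have "W \<in> null_sets lborel" using AE W by (simp add: AE_iff_null_sets borel_open)
  then have "negligible W" by (simp add: negligible_iff_null_sets null_sets_completionI)
  ultimately show False using open_not_negligible[OF W] by blast
qed

text \<open>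
  A maximiser of \<open>\<integral> v(x) (x \<bullet> e)\<close> is fixed by the polarisations with \<open>n \<bullet> e > 0\<close>, since each of them
  increases the integral strictly unless it leaves the function unchanged. The reflection with normal \<open>x - y\<close>
  exchanges \<open>x\<close> and \<open>y\<close>, so the maximiser is monotone in the height \<open>x \<bullet> e\<close>.
\<close>

lemma zonal_rearrangement:
  fixes e :: "'a::euclidean_space"
  assumes e: "norm e = 1" and \<psi>: "rearranged K B \<psi>\<^sub>0 \<psi>\<^sub>0"
  obtains v where "rearranged K B \<psi>\<^sub>0 v"
    "\<And>x y. x \<in> sphere 0 1 \<Longrightarrow> y \<in> sphere 0 1 \<Longrightarrow> y \<bullet> e < x \<bullet> e \<Longrightarrow> v y \<le> v x"
proof -
  obtain v where v: "rearranged K B \<psi>\<^sub>0 v"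
    and max: "\<And>u. rearranged K B \<psi>\<^sub>0 u \<Longrightarrow> (LINT x|sphere_prob. u x * (x \<bullet> e)) \<le> (LINT x|sphere_prob. v x * (x \<bullet> e))"
    using rearranged_maximiser[OF e \<psi>] by blast
  show ?thesis
  proof (rule that[OF v])
    fix x y :: 'a assume x: "x \<in> sphere 0 1" and y: "y \<in> sphere 0 1" and xy: "y \<bullet> e < x \<bullet> e"
    define n where "n = sgn (x - y)"
    have "x \<noteq> y" using xy by auto
    then have n: "norm n = 1" by (simp add: n_def norm_sgn)
    have xx: "x \<bullet> x = 1" "y \<bullet> y = 1" using x y by (simp_all add: norm_eq_1)
    have ne: "n \<bullet> e > 0" using xy \<open>x \<noteq> y\<close> by (simp add: n_def sgn_div_norm inner_diff_left)
    have nn: "(norm (x - y))^2 = 2 - 2 * (x \<bullet> y)"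
      using xx by (simp add: power2_norm_eq_inner inner_diff_left inner_diff_right inner_commute)
    then have xyd: "2 * (1 - x \<bullet> y) = norm (x - y) * norm (x - y)" by (simp add: power2_eq_square)
    have xn: "x \<bullet> n = (1 - x \<bullet> y) / norm (x - y)"
      using xx by (simp add: n_def sgn_div_norm inner_diff_right divide_inverse mult.commute)
    have "norm (x - y) * norm (x - y) > 0" using \<open>x \<noteq> y\<close> by simp
    then have "1 - x \<bullet> y > 0" unfolding xyd[symmetric] by simp
    then have xn0: "x \<bullet> n > 0" using xn \<open>x \<noteq> y\<close> by simp
    have Rx: "reflect n x = y"
    proof -
      have "(2 * (x \<bullet> n)) *\<^sub>R n = (2 * (1 - x \<bullet> y) / (norm (x - y) * norm (x - y))) *\<^sub>R (x - y)"
        unfolding xn by (simp add: n_def sgn_div_norm divide_inverse mult_ac)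
      also have "\<dots> = x - y" unfolding xyd using \<open>x \<noteq> y\<close> by simp
      finally show ?thesis by (simp add: reflect_def)
    qed
    define p where "p = polarise n v"
    have p: "rearranged K B \<psi>\<^sub>0 p" unfolding p_def by (rule rearranged_polarise[OF v n])
    have vc: "continuous_on (sphere 0 1) v" by (rule rearranged_continuous[OF v])
    have pc: "continuous_on (sphere 0 1) p" by (rule rearranged_continuous[OF p])
    define g where "g z = (p z - v z) * (z \<bullet> e)" for z
    have gc: "continuous_on (sphere 0 1) g" unfolding g_def by (intro continuous_intros pc vc)
    \<comment> \<open>Pairing a point with its mirror image shows the gain as the integral of a nonnegative function.\<close>
    have gg: "g z + g (reflect n z) = (p z - v z) * (z \<bullet> n) * (2 * (n \<bullet> e))" for z
    proof -
      have 1: "p (reflect n z) - v (reflect n z) = - (p z - v z)"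
        using polarise_cases[OF n, of v z] by (auto simp: p_def)
      have 2: "reflect n z \<bullet> e = z \<bullet> e - 2 * (z \<bullet> n) * (n \<bullet> e)" by (simp add: reflect_def inner_diff_left)
      show ?thesis unfolding g_def 1 2 by (simp add: algebra_simps)
    qed
    have gg0: "0 \<le> g z + g (reflect n z)" for z
      unfolding gg p_def using polarise_sign[of n v z] ne by simp
    have ggc: "continuous_on (sphere 0 1) (\<lambda>z. g z + g (reflect n z))"
      unfolding gg by (intro continuous_intros pc vc)
    have "(LINT z|sphere_prob. g z) = (LINT z|sphere_prob. p z * (z \<bullet> e)) - (LINT z|sphere_prob. v z * (z \<bullet> e))"
      unfolding g_def left_diff_distrib
      by (intro Bochner_Integration.integral_diff sphere_continuous_integrable continuous_intros pc vc)
    also have "\<dots> \<le> 0" using max[OF p] by simp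
    finally have "(LINT z|sphere_prob. g z + g (reflect n z)) \<le> 0"
      unfolding integral_sphere_reflect[OF gc n, symmetric] by simp
    moreover have "0 \<le> (LINT z|sphere_prob. g z + g (reflect n z))" by (intro integral_nonneg_AE AE_I2 gg0)
    ultimately have "g x + g (reflect n x) = 0"
      by (intro sphere_integral_zero[OF ggc gg0 _ x]) simp
    then have "p x = v x" unfolding gg using xn0 ne by simp
    then have "v x = (v x + v y) / 2 + \<bar>v x - v y\<bar> / 2"
      using xn0 Rx by (simp add: p_def polarise_def sgn_if)
    then show "v y \<le> v x" by argo
  qed
qed


section \<open>Reduction to a meridian\<close>

lemma integral_Icc_lborel:
  fixes h :: "real \<Rightarrow> real"
  assumes "continuous_on {a..b} h"
  shows "(LBINT x. indicator {a..b} x * h x) = integral {a..b} h"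
  using set_borel_integral_eq_integral(2)[OF borel_integrable_atLeastAtMost'[OF assms]]
  by (simp add: set_lebesgue_integral_def)

lemma meridian_derivative:
  fixes e :: "'a::euclidean_space"
  assumes e: "norm e = 1" and w: "norm w = 1" "e \<bullet> w = 0" and \<psi>: "smooth \<psi>"
  defines "\<gamma> \<equiv> \<lambda>s. cos s *\<^sub>R e + sin s *\<^sub>R w" and "\<gamma>' \<equiv> \<lambda>s. - sin s *\<^sub>R e + cos s *\<^sub>R w"
  shows "norm (\<gamma> s) = 1" and "((\<lambda>s. \<psi> (\<gamma> s)) has_real_derivative grad \<psi> (\<gamma> s) \<bullet> \<gamma>' s) (at s)"
    and "(grad \<psi> (\<gamma> s) \<bullet> \<gamma>' s)^2 \<le> (norm (tangential_grad \<psi> (\<gamma> s)))^2"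
    and "\<gamma> s \<bullet> e = cos s"
proof -
  have ee: "e \<bullet> e = 1" "w \<bullet> w = 1" "w \<bullet> e = 0" using e w by (simp_all add: norm_eq_1 inner_commute)
  have gg: "\<gamma> s \<bullet> \<gamma> s = 1" "\<gamma>' s \<bullet> \<gamma>' s = 1" "\<gamma> s \<bullet> \<gamma>' s = 0" "\<gamma> s \<bullet> e = cos s"
    using sin_cos_squared_add[of s]
    by (simp_all add: \<gamma>_def \<gamma>'_def inner_add_left inner_add_right ee w power2_eq_square algebra_simps)
  then show "norm (\<gamma> s) = 1" "\<gamma> s \<bullet> e = cos s" by (simp_all add: norm_eq_1)
  have "(\<gamma> has_derivative (\<lambda>h. h *\<^sub>R \<gamma>' s)) (at s)"
    unfolding \<gamma>_def \<gamma>'_def by (auto intro!: derivative_eq_intros simp: scaleR_add_right scaleR_diff_right)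
  from has_derivative_compose[OF this smooth_grad_has_derivative[OF \<psi>]]
  show "((\<lambda>s. \<psi> (\<gamma> s)) has_real_derivative grad \<psi> (\<gamma> s) \<bullet> \<gamma>' s) (at s)"
    by (simp add: has_field_derivative_def mult_commute_abs)
  have "grad \<psi> (\<gamma> s) \<bullet> \<gamma>' s = tangential_grad \<psi> (\<gamma> s) \<bullet> \<gamma>' s"
    by (simp add: tangential_grad_def inner_diff_left gg)
  then have "\<bar>grad \<psi> (\<gamma> s) \<bullet> \<gamma>' s\<bar> \<le> norm (tangential_grad \<psi> (\<gamma> s)) * norm (\<gamma>' s)"
    by (simp add: Cauchy_Schwarz_ineq2)
  also have "norm (\<gamma>' s) = 1" using gg by (simp add: norm_eq_1)
  finally show "(grad \<psi> (\<gamma> s) \<bullet> \<gamma>' s)^2 \<le> (norm (tangential_grad \<psi> (\<gamma> s)))^2"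
    by (simp add: abs_le_square_iff[symmetric])
qed

text \<open>
  In polar coordinates every integral is an average of integrals along the meridians from \<open>e\<close> to \<open>-e\<close>. Some
  meridian is at most average, up to an arbitrarily small error that avoids any discussion of where the average is attained.
\<close>

lemma meridian_integrals:
  fixes e :: "'a::euclidean_space" and J :: "'b::euclidean_space \<Rightarrow> 'a"
  assumes dim: "DIM('a) = DIM('b) + 1" and e: "norm e = 1"
    and J: "linear J" "\<And>y. norm (J y) = norm y" "\<And>y. e \<bullet> J y = 0"
  defines "\<gamma> \<equiv> \<lambda>y s. cos s *\<^sub>R e + sin s *\<^sub>R J y" and "\<rho> \<equiv> \<lambda>s. sin s ^ (DIM('b) - 1)"
  defines "Z \<equiv> \<integral>s. indicator {0<..<pi} s * \<rho> s \<partial>lborel"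
  shows "Z > 0"
    and "\<And>(F :: 'a \<Rightarrow> real) \<delta>. continuous_on (sphere 0 1) F \<Longrightarrow> (\<And>x. x \<in> sphere 0 1 \<Longrightarrow> 0 \<le> F x) \<Longrightarrow> \<delta> > 0 \<Longrightarrow>
      \<exists>y. norm y = 1 \<and> (NN s. ennreal (F (\<gamma> y s) * \<rho> s) * indicator {0<..<pi} s)
        \<le> ennreal (((LINT x|sphere_prob. F x) + \<delta>) * Z)"
    and "\<And>(F :: 'a \<Rightarrow> real) f. continuous_on (sphere 0 1) F \<Longrightarrow> (\<And>x. x \<in> sphere 0 1 \<Longrightarrow> 0 \<le> F x) \<Longrightarrow>
      (\<And>y s. norm y = 1 \<Longrightarrow> s \<in> {0<..<pi} \<Longrightarrow> F (\<gamma> y s) = f s) \<Longrightarrow>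
      (LINT x|sphere_prob. F x) * Z = (LBINT s. indicator {0<..<pi} s * (f s * \<rho> s))"
proof -
  define wt where "wt y = ennreal (DIM('a) * norm y) * indicator (ball 0 1 - {0}) y" for y :: 'b
  define W where "W = (NN y. wt y)"
  let ?S = "sphere_area TYPE('a)"
  let ?I = "\<lambda>F y. NN s. ennreal (F (\<gamma> (sgn y) s) * \<rho> s) * indicator {0<..<pi} s"
  let ?m = "\<lambda>F. LINT x|sphere_prob. F x"
  have wtm: "wt \<in> borel_measurable lborel"
  proof -
    have [measurable]: "ball (0::'b) 1 \<in> sets borel" by simp
    show ?thesis unfolding wt_def by measurable
  qed
  have \<rho>0: "0 \<le> \<rho> s" "\<rho> s \<le> 1" if "s \<in> {0<..<pi}" for s
    using that sin_gt_zero[of s] by (auto simp: \<rho>_def power_le_one)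
  have \<rho>c: "continuous_on S \<rho>" for S unfolding \<rho>_def by (intro continuous_intros)
  have [measurable]: "\<rho> \<in> borel_measurable borel" by (rule borel_measurable_continuous_onI[OF \<rho>c])
  have ind_int: "integrable lborel (\<lambda>s. indicator {0<..<pi} s * h s :: real)"
    if [measurable]: "h \<in> borel_measurable borel" and "\<And>s. s \<in> {0<..<pi} \<Longrightarrow> \<bar>h s\<bar> \<le> C" for h C
  proof (rule Bochner_Integration.integrable_bound)
    show "integrable lborel (\<lambda>s. indicator {0<..<pi} s *\<^sub>R C)" by (intro integrable_indicator) auto
    show "AE x in lborel. norm (indicator {0<..<pi} x * h x) \<le> norm (indicator {0<..<pi} x *\<^sub>R C)"
      using that(2) by (intro AE_I2) (fastforce simp: indicator_def)
  qed measurable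
  have nn: "(NN s. ennreal (h s) * indicator {0<..<pi} s) = ennreal (LBINT s. indicator {0<..<pi} s * h s)"
    if "h \<in> borel_measurable borel" "\<And>s. s \<in> {0<..<pi} \<Longrightarrow> 0 \<le> h s \<and> h s \<le> C" for h C
  proof -
    have "(NN s. ennreal (h s) * indicator {0<..<pi} s) = (NN s. ennreal (indicator {0<..<pi} s * h s))"
      by (rule nn_integral_cong) (simp add: indicator_def)
    also have "\<dots> = ennreal (LBINT s. indicator {0<..<pi} s * h s)"
      using that(2) by (intro nn_integral_eq_integral ind_int[OF that(1), of C] AE_I2) (auto simp: indicator_def)
    finally show ?thesis .
  qed
  have \<gamma>: "norm (\<gamma> y s) = 1" if "norm y = 1" for y s
    unfolding \<gamma>_def by (rule meridian_derivative(1)[OF e _ _ smooth_const]) (use that J in auto)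
  have \<gamma>c: "continuous_on UNIV (\<gamma> y)" for y unfolding \<gamma>_def by (intro continuous_intros)
  have formula: "(\<integral>\<^sup>+x. ennreal (F x) \<partial>sphere_measure) =
      (NN y. (?I F y) * wt y)"
    if "continuous_on (sphere 0 1) F" "\<And>x. x \<in> sphere 0 1 \<Longrightarrow> 0 \<le> F x" for F
    unfolding \<gamma>_def \<rho>_def wt_def
    by (rule nn_integral_meridian[OF dim e J sphere_continuous_measurable[OF that(1)] that(2)])
  have zonal: "(\<integral>\<^sup>+x. ennreal (F x) \<partial>sphere_measure) = ennreal (LBINT s. indicator {0<..<pi} s * (f s * \<rho> s)) * W"
    if F: "continuous_on (sphere 0 1) F" "\<And>x. x \<in> sphere 0 1 \<Longrightarrow> 0 \<le> F x"
      and f: "\<And>y s. norm y = 1 \<Longrightarrow> s \<in> {0<..<pi} \<Longrightarrow> F (\<gamma> y s) = f s" for F :: "'a \<Rightarrow> real" and f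
  proof -
    obtain C where C: "\<And>x. x \<in> sphere 0 1 \<Longrightarrow> norm (F x) \<le> C" "C \<ge> 0" using sphere_continuous_bounded[OF F(1)] by blast
    obtain y0 :: 'b where y0: "norm y0 = 1" using norm_Basis SOME_Basis by blast
    define h where "h s = F (\<gamma> y0 s) * \<rho> s" for s
    have "continuous_on UNIV (\<lambda>s. F (\<gamma> y0 s))"
      by (rule continuous_on_compose2[OF F(1) \<gamma>c]) (auto simp: \<gamma> y0)
    then have hm: "h \<in> borel_measurable borel"
      unfolding h_def by (intro borel_measurable_continuous_onI continuous_on_mult \<rho>c)
    have hb: "0 \<le> h s \<and> h s \<le> C" if "s \<in> {0<..<pi}" for s
    proof -
      have "\<gamma> y0 s \<in> sphere 0 1" using \<gamma>[OF y0] by simp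
      then have "0 \<le> F (\<gamma> y0 s)" "F (\<gamma> y0 s) \<le> C" using F(2) C(1) by force+
      then have "F (\<gamma> y0 s) * \<rho> s \<le> C * 1" using \<rho>0[OF that] by (intro mult_mono) auto
      then show ?thesis using \<open>0 \<le> F (\<gamma> y0 s)\<close> \<rho>0[OF that] by (simp add: h_def)
    qed
    have hf: "indicator {0<..<pi} s * (f s * \<rho> s) = indicator {0<..<pi} s * h s" for s
      using f[OF y0] by (simp add: h_def indicator_def)
    have "(?I F y) * wt y
        = ennreal (LBINT s. indicator {0<..<pi} s * h s) * wt y" for y
    proof (cases "y \<in> ball 0 1 - {0}")
      case True
      then have sy: "norm (sgn y) = 1" by (simp add: norm_sgn)
      have "(?I F y)
          = (NN s. ennreal (h s) * indicator {0<..<pi} s)"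
        by (rule nn_integral_cong) (simp add: h_def f[OF sy] f[OF y0] indicator_def)
      also have "\<dots> = ennreal (LBINT s. indicator {0<..<pi} s * h s)" by (rule nn[OF hm hb])
      finally show ?thesis by (simp only:)
    qed (simp add: wt_def)
    then have "(NN y. (?I F y) * wt y)
        = (NN y. ennreal (LBINT s. indicator {0<..<pi} s * h s) * wt y)"
      by (simp only:)
    also have "\<dots> = ennreal (LBINT s. indicator {0<..<pi} s * h s) * W"
      unfolding W_def by (rule nn_integral_cmult[OF wtm])
    finally show ?thesis unfolding hf using formula[OF F(1)] F(2) by (simp only:)
  qed
  have S: "ennreal ?S = ennreal Z * W"
  proof -
    have "ennreal ?S = (\<integral>\<^sup>+x. ennreal 1 \<partial>(sphere_measure :: 'a measure))" by (simp add: sphere_area(1))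
    also have "\<dots> = ennreal (LBINT s. indicator {0<..<pi} s * (1 * \<rho> s)) * W" by (rule zonal) auto
    finally show ?thesis by (simp add: Z_def)
  qed
  have Z0: "Z \<ge> 0" unfolding Z_def using \<rho>0 by (intro integral_nonneg_AE AE_I2) (auto simp: indicator_def)
  have Spos: "?S > 0" by (rule sphere_area(2))
  show Z: "Z > 0"
  proof (rule ccontr)
    assume "\<not> Z > 0"
    then have "Z = 0" using Z0 by simp
    then show False using S Spos by simp
  qed
  have "W \<noteq> \<infinity>"
  proof
    assume "W = \<infinity>"
    then have "ennreal ?S = \<infinity>" using S Z by (simp add: ennreal_mult_top)
    then show False by simp
  qed
  then obtain w where w: "W = ennreal w" "w \<ge> 0" by (cases W) auto
  have Sw: "?S = Z * w" using S Spos Z0 w by (simp add: ennreal_mult[symmetric])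
  show "\<exists>y. norm y = 1 \<and> (NN s. ennreal (F (\<gamma> y s) * \<rho> s) * indicator {0<..<pi} s)
        \<le> ennreal (((?m F) + \<delta>) * Z)"
    if F: "continuous_on (sphere 0 1) F" "\<And>x. x \<in> sphere 0 1 \<Longrightarrow> 0 \<le> F x" and \<delta>: "\<delta> > 0" for F :: "'a \<Rightarrow> real" and \<delta>
  proof (rule ccontr)
    assume no: "\<not> ?thesis"
    have F0: "0 \<le> (?m F)"
      using F(2) by (intro integral_nonneg_AE AE_I2) (auto simp: space_sphere_prob)
    have FS: "(LINT x|sphere_measure. F x) = (?m F) * ?S"
      using Spos by (simp add: integral_sphere_prob[OF sphere_continuous_measurable[OF F(1)]])
    have "ennreal (((?m F) + \<delta>) * Z) * W = (NN y. ennreal (((?m F) + \<delta>) * Z) * wt y)"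
      unfolding W_def by (rule nn_integral_cmult[OF wtm, symmetric])
    also have "\<dots> \<le> (NN y. (?I F y) * wt y)"
    proof (rule nn_integral_mono)
      fix y
      show "ennreal (((?m F) + \<delta>) * Z) * wt y
          \<le> (?I F y) * wt y"
      proof (cases "y \<in> ball 0 1 - {0}")
        case True
        then have "norm (sgn y) = 1" by (simp add: norm_sgn)
        then show ?thesis using no by (intro mult_right_mono) (auto simp: not_le intro: less_imp_le)
      qed (simp add: wt_def)
    qed
    also have "\<dots> = (\<integral>\<^sup>+x. ennreal (F x) \<partial>sphere_measure)" by (rule formula[OF F, symmetric])
    also have "\<dots> = ennreal (LINT x|sphere_measure. F x)"
      using F(2) by (intro nn_integral_eq_integral sphere_continuous_integrable F(1) AE_I2) auto
    finally have "ennreal (((?m F) + \<delta>) * Z * w) \<le> ennreal ((?m F) * ?S)"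
      unfolding FS using w F0 \<delta> Z0 by (simp add: ennreal_mult)
    then have "((?m F) + \<delta>) * (Z * w) \<le> (?m F) * ?S"
      using F0 Spos by (simp add: ennreal_le_iff mult.assoc)
    then show False unfolding Sw[symmetric] using mult_pos_pos[OF \<delta> Spos] by (simp add: distrib_right)
  qed
  show "(?m F) * Z = (LBINT s. indicator {0<..<pi} s * (f s * \<rho> s))"
    if F: "continuous_on (sphere 0 1) F" "\<And>x. x \<in> sphere 0 1 \<Longrightarrow> 0 \<le> F x"
      and f: "\<And>y s. norm y = 1 \<Longrightarrow> s \<in> {0<..<pi} \<Longrightarrow> F (\<gamma> y s) = f s" for F :: "'a \<Rightarrow> real" and f
  proof -
    define I where "I = (LBINT s. indicator {0<..<pi} s * (f s * \<rho> s))"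
    obtain y0 :: 'b where y0: "norm y0 = 1" using norm_Basis SOME_Basis by blast
    have "0 \<le> f s" if "s \<in> {0<..<pi}" for s
      using f[OF y0 that] F(2)[of "\<gamma> y0 s"] \<gamma>[OF y0] by simp
    then have I0: "0 \<le> I" unfolding I_def using \<rho>0 by (intro integral_nonneg_AE AE_I2) (auto simp: indicator_def)
    have "ennreal (LINT x|sphere_measure. F x) = (\<integral>\<^sup>+x. ennreal (F x) \<partial>sphere_measure)"
      using F(2) by (intro nn_integral_eq_integral[symmetric] sphere_continuous_integrable F(1) AE_I2) auto
    also have "\<dots> = ennreal I * W" unfolding I_def by (rule zonal[OF F(1)]) (use F(2) f in auto)
    also have "\<dots> = ennreal (I * w)" unfolding w(1) using I0 w(2) by (simp add: ennreal_mult)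
    finally have "(LINT x|sphere_measure. F x) = I * w"
      using I0 w(2) F(2) by (subst (asm) ennreal_inj) (auto intro!: integral_nonneg_AE AE_I2)
    moreover have "w > 0" using Sw Spos w(2) by (cases "w = 0") auto
    ultimately show ?thesis unfolding I_def[symmetric] integral_sphere_prob[OF sphere_continuous_measurable[OF F(1)]] Sw
      using Z by simp
  qed
qed

text \<open>
  The one-dimensional inequality is applied to smooth functions that approximate a zonal rearrangement,
  each on a meridian on which its energy exceeds the average by a vanishing amount at most.
\<close>

theorem sphere_interpolation:
  fixes \<psi>\<^sub>0 :: "'a::euclidean_space \<Rightarrow> real" and q :: real
  assumes dim: "DIM('a) = DIM('b::euclidean_space) + 1" and q: "q > 2" "q * (real DIM('b) - 2) < 2 * real DIM('b)"
    and A: "A = real DIM('b) / (q - 2)" and \<psi>: "smooth \<psi>\<^sub>0"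
  shows "A * (LINT x|sphere_prob. \<bar>\<psi>\<^sub>0 x\<bar> powr q) powr (2 / q) \<le> energy \<psi>\<^sub>0 + A * sqint sphere_prob \<psi>\<^sub>0"
proof -
  obtain e :: 'a where e: "norm e = 1" using norm_Basis SOME_Basis by blast
  obtain J :: "'b \<Rightarrow> 'a" where J: "linear J" "\<And>y. norm (J y) = norm y" "\<And>y. e \<bullet> J y = 0"
    using hyperplane_isometry[OF dim e] by metis
  define \<gamma> where "\<gamma> y s = cos s *\<^sub>R e + sin s *\<^sub>R J y" for y s
  define \<rho> where "\<rho> s = sin s ^ (DIM('b) - 1)" for s :: real
  define Z where "Z = (LBINT s. indicator {0<..<pi} s * \<rho> s)"
  note M = meridian_integrals[OF dim e J, folded \<rho>_def, folded Z_def \<gamma>_def]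
  obtain B where B: "B \<ge> 0" "\<And>x. x \<in> sphere 0 1 \<Longrightarrow> norm (\<psi>\<^sub>0 x) \<le> B"
    using sphere_continuous_bounded[OF smooth_continuous[OF \<psi>]] by blast
  have "compact (grad \<psi>\<^sub>0 ` cball 0 1)"
    by (intro compact_continuous_image smooth_continuous smooth_grad \<psi>) auto
  then obtain K where K: "\<And>x. x \<in> cball 0 1 \<Longrightarrow> norm (grad \<psi>\<^sub>0 x) \<le> K"
    using compact_imp_bounded bounded_iff by (metis imageI)
  have "rearranged K B \<psi>\<^sub>0 \<psi>\<^sub>0"
    unfolding rearranged_def using B K \<psi> by (auto intro!: exI[of _ \<psi>\<^sub>0])
  from zonal_rearrangement[OF e this] obtain v where v: "rearranged K B \<psi>\<^sub>0 v"
    and mono: "\<And>x y. x \<in> sphere 0 1 \<Longrightarrow> y \<in> sphere 0 1 \<Longrightarrow> y \<bullet> e < x \<bullet> e \<Longrightarrow> v y \<le> v x" by blast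
  have vc: "continuous_on (sphere 0 1) v" by (rule rearranged_continuous[OF v])
  have vB: "\<bar>v x\<bar> \<le> B" if "x \<in> sphere 0 1" for x using v that unfolding rearranged_def by blast
  have \<gamma>: "\<gamma> y s \<in> sphere 0 1" "\<gamma> y s \<bullet> e = cos s" if "norm y = 1" for y s
    using meridian_derivative(1,4)[OF e _ _ smooth_const, of "J y" s] that J by (simp_all add: \<gamma>_def)
  have \<gamma>c: "continuous_on UNIV (\<gamma> y)" for y unfolding \<gamma>_def by (intro continuous_intros)
  have v\<gamma>c: "continuous_on UNIV (\<lambda>s. v (\<gamma> y s))" if "norm y = 1" for y
    by (rule continuous_on_compose2[OF vc \<gamma>c]) (use \<gamma>[OF that] in auto)
  obtain y0 :: 'b where y0: "norm y0 = 1" using norm_Basis SOME_Basis by blast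
  define f where "f s = v (\<gamma> y0 s)" for s
  \<comment> \<open>Monotonicity in the height and continuity make the values on all meridians agree.\<close>
  have v_le: "v (\<gamma> y s) \<le> v (\<gamma> y' s)" if y: "norm y = 1" "norm y' = 1" and s: "s \<in> {0<..<pi}" for y y' s
  proof -
    have "(\<lambda>n. s + (pi - s) / real (Suc n)) \<longlonglongrightarrow> s + 0"
      by (intro tendsto_add tendsto_const LIMSEQ_Suc lim_const_over_n)
    then have "(\<lambda>n. v (\<gamma> y (s + (pi - s) / real (Suc n)))) \<longlonglongrightarrow> v (\<gamma> y s)"
      using continuous_on_tendsto_compose[OF v\<gamma>c[OF y(1)]] by simp
    then show ?thesis
    proof (rule LIMSEQ_le_const2, intro exI allI impI)
      fix n :: nat
      have "(pi - s) / real (Suc n) \<le> (pi - s) / 1" using s by (intro divide_left_mono) auto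
      moreover have "0 < (pi - s) / real (Suc n)" using s by simp
      ultimately have "cos (s + (pi - s) / real (Suc n)) < cos s"
        using s by (intro cos_monotone_0_pi) auto
      then show "v (\<gamma> y (s + (pi - s) / real (Suc n))) \<le> v (\<gamma> y' s)"
        using \<gamma>[OF y(1)] \<gamma>[OF y(2)] by (intro mono) auto
    qed
  qed
  then have vf: "v (\<gamma> y s) = f s" if "norm y = 1" "s \<in> {0<..<pi}" for y s
    unfolding f_def using that y0 by (intro antisym) auto
  define \<delta> where "\<delta> m = 1 / real (Suc m)" for m
  have \<delta>: "\<delta> m > 0" "\<delta> m \<le> 1" for m by (simp_all add: \<delta>_def)
  have \<delta>0: "\<delta> \<longlonglongrightarrow> 0" unfolding \<delta>_def by (intro LIMSEQ_Suc lim_const_over_n)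
  define Q where "Q m \<psi> y \<longleftrightarrow> smooth \<psi> \<and> (\<forall>x\<in>sphere 0 1. \<bar>\<psi> x - v x\<bar> \<le> \<delta> m) \<and> norm y = 1 \<and>
      (NN s. ennreal ((norm (tangential_grad \<psi> (\<gamma> y s)))^2 * \<rho> s) * indicator {0<..<pi} s)
        \<le> ennreal ((energy \<psi>\<^sub>0 + \<delta> m) * Z)" for m \<psi> y
  have "\<exists>\<psi> y. Q m \<psi> y" for m
  proof -
    obtain \<psi> where \<psi>: "smooth \<psi>" "energy \<psi> \<le> energy \<psi>\<^sub>0" "\<And>x. x \<in> sphere 0 1 \<Longrightarrow> \<bar>\<psi> x - v x\<bar> \<le> \<delta> m"
      using rearranged_approx[OF v \<delta>(1)] by metis
    have "\<exists>y. norm y = 1 \<and> (NN s. ennreal ((norm (tangential_grad \<psi> (\<gamma> y s)))^2 * \<rho> s) * indicator {0<..<pi} s)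
        \<le> ennreal ((energy \<psi> + \<delta> m) * Z)"
      unfolding energy_def
      by (rule M(2)) (auto intro!: continuous_intros tangential_grad_continuous \<psi>(1) \<delta>)
    then obtain y where y: "norm y = 1" "(NN s. ennreal ((norm (tangential_grad \<psi> (\<gamma> y s)))^2 * \<rho> s) * indicator {0<..<pi} s)
        \<le> ennreal ((energy \<psi> + \<delta> m) * Z)" by blast
    note y(2)
    also have "ennreal ((energy \<psi> + \<delta> m) * Z) \<le> ennreal ((energy \<psi>\<^sub>0 + \<delta> m) * Z)"
      using \<psi>(2) M(1) by (intro ennreal_leI mult_right_mono) auto
    finally show ?thesis unfolding Q_def using \<psi> y(1) by blast
  qed
  then obtain \<psi> y where "\<And>m. Q m (\<psi> m) (y m)" by metis
  then have \<psi>m: "\<And>m. smooth (\<psi> m)" "\<And>m x. x \<in> sphere 0 1 \<Longrightarrow> \<bar>\<psi> m x - v x\<bar> \<le> \<delta> m"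
    and y: "\<And>m. norm (y m) = 1" and
    en: "\<And>m. (NN s. ennreal ((norm (tangential_grad (\<psi> m) (\<gamma> (y m) s)))^2 * \<rho> s) * indicator {0<..<pi} s)
        \<le> ennreal ((energy \<psi>\<^sub>0 + \<delta> m) * Z)" unfolding Q_def by blast+
  define F where "F m s = \<psi> m (\<gamma> (y m) s)" for m s
  define F' where "F' m s = grad (\<psi> m) (\<gamma> (y m) s) \<bullet> (- sin s *\<^sub>R e + cos s *\<^sub>R J (y m))" for m s
  have dF: "(F m has_real_derivative F' m s) (at s)"
    and F'_le: "(F' m s)^2 \<le> (norm (tangential_grad (\<psi> m) (\<gamma> (y m) s)))^2" for m s
    using meridian_derivative(2,3)[OF e _ _ \<psi>m(1)[of m], of "J (y m)" s] y[of m] J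
    by (simp_all add: F_def[abs_def] F'_def \<gamma>_def)
  have F'c: "continuous_on S (F' m)" for S m
    unfolding F'_def
    by (intro continuous_intros continuous_on_compose2[OF smooth_continuous[OF smooth_grad[OF \<psi>m(1)], of UNIV]]
        continuous_on_subset[OF \<gamma>c]) auto
  have Fc: "continuous_on S (F m)" for S m
    unfolding F_def
    by (intro continuous_on_compose2[OF smooth_continuous[OF \<psi>m(1), of UNIV]] continuous_on_subset[OF \<gamma>c]) auto
  have FB: "\<bar>F m s\<bar> \<le> B + 1" for m s
    using \<psi>m(2)[OF \<gamma>(1)[OF y], of m m s] vB[OF \<gamma>(1)[OF y], of m s] \<delta>(2)[of m] unfolding F_def by argo
  have Flim: "(\<lambda>m. F m s) \<longlonglongrightarrow> f s" if s: "s \<in> {0<..<pi}" for s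
  proof (rule Lim_transform_bound[OF always_eventually _ , THEN LIM_zero_cancel])
    show "\<forall>m. norm (F m s - f s) \<le> norm (\<delta> m)"
      using \<psi>m(2)[OF \<gamma>(1)[OF y], of _ _ s] vf[OF y s] \<delta>(1) by (simp add: F_def less_imp_le)
  qed (rule \<delta>0)
  \<comment> \<open>The one-dimensional inequality requires endpoints inside \<open>(0, \<pi>)\<close>.\<close>
  define a where "a m = \<delta> m" for m
  define b where "b m = pi - \<delta> m" for m
  have ab: "0 < a m" "a m < b m" "b m < pi" for m
    using \<delta>[of m] pi_gt3 by (simp_all add: a_def b_def)
  have sub: "{a m..b m} \<subseteq> {0<..<pi}" for m using ab[of m] by auto
  have \<rho>c: "continuous_on S \<rho>" for S unfolding \<rho>_def by (intro continuous_intros)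
  have \<rho>0: "0 \<le> \<rho> s" "\<rho> s \<le> 1" if "s \<in> {0<..<pi}" for s
    using that sin_gt_zero[of s] by (auto simp: \<rho>_def power_le_one)
  have \<rho>ab: "0 \<le> \<rho> s" if "s \<in> {a m..b m}" for m s using \<rho>0(1) sub that by blast
  have lim: "(\<lambda>m. integral {a m..b m} (\<lambda>s. g m s * \<rho> s)) \<longlonglongrightarrow> (LBINT s. indicator {0<..<pi} s * (h s * \<rho> s))"
    if g: "\<And>m. continuous_on UNIV (g m)" and h: "continuous_on UNIV h" and C: "\<And>m s. \<bar>g m s\<bar> \<le> C"
      and gh: "\<And>s. s \<in> {0<..<pi} \<Longrightarrow> (\<lambda>m. g m s) \<longlonglongrightarrow> h s" for g :: "nat \<Rightarrow> real \<Rightarrow> real" and h :: "real \<Rightarrow> real" and C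
  proof -
    have [measurable]: "g m \<in> borel_measurable borel" "h \<in> borel_measurable borel" "\<rho> \<in> borel_measurable borel" for m
      using g h \<rho>c by (auto intro: borel_measurable_continuous_onI)
    have "(\<lambda>m. \<integral>s. indicator {a m..b m} s * (g m s * \<rho> s) \<partial>lborel) \<longlonglongrightarrow> (LBINT s. indicator {0<..<pi} s * (h s * \<rho> s))"
    proof (rule integral_dominated_convergence[where w = "\<lambda>s. indicator {0<..<pi} s *\<^sub>R C"])
      show "integrable lborel (\<lambda>s::real. indicator {0<..<pi} s *\<^sub>R C)" by (intro integrable_indicator) auto
      show "AE s in lborel. norm (indicator {a m..b m} s * (g m s * \<rho> s)) \<le> indicator {0<..<pi} s *\<^sub>R C" for m
      proof (rule AE_I2)
        fix s :: real
        show "norm (indicator {a m..b m} s * (g m s * \<rho> s)) \<le> indicator {0<..<pi} s *\<^sub>R C"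
        proof (cases "s \<in> {a m..b m}")
          case True
          then have s: "s \<in> {0<..<pi}" using sub by blast
          then have "\<bar>g m s\<bar> * \<bar>\<rho> s\<bar> \<le> C * 1" using C[of m s] \<rho>0[OF s] by (intro mult_mono) auto
          then show ?thesis using True s by (simp add: abs_mult)
        next
          case False
          then show ?thesis using order_trans[OF abs_ge_zero C[of m s]] by (auto simp: indicator_def)
        qed
      qed
      show "AE s in lborel. (\<lambda>m. indicator {a m..b m} s * (g m s * \<rho> s)) \<longlonglongrightarrow> indicator {0<..<pi} s * (h s * \<rho> s)"
      proof (rule AE_I2)
        fix s :: real
        show "(\<lambda>m. indicator {a m..b m} s * (g m s * \<rho> s)) \<longlonglongrightarrow> indicator {0<..<pi} s * (h s * \<rho> s)"
        proof (cases "s \<in> {0<..<pi}")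
          case True
          then have "0 < min s (pi - s)" by auto
          then have "\<forall>\<^sub>F m in sequentially. \<delta> m < min s (pi - s)" by (rule order_tendstoD(2)[OF \<delta>0])
          then have "\<forall>\<^sub>F m in sequentially. g m s * \<rho> s = indicator {a m..b m} s * (g m s * \<rho> s)"
            by eventually_elim (auto simp: a_def b_def)
          moreover have "(\<lambda>m. g m s * \<rho> s) \<longlonglongrightarrow> h s * \<rho> s" by (intro tendsto_mult gh[OF True] tendsto_const)
          ultimately show ?thesis using True by (auto intro: Lim_transform_eventually)
        next
          case False
          then have "s \<notin> {a m..b m}" for m using sub by blast
          with False show ?thesis by simp
        qed
      qed
    qed measurable
    moreover have "(LBINT s. indicator {a m..b m} s * (g m s * \<rho> s)) = integral {a m..b m} (\<lambda>s. g m s * \<rho> s)" for m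
      by (intro integral_Icc_lborel continuous_on_mult \<rho>c continuous_on_subset[OF g]) auto
    ultimately show ?thesis by simp
  qed
  have A0: "A > 0" unfolding A using q(1) by simp
  let ?I = "\<lambda>h. \<integral>s. indicator {0<..<pi} s * (h s * \<rho> s) \<partial>lborel"
  have ineq: "A * integral {a m..b m} (\<lambda>s. 1 * \<rho> s) powr (1 - 2 / q) * integral {a m..b m} (\<lambda>s. \<bar>F m s\<bar> powr q * \<rho> s) powr (2 / q)
      \<le> (energy \<psi>\<^sub>0 + \<delta> m) * Z + A * integral {a m..b m} (\<lambda>s. (F m s)^2 * \<rho> s)" for m
  proof -
    have pw: "sin s powr (real DIM('b) - 1) = \<rho> s" if "s \<in> {a m..b m}" for s
    proof -
      have "sin s > 0" using that sub by (intro sin_gt_zero) force+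
      moreover have "real DIM('b) - 1 = real (DIM('b) - 1)" by (simp add: of_nat_diff DIM_positive Suc_leI)
      ultimately show ?thesis unfolding \<rho>_def by (simp only: powr_realpow)
    qed
    have *: "integral {a m..b m} (\<lambda>s. g s * sin s powr (real DIM('b) - 1)) = integral {a m..b m} (\<lambda>s. g s * \<rho> s)" for g
      by (rule integral_cong) (simp add: pw)
    have "A * integral {a m..b m} (\<lambda>s. sin s powr (real DIM('b) - 1)) powr (1 - 2 / q)
        * integral {a m..b m} (\<lambda>s. \<bar>F m s\<bar> powr q * sin s powr (real DIM('b) - 1)) powr (2 / q)
      \<le> integral {a m..b m} (\<lambda>s. (F' m s)^2 * sin s powr (real DIM('b) - 1))
        + A * integral {a m..b m} (\<lambda>s. (F m s)^2 * sin s powr (real DIM('b) - 1))"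
      by (rule ultraspherical_interpolation[OF ab _ q A])
         (use DIM_positive[where 'a='b] dF F'c in \<open>auto simp: Suc_leI intro: has_field_derivative_at_within\<close>)
    then have "A * integral {a m..b m} (\<lambda>s. 1 * \<rho> s) powr (1 - 2 / q)
        * integral {a m..b m} (\<lambda>s. \<bar>F m s\<bar> powr q * \<rho> s) powr (2 / q)
      \<le> integral {a m..b m} (\<lambda>s. (F' m s)^2 * \<rho> s) + A * integral {a m..b m} (\<lambda>s. (F m s)^2 * \<rho> s)"
      using *[of "\<lambda>_. 1"] by (simp only: * mult_1)
    also have "integral {a m..b m} (\<lambda>s. (F' m s)^2 * \<rho> s) \<le> (energy \<psi>\<^sub>0 + \<delta> m) * Z"
    proof -
      have "ennreal (integral {a m..b m} (\<lambda>s. (F' m s)^2 * \<rho> s))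
          = (NN s. ennreal ((F' m s)^2 * \<rho> s) * indicator {a m..b m} s)"
        by (intro nn_integral_Icc[symmetric] continuous_on_mult \<rho>c continuous_on_power F'c mult_nonneg_nonneg \<rho>ab zero_le_power2)
      also have "\<dots> \<le> (NN s. ennreal ((norm (tangential_grad (\<psi> m) (\<gamma> (y m) s)))^2 * \<rho> s) * indicator {0<..<pi} s)"
      proof (rule nn_integral_mono)
        fix s :: real
        show "ennreal ((F' m s)^2 * \<rho> s) * indicator {a m..b m} s
            \<le> ennreal ((norm (tangential_grad (\<psi> m) (\<gamma> (y m) s)))^2 * \<rho> s) * indicator {0<..<pi} s"
        proof (cases "s \<in> {a m..b m}")
          case True
          then have s: "s \<in> {0<..<pi}" using sub by blast
          then show ?thesis using True F'_le[of m s] \<rho>0[OF s] by (simp add: ennreal_leI mult_right_mono)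
        qed simp
      qed
      also have "\<dots> \<le> ennreal ((energy \<psi>\<^sub>0 + \<delta> m) * Z)" by (rule en)
      finally show ?thesis
      proof (subst (asm) ennreal_le_iff)
        have "0 \<le> energy \<psi>\<^sub>0" unfolding energy_def by (intro integral_nonneg_AE AE_I2) auto
        then show "0 \<le> (energy \<psi>\<^sub>0 + \<delta> m) * Z" using \<delta>[of m] M(1) by simp
      qed
    qed
    finally show ?thesis by simp
  qed
  have q0: "q > 0" using q by simp
  have fc: "continuous_on UNIV f" unfolding f_def by (rule v\<gamma>c[OF y0])
  have Fq: "continuous_on S (\<lambda>s. \<bar>F m s\<bar> powr q)" for S m
    using q0 by (intro continuous_on_powr' continuous_on_rabs Fc continuous_on_const) auto
  have limq: "(\<lambda>m. integral {a m..b m} (\<lambda>s. \<bar>F m s\<bar> powr q * \<rho> s)) \<longlonglongrightarrow> ?I (\<lambda>s. \<bar>f s\<bar> powr q)"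
  proof (rule lim)
    show "continuous_on UNIV (\<lambda>s. \<bar>F m s\<bar> powr q)" for m by (rule Fq)
    show "continuous_on UNIV (\<lambda>s. \<bar>f s\<bar> powr q)"
      using q0 by (intro continuous_on_powr' continuous_on_rabs fc continuous_on_const) auto
    show "\<bar>\<bar>F m s\<bar> powr q\<bar> \<le> (B + 1) powr q" for m s using FB[of m s] q0 by (simp add: powr_mono2)
    show "(\<lambda>m. \<bar>F m s\<bar> powr q) \<longlonglongrightarrow> \<bar>f s\<bar> powr q" if "s \<in> {0<..<pi}" for s
      using q0 by (intro tendsto_powr' tendsto_rabs Flim[OF that] tendsto_const) auto
  qed
  have lim2: "(\<lambda>m. integral {a m..b m} (\<lambda>s. (F m s)^2 * \<rho> s)) \<longlonglongrightarrow> ?I (\<lambda>s. (f s)^2)"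
  proof (rule lim)
    show "\<bar>(F m s)^2\<bar> \<le> (B + 1)^2" for m s
      using power_mono[OF FB[of m s], of 2] by simp
  qed (auto intro!: continuous_intros Fc fc tendsto_intros Flim)
  have lim1: "(\<lambda>m. integral {a m..b m} (\<lambda>s. 1 * \<rho> s)) \<longlonglongrightarrow> ?I (\<lambda>s. 1)"
    by (rule lim[where C = 1]) auto
  have Z1: "?I (\<lambda>s. 1) = Z" by (simp add: Z_def)
  have "A * Z powr (1 - 2 / q) * ?I (\<lambda>s. \<bar>f s\<bar> powr q) powr (2 / q) \<le> (energy \<psi>\<^sub>0 + 0) * Z + A * ?I (\<lambda>s. (f s)^2)"
  proof (rule LIMSEQ_le)
    show "(\<lambda>m. A * integral {a m..b m} (\<lambda>s. 1 * \<rho> s) powr (1 - 2 / q) * integral {a m..b m} (\<lambda>s. \<bar>F m s\<bar> powr q * \<rho> s) powr (2 / q))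
        \<longlonglongrightarrow> A * Z powr (1 - 2 / q) * ?I (\<lambda>s. \<bar>f s\<bar> powr q) powr (2 / q)"
    proof (intro tendsto_mult tendsto_const)
      show "(\<lambda>m. integral {a m..b m} (\<lambda>s. 1 * \<rho> s) powr (1 - 2 / q)) \<longlonglongrightarrow> Z powr (1 - 2 / q)"
        using lim1 M(1) unfolding Z1 by (intro tendsto_powr tendsto_const) auto
      show "(\<lambda>m. integral {a m..b m} (\<lambda>s. \<bar>F m s\<bar> powr q * \<rho> s) powr (2 / q)) \<longlonglongrightarrow> ?I (\<lambda>s. \<bar>f s\<bar> powr q) powr (2 / q)"
        using q0
        by (intro tendsto_powr' limq tendsto_const disjI2 conjI always_eventually allI integral_nonneg
            integrable_continuous_interval continuous_on_mult \<rho>c Fq mult_nonneg_nonneg \<rho>ab) auto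
    qed
    show "(\<lambda>m. (energy \<psi>\<^sub>0 + \<delta> m) * Z + A * integral {a m..b m} (\<lambda>s. (F m s)^2 * \<rho> s))
        \<longlonglongrightarrow> (energy \<psi>\<^sub>0 + 0) * Z + A * ?I (\<lambda>s. (f s)^2)"
      by (intro tendsto_intros \<delta>0 lim2)
  qed (use ineq in blast)
  moreover have equi: "(LINT x|sphere_prob. h (\<psi>\<^sub>0 x)) * Z = ?I (\<lambda>s. h (f s))"
    if h: "continuous_on UNIV h" "\<And>t. 0 \<le> h t" for h :: "real \<Rightarrow> real"
  proof -
    have "(LINT x|sphere_prob. h (\<psi>\<^sub>0 x)) = (LINT x|sphere_prob. h (v x))" using v h(1) unfolding rearranged_def by simp
    moreover have "(LINT x|sphere_prob. h (v x)) * Z = ?I (\<lambda>s. h (f s))"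
      by (rule M(3)) (use h vf in \<open>auto intro: continuous_on_compose2[OF h(1) vc]\<close>)
    ultimately show ?thesis by simp
  qed
  define N where "N = (LINT x|sphere_prob. \<bar>\<psi>\<^sub>0 x\<bar> powr q)"
  have N: "N * Z = ?I (\<lambda>s. \<bar>f s\<bar> powr q)"
    unfolding N_def using q0 by (intro equi continuous_on_powr' continuous_intros) auto
  have "sqint sphere_prob \<psi>\<^sub>0 * Z = ?I (\<lambda>s. (f s)^2)" by (intro equi continuous_intros) auto
  ultimately have "A * Z powr (1 - 2 / q) * (N * Z) powr (2 / q) \<le> energy \<psi>\<^sub>0 * Z + A * (sqint sphere_prob \<psi>\<^sub>0 * Z)"
    unfolding N by simp
  moreover have "Z powr (1 - 2 / q) * (N * Z) powr (2 / q) = N powr (2 / q) * Z"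
  proof -
    have "N \<ge> 0" unfolding N_def by (intro integral_nonneg_AE AE_I2) auto
    moreover have "Z powr (1 - 2 / q) * Z powr (2 / q) = Z" using M(1) by (simp add: powr_add[symmetric])
    ultimately show ?thesis using M(1) by (simp add: powr_mult mult_ac)
  qed
  ultimately have "(A * N powr (2 / q)) * Z \<le> (energy \<psi>\<^sub>0 + A * sqint sphere_prob \<psi>\<^sub>0) * Z"
    by (simp add: mult.assoc distrib_right)
  then show ?thesis unfolding N_def using M(1) by simp
qed


section \<open>Small potentials\<close>

text \<open>The critical exponent is reached as a limit because \<open>\<psi>\<close> is bounded.\<close>

lemma sphere_interpolation_critical:
  fixes \<psi> :: "'a::euclidean_space \<Rightarrow> real" and q :: real
  assumes dim: "DIM('a) = DIM('b::euclidean_space) + 1" and q: "q > 2" "q * (real DIM('b) - 2) \<le> 2 * real DIM('b)"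
    and \<psi>: "smooth \<psi>"
  shows "real DIM('b) / (q - 2) * (LINT x|sphere_prob. \<bar>\<psi> x\<bar> powr q) powr (2 / q)
    \<le> energy \<psi> + real DIM('b) / (q - 2) * sqint sphere_prob \<psi>"
proof -
  define r where "r n = q - (q - 2) / (real n + 2)" for n
  have r: "2 < r n" "r n < q" for n
  proof -
    have "(q - 2) / (real n + 2) < (q - 2) / 1" using q(1) by (intro divide_strict_left_mono) auto
    then show "2 < r n" by (simp add: r_def)
    show "r n < q" using q(1) by (simp add: r_def)
  qed
  have r_lim: "r \<longlonglongrightarrow> q"
  proof -
    have "(\<lambda>n. (q - 2) / (real n + 2)) \<longlonglongrightarrow> 0" by real_asymp
    then have "r \<longlonglongrightarrow> q - 0" unfolding r_def[abs_def] by (intro tendsto_diff tendsto_const)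
    then show ?thesis by simp
  qed
  have sub: "r n * (real DIM('b) - 2) < 2 * real DIM('b)" for n
  proof (cases "real DIM('b) - 2 > 0")
    case True
    then have "r n * (real DIM('b) - 2) < q * (real DIM('b) - 2)" using r(2) by (intro mult_strict_right_mono) auto
    then show ?thesis using q(2) by linarith
  next
    case False
    then have "r n * (real DIM('b) - 2) \<le> 0" using r(1)[of n] by (intro mult_nonneg_nonpos) auto
    moreover have "0 < real DIM('b)" by simp
    ultimately show ?thesis by linarith
  qed
  obtain B where B: "B \<ge> 0" "\<And>x. x \<in> sphere 0 1 \<Longrightarrow> norm (\<psi> x) \<le> B"
    using sphere_continuous_bounded[OF smooth_continuous[OF \<psi>]] by blast
  have cont: "continuous_on (sphere 0 1) (\<lambda>x. \<bar>\<psi> x\<bar> powr s)" if "s > 0" for s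
    using that by (intro continuous_on_powr' continuous_on_rabs smooth_continuous \<psi> continuous_on_const) auto
  have "(\<lambda>n. \<integral>x. \<bar>\<psi> x\<bar> powr r n \<partial>sphere_prob) \<longlonglongrightarrow> (LINT x|sphere_prob. \<bar>\<psi> x\<bar> powr q)"
  proof (rule sphere_integral_limit)
    show "continuous_on (sphere 0 1) (\<lambda>x. \<bar>\<psi> x\<bar> powr r n)" for n using r(1)[of n] by (intro cont) simp
    show "continuous_on (sphere 0 1) (\<lambda>x. \<bar>\<psi> x\<bar> powr q)" using q(1) by (intro cont) simp
    show "\<bar>\<bar>\<psi> x\<bar> powr r n\<bar> \<le> (1 + B) powr q" if "x \<in> sphere 0 1" for n x
    proof -
      have "\<bar>\<psi> x\<bar> powr r n \<le> (1 + B) powr r n" using B(2)[OF that] r(1)[of n] by (intro powr_mono2) auto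
      also have "\<dots> \<le> (1 + B) powr q" using B(1) r(2)[of n] by (intro powr_mono) auto
      finally show ?thesis by simp
    qed
    show "(\<lambda>n. \<bar>\<psi> x\<bar> powr r n) \<longlonglongrightarrow> \<bar>\<psi> x\<bar> powr q" for x
      using q(1) by (intro tendsto_powr' tendsto_const r_lim) auto
  qed
  then have "(\<lambda>n. (LINT x|sphere_prob. \<bar>\<psi> x\<bar> powr r n) powr (2 / r n)) \<longlonglongrightarrow> (LINT x|sphere_prob. \<bar>\<psi> x\<bar> powr q) powr (2 / q)"
    using q(1)
    by (intro tendsto_powr' tendsto_divide tendsto_const r_lim disjI2 conjI always_eventually allI integral_nonneg_AE AE_I2) auto
  moreover have "(\<lambda>n. real DIM('b) / (r n - 2)) \<longlonglongrightarrow> real DIM('b) / (q - 2)"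
    using q(1) by (intro tendsto_divide tendsto_const tendsto_diff r_lim) auto
  ultimately show ?thesis
  proof (intro LIMSEQ_le[OF tendsto_mult tendsto_add[OF tendsto_const tendsto_mult[OF _ tendsto_const]]])
    show "\<exists>N. \<forall>n\<ge>N. real DIM('b) / (r n - 2) * (LINT x|sphere_prob. \<bar>\<psi> x\<bar> powr r n) powr (2 / r n)
        \<le> energy \<psi> + real DIM('b) / (r n - 2) * sqint sphere_prob \<psi>"
      using sphere_interpolation[OF dim r(1) sub refl \<psi>] by blast
  qed
qed

lemma Holder_integral:
  fixes f g :: "'a \<Rightarrow> real"
  assumes pr: "p > 1" "r > 1" "1 / p + 1 / r = 1"
    and nonneg: "\<And>x. x \<in> space M \<Longrightarrow> 0 \<le> f x" "\<And>x. x \<in> space M \<Longrightarrow> 0 \<le> g x"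
    and f: "f \<in> borel_measurable M" "integrable M (\<lambda>x. f x powr p)"
    and g: "g \<in> borel_measurable M" "integrable M (\<lambda>x. g x powr r)"
  shows "(LINT x|M. f x * g x) \<le> (LINT x|M. f x powr p) powr (1 / p) * (LINT x|M. g x powr r) powr (1 / r)"
proof -
  let ?F = "\<integral>x. f x powr p \<partial>M" and ?G = "\<integral>x. g x powr r \<partial>M"
  have zero: "AE x in M. h x = 0" if "(LINT x|M. h x powr s) = 0" "integrable M (\<lambda>x. h x powr s)" for h :: "'a \<Rightarrow> real" and s
    using that by (subst (asm) integral_nonneg_eq_0_iff_AE) auto
  have FG: "?F \<ge> 0" "?G \<ge> 0" by (auto intro!: integral_nonneg_AE AE_I2)
  show ?thesis
  proof (cases "?F = 0 \<or> ?G = 0")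
    case True
    then have "AE x in M. f x * g x = 0" using zero[OF _ f(2)] zero[OF _ g(2)] by auto
    then have "(LINT x|M. f x * g x) = (LINT x|M. 0)"
      using f(1) g(1) by (intro integral_cong_AE) auto
    then show ?thesis by simp
  next
    case False
    then have F: "?F > 0" and G: "?G > 0" using FG by (simp_all add: less_le)
    define a b where "a = ?F powr (1 / p)" and "b = ?G powr (1 / r)"
    have ab: "a > 0" "b > 0" "a powr p = ?F" "b powr r = ?G"
      using F G pr by (simp_all add: a_def b_def powr_powr)
    have pt: "f x * g x \<le> a * b * (f x powr p / (p * ?F) + g x powr r / (r * ?G))" if x: "x \<in> space M" for x
    proof -
      have "(f x / a) * (g x / b) \<le> (f x / a) powr p / p + (g x / b) powr r / r"
        using nonneg[OF x] ab by (intro Youngs_inequality pr) auto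
      also have "\<dots> = f x powr p / (p * ?F) + g x powr r / (r * ?G)"
        using nonneg[OF x] ab by (simp add: powr_divide mult.commute)
      finally show ?thesis using ab by (simp add: field_simps)
    qed
    have rhs: "integrable M (\<lambda>x. a * b * (f x powr p / (p * ?F) + g x powr r / (r * ?G)))"
      by (intro integrable_mult_right Bochner_Integration.integrable_add integrable_divide f(2) g(2))
    have "(LINT x|M. f x * g x) \<le> (LINT x|M. a * b * (f x powr p / (p * ?F) + g x powr r / (r * ?G)))"
    proof (rule integral_mono_AE[OF _ rhs])
      show "integrable M (\<lambda>x. f x * g x)"
      proof (rule Bochner_Integration.integrable_bound[OF rhs])
        show "AE x in M. norm (f x * g x) \<le> norm (a * b * (f x powr p / (p * ?F) + g x powr r / (r * ?G)))"
        proof (rule AE_I2)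
          fix x assume x: "x \<in> space M"
          have "\<bar>f x * g x\<bar> = f x * g x" using nonneg[OF x] by simp
          then show "norm (f x * g x) \<le> norm (a * b * (f x powr p / (p * ?F) + g x powr r / (r * ?G)))"
            using pt[OF x] unfolding real_norm_def by linarith
        qed
      qed (use f(1) g(1) in measurable)
    qed (use pt in \<open>auto intro!: AE_I2\<close>)
    also have "\<dots> = a * b * (1 / p + 1 / r)" using f(2) g(2) F G pr by simp
    finally show ?thesis unfolding pr(3) a_def b_def by simp
  qed
qed

text \<open>
  For \<open>q = 2 p / (p - 1)\<close> the interpolation constant \<open>d / (q - 2)\<close> is \<open>d (p - 1) / 2\<close>, the threshold for
  \<open>\<mu>\<close>. By Hoelder's inequality \<open>\<integral> V \<psi>\<^sup>2 \<le> \<mu> \<parallel>\<psi>\<parallel>\<^sub>q\<^sup>2\<close>, and below the threshold the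
  interpolation inequality bounds this by \<open>\<integral> |\<nabla>\<psi>|\<^sup>2 + \<mu> \<integral> \<psi>\<^sup>2\<close>.
\<close>

lemma lambda1_sphere_le_Lp_norm:
  fixes V :: "'a::euclidean_space \<Rightarrow> real"
  assumes dim: "DIM('a) = DIM('b::euclidean_space) + 1" and p: "p \<ge> 1" "p \<ge> real DIM('b) / 2"
    and V: "V \<in> nonneg_Lp p" and small: "Lp_norm sphere_prob p V \<le> real DIM('b) * (p - 1) / 2"
  shows "\<bar>lambda1_sphere V\<bar> \<le> Lp_norm sphere_prob p V"
proof (rule lambda1_sphere_abs_le)
  note Vi = nonneg_Lp_integrable[OF V p(1)]
  show "V \<in> borel_measurable sphere_measure" "\<And>x. x \<in> sphere 0 1 \<Longrightarrow> 0 \<le> V x" "integrable sphere_prob V"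
    by (fact Vi)+
  define \<mu> where "\<mu> = Lp_norm sphere_prob p V"
  have \<mu>0: "\<mu> \<ge> 0" by (simp add: \<mu>_def Lp_norm_def)
  have \<mu>p: "(LINT x|sphere_prob. V x powr p) = \<mu> powr p"
    unfolding \<mu>_def using p(1) by (intro Lp_norm_sphere_powr V) simp
  show "form_bound V (Lp_norm sphere_prob p V)"
    unfolding form_bound_def \<mu>_def[symmetric]
  proof (intro allI impI)
    fix \<psi> :: "'a \<Rightarrow> real" assume \<psi>: "smooth \<psi>"
    have [measurable]: "\<psi> \<in> borel_measurable sphere_prob" "V \<in> borel_measurable sphere_prob"
      using Vi(1) sphere_continuous_measurable[OF smooth_continuous[OF \<psi>]] by (simp_all add: measurable_sphere_prob)
    show "(LINT x|sphere_prob. V x * (\<psi> x)^2) \<le> energy \<psi> + \<mu> * sqint sphere_prob \<psi>"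
    proof (cases "p = 1")
      case True
      \<comment> \<open>The threshold is \<open>0\<close>, so \<open>V\<close> vanishes almost everywhere.\<close>
      then have "\<mu> = 0" using small \<mu>0 by (simp add: \<mu>_def)
      have "(LINT x|sphere_prob. V x) = (LINT x|sphere_prob. V x powr p)"
        using True Vi(2) by (intro Bochner_Integration.integral_cong) (auto simp: space_sphere_prob)
      then have "(LINT x|sphere_prob. V x) = 0" unfolding \<mu>p \<open>\<mu> = 0\<close> by simp
      then have "AE x in sphere_prob. V x = 0"
        using Vi(2,3) by (subst (asm) integral_nonneg_eq_0_iff_AE) (auto simp: space_sphere_prob intro!: AE_I2)
      then have "(LINT x|sphere_prob. V x * (\<psi> x)^2) = (LINT x|(sphere_prob :: 'a measure). 0)"
        by (intro integral_cong_AE) auto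
      then show "(LINT x|sphere_prob. V x * (\<psi> x)^2) \<le> energy \<psi> + \<mu> * sqint sphere_prob \<psi>"
        using energy_nonneg[of \<psi>] \<open>\<mu> = 0\<close> by simp
    next
      case False
      then have p1: "p > 1" using p(1) by simp
      define r where "r = p / (p - 1)"
      define A where "A = real DIM('b) * (p - 1) / 2"
      have r: "r > 1" "1 / p + 1 / r = 1" using p1 by (simp_all add: r_def field_simps)
      have A: "A > 0" using p1 by (simp add: A_def)
      have A_eq: "real DIM('b) / (2 * r - 2) = A"
        using p1 by (simp add: r_def A_def field_simps)
      have crit: "2 * r * (real DIM('b) - 2) \<le> 2 * real DIM('b)"
        using p1 p(2) by (simp add: r_def field_simps)
      let ?N = "(LINT x|sphere_prob. \<bar>\<psi> x\<bar> powr (2 * r)) powr (2 / (2 * r))"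
      have pw: "((\<psi> x)^2) powr r = \<bar>\<psi> x\<bar> powr (2 * r)" for x
      proof -
        have "(\<psi> x)^2 = \<bar>\<psi> x\<bar> powr 2" by (simp add: powr_numeral)
        then show ?thesis by (simp only: powr_powr)
      qed
      have "(LINT x|sphere_prob. V x * (\<psi> x)^2) \<le> (LINT x|sphere_prob. V x powr p) powr (1 / p) * (LINT x|sphere_prob. ((\<psi> x)^2) powr r) powr (1 / r)"
      proof (rule Holder_integral[OF p1 r])
        show "integrable sphere_prob (\<lambda>x. ((\<psi> x)^2) powr r)"
          using r by (intro sphere_continuous_integrable continuous_on_powr' continuous_on_power smooth_continuous \<psi> continuous_on_const) auto
      qed (use Vi in \<open>auto simp: space_sphere_prob\<close>)
      also have "\<dots> = \<mu> * ?N" using \<mu>0 p1 unfolding \<mu>p pw by (simp add: powr_powr)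
      finally have H: "(LINT x|sphere_prob. V x * (\<psi> x)^2) \<le> \<mu> * ?N" .
      have I: "A * ?N \<le> energy \<psi> + A * sqint sphere_prob \<psi>"
        using sphere_interpolation_critical[OF dim _ crit \<psi>] r(1) unfolding A_eq by simp
      have t: "\<mu> / A \<le> 1" "0 \<le> \<mu> / A" using small A \<mu>0 by (simp_all add: \<mu>_def A_def)
      have "\<mu> * ?N = (\<mu> / A) * (A * ?N)" using A by simp
      also have "\<dots> \<le> (\<mu> / A) * (energy \<psi> + A * sqint sphere_prob \<psi>)" by (rule mult_left_mono[OF I t(2)])
      also have "\<dots> = (\<mu> / A) * energy \<psi> + \<mu> * sqint sphere_prob \<psi>" using A by (simp add: distrib_left)
      also have "(\<mu> / A) * energy \<psi> \<le> 1 * energy \<psi>" by (rule mult_right_mono[OF t(1) energy_nonneg])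
      finally show "(LINT x|sphere_prob. V x * (\<psi> x)^2) \<le> energy \<psi> + \<mu> * sqint sphere_prob \<psi>"
        using H by simp
    qed
  qed
qed

theorem corollary2:
  fixes d :: nat and \<gamma> :: real
  assumes "d \<ge> 1"
    and "DIM('b::euclidean_space) = d"
    and "DIM('a::euclidean_space) = d + 1"
  shows
    "(\<gamma> > max 0 (1 - real d / 2) \<or> \<gamma> = 1 / 2 \<and> d = 1 \<longrightarrow>
      (\<exists>c :: real \<Rightarrow> real. (c \<longlongrightarrow> 1) at_top \<and>
        (\<forall>\<^sub>F \<mu> in at_top. \<forall>V \<in> nonneg_Lp (\<gamma> + real d / 2).
          Lp_norm sphere_prob (\<gamma> + real d / 2) (V :: 'a \<Rightarrow> real) = \<mu> \<longrightarrow>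
          ennreal (\<bar>lambda1_sphere V\<bar> powr \<gamma>)
            \<le> ennreal (c \<mu>) * KLT_const TYPE('b) \<gamma>
                * (\<integral>\<^sup>+x. ennreal (V x powr (\<gamma> + real d / 2)) \<partial>sphere_measure)))) \<and>
     (\<gamma> \<ge> max 0 (1 - real d / 2) \<longrightarrow>
      (\<forall>V \<in> nonneg_Lp (\<gamma> + real d / 2).
        Lp_norm sphere_prob (\<gamma> + real d / 2) (V :: 'a \<Rightarrow> real)
            \<le> real d * (2 * \<gamma> + real d - 2) / 4 \<longrightarrow>
        \<bar>lambda1_sphere V\<bar> powr (\<gamma> + real d / 2)
            \<le> (\<integral>x. V x powr (\<gamma> + real d / 2) \<partial>sphere_prob)) \<and>
      (\<forall>\<mu>. 0 \<le> \<mu> \<and> \<mu> \<le> real d * (2 * \<gamma> + real d - 2) / 4 \<longrightarrow>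
        (\<exists>V \<in> nonneg_Lp (\<gamma> + real d / 2).
          (\<exists>k. \<forall>x\<in>sphere 0 1. (V :: 'a \<Rightarrow> real) x = k) \<and>
          Lp_norm sphere_prob (\<gamma> + real d / 2) V = \<mu> \<and>
          \<bar>lambda1_sphere V\<bar> powr (\<gamma> + real d / 2)
            = (\<integral>x. V x powr (\<gamma> + real d / 2) \<partial>sphere_prob))))"
proof (intro conjI impI ballI allI)
  have dim: "DIM('a) = DIM('b) + 1" using assms by simp
  {
    assume h: "\<gamma> > max 0 (1 - real d / 2) \<or> \<gamma> = 1 / 2 \<and> d = 1"
    then have \<gamma>: "\<gamma> > 0" and p: "\<gamma> + real d / 2 \<ge> 1" by auto
    show "\<exists>c :: real \<Rightarrow> real. (c \<longlongrightarrow> 1) at_top \<and>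
        (\<forall>\<^sub>F \<mu> in at_top. \<forall>V \<in> nonneg_Lp (\<gamma> + real d / 2).
          Lp_norm sphere_prob (\<gamma> + real d / 2) (V :: 'a \<Rightarrow> real) = \<mu> \<longrightarrow>
          ennreal (\<bar>lambda1_sphere V\<bar> powr \<gamma>)
            \<le> ennreal (c \<mu>) * KLT_const TYPE('b) \<gamma>
                * (\<integral>\<^sup>+x. ennreal (V x powr (\<gamma> + real d / 2)) \<partial>sphere_measure))"
      using lambda1_sphere_asymptotic[OF dim \<gamma>] p unfolding assms(2) by blast
  next
    fix V :: "'a \<Rightarrow> real"
    assume \<gamma>: "\<gamma> \<ge> max 0 (1 - real d / 2)" and V: "V \<in> nonneg_Lp (\<gamma> + real d / 2)"
      and small: "Lp_norm sphere_prob (\<gamma> + real d / 2) V \<le> real d * (2 * \<gamma> + real d - 2) / 4"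
    define p where "p = \<gamma> + real d / 2"
    have p: "p \<ge> 1" "p \<ge> real d / 2" using \<gamma> by (auto simp: p_def)
    have "real d * (2 * \<gamma> + real d - 2) / 4 = real d * (p - 1) / 2" by (simp add: p_def field_simps)
    then have "Lp_norm sphere_prob p V \<le> real DIM('b) * (p - 1) / 2"
      using small unfolding assms(2) p_def[symmetric] by (simp only:)
    then have "\<bar>lambda1_sphere V\<bar> \<le> Lp_norm sphere_prob p V"
      using lambda1_sphere_le_Lp_norm[OF dim, of p V] p V unfolding assms(2) p_def[symmetric] by blast
    then have "\<bar>lambda1_sphere V\<bar> powr p \<le> Lp_norm sphere_prob p V powr p"
      using p by (intro powr_mono2) auto
    also have "\<dots> = (LINT x|sphere_prob. V x powr p)"
      using V p(1) by (intro Lp_norm_sphere_powr(1)[symmetric]) (simp_all add: p_def)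
    finally show "\<bar>lambda1_sphere V\<bar> powr (\<gamma> + real d / 2) \<le> (LINT x|sphere_prob. V x powr (\<gamma> + real d / 2))"
      unfolding p_def .
  next
    fix \<mu> :: real
    assume \<gamma>: "\<gamma> \<ge> max 0 (1 - real d / 2)" and \<mu>: "0 \<le> \<mu> \<and> \<mu> \<le> real d * (2 * \<gamma> + real d - 2) / 4"
    have p: "\<gamma> + real d / 2 > 0" using \<gamma> assms(1) by auto
    have V: "(\<lambda>_::'a. \<mu>) \<in> nonneg_Lp (\<gamma> + real d / 2)" using \<mu> by (simp add: nonneg_Lp_def)
    have norm: "Lp_norm sphere_prob (\<gamma> + real d / 2) (\<lambda>_::'a. \<mu>) = \<mu>"
      unfolding Lp_norm_def integral_sphere_const using \<mu> p by (simp add: powr_powr)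
    have "\<bar>lambda1_sphere (\<lambda>_::'a. \<mu>)\<bar> powr (\<gamma> + real d / 2) = (LINT x|(sphere_prob :: 'a measure). \<mu> powr (\<gamma> + real d / 2))"
      unfolding integral_sphere_const using lambda1_sphere_const[of \<mu>, where 'a='a] \<mu> by simp
    with V norm show "\<exists>V \<in> nonneg_Lp (\<gamma> + real d / 2).
          (\<exists>k. \<forall>x\<in>sphere 0 1. (V :: 'a \<Rightarrow> real) x = k) \<and>
          Lp_norm sphere_prob (\<gamma> + real d / 2) V = \<mu> \<and>
          \<bar>lambda1_sphere V\<bar> powr (\<gamma> + real d / 2)
            = (LINT x|sphere_prob. V x powr (\<gamma> + real d / 2))"
      by (intro bexI[of _ "\<lambda>_. \<mu>"]) auto
  }
qed

end
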